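(* Let $p_1,p_2,q_1,q_2\ge 1$ be real numbers such that $p_1\le q_1$ and $p_2\le q_2=q_1'$, where $1/q_1+1/q_1'=1$, and set $1/r_1=1/p_1-1/q_1$, $1/r_2=1/p_2-1/q_2$. Let $(\Omega,\Sigma,\mu)$ be a finite measure space. Let $X$ be an order continuous $p_1$-convex Banach function lattice and let $Y$ be a $p_2'$-concave order continuous Banach function lattice with the Fatou property on $(\Omega,\Sigma,\mu)$, where $1/p_2+1/p_2'=1$. Assume that the Köthe dual $Y'$ is also order continuous. Then the following statements about a (bounded linear) operator $T\colon X\to Y$ are equivalent. (i) $T$ is $(p_1,p_2)$-strongly $(q_1,q_2)$-concave. (ii) There is a constant $C>0$ such that for every $n$ and every choice of $(x_k)_{k=1}^n$ in $X$, $$\sup\Big\{\Big|\sum_{k=1}^n\langle T(x_k),y_k^*\rangle\Big|:\ (y_k^* )_{k=1}^n\subset Y^*,\ \sup_{(\alpha_k)\in B_{r_2}^n}\Big\|\Big(\sum_{k=1}^n|\alpha_ky_k^*|^{p_2}\Big)^{1/p_2}\Big\|_{Y^*}\le1\Big\}\le C\sup_{(\beta_k)\in B_{r_1}^n}\Big\|\Big(\sum_{k=1}^n|\beta_kx_k|^{p_1}\Big)^{1/p_1}\Big\|_X.$$ (iii) There are regular Borel probability measures $\nu_1$ on $B^{+}_{(X_{p_1})'}$ and $\nu_2$ on $B^{+}_{((Y')_{p_2})'}$, for which $S^{q_1}_{X_{p_1}}(\nu_1)$ and $S^{q_2}_{(Y')_{p_2}}(\nu_2)$ are Banach function lattices on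 $(\Omega,\Sigma,\mu)$ with continuous inclusions $\iota_X\colon X\to S^{q_1}_{X_{p_1}}(\nu_1)$ and $\iota_{Y'}\colon Y'\to S^{q_2}_{(Y')_{p_2}}(\nu_2)$, and a bounded linear operator $T_0\colon S^{q_1}_{X_{p_1}}(\nu_1)\to\big(S^{q_2}_{(Y')_{p_2}}(\nu_2)\big)'$ such that $$T=(\iota_{Y'})'\circ T_0\circ\iota_X,$$ where $(\iota_{Y'})'\colon\big(S^{q_2}_{(Y')_{p_2}}(\nu_2)\big)'\to Y''=Y$ is the Köthe adjoint of $\iota_{Y'}$.
   Context: A Banach function lattice on a $\sigma$-finite measure space $(\Omega,\Sigma,\mu)$ is a Banach space $X\subset L^0(\mu)$ such that $f\in L^0(\mu)$, $g\in X$, $|f|\le|g|$ a.e. imply $f\in X$ and $\|f\|_X\le\|g\|_X$. As a convention, Banach function lattices have full support (no set of positive measure on which all elements vanish a.e.), so that the Köthe dual $X'$, the space of functionals in $X^*$ of the form $x\mapsto\int_\Omega xx'\,d\mu$ with $x'\in L^0(\mu)$, is identified with the Banach function lattice of the (unique) representing functions, with the dual norm. The Köthe adjoint $(\iota_{Y'})'$ of the inclusion $\iota_{Y'}\colon Y'\to F$ is the map $F'\to(Y')'$ restricting functionals to $Y'$, i.e. the inclusion of functions. $X$ has the Fatou property if $0\le f_n\uparrow f$ a.e., $f_n\in X$, $\sup_n\|f_n\|_X<\infty$ imply $f\in X$ and $\|f_n\|_X\uparrow\|f\|_X$; equivalently $X=X''$ isometrically. $X$ is $p$-convex if $\|(\sum|x_k|^p)^{1/p}\|_X\le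 M\,(\sum\|x_k\|_X^p)^{1/p}$ and $s$-concave if $(\sum\|x_k\|_X^s)^{1/s}\le M\,\|(\sum|x_k|^s)^{1/s}\|_X$ for some $M$ and all finite sequences in $X$ (usual modification with maxima/suprema for $s=\infty$, in which case the condition always holds). Norms are assumed chosen so that the convexity/concavity constants are $M=1$; then $Y'$ is $p_2$-convex with constant $1$. For a $p$-convex $X$ (constant $1$), $X_p=\{f\in L^0(\mu):|f|^{1/p}\in X\}$ with norm $\|f\|_{X_p}=\||f|^{1/p}\|_X^p$ is a Banach function lattice. $B^{+}_{(X_p)'}$ is the set of nonnegative functions in the closed unit ball of $(X_p)'$, with the topology $\sigma((X_p)',X_p)$. For $1\le p\le q<\infty$ and a regular Borel probability measure $\xi$ on $B^{+}_{(X_p)'}$, $$S^q_{X_p}(\xi)=\Big\{f\in L^0(\mu):\ \|f\|=\Big(\int_{B^{+}_{(X_p)'}}\Big(\int_\Omega|f|^p\,h\,d\mu\Big)^{q/p}d\xi(h)\Big)^{1/q}<\infty\Big\}.$$ $B_r^n$ is the closed unit ball of $\ell_r^n=(\mathbb R^n,\|\cdot\|_r)$, $1\le r\le\infty$. An operator $T\colon X\to Y$ between Banach lattices is $(p_1,p_2)$-strongly $(q_1,q_2)$-concave (with $1\le p_1\le q_1$, $1\le p_2\le q_2$, $q_2=q_1'$, $1/r_i=1/p_i-1/q_i$) if there is $C>0$ such that $$\Big|\sum_{k=1}^n\langle Tx_k,y_k^*\rangle\Big|\le C\sup_{(\alpha_k)\in B_{r_1}^n}\Big\|\Big(\sum_{k=1}^n|\alpha_kx_k|^{p_1}\Big)^{1/p_1}\Big\|_X\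 \sup_{(\beta_k)\in B_{r_2}^n}\Big\|\Big(\sum_{k=1}^n|\beta_ky_k^*|^{p_2}\Big)^{1/p_2}\Big\|_{Y^*}$$ for all finite sequences $(x_k)_{k=1}^n$ in $X$ and $(y_k^* )_{k=1}^n$ in $Y^*$. *)

theory Defs
  imports "HOL-Analysis.Analysis" "HOL-Probability.Probability_Measure"
begin

text \<open>
  Elements of L^0 are represented by measurable real functions, and all notions below are invariant
  under almost everywhere equality. A normed space of (classes of) measurable functions is given by
  the set of representatives and a functional that is a norm modulo a.e. equality.
\<close>

record 'a fspace =
  elems :: "('a \<Rightarrow> real) set"
  nrm :: "('a \<Rightarrow> real) \<Rightarrow> real"

definition banach_function_lattice :: "'a measure \<Rightarrow> 'a fspace \<Rightarrow> bool" where
  "banach_function_lattice M X \<longleftrightarrow>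
     elems X \<subseteq> borel_measurable M \<and>
     (\<lambda>_. 0) \<in> elems X \<and>
     (\<forall>f\<in>elems X. \<forall>g\<in>elems X. (\<lambda>\<omega>. f \<omega> + g \<omega>) \<in> elems X \<and>
        nrm X (\<lambda>\<omega>. f \<omega> + g \<omega>) \<le> nrm X f + nrm X g) \<and>
     (\<forall>f\<in>elems X. \<forall>c. (\<lambda>\<omega>. c * f \<omega>) \<in> elems X \<and>
        nrm X (\<lambda>\<omega>. c * f \<omega>) = \<bar>c\<bar> * nrm X f) \<and>
     (\<forall>f\<in>elems X. 0 \<le> nrm X f \<and> (nrm X f = 0 \<longleftrightarrow> (AE \<omega> in M. f \<omega> = 0))) \<and>
     (\<forall>f\<in>borel_measurable M. \<forall>g\<in>elems X. (AE \<omega> in M. \<bar>f \<omega>\<bar> \<le> \<bar>g \<omega>\<bar>) \<longrightarrow>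
        f \<in> elems X \<and> nrm X f \<le> nrm X g) \<and>
     (\<forall>u. (\<forall>n. u n \<in> elems X) \<longrightarrow>
        (\<forall>e>0. \<exists>N::nat. \<forall>m\<ge>N. \<forall>n\<ge>N. nrm X (\<lambda>\<omega>. u m \<omega> - u n \<omega>) < e) \<longrightarrow>
        (\<exists>f\<in>elems X. (\<lambda>n. nrm X (\<lambda>\<omega>. u n \<omega> - f \<omega>)) \<longlonglongrightarrow> 0)) \<and>
     \<comment> \<open>full support\<close>
     (\<forall>A\<in>sets M. emeasure M A > 0 \<longrightarrow>
        \<not> (\<forall>f\<in>elems X. AE \<omega> in M. \<omega> \<in> A \<longrightarrow> f \<omega> = 0))"

text \<open>
  Sequential order continuity and order continuity coincide for function lattices over sigma-finite
  measures.
\<close>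

definition order_continuous :: "'a measure \<Rightarrow> 'a fspace \<Rightarrow> bool" where
  "order_continuous M X \<longleftrightarrow>
     (\<forall>f::nat \<Rightarrow> 'a \<Rightarrow> real. (\<forall>n. f n \<in> elems X) \<longrightarrow>
        (AE \<omega> in M. decseq (\<lambda>n. f n \<omega>) \<and> (\<lambda>n. f n \<omega>) \<longlonglongrightarrow> 0) \<longrightarrow>
        (\<lambda>n. nrm X (f n)) \<longlonglongrightarrow> 0)"

definition fatou_property :: "'a measure \<Rightarrow> 'a fspace \<Rightarrow> bool" where
  "fatou_property M X \<longleftrightarrow>
     (\<forall>(f::nat \<Rightarrow> 'a \<Rightarrow> real) g. (\<forall>n. f n \<in> elems X) \<longrightarrow> g \<in> borel_measurable M \<longrightarrow>
        (AE \<omega> in M. 0 \<le> f 0 \<omega> \<and> incseq (\<lambda>n. f n \<omega>) \<and> (\<lambda>n. f n \<omega>) \<longlonglongrightarrow> g \<omega>) \<longrightarrow>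
        bdd_above (range (\<lambda>n. nrm X (f n))) \<longrightarrow>
        g \<in> elems X \<and> incseq (\<lambda>n. nrm X (f n)) \<and> (\<lambda>n. nrm X (f n)) \<longlonglongrightarrow> nrm X g)"

text \<open>
  The norm of l_r^n, with r in [1, top]; only the values a k with k < n matter.
\<close>

definition lnorm :: "ennreal \<Rightarrow> nat \<Rightarrow> (nat \<Rightarrow> real) \<Rightarrow> real" where
  "lnorm r n a =
     (if r = top then Max (insert 0 ((\<lambda>k. \<bar>a k\<bar>) ` {..<n}))
      else (\<Sum>k<n. \<bar>a k\<bar> powr enn2real r) powr (1 / enn2real r))"

definition lball :: "ennreal \<Rightarrow> nat \<Rightarrow> (nat \<Rightarrow> real) set" where
  "lball r n = {a. lnorm r n a \<le> 1}"

definition conj_exp :: "ennreal \<Rightarrow> ennreal" where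
  "conj_exp p = 1 / (1 - 1 / p)"

definition p_convex :: "'a fspace \<Rightarrow> ennreal \<Rightarrow> real \<Rightarrow> bool" where
  "p_convex X p K \<longleftrightarrow>
     (\<forall>n x. (\<forall>k<n. x k \<in> elems X) \<longrightarrow>
        nrm X (\<lambda>\<omega>. lnorm p n (\<lambda>k. x k \<omega>)) \<le> K * lnorm p n (\<lambda>k. nrm X (x k)))"

definition s_concave :: "'a fspace \<Rightarrow> ennreal \<Rightarrow> real \<Rightarrow> bool" where
  "s_concave X s K \<longleftrightarrow>
     (\<forall>n x. (\<forall>k<n. x k \<in> elems X) \<longrightarrow>
        lnorm s n (\<lambda>k. nrm X (x k)) \<le> K * nrm X (\<lambda>\<omega>. lnorm s n (\<lambda>k. x k \<omega>)))"

definition bounded_operator ::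
  "'a measure \<Rightarrow> 'a fspace \<Rightarrow> 'a fspace \<Rightarrow> (('a \<Rightarrow> real) \<Rightarrow> ('a \<Rightarrow> real)) \<Rightarrow> bool" where
  "bounded_operator M X Y T \<longleftrightarrow>
     (\<forall>f\<in>elems X. T f \<in> elems Y) \<and>
     (\<forall>f\<in>elems X. \<forall>g\<in>elems X. AE \<omega> in M. T (\<lambda>\<omega>. f \<omega> + g \<omega>) \<omega> = T f \<omega> + T g \<omega>) \<and>
     (\<forall>f\<in>elems X. \<forall>c. AE \<omega> in M. T (\<lambda>\<omega>. c * f \<omega>) \<omega> = c * T f \<omega>) \<and>
     (\<exists>K. \<forall>f\<in>elems X. nrm Y (T f) \<le> K * nrm X f)"

text \<open>
  The topological dual. A functional is represented by any function with the prescribed values on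
  the space; boundedness makes it invariant under a.e. equality.
\<close>

definition dual :: "'a fspace \<Rightarrow> (('a \<Rightarrow> real) \<Rightarrow> real) set" where
  "dual X = {\<phi>.
     (\<forall>f\<in>elems X. \<forall>g\<in>elems X. \<phi> (\<lambda>\<omega>. f \<omega> + g \<omega>) = \<phi> f + \<phi> g) \<and>
     (\<forall>f\<in>elems X. \<forall>c. \<phi> (\<lambda>\<omega>. c * f \<omega>) = c * \<phi> f) \<and>
     (\<exists>K. \<forall>f\<in>elems X. \<bar>\<phi> f\<bar> \<le> K * nrm X f)}"

definition dual_norm :: "'a fspace \<Rightarrow> (('a \<Rightarrow> real) \<Rightarrow> real) \<Rightarrow> real" where
  "dual_norm X \<phi> = (SUP f\<in>{f\<in>elems X. nrm X f \<le> 1}. \<bar>\<phi> f\<bar>)"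

definition dual_le ::
  "'a measure \<Rightarrow> 'a fspace \<Rightarrow> (('a \<Rightarrow> real) \<Rightarrow> real) \<Rightarrow> (('a \<Rightarrow> real) \<Rightarrow> real) \<Rightarrow> bool" where
  "dual_le M X \<phi> \<psi> \<longleftrightarrow> (\<forall>f\<in>elems X. (AE \<omega> in M. 0 \<le> f \<omega>) \<longrightarrow> \<phi> f \<le> \<psi> f)"

text \<open>
  The element (sum of |\<phi>_k|^p)^(1/p) of the dual Banach lattice. In an arbitrary Banach lattice,
  where powers are not available pointwise, this expression denotes the order supremum of all
  combinations of the \<phi>_k with coefficients in the unit ball of the conjugate l_p'^n. In the dual
  it always exists, and two choices of it agree on the space.
\<close>

definition dual_psum ::
  "'a measure \<Rightarrow> 'a fspace \<Rightarrow> ennreal \<Rightarrow> nat \<Rightarrow> (nat \<Rightarrow> ('a \<Rightarrow> real) \<Rightarrow> real) \<Rightarrow> ('a \<Rightarrow> real) \<Rightarrow> real" where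
  "dual_psum M X p n \<phi> = (SOME \<psi>. \<psi> \<in> dual X \<and>
     (\<forall>a\<in>lball (conj_exp p) n. dual_le M X (\<lambda>f. \<Sum>k<n. a k * \<phi> k f) \<psi>) \<and>
     (\<forall>\<theta>\<in>dual X. (\<forall>a\<in>lball (conj_exp p) n. dual_le M X (\<lambda>f. \<Sum>k<n. a k * \<phi> k f) \<theta>) \<longrightarrow>
        dual_le M X \<psi> \<theta>))"

text \<open>
  The suprema over the unit ball of l_r^n are taken over nonempty bounded sets of reals.
\<close>

definition mixed_sup :: "'a fspace \<Rightarrow> ennreal \<Rightarrow> ennreal \<Rightarrow> nat \<Rightarrow> (nat \<Rightarrow> 'a \<Rightarrow> real) \<Rightarrow> real" where
  "mixed_sup X p r n x = (SUP \<alpha>\<in>lball r n. nrm X (\<lambda>\<omega>. lnorm p n (\<lambda>k. \<alpha> k * x k \<omega>)))"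

definition dual_mixed_sup ::
  "'a measure \<Rightarrow> 'a fspace \<Rightarrow> ennreal \<Rightarrow> ennreal \<Rightarrow> nat \<Rightarrow> (nat \<Rightarrow> ('a \<Rightarrow> real) \<Rightarrow> real) \<Rightarrow> real" where
  "dual_mixed_sup M Y p r n \<phi> =
     (SUP \<beta>\<in>lball r n. dual_norm Y (dual_psum M Y p n (\<lambda>k f. \<beta> k * \<phi> k f)))"

definition strongly_concave ::
  "'a measure \<Rightarrow> 'a fspace \<Rightarrow> 'a fspace \<Rightarrow> real \<Rightarrow> real \<Rightarrow> real \<Rightarrow> real \<Rightarrow>
     (('a \<Rightarrow> real) \<Rightarrow> ('a \<Rightarrow> real)) \<Rightarrow> bool" where
  "strongly_concave M X Y p1 p2 q1 q2 T \<longleftrightarrow>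
     (let r1 = 1 / ennreal (1 / p1 - 1 / q1); r2 = 1 / ennreal (1 / p2 - 1 / q2) in
      \<exists>C>0. \<forall>n x \<phi>. (\<forall>k<n. x k \<in> elems X) \<longrightarrow> (\<forall>k<n. \<phi> k \<in> dual Y) \<longrightarrow>
        \<bar>\<Sum>k<n. \<phi> k (T (x k))\<bar>
          \<le> C * mixed_sup X (ennreal p1) r1 n x * dual_mixed_sup M Y (ennreal p2) r2 n \<phi>)"

definition koethe_dual :: "'a measure \<Rightarrow> 'a fspace \<Rightarrow> 'a fspace" where
  "koethe_dual M X =
     \<lparr> elems = {h \<in> borel_measurable M. (\<forall>f\<in>elems X. integrable M (\<lambda>\<omega>. f \<omega> * h \<omega>)) \<and>
         (\<lambda>f. \<integral>\<omega>. f \<omega> * h \<omega> \<partial>M) \<in> dual X},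
       nrm = (\<lambda>h. dual_norm X (\<lambda>f. \<integral>\<omega>. f \<omega> * h \<omega> \<partial>M)) \<rparr>"

text \<open>
  \<open>R'\<close> is the Koethe adjoint of \<open>R : E \<rightarrow> F\<close>, as a map from \<open>F'\<close> to \<open>E'\<close> written in terms of representing
  functions (hence determined up to a.e. equality).
\<close>

definition koethe_adjoint ::
  "'a measure \<Rightarrow> 'a fspace \<Rightarrow> 'a fspace \<Rightarrow> (('a \<Rightarrow> real) \<Rightarrow> ('a \<Rightarrow> real)) \<Rightarrow>
     (('a \<Rightarrow> real) \<Rightarrow> ('a \<Rightarrow> real)) \<Rightarrow> bool" where
  "koethe_adjoint M E F R R' \<longleftrightarrow>
     bounded_operator M (koethe_dual M F) (koethe_dual M E) R' \<and>
     (\<forall>h\<in>elems (koethe_dual M F). \<forall>f\<in>elems E.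
        (\<integral>\<omega>. f \<omega> * R' h \<omega> \<partial>M) = (\<integral>\<omega>. R f \<omega> * h \<omega> \<partial>M))"

definition p_power :: "'a measure \<Rightarrow> 'a fspace \<Rightarrow> real \<Rightarrow> 'a fspace" where
  "p_power M X p =
     \<lparr> elems = {f \<in> borel_measurable M. (\<lambda>\<omega>. \<bar>f \<omega>\<bar> powr (1 / p)) \<in> elems X},
       nrm = (\<lambda>f. nrm X (\<lambda>\<omega>. \<bar>f \<omega>\<bar> powr (1 / p)) powr p) \<rparr>"

text \<open>
  The nonnegative part of the unit ball of \<open>Z'\<close>, with the topology \<open>\<sigma>(Z', Z)\<close>. On representatives
  this topology does not separate functions that agree a.e.; its open sets, and hence its Borel
  sets, are the preimages of those on the a.e. classes, so Borel measures on both are the same.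
\<close>

definition pos_ball :: "'a measure \<Rightarrow> 'a fspace \<Rightarrow> ('a \<Rightarrow> real) set" where
  "pos_ball M Z = {h \<in> elems (koethe_dual M Z).
     (AE \<omega> in M. 0 \<le> h \<omega>) \<and> nrm (koethe_dual M Z) h \<le> 1}"

definition pos_ball_topology :: "'a measure \<Rightarrow> 'a fspace \<Rightarrow> ('a \<Rightarrow> real) topology" where
  "pos_ball_topology M Z =
     pullback_topology (pos_ball M Z) (\<lambda>h. \<lambda>f\<in>elems Z. \<integral>\<omega>. f \<omega> * h \<omega> \<partial>M)
       (product_topology (\<lambda>_. euclideanreal) (elems Z))"

text \<open>
  Compact sets in the inner regularity are required to be closed since \<open>\<tau>\<close> need not be Hausdorff
  before passing to a.e. classes; after passing to classes closedness is automatic.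
\<close>

definition regular_borel_prob :: "'b topology \<Rightarrow> 'b measure \<Rightarrow> bool" where
  "regular_borel_prob \<tau> \<xi> \<longleftrightarrow>
     prob_space \<xi> \<and> space \<xi> = topspace \<tau> \<and> sets \<xi> = sigma_sets (topspace \<tau>) {U. openin \<tau> U} \<and>
     (\<forall>A\<in>sets \<xi>.
        emeasure \<xi> A = (INF U\<in>{U. openin \<tau> U \<and> A \<subseteq> U}. emeasure \<xi> U) \<and>
        emeasure \<xi> A = (SUP K\<in>{K. compactin \<tau> K \<and> closedin \<tau> K \<and> K \<subseteq> A}. emeasure \<xi> K))"

definition ennreal_powr :: "ennreal \<Rightarrow> real \<Rightarrow> ennreal" where
  "ennreal_powr x a = (if x = top then top else ennreal (enn2real x powr a))"

definition S_functional :: "'a measure \<Rightarrow> real \<Rightarrow> real \<Rightarrow> ('a \<Rightarrow> real) measure \<Rightarrow> ('a \<Rightarrow> real) \<Rightarrow> ennreal" where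
  "S_functional M p q \<xi> f =
     ennreal_powr
       (\<integral>\<^sup>+h. ennreal_powr (\<integral>\<^sup>+\<omega>. ennreal (\<bar>f \<omega>\<bar> powr p * h \<omega>) \<partial>M) (q / p) \<partial>\<xi>) (1 / q)"

text \<open>
  \<open>S^q_{X_p}(\<xi>)\<close>; the lattice \<open>X\<close> enters only through the space on which \<open>\<xi>\<close> lives.
\<close>

definition S_space :: "'a measure \<Rightarrow> real \<Rightarrow> real \<Rightarrow> ('a \<Rightarrow> real) measure \<Rightarrow> 'a fspace" where
  "S_space M p q \<xi> =
     \<lparr> elems = {f \<in> borel_measurable M. S_functional M p q \<xi> f < top},
       nrm = (\<lambda>f. enn2real (S_functional M p q \<xi> f)) \<rparr>"

end

theory Submission
  imports Defs
begin

text \<open>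
  Order continuity identifies the functionals on \<open>X\<^sub>p\<close> with functions \<open>h\<close>, so that by Hoelder duality in
  \<open>\<ell>\<^sub>r\<close> the \<open>q\<close>-th power of the mixed norm of \<open>(x\<^sub>k)\<close> is the supremum over \<open>h\<close> in the positive ball of
  \<open>(X\<^sub>p)'\<close> of the sum over \<open>k\<close> of \<open>(\<integral> |x\<^sub>k|\<^sup>p h)\<^bsup>q/p\<^esup>\<close>. Integrating this function of \<open>h\<close> against a probability
  measure gives the norm of \<open>S\<close>, which yields the step from a factorization to concavity. Conversely,
  Young's inequality turns concavity into the statement that certain sums of functions of \<open>h\<^sub>1\<close> and \<open>h\<^sub>2\<close>
  have suprema dominating \<open>\<Sum> \<langle>T x\<^sub>k, y\<^sub>k\<rangle>\<close>; a sandwich theorem replaces the suprema by positive functionals,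
  and these by regular Borel measures. The resulting bound of \<open>\<langle>T x, y\<rangle>\<close> by the product of the two
  norms lets \<open>T\<close> extend by density to an operator into the Koethe dual of the second space.
\<close>


section \<open>The Hahn--Banach theorem\<close>

text \<open>The conjugacy of q1 and q2 does more than allow Young's inequality. Scaling x by
  c^(1/q1) and y by c^(1/q2) makes both power sums and the pairing homogeneous of degree one, and
  finite families add by concatenation; so the demands on the sought functionals form a convex cone,
  and no minimax argument is required. Two obstacles shape the rest. Elements are representatives,
  so the positive ball need not be Hausdorff; compactness and normality are what can be transferred
  to it. The separating functionals live on all bounded functions and yield finitely additive set
  functions through indicators. Regularizing these preserves only an inequality on closed sets,
  which is enough for domination. Secondly, the dual lattice of Y is abstract, with sums of powers
  defined as order suprema. Order continuity of Y turns these into pointwise norms of representing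
  functions, and concavity of Y becomes the convexity of Y' that makes its power space normed; order
  continuity of Y' then makes the weak topology of the second ball compact.\<close>

definition fun_subspace :: "('b \<Rightarrow> real) set \<Rightarrow> bool" where
  "fun_subspace V \<longleftrightarrow> (\<lambda>_. 0) \<in> V \<and> (\<forall>f\<in>V. \<forall>g\<in>V. (\<lambda>x. f x + g x) \<in> V) \<and>
     (\<forall>f\<in>V. \<forall>c. (\<lambda>x. c * f x) \<in> V)"

definition linear_fun_on :: "('b \<Rightarrow> real) set \<Rightarrow> (('b \<Rightarrow> real) \<Rightarrow> real) \<Rightarrow> bool" where
  "linear_fun_on V L \<longleftrightarrow> (\<forall>f\<in>V. \<forall>g\<in>V. L (\<lambda>x. f x + g x) = L f + L g) \<and>
     (\<forall>f\<in>V. \<forall>c. L (\<lambda>x. c * f x) = c * L f)"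

lemma linear_fun_on_add: "linear_fun_on V L \<Longrightarrow> f \<in> V \<Longrightarrow> g \<in> V \<Longrightarrow> L (\<lambda>x. f x + g x) = L f + L g"
  by (simp add: linear_fun_on_def)

lemma linear_fun_on_scale: "linear_fun_on V L \<Longrightarrow> f \<in> V \<Longrightarrow> L (\<lambda>x. c * f x) = c * L f"
  by (simp add: linear_fun_on_def)

definition sublinear_on :: "('b \<Rightarrow> real) set \<Rightarrow> (('b \<Rightarrow> real) \<Rightarrow> real) \<Rightarrow> bool" where
  "sublinear_on V p \<longleftrightarrow> (\<forall>f\<in>V. \<forall>g\<in>V. p (\<lambda>x. f x + g x) \<le> p f + p g) \<and>
     (\<forall>f\<in>V. \<forall>c\<ge>0. p (\<lambda>x. c * f x) = c * p f)"

text \<open>A pair \<open>(f, s)\<close> is a demand that the sought functional take at least the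
  value \<open>s\<close> at \<open>f\<close>. Pairs, unlike a function of \<open>f\<close>, allow
  several demands at one point and behave well under unions of chains.\<close>

definition pair_cone :: "(('b \<Rightarrow> real) \<times> real) set \<Rightarrow> bool" where
  "pair_cone D \<longleftrightarrow> ((\<lambda>_. 0), 0) \<in> D \<and>
     (\<forall>f s g t. (f, s) \<in> D \<longrightarrow> (g, t) \<in> D \<longrightarrow> ((\<lambda>x. f x + g x), s + t) \<in> D) \<and>
     (\<forall>f s c. (f, s) \<in> D \<longrightarrow> c > 0 \<longrightarrow> ((\<lambda>x. c * f x), c * s) \<in> D)"

lemma pair_coneI:
  assumes "((\<lambda>_. 0), 0) \<in> D"
    and "\<And>f s g t. (f, s) \<in> D \<Longrightarrow> (g, t) \<in> D \<Longrightarrow> ((\<lambda>x. f x + g x), s + t) \<in> D"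
    and "\<And>f s c. (f, s) \<in> D \<Longrightarrow> c > 0 \<Longrightarrow> ((\<lambda>x. c * f x), c * s) \<in> D"
  shows "pair_cone D"
  using assms unfolding pair_cone_def by blast

text \<open>
  Sandwich form of the Hahn--Banach theorem. In a maximal cone \<open>D\<close> of pairs \<open>(f, s)\<close> with
  \<open>s \<le> p f\<close>, the largest \<open>s\<close> paired with \<open>f\<close> is a linear function of \<open>f\<close>.
\<close>

theorem hahn_banach_sandwich:
  fixes p :: "('b \<Rightarrow> real) \<Rightarrow> real"
  assumes V: "fun_subspace V" and p: "sublinear_on V p"
    and C: "pair_cone C" "\<And>f s. (f, s) \<in> C \<Longrightarrow> f \<in> V" "\<And>f s. (f, s) \<in> C \<Longrightarrow> s \<le> p f"
  obtains L where "linear_fun_on V L" "\<And>f. f \<in> V \<Longrightarrow> L f \<le> p f" "\<And>f s. (f, s) \<in> C \<Longrightarrow> s \<le> L f"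
proof -
  have Vadd: "(\<lambda>x. f x + g x) \<in> V" if "f \<in> V" "g \<in> V" for f g
    using V that unfolding fun_subspace_def by blast
  have Vsc: "(\<lambda>x. c * f x) \<in> V" if "f \<in> V" for f c
    using V that unfolding fun_subspace_def by blast
  have V0: "(\<lambda>_. 0) \<in> V" using V unfolding fun_subspace_def by blast
  have psub: "p (\<lambda>x. f x + g x) \<le> p f + p g" if "f \<in> V" "g \<in> V" for f g
    using p that unfolding sublinear_on_def by blast
  have psc: "p (\<lambda>x. c * f x) = c * p f" if "f \<in> V" "c \<ge> 0" for f c
    using p that unfolding sublinear_on_def by blast
  define adm where "adm = {D. pair_cone D \<and> C \<subseteq> D \<and> (\<forall>(f, s)\<in>D. f \<in> V \<and> s \<le> p f)}"
  have "\<exists>D\<in>adm. \<forall>D'\<in>adm. D \<subseteq> D' \<longrightarrow> D' = D"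
  proof (rule subset_Zorn_nonempty)
    show "adm \<noteq> {}" using C unfolding adm_def by blast
    fix K assume K: "K \<noteq> {}" "subset.chain adm K"
    have chain: "D \<subseteq> D' \<or> D' \<subseteq> D" if "D \<in> K" "D' \<in> K" for D D'
      using K(2) that unfolding subset.chain_def by blast
    have Kadm: "D \<in> adm" if "D \<in> K" for D using K(2) that unfolding subset.chain_def by blast
    have "pair_cone (\<Union>K)"
    proof (rule pair_coneI)
      show "((\<lambda>_. 0), 0) \<in> \<Union>K"
        using K(1) Kadm unfolding adm_def pair_cone_def by blast
    next
      fix f s g t assume "(f, s) \<in> \<Union>K" "(g, t) \<in> \<Union>K"
      then obtain D D' where "D \<in> K" "D' \<in> K" "(f, s) \<in> D" "(g, t) \<in> D'" by blast
      with chain[of D D'] obtain D'' where D'': "D'' \<in> K" "(f, s) \<in> D''" "(g, t) \<in> D''" by blast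
      then have "pair_cone D''" using Kadm unfolding adm_def by blast
      then show "((\<lambda>x. f x + g x), s + t) \<in> \<Union>K" using D'' unfolding pair_cone_def by blast
    next
      fix f s and c :: real assume "(f, s) \<in> \<Union>K" "c > 0"
      then obtain D where D: "D \<in> K" "(f, s) \<in> D" by blast
      then have "pair_cone D" using Kadm unfolding adm_def by blast
      then show "((\<lambda>x. c * f x), c * s) \<in> \<Union>K" using D \<open>c > 0\<close> unfolding pair_cone_def by blast
    qed
    then show "\<Union>K \<in> adm" using K(1) Kadm unfolding adm_def by blast
  qed
  then obtain D where D: "D \<in> adm" and max: "\<And>D'. D' \<in> adm \<Longrightarrow> D \<subseteq> D' \<Longrightarrow> D' = D" by blast
  have cone: "pair_cone D" and CD: "C \<subseteq> D" and DV: "\<And>f s. (f, s) \<in> D \<Longrightarrow> f \<in> V"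
    and Dp: "\<And>f s. (f, s) \<in> D \<Longrightarrow> s \<le> p f" using D unfolding adm_def by auto
  have D0: "((\<lambda>_. 0), 0) \<in> D"
    and Dadd: "\<And>f s g t. (f, s) \<in> D \<Longrightarrow> (g, t) \<in> D \<Longrightarrow> ((\<lambda>x. f x + g x), s + t) \<in> D"
    and Dsc: "\<And>f s c. (f, s) \<in> D \<Longrightarrow> c > 0 \<Longrightarrow> ((\<lambda>x. c * f x), c * s) \<in> D"
    using cone unfolding pair_cone_def by blast+
  \<comment> \<open>Adjoining the ray through \<open>(f, a)\<close> respects the bound by
    \<open>p\<close>: a pair with coefficient t > 0 of \<open>f\<close> is t times one with
    coefficient 1, and the hypothesis covers exactly that coefficient. Maximality then puts
    \<open>(f, a)\<close> into \<open>D\<close>.\<close>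
  have ext: "(f, a) \<in> D" if f: "f \<in> V" and a: "\<And>c s. (c, s) \<in> D \<Longrightarrow> s + a \<le> p (\<lambda>x. c x + f x)" for f a
  proof -
    define D' where "D' = {((\<lambda>x. c x + t * f x), s + t * a) | c s t. (c, s) \<in> D \<and> t \<ge> 0}"
    have D'I: "((\<lambda>x. c x + t * f x), s + t * a) \<in> D'" if "(c, s) \<in> D" "t \<ge> 0" for c s t
      unfolding D'_def using that by blast
    have D'E: "\<exists>c s t. g = (\<lambda>x. c x + t * f x) \<and> b = s + t * a \<and> (c, s) \<in> D \<and> t \<ge> 0"
      if "(g, b) \<in> D'" for g b
      using that unfolding D'_def by blast
    have sub: "D \<subseteq> D'"
    proof safe
      fix c s assume "(c, s) \<in> D"
      from D'I[OF this, of 0] show "(c, s) \<in> D'" by simp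
    qed
    have "pair_cone D'"
    proof (rule pair_coneI)
      show "((\<lambda>_. 0), 0) \<in> D'" using sub D0 by blast
    next
      fix g b g' b' assume "(g, b) \<in> D'" "(g', b') \<in> D'"
      from D'E[OF this(1)] obtain c s t
        where 1: "g = (\<lambda>x. c x + t * f x)" "b = s + t * a" "(c, s) \<in> D" "t \<ge> 0" by blast
      from D'E[OF \<open>(g', b') \<in> D'\<close>] obtain c' s' t'
        where 2: "g' = (\<lambda>x. c' x + t' * f x)" "b' = s' + t' * a" "(c', s') \<in> D" "t' \<ge> 0" by blast
      have "((\<lambda>x. (c x + c' x) + (t + t') * f x), (s + s') + (t + t') * a) \<in> D'"
        using 1 2 by (intro D'I Dadd) auto
      moreover have "(\<lambda>x. (c x + c' x) + (t + t') * f x) = (\<lambda>x. g x + g' x)"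
        using 1 2 by (auto simp: algebra_simps)
      moreover have "(s + s') + (t + t') * a = b + b'" using 1 2 by (auto simp: algebra_simps)
      ultimately show "((\<lambda>x. g x + g' x), b + b') \<in> D'" by simp
    next
      fix g b and d :: real assume "(g, b) \<in> D'" "d > 0"
      from D'E[OF this(1)] obtain c s t
        where *: "g = (\<lambda>x. c x + t * f x)" "b = s + t * a" "(c, s) \<in> D" "t \<ge> 0" by blast
      have "((\<lambda>x. (d * c x) + (d * t) * f x), d * s + (d * t) * a) \<in> D'"
        using * \<open>d > 0\<close> by (intro D'I Dsc) auto
      then show "((\<lambda>x. d * g x), d * b) \<in> D'" using * by (simp add: algebra_simps)
    qed
    moreover have "g \<in> V \<and> b \<le> p g" if gb: "(g, b) \<in> D'" for g b
    proof -
      obtain c s t where *: "g = (\<lambda>x. c x + t * f x)" "b = s + t * a" "(c, s) \<in> D" "t \<ge> 0"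
        using D'E[OF gb] by blast
      show ?thesis
      proof (cases "t = 0")
        case True
        then show ?thesis using * DV Dp by auto
      next
        case False
        then have t: "t > 0" using * by auto
        have "((\<lambda>x. (1/t) * c x), (1/t) * s) \<in> D" using Dsc[OF *(3), of "1/t"] t by simp
        then have "(1/t) * s + a \<le> p (\<lambda>x. (1/t) * c x + f x)" by (rule a)
        then have "t * ((1/t) * s + a) \<le> t * p (\<lambda>x. (1/t) * c x + f x)" using t by simp
        also have "\<dots> = p (\<lambda>x. t * ((1/t) * c x + f x))"
          using t by (intro psc[symmetric] Vadd Vsc DV[OF *(3)] f) simp
        also have "(\<lambda>x. t * ((1/t) * c x + f x)) = g" using t * by (auto simp: field_simps)
        also have "t * ((1/t) * s + a) = b" using t *(2) by (simp add: distrib_left)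
        finally have "b \<le> p g" .
        moreover have "g \<in> V" unfolding *(1) using DV[OF *(3)] f by (intro Vadd Vsc)
        ultimately show ?thesis by simp
      qed
    qed
    ultimately have "D' \<in> adm" using CD sub unfolding adm_def by auto
    then have "D' = D" using max sub by blast
    then show ?thesis using D'I[OF D0, of 1] by simp
  qed
  \<comment> \<open>The infimum is the largest \<open>a\<close> that \<open>ext\<close> admits for
    \<open>f\<close>, so \<open>(f, L f)\<close> itself belongs to \<open>D\<close>.\<close>
  define L where "L f = (INF (c, s)\<in>D. p (\<lambda>x. c x + f x) - s)" for f
  have bdd: "s + - p (\<lambda>x. - f x) \<le> p (\<lambda>x. c x + f x)" if "f \<in> V" "(c, s) \<in> D" for f c s
  proof -
    have m: "(\<lambda>x. - f x) \<in> V" using Vsc[of f "-1"] that by simp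
    have "s \<le> p c" using Dp that by blast
    also have "p c = p (\<lambda>x. (c x + f x) + (- f x))" by simp
    also have "\<dots> \<le> p (\<lambda>x. c x + f x) + p (\<lambda>x. - f x)"
      using m that DV by (intro psub Vadd) auto
    finally show ?thesis by simp
  qed
  have bddb: "bdd_below ((\<lambda>(c, s). p (\<lambda>x. c x + f x) - s) ` D)" if "f \<in> V" for f
    by (rule bdd_belowI[where m = "- p (\<lambda>x. - f x)"]) (use bdd[OF that] in \<open>fastforce\<close>)
  have Lle: "L f \<le> p (\<lambda>x. c x + f x) - s" if "f \<in> V" "(c, s) \<in> D" for f c s
    unfolding L_def using cINF_lower[OF bddb[OF that(1)] that(2)] by simp
  have Lge: "a \<le> L f" if "\<And>c s. (c, s) \<in> D \<Longrightarrow> s + a \<le> p (\<lambda>x. c x + f x)" for f a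
    unfolding L_def
  proof (rule cINF_greatest)
    show "D \<noteq> {}" using D0 by blast
    show "a \<le> (case cs of (c, s) \<Rightarrow> p (\<lambda>x. c x + f x) - s)" if "cs \<in> D" for cs
      using \<open>\<And>c s. (c, s) \<in> D \<Longrightarrow> s + a \<le> p (\<lambda>x. c x + f x)\<close>[of "fst cs" "snd cs"] that
      by (simp add: case_prod_beta)
  qed
  have LD: "(f, L f) \<in> D" if "f \<in> V" for f
    by (rule ext[OF that]) (use Lle[OF that] in \<open>fastforce\<close>)
  have DL: "s \<le> L f" if fs: "(f, s) \<in> D" for f s
  proof (rule Lge)
    fix c t assume "(c, t) \<in> D"
    from Dp[OF Dadd[OF this fs]] show "t + s \<le> p (\<lambda>x. c x + f x)" .
  qed
  have L0: "L (\<lambda>_. 0) = 0"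
    using Lle[OF V0 D0] DL[OF D0] psc[OF V0, of 0] by simp
  \<comment> \<open>The cone makes \<open>L\<close> superadditive. The opposite inequality rests on
    splitting the bound for the sum of two pairs: c' + c = (c' + f) + (c - f), and \<open>p\<close>
    is subadditive.\<close>
  have Lneg: "L (\<lambda>x. - f x) \<ge> - L f" if f: "f \<in> V" for f
  proof (rule Lge)
    fix c s assume cs: "(c, s) \<in> D"
    have m: "(\<lambda>x. - f x) \<in> V" using Vsc[of f "-1"] f by simp
    show "s + - L f \<le> p (\<lambda>x. c x + - f x)"
    proof -
      have "s - p (\<lambda>x. c x + - f x) \<le> L f"
      proof (rule Lge)
        fix c' s' assume cs': "(c', s') \<in> D"
        have "s' + s \<le> p (\<lambda>x. c' x + c x)" using Dp[OF Dadd[OF cs' cs]] .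
        also have "(\<lambda>x. c' x + c x) = (\<lambda>x. (c' x + f x) + (c x + - f x))" by (auto simp: algebra_simps)
        also have "p \<dots> \<le> p (\<lambda>x. c' x + f x) + p (\<lambda>x. c x + - f x)"
          using f m DV[OF cs] DV[OF cs'] by (intro psub Vadd)
        finally show "s' + (s - p (\<lambda>x. c x + - f x)) \<le> p (\<lambda>x. c' x + f x)" by simp
      qed
      then show ?thesis by simp
    qed
  qed
  have Lsup: "L f + L g \<le> L (\<lambda>x. f x + g x)" if "f \<in> V" "g \<in> V" for f g
    using DL[OF Dadd[OF LD LD]] that by blast
  have Lm: "L (\<lambda>x. - f x) = - L f" if f: "f \<in> V" for f
  proof -
    have m: "(\<lambda>x. - f x) \<in> V" using Vsc[of f "-1"] f by simp
    show ?thesis using Lsup[OF f m] L0 Lneg[OF f] by simp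
  qed
  have Ladd: "L (\<lambda>x. f x + g x) = L f + L g" if f: "f \<in> V" and g: "g \<in> V" for f g
  proof -
    have m: "(\<lambda>x. - f x) \<in> V" using Vsc[of f "-1"] f by simp
    have "L (\<lambda>x. - f x) + L (\<lambda>x. f x + g x) \<le> L (\<lambda>x. - f x + (f x + g x))"
      using Lsup[OF m Vadd[OF f g]] .
    then show ?thesis using Lm[OF f] Lsup[OF f g] by simp
  qed
  have Lpos: "L (\<lambda>x. c * f x) = c * L f" if f: "f \<in> V" and c: "c > 0" for f c
  proof -
    have 1: "c * L f \<le> L (\<lambda>x. c * f x)" if "f \<in> V" "c > 0" for f c
      using DL[OF Dsc[OF LD]] that by blast
    have "(\<lambda>x. (1/c) * (c * f x)) = f" using c by auto
    then have "(1/c) * L (\<lambda>x. c * f x) \<le> L f" using 1[OF Vsc[OF f], of "1/c" c] c by simp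
    then have "L (\<lambda>x. c * f x) \<le> c * L f" using c by (simp add: field_simps)
    with 1[OF f c] show ?thesis by simp
  qed
  have Lsc: "L (\<lambda>x. c * f x) = c * L f" if f: "f \<in> V" for f c
  proof -
    consider "c > 0" | "c = 0" | "- c > 0" by linarith
    then show ?thesis
    proof cases
      case 3
      have "L (\<lambda>x. - (- c * f x)) = - L (\<lambda>x. - c * f x)" by (rule Lm[OF Vsc[OF f]])
      then show ?thesis using Lpos[OF f 3] by simp
    qed (use Lpos[OF f] L0 in auto)
  qed
  show ?thesis
  proof (rule that)
    show "linear_fun_on V L" using Ladd Lsc unfolding linear_fun_on_def by blast
    show "L f \<le> p f" if "f \<in> V" for f using Lle[OF that D0] by simp
    show "s \<le> L f" if "(f, s) \<in> C" for f s using DL CD that by blast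
  qed
qed

section \<open>Regular Borel measures on compact spaces\<close>

lemma ennreal_SUP_add_le:
  fixes f :: "'i \<Rightarrow> ennreal"
  assumes "I \<noteq> {}" "\<And>i. i \<in> I \<Longrightarrow> f i + c \<le> b"
  shows "(SUP i\<in>I. f i) + c \<le> b"
proof -
  have "(SUP i\<in>I. f i) + c = (SUP i\<in>I. f i + c)"
    by (rule ennreal_SUP_add_left[symmetric, OF assms(1)])
  also have "\<dots> \<le> b" using assms(2) by (rule SUP_least)
  finally show ?thesis .
qed

text \<open>
  Unlike in the usual proof of the Riesz representation theorem, the set function is already given
  on the closed sets, so that no Urysohn functions are needed.
\<close>

theorem regular_measure_of_finitely_additive:
  fixes \<tau> :: "'b topology" and lam :: "'b set \<Rightarrow> real"
  assumes comp: "compact_space \<tau>" and normal: "normal_space \<tau>"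
    and nonneg: "\<And>A. A \<subseteq> topspace \<tau> \<Longrightarrow> 0 \<le> lam A"
    and add: "\<And>A B. A \<subseteq> topspace \<tau> \<Longrightarrow> B \<subseteq> topspace \<tau> \<Longrightarrow> A \<inter> B = {} \<Longrightarrow> lam (A \<union> B) = lam A + lam B"
    and total: "lam (topspace \<tau>) = 1"
  obtains \<nu> where "regular_borel_prob \<tau> \<nu>" "\<And>C. closedin \<tau> C \<Longrightarrow> ennreal (lam C) \<le> emeasure \<nu> C"
proof -
  define \<Omega> where "\<Omega> = topspace \<tau>"
  have mono: "lam A \<le> lam B" if "A \<subseteq> B" "B \<subseteq> \<Omega>" for A B
  proof -
    have "lam (A \<union> (B - A)) = lam A + lam (B - A)" using that unfolding \<Omega>_def by (intro add) auto
    moreover have "A \<union> (B - A) = B" using that by auto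
    moreover have "0 \<le> lam (B - A)" using that unfolding \<Omega>_def by (intro nonneg) auto
    ultimately show ?thesis by simp
  qed
  have empty: "lam {} = 0" using add[of "{}" "{}"] by simp
  have subadd: "lam (A \<union> B) \<le> lam A + lam B" if "A \<subseteq> \<Omega>" "B \<subseteq> \<Omega>" for A B
  proof -
    have "lam (A \<union> (B - A)) = lam A + lam (B - A)" using that unfolding \<Omega>_def by (intro add) auto
    moreover have "lam (B - A) \<le> lam B" using that by (intro mono) auto
    ultimately show ?thesis by simp
  qed
  have clsub: "C \<subseteq> \<Omega>" if "closedin \<tau> C" for C using closedin_subset[OF that] unfolding \<Omega>_def .
  have opsub: "C \<subseteq> \<Omega>" if "openin \<tau> C" for C using openin_subset[OF that] unfolding \<Omega>_def .
  \<comment> \<open>Inner content of open sets through their closed subsets, followed by the outer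
    measure that it induces. The given set function is only finitely additive and may itself be far
    from regular.\<close>
  define o' where "o' U = (SUP C\<in>{C. closedin \<tau> C \<and> C \<subseteq> U}. ennreal (lam C))" for U
  define n where "n A = (INF U\<in>{U. openin \<tau> U \<and> A \<subseteq> U}. o' U)" for A
  have o_mono: "o' U \<le> o' V" if "U \<subseteq> V" for U V
    unfolding o'_def using that by (intro SUP_subset_mono) auto
  have oI: "ennreal (lam C) \<le> o' U" if "closedin \<tau> C" "C \<subseteq> U" for C U
    unfolding o'_def using that by (intro SUP_upper) auto
  have n_open: "n U = o' U" if "openin \<tau> U" for U
    unfolding n_def using that by (intro antisym INF_greatest INF_lower2[of U]) (auto intro: o_mono)
  have n_le: "n A \<le> o' U" if "openin \<tau> U" "A \<subseteq> U" for A U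
    unfolding n_def using that by (intro INF_lower) auto
  have n_mono: "n A \<le> n B" if "A \<subseteq> B" for A B
    unfolding n_def using that by (intro INF_superset_mono) auto
  have o_le: "o' U \<le> b" if "\<And>C. closedin \<tau> C \<Longrightarrow> C \<subseteq> U \<Longrightarrow> ennreal (lam C) \<le> b" for U b
    unfolding o'_def using that by (intro SUP_least) auto
  have o_empty: "o' {} = 0"
  proof -
    have "o' {} \<le> 0" by (rule o_le) (use empty in auto)
    then show ?thesis by simp
  qed
  have o_space: "o' \<Omega> = 1"
  proof (rule antisym)
    show "o' \<Omega> \<le> 1"
    proof (rule o_le)
      fix C assume "C \<subseteq> \<Omega>"
      then have "lam C \<le> 1" using mono[of C \<Omega>] total unfolding \<Omega>_def by simp
      then show "ennreal (lam C) \<le> 1" by simp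
    qed
    show "1 \<le> o' \<Omega>" using oI[of \<Omega> \<Omega>] total unfolding \<Omega>_def by simp
  qed
  have fin_sub: "ennreal (lam C) \<le> (\<Sum>i<N. o' (U i))"
    if "\<And>i. openin \<tau> (U i)" "closedin \<tau> C" "C \<subseteq> (\<Union>i<N. U i)" for U :: "nat \<Rightarrow> 'b set" and C N
    using that(2,3)
  proof (induction N arbitrary: C)
    case 0
    then show ?case using empty by simp
  next
    case (Suc N)
    define W where "W = (\<Union>i<N. U i)"
    have W: "openin \<tau> W" unfolding W_def using that(1) by blast
    have cl: "closedin \<tau> (C - U N)" "closedin \<tau> (C - W)" using Suc.prems that(1) W by auto
    have CW: "C \<subseteq> W \<union> U N" using Suc.prems(2) unfolding W_def by (auto simp: lessThan_Suc)
    then have "disjnt (C - U N) (C - W)" unfolding disjnt_def by auto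
    \<comment> \<open>\<open>C - U N\<close> and \<open>C - W\<close> are disjoint closed sets.
      Cutting \<open>C\<close> along open sets separating them leaves closed pieces:
      \<open>C - Q\<close> lies in \<open>W\<close> and \<open>C - P\<close> in \<open>U N\<close>,
      and together they cover \<open>C\<close>.\<close>
    with normal cl obtain P Q where PQ: "openin \<tau> P" "openin \<tau> Q" "C - U N \<subseteq> P" "C - W \<subseteq> Q" "disjnt P Q"
      unfolding normal_space_def by metis
    have c1: "closedin \<tau> (C - Q)" and c2: "closedin \<tau> (C - P)" using PQ Suc.prems by auto
    have "lam C \<le> lam ((C - Q) \<union> (C - P))"
      using PQ(5) clsub[OF Suc.prems(1)] by (intro mono) (auto simp: disjnt_def)
    also have "\<dots> \<le> lam (C - Q) + lam (C - P)" using clsub[OF c1] clsub[OF c2] by (rule subadd)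
    finally have "ennreal (lam C) \<le> ennreal (lam (C - Q)) + ennreal (lam (C - P))"
      using nonneg clsub[OF c1] clsub[OF c2] unfolding \<Omega>_def by (subst ennreal_plus[symmetric]) (auto simp del: ennreal_plus)
    also have "\<dots> \<le> (\<Sum>i<N. o' (U i)) + o' (U N)"
    proof (rule add_mono)
      show "ennreal (lam (C - Q)) \<le> (\<Sum>i<N. o' (U i))"
        using PQ by (intro Suc.IH[OF c1]) (auto simp: W_def)
      show "ennreal (lam (C - P)) \<le> o' (U N)" using PQ by (intro oI c2) auto
    qed
    finally show ?case by simp
  qed
  \<comment> \<open>A closed set inside a countable union of open sets is compact, so finitely many
    of them already cover it.\<close>
  have o_csub: "o' (\<Union>i. U i) \<le> (\<Sum>i. o' (U i))" if "\<And>i. openin \<tau> (U i)" for U :: "nat \<Rightarrow> 'b set"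
  proof (rule o_le)
    fix C assume C: "closedin \<tau> C" "C \<subseteq> (\<Union>i. U i)"
    have "compactin \<tau> C" using comp C(1) by (rule closedin_compact_space)
    moreover have "\<forall>V\<in>range U. openin \<tau> V" using that by auto
    ultimately obtain F where F: "finite F" "F \<subseteq> range U" "C \<subseteq> \<Union>F"
      using C(2) unfolding compactin_def by blast
    then obtain I where I: "finite I" "F = U ` I" by (meson finite_subset_image)
    then obtain N where "I \<subseteq> {..<N}" using finite_nat_iff_bounded by blast
    then have "C \<subseteq> (\<Union>i<N. U i)" using F(3) I(2) by blast
    then have "ennreal (lam C) \<le> (\<Sum>i<N. o' (U i))" by (intro fin_sub that C)
    also have "\<dots> \<le> (\<Sum>i. o' (U i))" by (rule sum_le_suminf) auto
    finally show "ennreal (lam C) \<le> (\<Sum>i. o' (U i))" .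
  qed
  have n_fin: "n A < top" if "A \<subseteq> \<Omega>" for A
    using n_le[OF openin_topspace, of A] that o_space unfolding \<Omega>_def
    by (metis ennreal_one_less_top order.strict_trans1)
  have csa: "countably_subadditive (Pow \<Omega>) n"
    unfolding countably_subadditive_def
  proof safe
    fix A :: "nat \<Rightarrow> 'b set" assume A: "range A \<subseteq> Pow \<Omega>"
    show "n (\<Union>i. A i) \<le> (\<Sum>i. n (A i))"
    proof (rule ennreal_le_epsilon)
      fix e :: real assume e: "0 < e"
      have "\<exists>U. openin \<tau> U \<and> A i \<subseteq> U \<and> o' U \<le> n (A i) + ennreal (e * (1/2)^Suc i)" for i
      proof -
        have "A i \<subseteq> \<Omega>" using A by blast
        then have "n (A i) < n (A i) + ennreal (e * (1/2)^Suc i)"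
          using n_fin[of "A i"] e by (auto simp: ennreal_add_left_cancel_less)
        then obtain U where "openin \<tau> U" "A i \<subseteq> U" "o' U < n (A i) + ennreal (e * (1/2)^Suc i)"
          unfolding n_def INF_less_iff by auto
        then show ?thesis using less_imp_le by blast
      qed
      then obtain U where U: "\<And>i. openin \<tau> (U i)" "\<And>i. A i \<subseteq> U i"
        "\<And>i. o' (U i) \<le> n (A i) + ennreal (e * (1/2)^Suc i)" by metis
      have "n (\<Union>i. A i) \<le> o' (\<Union>i. U i)" using U by (intro n_le) auto
      also have "\<dots> \<le> (\<Sum>i. o' (U i))" using U(1) by (rule o_csub)
      also have "\<dots> \<le> (\<Sum>i. n (A i) + ennreal (e * (1/2)^Suc i))" by (intro suminf_le U(3)) auto
      also have "\<dots> = (\<Sum>i. n (A i)) + (\<Sum>i. ennreal (e * (1/2)^Suc i))"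
        by (rule suminf_add[symmetric]) auto
      also have "(\<Sum>i. ennreal (e * (1/2)^Suc i)) = ennreal e"
      proof (rule suminf_ennreal_eq)
        show "0 \<le> e * (1/2)^Suc i" for i using e by simp
        show "(\<lambda>i. e * (1/2)^Suc i) sums e" using sums_mult[OF power_half_series, of e] by simp
      qed
      finally show "n (\<Union>i. A i) \<le> (\<Sum>i. n (A i)) + ennreal e" .
    qed
  qed
  interpret P: sigma_algebra \<Omega> "Pow \<Omega>" by (rule sigma_algebra_Pow)
  have pos: "positive (Pow \<Omega>) n" unfolding positive_def using n_open[of "{}"] o_empty by simp
  have oms: "outer_measure_space (Pow \<Omega>) n"
    unfolding outer_measure_space_def using csa pos n_mono by (auto simp: increasing_def)
  define L where "L = lambda_system \<Omega> (Pow \<Omega>) n"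
  have ms: "measure_space \<Omega> L n" unfolding L_def by (rule P.caratheodory_lemma[OF oms])
  have n_sub: "n (A \<union> B) \<le> n A + n B" if "A \<subseteq> \<Omega>" "B \<subseteq> \<Omega>" "A \<inter> B = {}" for A B
    using P.countably_subadditive_subadditive[OF pos csa] that unfolding subadditive_def by auto
  \<comment> \<open>Caratheodory measurability of open sets: exhaust \<open>V \<inter> U\<close> by
    a closed \<open>C\<close>, then exhaust the open set \<open>V - C\<close>, which contains
    \<open>V - U\<close>, by a closed \<open>D\<close>. On the disjoint union of \<open>C\<close>
    and \<open>D\<close> the given set function is additive.\<close>
  have opL: "U \<in> L" if U: "openin \<tau> U" for U
  proof -
    have key: "o' (V \<inter> U) + n (V - U) \<le> o' V" if V: "openin \<tau> V" for V
      unfolding o'_def[of "V \<inter> U"]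
    proof (rule ennreal_SUP_add_le)
      show "{C. closedin \<tau> C \<and> C \<subseteq> V \<inter> U} \<noteq> {}" using closedin_empty by blast
      fix C assume "C \<in> {C. closedin \<tau> C \<and> C \<subseteq> V \<inter> U}"
      then have C: "closedin \<tau> C" "C \<subseteq> V" "C \<subseteq> U" by auto
      have op: "openin \<tau> (V - C)" using V C by auto
      have "n (V - U) \<le> o' (V - C)" using op C by (intro n_le) auto
      then have "ennreal (lam C) + n (V - U) \<le> o' (V - C) + ennreal (lam C)"
        by (simp add: add.commute add_right_mono)
      also have "\<dots> \<le> o' V"
        unfolding o'_def[of "V - C"]
      proof (rule ennreal_SUP_add_le)
        show "{D. closedin \<tau> D \<and> D \<subseteq> V - C} \<noteq> {}" using closedin_empty by blast
        fix D assume "D \<in> {D. closedin \<tau> D \<and> D \<subseteq> V - C}"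
        then have D: "closedin \<tau> D" "D \<subseteq> V - C" by auto
        have "ennreal (lam D) + ennreal (lam C) = ennreal (lam D + lam C)"
          using nonneg clsub[OF D(1)] clsub[OF C(1)] unfolding \<Omega>_def by simp
        also have "lam D + lam C = lam (D \<union> C)"
          using clsub[OF D(1)] clsub[OF C(1)] D unfolding \<Omega>_def by (intro add[symmetric]) auto
        also have "ennreal \<dots> \<le> o' V" using C D by (intro oI) auto
        finally show "ennreal (lam D) + ennreal (lam C) \<le> o' V" .
      qed
      finally show "ennreal (lam C) + n (V - U) \<le> o' V" .
    qed
    have "n (A \<inter> U) + n (A - U) = n A" if A: "A \<subseteq> \<Omega>" for A
    proof (rule antisym)
      show "n (A \<inter> U) + n (A - U) \<le> n A"
        unfolding n_def[of A]
      proof (rule INF_greatest)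
        fix V assume "V \<in> {V. openin \<tau> V \<and> A \<subseteq> V}"
        then have V: "openin \<tau> V" "A \<subseteq> V" by auto
        have "n (A \<inter> U) \<le> o' (V \<inter> U)" using V U by (intro n_le) auto
        moreover have "n (A - U) \<le> n (V - U)" using V by (intro n_mono) auto
        ultimately have "n (A \<inter> U) + n (A - U) \<le> o' (V \<inter> U) + n (V - U)" by (rule add_mono)
        also have "\<dots> \<le> o' V" by (rule key[OF V(1)])
        finally show "n (A \<inter> U) + n (A - U) \<le> o' V" .
      qed
      have "A = (A \<inter> U) \<union> (A - U)" by auto
      then show "n A \<le> n (A \<inter> U) + n (A - U)" using n_sub[of "A \<inter> U" "A - U"] A by auto
    qed
    then show ?thesis unfolding L_def P.lambda_system_eq using opsub[OF U] by auto
  qed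
  have opPow: "{U. openin \<tau> U} \<subseteq> Pow \<Omega>" using opsub by auto
  define \<nu> where "\<nu> = measure_of \<Omega> {U. openin \<tau> U} n"
  have sets: "sets \<nu> = sigma_sets \<Omega> {U. openin \<tau> U}"
    and space: "space \<nu> = \<Omega>" unfolding \<nu>_def using opPow by auto
  have sL: "sigma_algebra \<Omega> L" using ms unfolding measure_space_def by simp
  have sub: "sets \<nu> \<subseteq> L"
  proof -
    have "{U. openin \<tau> U} \<subseteq> L" using opL by blast
    from sigma_algebra.sigma_sets_subset[OF sL this] show ?thesis unfolding sets .
  qed
  have "measure_space \<Omega> (sets \<nu>) n"
    using ms _ sub by (rule measure_down) (use sets.sigma_algebra_axioms[of \<nu>] space in simp)
  then have em: "emeasure \<nu> A = n A" if "A \<in> sets \<nu>" for A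
    using that by (intro emeasure_measure_of[OF \<nu>_def opPow]) (auto simp: measure_space_def)
  have op_sets: "U \<in> sets \<nu>" if "openin \<tau> U" for U unfolding sets using that by auto
  have cl_sets: "C \<in> sets \<nu>" if "closedin \<tau> C" for C
  proof -
    have "openin \<tau> (\<Omega> - C)" using that unfolding \<Omega>_def by auto
    then have "space \<nu> - (\<Omega> - C) \<in> sets \<nu>" by (intro sets.compl_sets op_sets)
    then show ?thesis using clsub[OF that] space by (simp add: double_diff)
  qed
  have tot: "emeasure \<nu> \<Omega> = 1"
    using em[OF op_sets[OF openin_topspace]] n_open[OF openin_topspace] o_space unfolding \<Omega>_def by simp
  have prob: "prob_space \<nu>" using tot space by (intro prob_spaceI) simp
  interpret prob_space \<nu> by (rule prob)
  have outer: "emeasure \<nu> A = (INF U\<in>{U. openin \<tau> U \<and> A \<subseteq> U}. emeasure \<nu> U)" if "A \<in> sets \<nu>" for A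
    unfolding em[OF that] n_def[of A] by (intro INF_cong refl) (auto simp: em[OF op_sets] n_open)
  \<comment> \<open>Outer regularity of the complement: removing from the space an open set that
    barely exceeds the complement of \<open>A\<close> leaves a closed subset of \<open>A\<close>,
    compact because the space is.\<close>
  have inner: "emeasure \<nu> A = (SUP K\<in>{K. compactin \<tau> K \<and> closedin \<tau> K \<and> K \<subseteq> A}. emeasure \<nu> K)"
    (is "_ = ?S") if A: "A \<in> sets \<nu>" for A
  proof (rule antisym)
    show "?S \<le> emeasure \<nu> A" using A by (intro SUP_least emeasure_mono) auto
    show "emeasure \<nu> A \<le> ?S"
    proof (rule ennreal_le_epsilon)
      fix e :: real assume e: "0 < e"
      have AO: "A \<subseteq> \<Omega>" using sets.sets_into_space[OF A] space by simp
      define B where "B = \<Omega> - A"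
      have B: "B \<in> sets \<nu>" unfolding B_def using A space sets.compl_sets by metis
      have "emeasure \<nu> B < emeasure \<nu> B + ennreal e"
        using e emeasure_finite[of B] by (auto simp: ennreal_add_left_cancel_less less_top)
      then have "(INF U\<in>{U. openin \<tau> U \<and> B \<subseteq> U}. emeasure \<nu> U) < emeasure \<nu> B + ennreal e"
        using outer[OF B] by simp
      then obtain U where U: "openin \<tau> U" "B \<subseteq> U" "emeasure \<nu> U < emeasure \<nu> B + ennreal e"
        unfolding INF_less_iff by auto
      define K where "K = \<Omega> - U"
      have K: "closedin \<tau> K" unfolding K_def \<Omega>_def using U(1) by auto
      have KA: "K \<subseteq> A" unfolding K_def using U(2) B_def by auto
      have "emeasure \<nu> A + emeasure \<nu> B = emeasure \<nu> (A \<union> B)"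
        using A B unfolding B_def by (intro plus_emeasure) auto
      also have "A \<union> B = K \<union> U" using AO opsub[OF U(1)] unfolding B_def K_def by auto
      also have "emeasure \<nu> (K \<union> U) = emeasure \<nu> K + emeasure \<nu> U"
        using cl_sets[OF K] op_sets[OF U(1)] unfolding K_def by (intro plus_emeasure[symmetric]) auto
      also have "\<dots> \<le> emeasure \<nu> K + (emeasure \<nu> B + ennreal e)"
        using U(3) by (intro add_left_mono) simp
      also have "emeasure \<nu> K \<le> ?S" using K KA comp by (intro SUP_upper) (auto intro: closedin_compact_space)
      finally have "emeasure \<nu> B + emeasure \<nu> A \<le> emeasure \<nu> B + (?S + ennreal e)"
        by (simp add: algebra_simps add_right_mono)
      then show "emeasure \<nu> A \<le> ?S + ennreal e"
        using emeasure_finite[of B] by (auto simp: ennreal_add_left_cancel_le)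
    qed
  qed
  show ?thesis
  proof (rule that)
    show "regular_borel_prob \<tau> \<nu>"
      unfolding regular_borel_prob_def \<Omega>_def[symmetric]
      by (intro conjI ballI prob space sets outer inner)
    show "ennreal (lam C) \<le> emeasure \<nu> C" if C: "closedin \<tau> C" for C
      unfolding em[OF cl_sets[OF C]] n_def using C by (intro INF_greatest oI) auto
  qed
qed

text \<open>A discrete layer cake. Level 0 is always counted when \<open>N\<close> is positive, so
  the count of levels below \<open>y\<close> never falls short of \<open>y\<close> and exceeds it by
  at most one.\<close>

lemma count_le_level:
  fixes y :: real and N :: nat
  assumes "0 \<le> y" "y \<le> real N"
  shows "y \<le> (\<Sum>i<N. if real i \<le> y then 1 else 0)" "(\<Sum>i<N. if real i \<le> y then 1 else 0) \<le> y + 1"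
proof -
  have set: "{i. i < N \<and> real i \<le> y} = {..<min N (nat \<lfloor>y\<rfloor> + 1)}"
    using assms(1) by (auto simp: le_nat_floor less_Suc_eq_le) linarith
  have "(\<Sum>i<N. if real i \<le> y then 1 else (0::real)) = real (card {i. i < N \<and> real i \<le> y})"
    by (simp add: sum.If_cases lessThan_def Int_def conj_commute)
  also have "\<dots> = real (min N (nat \<lfloor>y\<rfloor> + 1))" unfolding set by simp
  finally have eq: "(\<Sum>i<N. if real i \<le> y then 1 else (0::real)) = min (real N) (of_int \<lfloor>y\<rfloor> + 1)"
    using assms(1) by (simp add: of_nat_min of_nat_nat add.commute)
  show "y \<le> (\<Sum>i<N. if real i \<le> y then 1 else 0)" unfolding eq using assms by linarith
  show "(\<Sum>i<N. if real i \<le> y then 1 else 0) \<le> y + 1" unfolding eq by linarith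
qed

text \<open>Continuity is deliberately absent: a functional on all bounded functions can be
  evaluated at the indicator of an arbitrary set, which produces a finitely additive set
  function.\<close>

definition bounded_funs :: "'b set \<Rightarrow> ('b \<Rightarrow> real) set" where
  "bounded_funs K = {f. bounded (f ` K)}"

lemma bounded_funsI: "(\<And>x. x \<in> K \<Longrightarrow> \<bar>f x\<bar> \<le> B) \<Longrightarrow> f \<in> bounded_funs K"
  by (auto simp: bounded_funs_def bounded_iff)

lemma bounded_funs_add: "f \<in> bounded_funs K \<Longrightarrow> g \<in> bounded_funs K \<Longrightarrow> (\<lambda>x. f x + g x) \<in> bounded_funs K"
  using bounded_plus_comp[of f K g] by (simp add: bounded_funs_def)

lemma bounded_funs_scale: "f \<in> bounded_funs K \<Longrightarrow> (\<lambda>x. c * f x) \<in> bounded_funs K"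
  using bounded_scaleR_comp[of f K c] by (simp add: bounded_funs_def)

lemma regular_borel_prob_continuous_measurable:
  assumes "regular_borel_prob \<tau> \<nu>" "continuous_map \<tau> euclideanreal G"
  shows "G \<in> borel_measurable \<nu>"
proof (rule borel_measurableI)
  fix S :: "real set" assume "open S"
  then have "openin \<tau> {x \<in> topspace \<tau>. G x \<in> S}" using assms(2) by (simp add: continuous_map_def)
  then have "{x \<in> topspace \<tau>. G x \<in> S} \<in> sets \<nu>" using assms(1) unfolding regular_borel_prob_def by auto
  moreover have "{x \<in> topspace \<tau>. G x \<in> S} = G -` S \<inter> space \<nu>"
    using assms(1) unfolding regular_borel_prob_def by auto
  ultimately show "G -` S \<inter> space \<nu> \<in> sets \<nu>" by simp
qed

text \<open>The values of \<open>L\<close> at indicators are regularized to a measure that dominates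
  them on closed sets. Superlevel sets of a continuous \<open>G\<close> are closed, so a layer-cake
  sum carries the domination over to \<open>G\<close>. An inequality suffices, as the measure only
  has to bound \<open>L\<close> from above.\<close>

theorem regular_measure_of_functional:
  fixes \<tau> :: "'b topology" and L :: "('b \<Rightarrow> real) \<Rightarrow> real"
  assumes comp: "compact_space \<tau>" and normal: "normal_space \<tau>"
    and lin: "linear_fun_on (bounded_funs (topspace \<tau>)) L"
    and pos: "\<And>f. f \<in> bounded_funs (topspace \<tau>) \<Longrightarrow> (\<And>x. x \<in> topspace \<tau> \<Longrightarrow> 0 \<le> f x) \<Longrightarrow> 0 \<le> L f"
    and one: "L (\<lambda>_. 1) = 1"
  obtains \<nu> where "regular_borel_prob \<tau> \<nu>"
    "\<And>G. continuous_map \<tau> euclideanreal G \<Longrightarrow> (\<And>x. x \<in> topspace \<tau> \<Longrightarrow> 0 \<le> G x) \<Longrightarrow>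
      ennreal (L G) \<le> (\<integral>\<^sup>+x. ennreal (G x) \<partial>\<nu>)"
proof -
  let ?\<Omega> = "topspace \<tau>"
  define V where "V = bounded_funs ?\<Omega>"
  note VI = bounded_funsI[of ?\<Omega>, folded V_def]
  note Vadd = bounded_funs_add[of _ ?\<Omega>, folded V_def]
  note Vsc = bounded_funs_scale[of _ ?\<Omega>, folded V_def]
  note lin = lin[folded V_def] and pos = pos[folded V_def]
  note Ladd = linear_fun_on_add[OF lin] and Lsc = linear_fun_on_scale[OF lin]
  have Vind: "(indicat_real A) \<in> V" for A by (rule VI[where B=1]) (auto simp: indicator_def)
  have Vsum: "(\<lambda>x. \<Sum>i<N. F i x) \<in> V" if "\<And>i. F i \<in> V" for F and N :: nat
  proof (induction N)
    case 0
    show ?case by (rule VI[where B=0]) auto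
  qed (use that Vadd in simp)
  have Lsum: "L (\<lambda>x. \<Sum>i<N. F i x) = (\<Sum>i<N. L (F i))" if "\<And>i. F i \<in> V" for F and N :: nat
  proof (induction N)
    case 0
    show ?case using Lsc[OF that, of 0 0] by simp
  qed (use that Vsum Ladd in simp)
  have Lmono: "L f \<le> L g" if "f \<in> V" "g \<in> V" "\<And>x. x \<in> ?\<Omega> \<Longrightarrow> f x \<le> g x" for f g
  proof -
    have m: "(\<lambda>x. (-1) * f x) \<in> V" by (rule Vsc[OF that(1)])
    have "0 \<le> L (\<lambda>x. g x + (-1) * f x)" using that m by (intro pos Vadd) auto
    also have "\<dots> = L g - L f" using Ladd[OF that(2) m] Lsc[OF that(1), of "-1"] by simp
    finally show ?thesis by simp
  qed
  define lam where "lam A = L (indicat_real A)" for A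
  have "\<exists>\<nu>. regular_borel_prob \<tau> \<nu> \<and> (\<forall>C. closedin \<tau> C \<longrightarrow> ennreal (lam C) \<le> emeasure \<nu> C)"
  proof (rule regular_measure_of_finitely_additive[OF comp normal, of lam])
    show "0 \<le> lam A" for A unfolding lam_def by (intro pos Vind) auto
    show "lam (A \<union> B) = lam A + lam B" if "A \<inter> B = {}" for A B
    proof -
      have "indicat_real (A \<union> B) = (\<lambda>x. indicat_real A x + indicat_real B x)"
        using that by (auto simp: indicator_def fun_eq_iff)
      then show ?thesis unfolding lam_def using Ladd[OF Vind Vind] by simp
    qed
    \<comment> \<open>The two functions may differ off the space; monotonicity compares values on
      the space only, so it gives both inequalities.\<close>
    have "L (indicat_real ?\<Omega>) = L (\<lambda>_. 1)"
      by (intro antisym Lmono Vind VI[where B=1]) auto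
    then show "lam ?\<Omega> = 1" unfolding lam_def using one by simp
  qed blast
  then obtain \<nu> where \<nu>: "regular_borel_prob \<tau> \<nu>" "\<And>C. closedin \<tau> C \<Longrightarrow> ennreal (lam C) \<le> emeasure \<nu> C"
    by blast
  interpret prob_space \<nu> using \<nu>(1) unfolding regular_borel_prob_def by simp
  have space: "space \<nu> = ?\<Omega>" and sets: "sets \<nu> = sigma_sets ?\<Omega> {U. openin \<tau> U}"
    using \<nu>(1) unfolding regular_borel_prob_def by auto
  have op_sets: "U \<in> sets \<nu>" if "openin \<tau> U" for U unfolding sets using that by auto
  have cl_sets: "C \<in> sets \<nu>" if "closedin \<tau> C" for C
  proof -
    have "openin \<tau> (?\<Omega> - C)" using that by auto
    then have "space \<nu> - (?\<Omega> - C) \<in> sets \<nu>" by (intro sets.compl_sets op_sets)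
    then show ?thesis using closedin_subset[OF that] space by (simp add: double_diff)
  qed
  show ?thesis
  proof (rule that[OF \<nu>(1)])
    fix G assume cont: "continuous_map \<tau> euclideanreal G" and G0: "\<And>x. x \<in> ?\<Omega> \<Longrightarrow> 0 \<le> G x"
    have "compactin euclideanreal (G ` ?\<Omega>)"
      using comp cont unfolding compact_space_def by (rule image_compactin)
    then have "bounded (G ` ?\<Omega>)" by (simp add: compact_imp_bounded)
    then obtain b where b: "\<And>x. x \<in> ?\<Omega> \<Longrightarrow> \<bar>G x\<bar> \<le> b" unfolding bounded_iff by auto
    \<comment> \<open>The added 1 makes the bound strictly positive, so that heights can be measured
      in units of \<open>B / real N\<close>.\<close>
    define B where "B = \<bar>b\<bar> + 1"
    have B: "B > 0" "\<And>x. x \<in> ?\<Omega> \<Longrightarrow> G x \<le> B" unfolding B_def using b by force+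
    have GV: "G \<in> V" using b by (rule VI)
    have Gm: "G \<in> borel_measurable \<nu>" by (rule regular_borel_prob_continuous_measurable[OF \<nu>(1) cont])
    have clos: "closedin \<tau> {x \<in> ?\<Omega>. t \<le> G x}" for t
    proof -
      have "closedin \<tau> {x \<in> ?\<Omega>. G x \<in> {t..}}"
        using cont by (rule closedin_continuous_map_preimage) simp
      then show ?thesis by simp
    qed
    \<comment> \<open>A staircase with steps of height \<open>B / real N\<close> over the closed
      superlevel sets lies between \<open>G\<close> and \<open>G + B / real N\<close>. The first
      inequality bounds \<open>L G\<close>, the second bounds the integral of the staircase.\<close>
    have step: "ennreal (L G) \<le> (\<integral>\<^sup>+x. ennreal (G x) \<partial>\<nu>) + ennreal (B / real N)" if N: "N > 0" for N :: nat
    proof -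
      define C where "C i = {x \<in> ?\<Omega>. real i * B / real N \<le> G x}" for i
      have Ccl: "closedin \<tau> (C i)" for i unfolding C_def by (rule clos)
      have ind: "(\<Sum>i<N. indicat_real (C i) x) = (\<Sum>i<N. if real i \<le> G x * real N / B then 1 else 0)" if "x \<in> ?\<Omega>" for x
        using that B N by (intro sum.cong refl) (auto simp: C_def indicator_def field_simps)
      have low: "G x \<le> B / real N * (\<Sum>i<N. indicat_real (C i) x)" if x: "x \<in> ?\<Omega>" for x
      proof -
        have "G x * real N / B \<le> (\<Sum>i<N. indicat_real (C i) x)"
          unfolding ind[OF x] using G0[OF x] B(2)[OF x] B(1) N by (intro count_le_level) (auto simp: field_simps)
        then show ?thesis using B N by (simp add: field_simps)
      qed
      have up: "B / real N * (\<Sum>i<N. indicat_real (C i) x) \<le> G x + B / real N" if x: "x \<in> ?\<Omega>" for x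
      proof -
        have "(\<Sum>i<N. indicat_real (C i) x) \<le> G x * real N / B + 1"
          unfolding ind[OF x] using G0[OF x] B(2)[OF x] B(1) N by (intro count_le_level) (auto simp: field_simps)
        then show ?thesis using B N by (simp add: field_simps)
      qed
      have "L G \<le> L (\<lambda>x. B / real N * (\<Sum>i<N. indicat_real (C i) x))"
        using low by (intro Lmono GV Vsc Vsum Vind)
      also have "\<dots> = B / real N * (\<Sum>i<N. lam (C i))"
        unfolding lam_def using Vind by (subst Lsc[OF Vsum], simp, subst Lsum) auto
      finally have "ennreal (L G) \<le> ennreal (B / real N * (\<Sum>i<N. lam (C i)))" by (rule ennreal_leI)
      also have "\<dots> = ennreal (B / real N) * (\<Sum>i<N. ennreal (lam (C i)))"
        using B N by (subst sum_ennreal) (auto simp: ennreal_mult'[symmetric] lam_def intro!: pos Vind)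
      also have "\<dots> \<le> ennreal (B / real N) * (\<Sum>i<N. emeasure \<nu> (C i))"
        by (intro mult_left_mono sum_mono \<nu>(2) Ccl) auto
      also have "\<dots> = (\<integral>\<^sup>+x. ennreal (B / real N) * (\<Sum>i<N. indicator (C i) x) \<partial>\<nu>)"
        using cl_sets[OF Ccl] by (simp add: nn_integral_cmult nn_integral_sum)
      also have "\<dots> = (\<integral>\<^sup>+x. ennreal (B / real N * (\<Sum>i<N. indicat_real (C i) x)) \<partial>\<nu>)"
      proof (rule nn_integral_cong)
        fix x
        have "(\<Sum>i<N. indicator (C i) x) = ennreal (\<Sum>i<N. indicat_real (C i) x)"
          by (subst sum_ennreal[symmetric]) (auto simp: ennreal_indicator)
        then show "ennreal (B / real N) * (\<Sum>i<N. indicator (C i) x) = ennreal (B / real N * (\<Sum>i<N. indicat_real (C i) x))"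
          using B by (simp add: ennreal_mult'[symmetric])
      qed
      also have "\<dots> \<le> (\<integral>\<^sup>+x. ennreal (G x) + ennreal (B / real N) \<partial>\<nu>)"
        using up G0 B N space by (intro nn_integral_mono) (subst ennreal_plus[symmetric], auto simp del: ennreal_plus intro!: ennreal_leI)
      also have "\<dots> = (\<integral>\<^sup>+x. ennreal (G x) \<partial>\<nu>) + ennreal (B / real N)"
        using Gm by (subst nn_integral_add) (auto simp: emeasure_space_1)
      finally show ?thesis .
    qed
    show "ennreal (L G) \<le> (\<integral>\<^sup>+x. ennreal (G x) \<partial>\<nu>)"
    proof (rule ennreal_le_epsilon)
      fix e :: real assume "0 < e"
      then obtain N :: nat where N: "B / e < real N" using reals_Archimedean2 by blast
      then have N0: "N > 0" using B \<open>0 < e\<close> by (cases N) (auto simp: field_simps)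
      have "ennreal (L G) \<le> (\<integral>\<^sup>+x. ennreal (G x) \<partial>\<nu>) + ennreal (B / real N)" by (rule step[OF N0])
      also have "\<dots> \<le> (\<integral>\<^sup>+x. ennreal (G x) \<partial>\<nu>) + ennreal e"
        using N N0 \<open>0 < e\<close> by (intro add_left_mono ennreal_leI) (simp add: field_simps)
      finally show "ennreal (L G) \<le> (\<integral>\<^sup>+x. ennreal (G x) \<partial>\<nu>) + ennreal e" .
    qed
  qed
qed

section \<open>Inequalities for powers\<close>

lemma ennreal_powr_ennreal: "0 \<le> x \<Longrightarrow> ennreal_powr (ennreal x) a = ennreal (x powr a)"
  by (simp add: ennreal_powr_def)

lemma ennreal_powr_top [simp]: "ennreal_powr top a = top"
  by (simp add: ennreal_powr_def)

lemma ennreal_powr_0 [simp]: "ennreal_powr 0 a = 0"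
  by (simp add: ennreal_powr_def)

lemma ennreal_powr_eq_0_iff [simp]: "ennreal_powr x a = 0 \<longleftrightarrow> x = 0"
  by (cases x) (auto simp: ennreal_powr_ennreal)

lemma ennreal_powr_less_top_iff [simp]: "ennreal_powr x a < top \<longleftrightarrow> x < top"
  by (simp add: ennreal_powr_def less_top)

lemma ennreal_powr_mono: "0 \<le> a \<Longrightarrow> x \<le> y \<Longrightarrow> ennreal_powr x a \<le> ennreal_powr y a"
  by (cases x; cases y) (auto simp: ennreal_powr_ennreal top_unique intro!: ennreal_leI powr_mono2)

lemma ennreal_powr_powr: "ennreal_powr (ennreal_powr x a) b = ennreal_powr x (a * b)"
  by (cases x) (auto simp: ennreal_powr_ennreal powr_powr)

lemma ennreal_powr_one [simp]: "ennreal_powr x 1 = x"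
  by (cases x) (auto simp: ennreal_powr_ennreal)

lemma ennreal_powr_mult: "ennreal_powr (x * y) a = ennreal_powr x a * ennreal_powr y a"
proof (cases "x = top \<or> y = top")
  case True
  then show ?thesis by (auto simp: ennreal_mult_top ennreal_top_mult)
next
  case False
  then obtain r s where "x = ennreal r" "0 \<le> r" "y = ennreal s" "0 \<le> s" by (cases x; cases y) auto
  then show ?thesis
    by (simp add: ennreal_mult[symmetric] ennreal_powr_ennreal powr_mult)
qed

lemma ennreal_powr_inverse: "a > 0 \<Longrightarrow> ennreal_powr (ennreal_powr x a) (1 / a) = x"
  by (simp add: ennreal_powr_powr)

lemma ennreal_powr_inverse': "a > 0 \<Longrightarrow> ennreal_powr (ennreal_powr x (1 / a)) a = x"
  by (simp add: ennreal_powr_powr)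

lemma ennreal_powr_le_iff:
  assumes "a > 0" shows "ennreal_powr x a \<le> y \<longleftrightarrow> x \<le> ennreal_powr y (1 / a)"
  using ennreal_powr_mono[of a x "ennreal_powr y (1 / a)"] ennreal_powr_mono[of "1 / a" "ennreal_powr x a" y] assms
  by (auto simp: ennreal_powr_powr)

lemma le_ennreal_powr_iff:
  assumes "a > 0" shows "y \<le> ennreal_powr x a \<longleftrightarrow> ennreal_powr y (1 / a) \<le> x"
  using ennreal_powr_mono[of a "ennreal_powr y (1 / a)" x] ennreal_powr_mono[of "1 / a" y "ennreal_powr x a"] assms
  by (auto simp: ennreal_powr_powr)

text \<open>A power with exponent a > 0 is an order isomorphism with inverse the power 1/a, hence
  commutes with arbitrary suprema, infinite values included.\<close>

lemma ennreal_powr_SUP: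
  assumes "a > 0" shows "ennreal_powr (SUP i\<in>I. f i) a = (SUP i\<in>I. ennreal_powr (f i) a)"
proof (rule antisym)
  show "ennreal_powr (SUP i\<in>I. f i) a \<le> (SUP i\<in>I. ennreal_powr (f i) a)"
    unfolding ennreal_powr_le_iff[OF assms]
    by (intro SUP_least) (subst ennreal_powr_le_iff[OF assms, symmetric], intro SUP_upper)
  show "(SUP i\<in>I. ennreal_powr (f i) a) \<le> ennreal_powr (SUP i\<in>I. f i) a"
    using assms by (intro SUP_least ennreal_powr_mono SUP_upper) auto
qed

lemma ennreal_powr_INF:
  assumes "a > 0" shows "ennreal_powr (INF i\<in>I. f i) a = (INF i\<in>I. ennreal_powr (f i) a)"
proof (rule antisym)
  show "(INF i\<in>I. ennreal_powr (f i) a) \<le> ennreal_powr (INF i\<in>I. f i) a"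
    unfolding le_ennreal_powr_iff[OF assms]
    by (intro INF_greatest) (subst le_ennreal_powr_iff[OF assms, symmetric], intro INF_lower)
  show "ennreal_powr (INF i\<in>I. f i) a \<le> (INF i\<in>I. ennreal_powr (f i) a)"
    using assms by (intro INF_greatest ennreal_powr_mono INF_lower) auto
qed

lemma measurable_ennreal_powr [measurable (raw)]:
  assumes [measurable]: "f \<in> borel_measurable M"
  shows "(\<lambda>x. ennreal_powr (f x) a) \<in> borel_measurable M"
  unfolding ennreal_powr_def by measurable

lemma powr_convex_combination:
  fixes x y s t p :: real
  assumes p: "1 \<le> p" and xy: "0 \<le> x" "0 \<le> y" and st: "0 < s" "0 < t" "s + t = 1"
  shows "(s * x + t * y) powr p \<le> s * x powr p + t * y powr p"
proof -
  \<comment> \<open>Convexity is at hand on the positive half-line. If one of the points is 0, the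
    claim reduces to c^p \<le> c for c \<le> 1.\<close>
  have scale: "(c * z) powr p \<le> c * z powr p" if "0 < c" "c \<le> 1" "0 \<le> z" for c z :: real
  proof -
    have "c powr p \<le> c powr 1" using that p by (intro powr_mono') auto
    then show ?thesis using that by (simp add: powr_mult mult_right_mono)
  qed
  consider "x = 0" | "y = 0" | "x > 0" "y > 0" using xy by linarith
  then show ?thesis
  proof cases
    case 3
    then show ?thesis using powr_convex[OF p] st unfolding convex_on_def by simp
  qed (use scale[of t y] scale[of s x] xy st in auto)
qed

text \<open>Convexity of the power at x/a and y/b with weights a/(a+b) and b/(a+b). With a and b
  close to the norms of two functions, integration gives Minkowski's inequality.\<close>

lemma ennreal_powr_add_le:
  fixes a b p :: real
  assumes p: "1 \<le> p" and ab: "0 < a" "0 < b"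
  shows "ennreal_powr (x + y) p \<le>
    ennreal ((a + b) powr p) * (ennreal (a / (a + b) * a powr - p) * ennreal_powr x p +
       ennreal (b / (a + b) * b powr - p) * ennreal_powr y p)"
proof (cases "x = top \<or> y = top")
  case True
  then show ?thesis using ab by (auto simp: ennreal_mult_top ennreal_top_mult)
next
  case False
  then obtain r s where rs: "x = ennreal r" "0 \<le> r" "y = ennreal s" "0 \<le> s" by (cases x; cases y) auto
  have "(a + b) * (a / (a + b) * (r / a) + b / (a + b) * (s / b)) = r + s"
    using ab by (simp add: add_divide_distrib[symmetric])
  then have "(r + s) powr p = ((a + b) * (a / (a + b) * (r / a) + b / (a + b) * (s / b))) powr p"
    by simp
  also have "\<dots> = (a + b) powr p * (a / (a + b) * (r / a) + b / (a + b) * (s / b)) powr p"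
    by (rule powr_mult)
  also have "\<dots> \<le> (a + b) powr p * (a / (a + b) * (r / a) powr p + b / (a + b) * (s / b) powr p)"
    using ab rs p by (intro mult_left_mono powr_convex_combination) (auto simp: add_divide_distrib[symmetric])
  also have "\<dots> = (a + b) powr p * (a / (a + b) * a powr - p * r powr p + b / (a + b) * b powr - p * s powr p)"
    using ab rs by (simp add: powr_divide powr_minus divide_inverse powr_mult inverse_powr mult.assoc)
  finally have "ennreal ((r + s) powr p) \<le> ennreal \<dots>" by (rule ennreal_leI)
  then show ?thesis using rs ab
    by (simp add: ennreal_powr_ennreal ennreal_mult'[symmetric] ennreal_plus[symmetric] del: ennreal_plus)
qed

theorem nn_integral_Minkowski:
  fixes u v :: "'a \<Rightarrow> ennreal"
  assumes p: "1 \<le> p" and [measurable]: "u \<in> borel_measurable M" "v \<in> borel_measurable M"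
  shows "ennreal_powr (\<integral>\<^sup>+x. ennreal_powr (u x + v x) p \<partial>M) (1 / p) \<le>
    ennreal_powr (\<integral>\<^sup>+x. ennreal_powr (u x) p \<partial>M) (1 / p) +
    ennreal_powr (\<integral>\<^sup>+x. ennreal_powr (v x) p \<partial>M) (1 / p)" (is "?N \<le> ?U + ?V")
proof (rule ennreal_le_epsilon)
  fix e :: real assume e: "0 < e" and fin: "?U + ?V < top"
  have p0: "p > 0" using p by simp
  obtain a' b' where a': "?U = ennreal a'" "0 \<le> a'" and b': "?V = ennreal b'" "0 \<le> b'"
    using fin by (cases ?U; cases ?V) auto
  \<comment> \<open>Half of \<open>e\<close> is added to each norm, so that division is possible
    even when a norm vanishes.\<close>
  define a b where "a = a' + e / 2" and "b = b' + e / 2"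
  have ab: "0 < a" "0 < b" using a' b' e unfolding a_def b_def by auto
  have norm: "ennreal (c powr - p) * (\<integral>\<^sup>+x. ennreal_powr (w x) p \<partial>M) \<le> 1"
    if "ennreal_powr (\<integral>\<^sup>+x. ennreal_powr (w x) p \<partial>M) (1 / p) \<le> ennreal c" "c > 0" for c w
  proof -
    have "(\<integral>\<^sup>+x. ennreal_powr (w x) p \<partial>M) \<le> ennreal_powr (ennreal c) p"
      using that(1) p0 by (subst (asm) ennreal_powr_le_iff) auto
    then have "ennreal (c powr - p) * (\<integral>\<^sup>+x. ennreal_powr (w x) p \<partial>M) \<le> ennreal (c powr - p) * ennreal (c powr p)"
      using that(2) by (intro mult_left_mono) (auto simp: ennreal_powr_ennreal)
    also have "\<dots> = 1" using that(2) by (simp add: ennreal_mult'[symmetric] powr_add[symmetric])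
    finally show ?thesis .
  qed
  have e1: "ennreal (a / (a + b) * a powr - p) = ennreal (a / (a + b)) * ennreal (a powr - p)"
    and e2: "ennreal (b / (a + b) * b powr - p) = ennreal (b / (a + b)) * ennreal (b powr - p)"
    using ab by (subst ennreal_mult[symmetric]; simp)+
  have "(\<integral>\<^sup>+x. ennreal_powr (u x + v x) p \<partial>M) \<le>
    (\<integral>\<^sup>+x. ennreal ((a + b) powr p) * (ennreal (a / (a + b) * a powr - p) * ennreal_powr (u x) p +
       ennreal (b / (a + b) * b powr - p) * ennreal_powr (v x) p) \<partial>M)"
    by (intro nn_integral_mono ennreal_powr_add_le p ab)
  also have "\<dots> = ennreal ((a + b) powr p) *
     (ennreal (a / (a + b)) * (ennreal (a powr - p) * (\<integral>\<^sup>+x. ennreal_powr (u x) p \<partial>M)) +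
      ennreal (b / (a + b)) * (ennreal (b powr - p) * (\<integral>\<^sup>+x. ennreal_powr (v x) p \<partial>M)))"
    unfolding e1 e2 by (simp add: nn_integral_cmult nn_integral_add mult.assoc)
  also have "\<dots> \<le> ennreal ((a + b) powr p) * (ennreal (a / (a + b)) * 1 + ennreal (b / (a + b)) * 1)"
    using a' b' e ab unfolding a_def[symmetric] b_def[symmetric]
    by (intro mult_left_mono add_mono norm) (auto simp: a_def b_def)
  also have "ennreal (a / (a + b)) * 1 + ennreal (b / (a + b)) * 1 = 1"
    using ab by (simp add: ennreal_plus[symmetric] add_divide_distrib[symmetric] del: ennreal_plus)
  finally have "(\<integral>\<^sup>+x. ennreal_powr (u x + v x) p \<partial>M) \<le> ennreal_powr (ennreal (a + b)) p"
    using ab by (simp add: ennreal_powr_ennreal del: ennreal_plus)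
  then have "?N \<le> ennreal (a + b)" using p0 by (subst ennreal_powr_le_iff) auto
  also have "\<dots> = ?U + ?V + ennreal e"
    using a' b' e unfolding a_def b_def by (simp add: ennreal_plus[symmetric] del: ennreal_plus)
  finally show "?N \<le> ?U + ?V + ennreal e" .
qed

section \<open>Hoelder's inequality and norming vectors for finite sequences\<close>

lemma sum_Hoelder:
  fixes a b :: "nat \<Rightarrow> real"
  assumes pq: "1 < p" "1 < q" "1 / p + 1 / q = 1"
  shows "(\<Sum>k<n. \<bar>a k\<bar> * \<bar>b k\<bar>) \<le> (\<Sum>k<n. \<bar>a k\<bar> powr p) powr (1 / p) * (\<Sum>k<n. \<bar>b k\<bar> powr q) powr (1 / q)"
proof -
  define A B where "A = (\<Sum>k<n. \<bar>a k\<bar> powr p)" and "B = (\<Sum>k<n. \<bar>b k\<bar> powr q)"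
  have AB: "0 \<le> A" "0 \<le> B" unfolding A_def B_def by (auto intro: sum_nonneg)
  show ?thesis
  proof (cases "A = 0 \<or> B = 0")
    case True
    have "\<bar>a k\<bar> * \<bar>b k\<bar> = 0" if "k < n" for k
    proof -
      have "\<bar>a k\<bar> powr p = 0 \<or> \<bar>b k\<bar> powr q = 0"
        using True that unfolding A_def B_def by (subst (asm) (1 2) sum_nonneg_eq_0_iff) auto
      then show ?thesis by auto
    qed
    then have "(\<Sum>k<n. \<bar>a k\<bar> * \<bar>b k\<bar>) = 0" by (intro sum.neutral) auto
    then show ?thesis by simp
  next
    case False
    then have AB: "0 < A" "0 < B" using AB by auto
    \<comment> \<open>Division by the two norms makes Young's bounds add up to 1/p + 1/q =
      1.\<close>
    define \<alpha> \<beta> where "\<alpha> = A powr (1 / p)" and "\<beta> = B powr (1 / q)"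
    have \<alpha>\<beta>: "\<alpha> > 0" "\<beta> > 0" "\<alpha> powr p = A" "\<beta> powr q = B"
      using AB pq unfolding \<alpha>_def \<beta>_def by (auto simp: powr_powr)
    have "(\<Sum>k<n. (\<bar>a k\<bar> / \<alpha>) * (\<bar>b k\<bar> / \<beta>)) \<le> (\<Sum>k<n. (\<bar>a k\<bar> / \<alpha>) powr p / p + (\<bar>b k\<bar> / \<beta>) powr q / q)"
      using pq \<alpha>\<beta> by (intro sum_mono Youngs_inequality) auto
    also have "\<dots> = (\<Sum>k<n. \<bar>a k\<bar> powr p) / A / p + (\<Sum>k<n. \<bar>b k\<bar> powr q) / B / q"
      using \<alpha>\<beta> by (simp add: sum.distrib powr_divide sum_divide_distrib)
    also have "\<dots> = 1" using AB pq unfolding A_def[symmetric] B_def[symmetric] by simp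
    finally have "(\<Sum>k<n. \<bar>a k\<bar> * \<bar>b k\<bar>) / (\<alpha> * \<beta>) \<le> 1"
      by (simp add: sum_divide_distrib)
    then show ?thesis using \<alpha>\<beta> unfolding A_def[symmetric] B_def[symmetric] \<alpha>_def[symmetric] \<beta>_def[symmetric]
      by (simp add: field_simps)
  qed
qed

lemma lnorm_ennreal: "0 \<le> p \<Longrightarrow> lnorm (ennreal p) n a = (\<Sum>k<n. \<bar>a k\<bar> powr p) powr (1 / p)"
  by (simp add: lnorm_def)

lemma lnorm_nonneg: "0 \<le> lnorm r n a"
  by (auto simp: lnorm_def)

lemma lnorm_zero [simp]: "lnorm r n (\<lambda>_. 0) = 0"
  by (cases "n = 0") (auto simp: lnorm_def image_constant_conv)

lemma lnorm_mono:
  assumes "\<And>k. k < n \<Longrightarrow> \<bar>a k\<bar> \<le> \<bar>b k\<bar>"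
  shows "lnorm r n a \<le> lnorm r n b"
proof (cases "r = top")
  case True
  have "x \<le> Max (insert 0 ((\<lambda>k. \<bar>b k\<bar>) ` {..<n}))" if x: "x \<in> insert 0 ((\<lambda>k. \<bar>a k\<bar>) ` {..<n})" for x
  proof (cases "x = 0")
    case False
    then obtain k where k: "k < n" "x = \<bar>a k\<bar>" using x by auto
    then have "x \<le> \<bar>b k\<bar>" using assms by auto
    also have "\<dots> \<le> Max (insert 0 ((\<lambda>k. \<bar>b k\<bar>) ` {..<n}))" using k by (intro Max_ge) auto
    finally show ?thesis .
  qed auto
  then show ?thesis using True by (simp add: lnorm_def)
next
  case False
  then show ?thesis using assms
    by (auto simp: lnorm_def intro!: powr_mono2 sum_mono sum_nonneg)
qed

lemma lnorm_cong: "(\<And>k. k < n \<Longrightarrow> \<bar>a k\<bar> = \<bar>b k\<bar>) \<Longrightarrow> lnorm r n a = lnorm r n b"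
  by (intro antisym lnorm_mono) auto

lemma lnorm_top_le_iff: "lnorm top n a \<le> c \<longleftrightarrow> 0 \<le> c \<and> (\<forall>k<n. \<bar>a k\<bar> \<le> c)"
  by (auto simp: lnorm_def)

lemma abs_le_lnorm:
  assumes "k < n" "r = top \<or> 0 < enn2real r"
  shows "\<bar>a k\<bar> \<le> lnorm r n a"
proof (cases "r = top")
  case True
  then show ?thesis using lnorm_top_le_iff[of n a "lnorm top n a"] assms by simp
next
  case False
  define s where "s = enn2real r"
  have s: "s > 0" using assms False unfolding s_def by simp
  have "\<bar>a k\<bar> powr s \<le> (\<Sum>k<n. \<bar>a k\<bar> powr s)" using assms by (intro member_le_sum) auto
  then have "(\<bar>a k\<bar> powr s) powr (1 / s) \<le> (\<Sum>k<n. \<bar>a k\<bar> powr s) powr (1 / s)"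
    using s by (intro powr_mono2) auto
  then show ?thesis using s False unfolding lnorm_def s_def[symmetric] by (simp add: powr_powr)
qed

lemma lnorm_scale:
  assumes "r = top \<or> 0 < enn2real r"
  shows "lnorm r n (\<lambda>k. c * a k) = \<bar>c\<bar> * lnorm r n a"
proof (cases "r = top")
  case True
  have le: "lnorm top n (\<lambda>k. c * a k) \<le> \<bar>c\<bar> * lnorm top n a" for c a
    unfolding lnorm_top_le_iff using abs_le_lnorm[of _ n top a]
    by (auto simp: abs_mult lnorm_nonneg intro: mult_left_mono)
  show ?thesis
  proof (cases "c = 0")
    case False
    have "lnorm top n (\<lambda>k. (1 / c) * (c * a k)) \<le> \<bar>1 / c\<bar> * lnorm top n (\<lambda>k. c * a k)" by (rule le)
    then show ?thesis using le[of c a] True False by (simp add: field_simps)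
  qed simp
next
  case False
  define s where "s = enn2real r"
  have s: "s > 0" using assms False unfolding s_def by simp
  show ?thesis using False s unfolding lnorm_def s_def[symmetric]
    by (simp add: abs_mult powr_mult sum_distrib_left[symmetric] powr_powr sum_nonneg)
qed

text \<open>Every entry is at most the sum S, hence |a_k|^p \<le> |a_k| S^(p-1), and these bounds
  add up to S^p.\<close>

lemma lnorm_le_sum:
  assumes "1 \<le> p"
  shows "lnorm (ennreal p) n a \<le> (\<Sum>k<n. \<bar>a k\<bar>)"
proof -
  define S where "S = (\<Sum>k<n. \<bar>a k\<bar>)"
  have S: "0 \<le> S" unfolding S_def by (auto intro: sum_nonneg)
  have "(\<Sum>k<n. \<bar>a k\<bar> powr p) \<le> (\<Sum>k<n. \<bar>a k\<bar> * S powr (p - 1))"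
  proof (rule sum_mono)
    fix k assume "k \<in> {..<n}"
    then have "\<bar>a k\<bar> \<le> S" unfolding S_def by (intro member_le_sum) auto
    then have "\<bar>a k\<bar> powr (p - 1) \<le> S powr (p - 1)" using assms by (intro powr_mono2) auto
    then have "\<bar>a k\<bar> * \<bar>a k\<bar> powr (p - 1) \<le> \<bar>a k\<bar> * S powr (p - 1)" by (intro mult_left_mono) auto
    then show "\<bar>a k\<bar> powr p \<le> \<bar>a k\<bar> * S powr (p - 1)" by (simp add: powr_mult_base)
  qed
  also have "\<dots> = S powr p" using S by (simp add: sum_distrib_right[symmetric] S_def[symmetric] powr_mult_base)
  finally have "(\<Sum>k<n. \<bar>a k\<bar> powr p) powr (1 / p) \<le> (S powr p) powr (1 / p)"
    using assms by (intro powr_mono2) (auto intro: sum_nonneg)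
  then show ?thesis using assms S by (simp add: lnorm_ennreal powr_powr S_def[symmetric])
qed

lemma lnorm_measurable [measurable]:
  assumes "\<And>k. k < n \<Longrightarrow> x k \<in> borel_measurable M"
  shows "(\<lambda>\<omega>. lnorm r n (\<lambda>k. x k \<omega>)) \<in> borel_measurable M"
proof (cases "r = top")
  case True
  \<comment> \<open>The extra index n carries the value 0, which turns the inserted 0 into a member
    of a maximum over a fixed nonempty index set.\<close>
  have eq: "(\<lambda>\<omega>. lnorm r n (\<lambda>k. x k \<omega>)) = (\<lambda>\<omega>. Max ((\<lambda>k. if k < n then \<bar>x k \<omega>\<bar> else 0) ` {..n}))"
  proof
    fix \<omega>
    have "insert 0 ((\<lambda>k. \<bar>x k \<omega>\<bar>) ` {..<n}) = (\<lambda>k. if k < n then \<bar>x k \<omega>\<bar> else 0) ` {..n}"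
      by (auto simp: image_iff le_less)
    then show "lnorm r n (\<lambda>k. x k \<omega>) = Max ((\<lambda>k. if k < n then \<bar>x k \<omega>\<bar> else 0) ` {..n})"
      using True by (simp add: lnorm_def)
  qed
  have "(\<lambda>\<omega>. if k < n then \<bar>x k \<omega>\<bar> else 0) \<in> borel_measurable M" for k
    using assms by (cases "k < n") auto
  then show ?thesis unfolding eq by (intro borel_measurable_Max) auto
next
  case False
  show ?thesis using False assms unfolding lnorm_def by (auto intro!: borel_measurable_sum)
qed

text \<open>Inversion is an involution of the extended half-line and exchanges 0 with
  \<open>top\<close>. Relations between reciprocals of exponents can therefore be solved at the
  endpoints too.\<close>

lemma ennreal_one_div_eq_iff: "1 / r = (c :: ennreal) \<longleftrightarrow> r = 1 / c"
proof -
  have "inverse (inverse x) = x" for x :: ennreal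
  proof (cases x)
    case (real r)
    then show ?thesis by (cases "r = 0") (auto simp: inverse_ennreal)
  qed simp
  then show ?thesis by (metis divide_ennreal_def mult_1)
qed

lemma ennreal_one_div: "0 < c \<Longrightarrow> 1 / ennreal c = ennreal (1 / c)"
  using divide_ennreal[of 1 c] by simp

lemma conjugate_exponent_cases:
  assumes "1 \<le> p" "1 / ennreal p + 1 / p' = 1"
  obtains "p = 1" "p' = top" | "1 < p" "p' = ennreal (p / (p - 1))"
proof -
  have "1 / ennreal p = ennreal (1 / p)" using assms by (intro ennreal_one_div) auto
  then have e: "ennreal (1 / p) + 1 / p' = 1" using assms by simp
  then have "1 / p' \<noteq> top" by auto
  then obtain c where c: "1 / p' = ennreal c" "0 \<le> c" by (cases "1 / p'") auto
  have "ennreal (1 / p + c) = ennreal 1" using e c assms by simp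
  then have "c = 1 - 1 / p" using c assms by (subst (asm) ennreal_inj) auto
  then have p': "p' = 1 / ennreal (1 - 1 / p)" using c by (simp add: ennreal_one_div_eq_iff)
  show ?thesis
  proof (cases "p = 1")
    case True
    then show ?thesis using that(1) p' by (simp add: divide_ennreal_def)
  next
    case False
    then have "1 < p" using assms by simp
    then have "p' = ennreal (1 / (1 - 1 / p))" using p' by (simp add: ennreal_one_div)
    also have "1 / (1 - 1 / p) = p / (p - 1)" using \<open>1 < p\<close> by (simp add: field_simps)
    finally show ?thesis using that(2) \<open>1 < p\<close> by simp
  qed
qed

lemma conj_exp_eq:
  assumes "1 \<le> p" "1 / ennreal p + 1 / p' = 1"
  shows "conj_exp (ennreal p) = p'"
proof -
  have "1 / ennreal p = ennreal (1 / p)" using assms by (intro ennreal_one_div) auto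
  then have "1 - 1 / ennreal p = 1 / p'" using assms(2)
    by (metis ennreal_add_diff_cancel_left ennreal_neq_top infinity_ennreal_def)
  then have "1 / p' = 1 - 1 / ennreal p" by simp
  then show ?thesis unfolding conj_exp_def ennreal_one_div_eq_iff by simp
qed

lemma lnorm_Hoelder:
  assumes "1 \<le> p" "1 / ennreal p + 1 / p' = 1"
  shows "(\<Sum>k<n. \<bar>a k\<bar> * \<bar>b k\<bar>) \<le> lnorm (ennreal p) n a * lnorm p' n b"
  using assms
proof (cases rule: conjugate_exponent_cases)
  case 1
  have "(\<Sum>k<n. \<bar>a k\<bar> * \<bar>b k\<bar>) \<le> (\<Sum>k<n. \<bar>a k\<bar> * lnorm top n b)"
    by (intro sum_mono mult_left_mono abs_le_lnorm) auto
  then show ?thesis using 1 lnorm_ennreal[of 1 n a] by (simp add: sum_distrib_right[symmetric] sum_nonneg)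
next
  case 2
  then show ?thesis using sum_Hoelder[of p "p / (p - 1)" a b n] by (simp add: lnorm_ennreal field_simps)
qed

text \<open>The vector in the conjugate unit ball that norms |a|, given by a formula so that it
  depends measurably on a. For a = 0 the division yields 0; for p = 1 the convention that 0 powr 0
  is 0 makes it the indicator of the support.\<close>

definition dual_vec :: "real \<Rightarrow> nat \<Rightarrow> (nat \<Rightarrow> real) \<Rightarrow> nat \<Rightarrow> real" where
  "dual_vec p n a k = \<bar>a k\<bar> powr (p - 1) / lnorm (ennreal p) n a powr (p - 1)"

lemma dual_vec_nonneg: "0 \<le> dual_vec p n a k"
  by (simp add: dual_vec_def)

lemma lnorm_eq_0_D: "0 < p \<Longrightarrow> lnorm (ennreal p) n a = 0 \<Longrightarrow> k < n \<Longrightarrow> a k = 0"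
  using abs_le_lnorm[of k n "ennreal p" a] by simp

lemma lnorm_powr: "0 < p \<Longrightarrow> lnorm (ennreal p) n a powr p = (\<Sum>k<n. \<bar>a k\<bar> powr p)"
  by (simp add: lnorm_ennreal powr_powr sum_nonneg)

lemma dual_vec_sum:
  assumes "1 \<le> p"
  shows "(\<Sum>k<n. dual_vec p n a k * \<bar>a k\<bar>) = lnorm (ennreal p) n a"
proof (cases "lnorm (ennreal p) n a = 0")
  case True
  then show ?thesis using lnorm_eq_0_D[of p n a] assms by simp
next
  case False
  define H where "H = lnorm (ennreal p) n a"
  have H: "H > 0" using False lnorm_nonneg[of "ennreal p" n a] unfolding H_def by simp
  have "(\<Sum>k<n. dual_vec p n a k * \<bar>a k\<bar>) = (\<Sum>k<n. \<bar>a k\<bar> powr p / H powr (p - 1))"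
    unfolding dual_vec_def H_def[symmetric]
    by (intro sum.cong refl) (simp add: powr_mult_base mult.commute)
  also have "\<dots> = H powr p / H powr (p - 1)"
    using lnorm_powr[of p n a] assms unfolding H_def[symmetric] by (simp add: sum_divide_distrib)
  also have "\<dots> = H" using H by (simp add: powr_diff)
  finally show ?thesis unfolding H_def .
qed

lemma lnorm_dual_vec:
  assumes "1 \<le> p" "1 / ennreal p + 1 / p' = 1"
  shows "lnorm p' n (dual_vec p n a) \<le> 1"
  using assms
proof (cases rule: conjugate_exponent_cases)
  case 1
  then show ?thesis unfolding 1(2) lnorm_top_le_iff
    by (auto simp: dual_vec_def)
next
  case 2
  define H where "H = lnorm (ennreal p) n a"
  have H: "H \<ge> 0" using lnorm_nonneg[of "ennreal p" n a] unfolding H_def by simp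
  have "(\<Sum>k<n. \<bar>dual_vec p n a k\<bar> powr (p / (p - 1))) = (\<Sum>k<n. \<bar>a k\<bar> powr p * (1 / H powr p))"
    unfolding dual_vec_def H_def[symmetric] using 2 H
    by (intro sum.cong refl) (simp add: powr_divide powr_powr)
  also have "\<dots> = H powr p / H powr p"
    using lnorm_powr[of p n a] assms unfolding H_def[symmetric] sum_distrib_right[symmetric] by simp
  also have "\<dots> \<le> 1" by simp
  finally have "(\<Sum>k<n. \<bar>dual_vec p n a k\<bar> powr (p / (p - 1))) powr (1 / (p / (p - 1))) \<le> 1 powr (1 / (p / (p - 1)))"
    using 2 by (intro powr_mono2) (auto intro: sum_nonneg)
  then show ?thesis using 2 by (simp add: lnorm_ennreal)
qed

section \<open>The exponent r and coefficients from the unit ball of l_r\<close>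

lemma mixed_exponent_cases:
  assumes "1 \<le> p" "p \<le> q" "1 / r = ennreal (1 / p - 1 / q)"
  obtains "p = q" "r = top" | "p < q" "r = ennreal (p * q / (q - p))"
proof -
  have r: "r = 1 / ennreal (1 / p - 1 / q)" using assms(3) by (simp add: ennreal_one_div_eq_iff)
  show ?thesis
  proof (cases "p = q")
    case True
    then show ?thesis using that(1) r by (simp add: divide_ennreal_def)
  next
    case False
    then have "p < q" using assms by simp
    then have "0 < 1 / p - 1 / q" using assms by (simp add: field_simps)
    then have "r = ennreal (1 / (1 / p - 1 / q))" using r by (simp add: ennreal_one_div)
    also have "1 / (1 / p - 1 / q) = p * q / (q - p)" using \<open>p < q\<close> assms by (simp add: field_simps)
    finally show ?thesis using that(2) \<open>p < q\<close> by simp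
  qed
qed

lemma mixed_exponent_pos:
  assumes "1 \<le> p" "p \<le> q" "1 / r = ennreal (1 / p - 1 / q)"
  shows "r = top \<or> 0 < enn2real r"
  using assms
proof (cases rule: mixed_exponent_cases)
  case 2
  then have "0 < p * q / (q - p)" using assms by simp
  then show ?thesis using 2 by simp
qed simp

lemma zero_in_lball [simp]: "(\<lambda>_. 0) \<in> lball r n"
  by (simp add: lball_def)

lemma lball_abs_le_1:
  assumes "\<alpha> \<in> lball r n" "r = top \<or> 0 < enn2real r" "k < n"
  shows "\<bar>\<alpha> k\<bar> \<le> 1"
  using abs_le_lnorm[OF assms(3,2), of \<alpha>] assms(1) by (simp add: lball_def)

lemma lball_solid: "\<beta> \<in> lball r n \<Longrightarrow> (\<And>k. k < n \<Longrightarrow> \<bar>\<alpha> k\<bar> \<le> \<bar>\<beta> k\<bar>) \<Longrightarrow> \<alpha> \<in> lball r n"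
  using lnorm_mono[of n \<alpha> \<beta> r] by (simp add: lball_def)

text \<open>Hoelder's inequality with exponents q/(q-p) and q/p, applied to |\<alpha>|^p and c. As p
  times q/(q-p) is r, the ball of l_r bounds the first factor by 1. The case p = q is the pairing of
  l_\<infinity> with l_1.\<close>

lemma mixed_sum_le:
  fixes c :: "nat \<Rightarrow> real"
  assumes e: "1 \<le> p" "p \<le> q" "1 / r = ennreal (1 / p - 1 / q)"
    and \<alpha>: "\<alpha> \<in> lball r n" and c: "\<And>k. k < n \<Longrightarrow> 0 \<le> c k"
  shows "(\<Sum>k<n. \<bar>\<alpha> k\<bar> powr p * c k) \<le> (\<Sum>k<n. c k powr (q / p)) powr (p / q)"
  using e
proof (cases rule: mixed_exponent_cases)
  case 1
  have "(\<Sum>k<n. \<bar>\<alpha> k\<bar> powr p * c k) \<le> (\<Sum>k<n. 1 * c k)"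
    using lball_abs_le_1[OF \<alpha>] 1 c e by (intro sum_mono mult_right_mono powr_le1) auto
  then show ?thesis using 1 e c by (simp add: sum_nonneg)
next
  case 2
  define s t where "s = q / p" and "t = q / (q - p)"
  have st: "1 < s" "1 < t" "1 / t + 1 / s = 1" using 2 e unfolding s_def t_def by (auto simp: field_simps)
  have pt: "p * t = p * q / (q - p)" unfolding t_def by simp
  have "(\<Sum>k<n. \<bar>\<bar>\<alpha> k\<bar> powr p\<bar> * \<bar>c k\<bar>) \<le>
     (\<Sum>k<n. \<bar>\<bar>\<alpha> k\<bar> powr p\<bar> powr t) powr (1 / t) * (\<Sum>k<n. \<bar>c k\<bar> powr s) powr (1 / s)"
    by (rule sum_Hoelder) (use st in auto)
  also have "(\<Sum>k<n. \<bar>\<bar>\<alpha> k\<bar> powr p\<bar> powr t) = (\<Sum>k<n. \<bar>\<alpha> k\<bar> powr (p * t))" by (simp add: powr_powr)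
  also have "\<dots> powr (1 / t) \<le> 1"
  proof -
    have "lnorm (ennreal (p * t)) n \<alpha> \<le> 1" using \<alpha> 2 unfolding lball_def pt by simp
    then have "lnorm (ennreal (p * t)) n \<alpha> powr (p * t) \<le> 1"
      using e st lnorm_nonneg by (intro powr_le1) auto
    then have "(\<Sum>k<n. \<bar>\<alpha> k\<bar> powr (p * t)) \<le> 1" using e st by (subst (asm) lnorm_powr) auto
    then show ?thesis using st by (intro powr_le1) (auto simp: sum_nonneg abs_of_nonneg)
  qed
  finally have "(\<Sum>k<n. \<bar>\<bar>\<alpha> k\<bar> powr p\<bar> * \<bar>c k\<bar>) \<le> (\<Sum>k<n. \<bar>c k\<bar> powr s) powr (1 / s)"
    by (simp add: mult_right_mono)
  then show ?thesis using c unfolding s_def by (simp cong: sum.cong_simp)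
qed

text \<open>The equality case of Hoelder's inequality: |\<alpha>|^p has to be the norming vector of
  c for the exponent q/p, so \<alpha> is its p-th root. For p = q the constant 1 does it.\<close>

lemma mixed_sum_attained:
  fixes c :: "nat \<Rightarrow> real"
  assumes e: "1 \<le> p" "p \<le> q" "1 / r = ennreal (1 / p - 1 / q)"
    and c: "\<And>k. k < n \<Longrightarrow> 0 \<le> c k"
  obtains \<alpha> where "\<alpha> \<in> lball r n" "(\<Sum>k<n. \<bar>\<alpha> k\<bar> powr p * c k) = (\<Sum>k<n. c k powr (q / p)) powr (p / q)"
  using e
proof (cases rule: mixed_exponent_cases)
  case 1
  have "(\<lambda>_. 1) \<in> lball r n" unfolding lball_def 1 using lnorm_top_le_iff[of n "\<lambda>_. 1" 1] by simp
  then show ?thesis using that[of "\<lambda>_. 1"] 1 e sum_nonneg[of "{..<n}" c] c by simp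
next
  case 2
  define s t where "s = q / p" and "t = q / (q - p)"
  have st: "1 < s" "1 < t" "1 / s + 1 / t = 1" "t = s / (s - 1)"
    using 2 e unfolding s_def t_def by (auto simp: field_simps)
  have pt: "p * t = p * q / (q - p)" unfolding t_def by simp
  have conj: "1 / ennreal s + 1 / ennreal t = 1"
    using st by (simp add: ennreal_one_div ennreal_plus[symmetric] del: ennreal_plus)
  define \<alpha> where "\<alpha> k = dual_vec s n c k powr (1 / p)" for k
  have \<alpha>p: "\<bar>\<alpha> k\<bar> powr p = dual_vec s n c k" for k
    unfolding \<alpha>_def using e dual_vec_nonneg[of s n c k] by (simp add: powr_powr)
  have "lnorm (ennreal t) n (dual_vec s n c) \<le> 1" using st conj by (intro lnorm_dual_vec) auto
  then have "lnorm (ennreal t) n (dual_vec s n c) powr t \<le> 1"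
    using st lnorm_nonneg by (intro powr_le1) auto
  then have "(\<Sum>k<n. \<bar>dual_vec s n c k\<bar> powr t) \<le> 1" using st by (subst (asm) lnorm_powr) auto
  moreover have "\<bar>dual_vec s n c k\<bar> powr t = \<bar>\<alpha> k\<bar> powr (p * t)" for k
    using \<alpha>p[of k] dual_vec_nonneg[of s n c k] by (simp add: powr_powr[symmetric])
  ultimately have "(\<Sum>k<n. \<bar>\<alpha> k\<bar> powr (p * t)) \<le> 1" by simp
  then have "(\<Sum>k<n. \<bar>\<alpha> k\<bar> powr (p * t)) powr (1 / (p * t)) \<le> 1"
    using st(1,2) e by (intro powr_le1) (auto simp: sum_nonneg abs_of_nonneg)
  then have "\<alpha> \<in> lball r n" using st e unfolding lball_def 2(2) pt[symmetric] by (simp add: lnorm_ennreal)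
  moreover have "(\<Sum>k<n. \<bar>\<alpha> k\<bar> powr p * c k) = (\<Sum>k<n. dual_vec s n c k * \<bar>c k\<bar>)"
    using c by (simp add: \<alpha>p cong: sum.cong_simp)
  moreover have "\<dots> = (\<Sum>k<n. c k powr s) powr (1 / s)"
    using st c by (subst dual_vec_sum) (auto simp: lnorm_ennreal cong: sum.cong_simp)
  ultimately show ?thesis using that unfolding s_def by simp
qed

section \<open>Function lattices\<close>

text \<open>Norm and lattice axioms without completeness and full support. Koethe duals and the
  spaces \<open>S\<close> enter at this level; their completeness is derived afterwards from a Fatou
  property of the norm.\<close>

locale function_lattice =
  fixes M :: "'a measure" and X :: "'a fspace"
  assumes elem_measurable: "f \<in> elems X \<Longrightarrow> f \<in> borel_measurable M"
    and zero_elem: "(\<lambda>_. 0) \<in> elems X"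
    and add_elem: "f \<in> elems X \<Longrightarrow> g \<in> elems X \<Longrightarrow> (\<lambda>\<omega>. f \<omega> + g \<omega>) \<in> elems X"
    and nrm_add: "f \<in> elems X \<Longrightarrow> g \<in> elems X \<Longrightarrow> nrm X (\<lambda>\<omega>. f \<omega> + g \<omega>) \<le> nrm X f + nrm X g"
    and scale_elem: "f \<in> elems X \<Longrightarrow> (\<lambda>\<omega>. c * f \<omega>) \<in> elems X"
    and nrm_scale: "f \<in> elems X \<Longrightarrow> nrm X (\<lambda>\<omega>. c * f \<omega>) = \<bar>c\<bar> * nrm X f"
    and nrm_nonneg: "f \<in> elems X \<Longrightarrow> 0 \<le> nrm X f"
    and nrm_eq_0_iff: "f \<in> elems X \<Longrightarrow> nrm X f = 0 \<longleftrightarrow> (AE \<omega> in M. f \<omega> = 0)"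
    and solid_elem: "f \<in> borel_measurable M \<Longrightarrow> g \<in> elems X \<Longrightarrow> (AE \<omega> in M. \<bar>f \<omega>\<bar> \<le> \<bar>g \<omega>\<bar>) \<Longrightarrow> f \<in> elems X"
    and nrm_solid: "f \<in> borel_measurable M \<Longrightarrow> g \<in> elems X \<Longrightarrow> (AE \<omega> in M. \<bar>f \<omega>\<bar> \<le> \<bar>g \<omega>\<bar>) \<Longrightarrow> nrm X f \<le> nrm X g"

definition norm_complete :: "'a fspace \<Rightarrow> bool" where
  "norm_complete X \<longleftrightarrow> (\<forall>u. (\<forall>n. u n \<in> elems X) \<longrightarrow>
     (\<forall>e>0. \<exists>N::nat. \<forall>m\<ge>N. \<forall>n\<ge>N. nrm X (\<lambda>\<omega>. u m \<omega> - u n \<omega>) < e) \<longrightarrow>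
     (\<exists>f\<in>elems X. (\<lambda>n. nrm X (\<lambda>\<omega>. u n \<omega> - f \<omega>)) \<longlonglongrightarrow> 0))"

definition full_support :: "'a measure \<Rightarrow> 'a fspace \<Rightarrow> bool" where
  "full_support M X \<longleftrightarrow> (\<forall>A\<in>sets M. emeasure M A > 0 \<longrightarrow>
     \<not> (\<forall>f\<in>elems X. AE \<omega> in M. \<omega> \<in> A \<longrightarrow> f \<omega> = 0))"

lemma banach_function_lattice_iff:
  "banach_function_lattice M X \<longleftrightarrow> function_lattice M X \<and> norm_complete X \<and> full_support M X"
proof
  assume B: "banach_function_lattice M X"
  note B' = B[unfolded banach_function_lattice_def, folded norm_complete_def full_support_def]
  have 0: "elems X \<subseteq> borel_measurable M" using B' by (elim conjE)
  have 1: "(\<lambda>_. 0) \<in> elems X" using B' by (elim conjE)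
  have 2: "\<forall>f\<in>elems X. \<forall>g\<in>elems X. (\<lambda>\<omega>. f \<omega> + g \<omega>) \<in> elems X \<and>
        nrm X (\<lambda>\<omega>. f \<omega> + g \<omega>) \<le> nrm X f + nrm X g" using B' by (elim conjE)
  have 3: "\<forall>f\<in>elems X. \<forall>c. (\<lambda>\<omega>. c * f \<omega>) \<in> elems X \<and>
        nrm X (\<lambda>\<omega>. c * f \<omega>) = \<bar>c\<bar> * nrm X f" using B' by (elim conjE)
  have 4: "\<forall>f\<in>elems X. 0 \<le> nrm X f \<and> (nrm X f = 0 \<longleftrightarrow> (AE \<omega> in M. f \<omega> = 0))" using B' by (elim conjE)
  have 5: "\<forall>f\<in>borel_measurable M. \<forall>g\<in>elems X. (AE \<omega> in M. \<bar>f \<omega>\<bar> \<le> \<bar>g \<omega>\<bar>) \<longrightarrow>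
        f \<in> elems X \<and> nrm X f \<le> nrm X g" using B' by (elim conjE)
  have 6: "norm_complete X" using B' by (elim conjE)
  have 7: "full_support M X" using B' by (elim conjE)
  have "function_lattice M X"
    by (rule function_lattice.intro) (use 0 in fast, use 1 in fast, use 2 in fast, use 2 in fast, use 3 in fast,
      use 3 in fast, use 4 in fast, use 4 in fast, use 5 in fast, use 5 in fast)
  then show "function_lattice M X \<and> norm_complete X \<and> full_support M X" using 6 7 by (intro conjI)
next
  assume "function_lattice M X \<and> norm_complete X \<and> full_support M X"
  then have f: "function_lattice M X" and c: "norm_complete X" "full_support M X" by auto
  interpret function_lattice M X by (rule f)
  show "banach_function_lattice M X"
    unfolding banach_function_lattice_def norm_complete_def[symmetric] full_support_def[symmetric]
  proof (intro conjI ballI allI impI subsetI c)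
    fix f g assume fg: "f \<in> borel_measurable M" "g \<in> elems X" "AE \<omega> in M. \<bar>f \<omega>\<bar> \<le> \<bar>g \<omega>\<bar>"
    show "f \<in> elems X" "nrm X f \<le> nrm X g" using solid_elem[OF fg] nrm_solid[OF fg] by auto
  qed (fact elem_measurable zero_elem | erule add_elem nrm_add scale_elem nrm_scale nrm_nonneg nrm_eq_0_iff; assumption?)+
qed

section \<open>Functionals on a function lattice and its Koethe dual\<close>

context function_lattice
begin

lemma minus_elem: "f \<in> elems X \<Longrightarrow> (\<lambda>\<omega>. - f \<omega>) \<in> elems X"
  using scale_elem[of f "-1"] by simp

lemma nrm_minus: "f \<in> elems X \<Longrightarrow> nrm X (\<lambda>\<omega>. - f \<omega>) = nrm X f"
  using nrm_scale[of f "-1"] by simp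

lemma diff_elem: "f \<in> elems X \<Longrightarrow> g \<in> elems X \<Longrightarrow> (\<lambda>\<omega>. f \<omega> - g \<omega>) \<in> elems X"
  using add_elem[of f "\<lambda>\<omega>. - g \<omega>"] minus_elem by simp

lemma nrm_diff: "f \<in> elems X \<Longrightarrow> g \<in> elems X \<Longrightarrow> nrm X (\<lambda>\<omega>. f \<omega> - g \<omega>) \<le> nrm X f + nrm X g"
  using nrm_add[of f "\<lambda>\<omega>. - g \<omega>"] minus_elem nrm_minus by simp

lemma nrm_diff_commute: "f \<in> elems X \<Longrightarrow> g \<in> elems X \<Longrightarrow> nrm X (\<lambda>\<omega>. f \<omega> - g \<omega>) = nrm X (\<lambda>\<omega>. g \<omega> - f \<omega>)"
  using nrm_minus[OF diff_elem, of f g] by simp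

lemma nrm_le_diff: "f \<in> elems X \<Longrightarrow> g \<in> elems X \<Longrightarrow> nrm X f \<le> nrm X (\<lambda>\<omega>. f \<omega> - g \<omega>) + nrm X g"
  using nrm_add[OF diff_elem, of f g g] by simp

lemma abs_elem: "f \<in> elems X \<Longrightarrow> (\<lambda>\<omega>. \<bar>f \<omega>\<bar>) \<in> elems X"
  by (rule solid_elem[of _ f]) (auto dest: elem_measurable)

lemma nrm_abs: "f \<in> elems X \<Longrightarrow> nrm X (\<lambda>\<omega>. \<bar>f \<omega>\<bar>) = nrm X f"
  by (intro antisym nrm_solid) (auto dest: elem_measurable abs_elem)

lemma pos_part_elem: "f \<in> elems X \<Longrightarrow> (\<lambda>\<omega>. max 0 (f \<omega>)) \<in> elems X"
  by (rule solid_elem[of _ f]) (auto dest: elem_measurable)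

lemma sum_elem: "(\<And>k. k < n \<Longrightarrow> x k \<in> elems X) \<Longrightarrow> (\<lambda>\<omega>. \<Sum>k<n. x k \<omega>) \<in> elems X" for n :: nat
  by (induction n) (auto intro: zero_elem add_elem)

lemma nrm_zero: "nrm X (\<lambda>_. 0) = 0"
  using nrm_eq_0_iff[OF zero_elem] by simp

lemma nrm_sum: "(\<And>k. k < n \<Longrightarrow> x k \<in> elems X) \<Longrightarrow> nrm X (\<lambda>\<omega>. \<Sum>k<n. x k \<omega>) \<le> (\<Sum>k<n. nrm X (x k))" for n :: nat
proof (induction n)
  case (Suc n)
  have "nrm X (\<lambda>\<omega>. (\<Sum>k<n. x k \<omega>) + x n \<omega>) \<le> nrm X (\<lambda>\<omega>. \<Sum>k<n. x k \<omega>) + nrm X (x n)"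
    using Suc.prems by (intro nrm_add sum_elem) auto
  also have "\<dots> \<le> (\<Sum>k<n. nrm X (x k)) + nrm X (x n)" using Suc by auto
  finally show ?case by simp
qed (simp add: nrm_zero)

lemma elem_cong_AE: "f \<in> elems X \<Longrightarrow> g \<in> borel_measurable M \<Longrightarrow> (AE \<omega> in M. g \<omega> = f \<omega>) \<Longrightarrow> g \<in> elems X"
  by (rule solid_elem[of _ f]) auto

lemma nrm_cong_AE: "f \<in> elems X \<Longrightarrow> g \<in> elems X \<Longrightarrow> (AE \<omega> in M. f \<omega> = g \<omega>) \<Longrightarrow> nrm X f = nrm X g"
  by (intro antisym nrm_solid) (auto dest: elem_measurable)

lemma mult_elem:
  assumes "f \<in> elems X" "g \<in> borel_measurable M" "\<And>\<omega>. \<bar>g \<omega>\<bar> \<le> c"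
  shows "(\<lambda>\<omega>. f \<omega> * g \<omega>) \<in> elems X"
proof (rule solid_elem[OF _ scale_elem[OF assms(1), of "\<bar>c\<bar>"]])
  show "AE \<omega> in M. \<bar>f \<omega> * g \<omega>\<bar> \<le> \<bar>\<bar>c\<bar> * f \<omega>\<bar>"
  proof (rule AE_I2)
    fix \<omega>
    have "\<bar>g \<omega>\<bar> \<le> \<bar>c\<bar>" using assms(3)[of \<omega>] by linarith
    then show "\<bar>f \<omega> * g \<omega>\<bar> \<le> \<bar>\<bar>c\<bar> * f \<omega>\<bar>"
      using mult_left_mono[of "\<bar>g \<omega>\<bar>" "\<bar>c\<bar>" "\<bar>f \<omega>\<bar>"] by (simp add: abs_mult mult.commute)
  qed
qed (use assms elem_measurable in auto)

lemma lnorm_elem: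
  assumes "1 \<le> p" "\<And>k. k < n \<Longrightarrow> x k \<in> elems X"
  shows "(\<lambda>\<omega>. lnorm (ennreal p) n (\<lambda>k. x k \<omega>)) \<in> elems X"
    and "nrm X (\<lambda>\<omega>. lnorm (ennreal p) n (\<lambda>k. x k \<omega>)) \<le> (\<Sum>k<n. nrm X (x k))"
proof -
  have m: "(\<lambda>\<omega>. lnorm (ennreal p) n (\<lambda>k. x k \<omega>)) \<in> borel_measurable M"
    using assms by (intro lnorm_measurable elem_measurable)
  have e: "(\<lambda>\<omega>. \<Sum>k<n. \<bar>x k \<omega>\<bar>) \<in> elems X" using assms by (intro sum_elem abs_elem)
  have le: "AE \<omega> in M. \<bar>lnorm (ennreal p) n (\<lambda>k. x k \<omega>)\<bar> \<le> \<bar>\<Sum>k<n. \<bar>x k \<omega>\<bar>\<bar>"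
  proof (rule AE_I2)
    fix \<omega>
    show "\<bar>lnorm (ennreal p) n (\<lambda>k. x k \<omega>)\<bar> \<le> \<bar>\<Sum>k<n. \<bar>x k \<omega>\<bar>\<bar>"
      using lnorm_le_sum[OF assms(1), of n "\<lambda>k. x k \<omega>"] lnorm_nonneg[of "ennreal p" n "\<lambda>k. x k \<omega>"] by linarith
  qed
  show "(\<lambda>\<omega>. lnorm (ennreal p) n (\<lambda>k. x k \<omega>)) \<in> elems X" by (rule solid_elem[OF m e le])
  have "nrm X (\<lambda>\<omega>. lnorm (ennreal p) n (\<lambda>k. x k \<omega>)) \<le> nrm X (\<lambda>\<omega>. \<Sum>k<n. \<bar>x k \<omega>\<bar>)"
    by (rule nrm_solid[OF m e le])
  also have "\<dots> \<le> (\<Sum>k<n. nrm X (\<lambda>\<omega>. \<bar>x k \<omega>\<bar>))" using assms by (intro nrm_sum abs_elem)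
  also have "\<dots> = (\<Sum>k<n. nrm X (x k))" using assms by (intro sum.cong refl nrm_abs) auto
  finally show "nrm X (\<lambda>\<omega>. lnorm (ennreal p) n (\<lambda>k. x k \<omega>)) \<le> (\<Sum>k<n. nrm X (x k))" .
qed

lemma dual_add: "\<phi> \<in> dual X \<Longrightarrow> f \<in> elems X \<Longrightarrow> g \<in> elems X \<Longrightarrow> \<phi> (\<lambda>\<omega>. f \<omega> + g \<omega>) = \<phi> f + \<phi> g"
  by (simp add: dual_def)

lemma dual_scale: "\<phi> \<in> dual X \<Longrightarrow> f \<in> elems X \<Longrightarrow> \<phi> (\<lambda>\<omega>. c * f \<omega>) = c * \<phi> f"
  by (simp add: dual_def)

lemma dual_bound: "\<phi> \<in> dual X \<Longrightarrow> \<exists>K\<ge>0. \<forall>f\<in>elems X. \<bar>\<phi> f\<bar> \<le> K * nrm X f"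
proof -
  assume "\<phi> \<in> dual X"
  then obtain K where K: "\<forall>f\<in>elems X. \<bar>\<phi> f\<bar> \<le> K * nrm X f" by (auto simp: dual_def)
  have "\<bar>\<phi> f\<bar> \<le> \<bar>K\<bar> * nrm X f" if "f \<in> elems X" for f
  proof -
    have "K * nrm X f \<le> \<bar>K\<bar> * nrm X f" using nrm_nonneg[OF that] by (intro mult_right_mono) auto
    then show ?thesis using K that by fastforce
  qed
  then show ?thesis by (intro exI[of _ "\<bar>K\<bar>"]) auto
qed

lemma dual_minus: "\<phi> \<in> dual X \<Longrightarrow> f \<in> elems X \<Longrightarrow> \<phi> (\<lambda>\<omega>. - f \<omega>) = - \<phi> f"
  using dual_scale[of \<phi> f "-1"] by simp

lemma dual_diff: "\<phi> \<in> dual X \<Longrightarrow> f \<in> elems X \<Longrightarrow> g \<in> elems X \<Longrightarrow> \<phi> (\<lambda>\<omega>. f \<omega> - g \<omega>) = \<phi> f - \<phi> g"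
  using dual_add[of \<phi> f "\<lambda>\<omega>. - g \<omega>"] minus_elem dual_minus by simp

lemma dual_cong_AE:
  assumes "\<phi> \<in> dual X" "f \<in> elems X" "g \<in> elems X" "AE \<omega> in M. f \<omega> = g \<omega>"
  shows "\<phi> f = \<phi> g"
proof -
  obtain K where K: "\<forall>f\<in>elems X. \<bar>\<phi> f\<bar> \<le> K * nrm X f" using dual_bound[OF assms(1)] by auto
  have "nrm X (\<lambda>\<omega>. f \<omega> - g \<omega>) = 0" using assms by (subst nrm_eq_0_iff) (auto intro: diff_elem)
  then have "\<phi> (\<lambda>\<omega>. f \<omega> - g \<omega>) = 0" using K diff_elem[OF assms(2,3)] by fastforce
  then show ?thesis using dual_diff[OF assms(1-3)] by simp
qed

lemma dual_norm_le:
  assumes "0 \<le> c" "\<And>f. f \<in> elems X \<Longrightarrow> \<bar>\<phi> f\<bar> \<le> c * nrm X f"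
  shows "dual_norm X \<phi> \<le> c"
  unfolding dual_norm_def
proof (rule cSUP_least)
  show "{f \<in> elems X. nrm X f \<le> 1} \<noteq> {}" using zero_elem nrm_zero by auto
  fix f assume "f \<in> {f \<in> elems X. nrm X f \<le> 1}"
  then show "\<bar>\<phi> f\<bar> \<le> c" using assms(2)[of f] mult_left_mono[of "nrm X f" 1 c] assms(1) by auto
qed

lemma dual_norm_bdd:
  assumes "\<phi> \<in> dual X" shows "bdd_above ((\<lambda>f. \<bar>\<phi> f\<bar>) ` {f \<in> elems X. nrm X f \<le> 1})"
proof -
  obtain K where K: "K \<ge> 0" "\<forall>f\<in>elems X. \<bar>\<phi> f\<bar> \<le> K * nrm X f" using dual_bound[OF assms] by auto
  show ?thesis
  proof (rule bdd_aboveI2)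
    fix f assume "f \<in> {f \<in> elems X. nrm X f \<le> 1}"
    then show "\<bar>\<phi> f\<bar> \<le> K" using K mult_left_mono[of "nrm X f" 1 K] by fastforce
  qed
qed

lemma dual_norm_nonneg: "\<phi> \<in> dual X \<Longrightarrow> 0 \<le> dual_norm X \<phi>"
  unfolding dual_norm_def using zero_elem nrm_zero
  by (intro cSUP_upper2[OF dual_norm_bdd, of _ "\<lambda>_. 0"]) auto

lemma dual_norm_bound:
  assumes \<phi>: "\<phi> \<in> dual X" and f: "f \<in> elems X"
  shows "\<bar>\<phi> f\<bar> \<le> dual_norm X \<phi> * nrm X f"
proof (cases "nrm X f = 0")
  case True
  then show ?thesis using dual_bound[OF \<phi>] f by fastforce
next
  case False
  then have pos: "nrm X f > 0" using nrm_nonneg[OF f] by simp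
  define g where "g = (\<lambda>\<omega>. (1 / nrm X f) * f \<omega>)"
  have g: "g \<in> elems X" "nrm X g \<le> 1" unfolding g_def using scale_elem[OF f, of "1 / nrm X f"] nrm_scale[OF f, of "1 / nrm X f"] pos by auto
  have "\<bar>\<phi> g\<bar> \<le> dual_norm X \<phi>"
    unfolding dual_norm_def using g by (intro cSUP_upper dual_norm_bdd \<phi>) auto
  also have "\<phi> g = (1 / nrm X f) * \<phi> f" unfolding g_def by (rule dual_scale[OF \<phi> f])
  finally show ?thesis using pos by (simp add: abs_mult field_simps)
qed

lemma dual_norm_cong: "(\<And>f. f \<in> elems X \<Longrightarrow> \<phi> f = \<psi> f) \<Longrightarrow> dual_norm X \<phi> = dual_norm X \<psi>"
  unfolding dual_norm_def by (intro SUP_cong) auto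

abbreviation X' where "X' \<equiv> koethe_dual M X"

lemma koethe_measurable: "h \<in> elems X' \<Longrightarrow> h \<in> borel_measurable M"
  by (simp add: koethe_dual_def)

lemma koethe_integrable: "h \<in> elems X' \<Longrightarrow> f \<in> elems X \<Longrightarrow> integrable M (\<lambda>\<omega>. f \<omega> * h \<omega>)"
  by (simp add: koethe_dual_def)

lemma koethe_functional: "h \<in> elems X' \<Longrightarrow> (\<lambda>f. \<integral>\<omega>. f \<omega> * h \<omega> \<partial>M) \<in> dual X"
  by (simp add: koethe_dual_def)

lemma koethe_nrm_nonneg: "h \<in> elems X' \<Longrightarrow> 0 \<le> nrm X' h"
  using dual_norm_nonneg[OF koethe_functional] by (simp add: koethe_dual_def)

lemma koethe_bound: "h \<in> elems X' \<Longrightarrow> f \<in> elems X \<Longrightarrow> \<bar>\<integral>\<omega>. f \<omega> * h \<omega> \<partial>M\<bar> \<le> nrm X' h * nrm X f"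
  using dual_norm_bound[OF koethe_functional] by (simp add: koethe_dual_def)

text \<open>By solidity \<open>f\<close> may be replaced by \<open>\<bar>f\<bar>\<close> times the
  sign of \<open>h\<close>, which turns the integral of the product into that of its absolute
  value.\<close>

lemma koethe_abs_bound:
  assumes h: "h \<in> elems X'" and f: "f \<in> elems X"
  shows "(\<integral>\<omega>. \<bar>f \<omega> * h \<omega>\<bar> \<partial>M) \<le> nrm X' h * nrm X f"
proof -
  define g where "g = (\<lambda>\<omega>. \<bar>f \<omega>\<bar> * sgn (h \<omega>))"
  have hm: "h \<in> borel_measurable M" using koethe_measurable[OF h] .
  have fm: "f \<in> borel_measurable M" using elem_measurable[OF f] .
  have gm: "g \<in> borel_measurable M" unfolding g_def using hm fm by (auto simp: sgn_real_def)
  have le: "AE \<omega> in M. \<bar>g \<omega>\<bar> \<le> \<bar>f \<omega>\<bar>" unfolding g_def by (auto simp: sgn_real_def)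
  have g: "g \<in> elems X" "nrm X g \<le> nrm X f" using solid_elem[OF gm f le] nrm_solid[OF gm f le] by auto
  have "(\<integral>\<omega>. \<bar>f \<omega> * h \<omega>\<bar> \<partial>M) = (\<integral>\<omega>. g \<omega> * h \<omega> \<partial>M)"
    unfolding g_def by (intro Bochner_Integration.integral_cong refl) (auto simp: sgn_real_def abs_mult)
  also have "\<dots> \<le> nrm X' h * nrm X g" using koethe_bound[OF h g(1)] by simp
  also have "\<dots> \<le> nrm X' h * nrm X f" using koethe_nrm_nonneg[OF h] g by (intro mult_left_mono)
  finally show ?thesis .
qed

lemma koethe_nn_bound:
  assumes h: "h \<in> elems X'" and f: "f \<in> elems X"
  shows "(\<integral>\<^sup>+\<omega>. ennreal \<bar>f \<omega> * h \<omega>\<bar> \<partial>M) \<le> ennreal (nrm X' h * nrm X f)"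
  using koethe_abs_bound[OF assms] koethe_integrable[OF assms]
  by (subst nn_integral_eq_integral) (auto intro: ennreal_leI)

text \<open>Nonnegative test functions and the nonnegative integral suffice: finiteness gives
  integrability, and the bound gives both continuity of the functional and the norm estimate.
  Membership in Koethe duals is established through this criterion throughout.\<close>

lemma koetheI:
  assumes h: "h \<in> borel_measurable M" and c: "0 \<le> c"
    and bound: "\<And>f. f \<in> elems X \<Longrightarrow> (\<And>\<omega>. 0 \<le> f \<omega>) \<Longrightarrow> (\<integral>\<^sup>+\<omega>. ennreal (f \<omega> * \<bar>h \<omega>\<bar>) \<partial>M) \<le> ennreal (c * nrm X f)"
  shows "h \<in> elems X'" "nrm X' h \<le> c"
proof -
  have nn: "(\<integral>\<^sup>+\<omega>. ennreal \<bar>f \<omega> * h \<omega>\<bar> \<partial>M) \<le> ennreal (c * nrm X f)" if f: "f \<in> elems X" for f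
    using bound[OF abs_elem[OF f]] nrm_abs[OF f] by (simp add: abs_mult)
  have int: "integrable M (\<lambda>\<omega>. f \<omega> * h \<omega>)" if f: "f \<in> elems X" for f
  proof (rule integrableI_bounded)
    show "(\<lambda>\<omega>. f \<omega> * h \<omega>) \<in> borel_measurable M" using h elem_measurable[OF f] by simp
    show "(\<integral>\<^sup>+\<omega>. ennreal (norm (f \<omega> * h \<omega>)) \<partial>M) < \<infinity>"
      using nn[OF f] by (simp add: le_less_trans)
  qed
  have b: "\<bar>\<integral>\<omega>. f \<omega> * h \<omega> \<partial>M\<bar> \<le> c * nrm X f" if f: "f \<in> elems X" for f
  proof -
    have "ennreal (norm (\<integral>\<omega>. f \<omega> * h \<omega> \<partial>M)) \<le> (\<integral>\<^sup>+\<omega>. ennreal (norm (f \<omega> * h \<omega>)) \<partial>M)"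
      by (rule integral_norm_bound_ennreal[OF int[OF f]])
    also have "\<dots> \<le> ennreal (c * nrm X f)" using nn[OF f] by simp
    finally show ?thesis using c nrm_nonneg[OF f] by (simp add: ennreal_le_iff)
  qed
  have "(\<lambda>f. \<integral>\<omega>. f \<omega> * h \<omega> \<partial>M) \<in> dual X"
    unfolding dual_def using int b
    by (auto simp: distrib_right mult.assoc)
  then show "h \<in> elems X'" using h int by (simp add: koethe_dual_def)
  show "nrm X' h \<le> c" using dual_norm_le[OF c b] by (simp add: koethe_dual_def)
qed

end

text \<open>In contrast to \<open>fatou_property\<close>, a bound \<open>c\<close> common to the
  sequence is handed to the limit, and convergence of the norms is not asserted. In this form the
  property follows directly from monotone convergence and yields completeness.\<close>

definition fatou_norm :: "'a measure \<Rightarrow> 'a fspace \<Rightarrow> bool" where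
  "fatou_norm M X \<longleftrightarrow> (\<forall>(f :: nat \<Rightarrow> 'a \<Rightarrow> real) g c. (\<forall>n. f n \<in> elems X) \<longrightarrow> g \<in> borel_measurable M \<longrightarrow>
     (\<forall>n \<omega>. 0 \<le> f n \<omega>) \<longrightarrow> (AE \<omega> in M. incseq (\<lambda>n. f n \<omega>) \<and> (\<lambda>n. f n \<omega>) \<longlonglongrightarrow> g \<omega>) \<longrightarrow>
     (\<forall>n. nrm X (f n) \<le> c) \<longrightarrow> g \<in> elems X \<and> nrm X g \<le> c)"

context function_lattice
begin

lemma fatou_normD:
  assumes "fatou_norm M X" "\<And>n. f n \<in> elems X" "g \<in> borel_measurable M" "\<And>n \<omega>. 0 \<le> f n \<omega>"
    "AE \<omega> in M. incseq (\<lambda>n. f n \<omega>) \<and> (\<lambda>n. f n \<omega>) \<longlonglongrightarrow> g \<omega>" "\<And>n. nrm X (f n) \<le> c"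
  shows "g \<in> elems X" "nrm X g \<le> c"
  using assms unfolding fatou_norm_def by blast+

text \<open>The summation step of the Riesz-Fischer argument: partial sums of nonnegative elements
  increase and have norms at most \<open>c\<close>, so once the set of divergence is known to be
  null, the Fatou bound applies to the sum.\<close>

lemma fatou_norm_sums:
  assumes fatou: "fatou_norm M X" and d: "\<And>k. d k \<in> elems X" "\<And>k \<omega>. 0 \<le> d k \<omega>"
    and c: "\<And>n. (\<Sum>k<n. nrm X (d k)) \<le> c"
  obtains s where "s \<in> elems X" "nrm X s \<le> c" "AE \<omega> in M. (\<lambda>k. d k \<omega>) sums s \<omega>"
proof -
  have dm [measurable]: "d k \<in> borel_measurable M" for k using elem_measurable[OF d(1)] .
  define S where "S = (\<lambda>\<omega>. \<Sum>k. ennreal (d k \<omega>))"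
  have Sm [measurable]: "S \<in> borel_measurable M" unfolding S_def by measurable
  define A where "A = {\<omega> \<in> space M. S \<omega> = top}"
  have Am [measurable]: "A \<in> sets M" unfolding A_def by measurable
  have part: "(\<lambda>\<omega>. \<Sum>k<n. d k \<omega>) \<in> elems X" "nrm X (\<lambda>\<omega>. \<Sum>k<n. d k \<omega>) \<le> c" for n
    using nrm_sum[of n d] c[of n] sum_elem[of n d] d by auto
  have part_mono: "incseq (\<lambda>n. \<Sum>k<n. d k \<omega>)" for \<omega>
    using d(2) by (intro incseq_SucI) simp
  \<comment> \<open>Partial sums cut off at height m on the set \<open>A\<close> of divergence
    increase to m times the indicator of \<open>A\<close>. So m times the norm of that indicator is
    at most \<open>c\<close> for all m, which forces \<open>A\<close> to be null.\<close>
  have big: "(\<lambda>\<omega>. real m * indicat_real A \<omega>) \<in> elems X \<and> nrm X (\<lambda>\<omega>. real m * indicat_real A \<omega>) \<le> c" for m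
  proof -
    define g where "g n \<omega> = min (\<Sum>k<n. d k \<omega>) (real m) * indicat_real A \<omega>" for n \<omega>
    have gm: "g n \<in> borel_measurable M" for n unfolding g_def by measurable
    have gle: "AE \<omega> in M. \<bar>g n \<omega>\<bar> \<le> \<bar>\<Sum>k<n. d k \<omega>\<bar>" for n
      using d(2) by (intro AE_I2) (auto simp: g_def indicator_def sum_nonneg)
    have g1: "g n \<in> elems X" for n by (rule solid_elem[OF gm part(1) gle])
    have g2: "nrm X (g n) \<le> c" for n using nrm_solid[OF gm part(1) gle] part(2) by (rule order_trans)
    have g3: "0 \<le> g n \<omega>" for n \<omega> unfolding g_def using d(2) by (auto intro!: mult_nonneg_nonneg sum_nonneg)
    have "(\<lambda>n. g n \<omega>) \<longlonglongrightarrow> real m * indicat_real A \<omega>" for \<omega>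
    proof (cases "\<omega> \<in> A")
      case True
      have "(\<lambda>n. \<Sum>k<n. ennreal (d k \<omega>)) \<longlonglongrightarrow> S \<omega>"
        unfolding S_def by (rule summable_LIMSEQ) auto
      then have "(\<lambda>n. ennreal (\<Sum>k<n. d k \<omega>)) \<longlonglongrightarrow> top"
        using True d(2) by (simp add: A_def sum_ennreal)
      then have "\<forall>\<^sub>F n in sequentially. ennreal (real m) < ennreal (\<Sum>k<n. d k \<omega>)"
        by (rule order_tendstoD) simp
      then have "\<forall>\<^sub>F n in sequentially. g n \<omega> = real m * indicat_real A \<omega>"
        by eventually_elim (auto simp: g_def ennreal_less_iff min_def)
      then show ?thesis by (rule tendsto_eventually)
    qed (simp add: g_def)
    moreover have "incseq (\<lambda>n. g n \<omega>)" for \<omega>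
      using part_mono[of \<omega>] unfolding incseq_def g_def
      by (auto intro!: mult_right_mono min.mono)
    ultimately have "AE \<omega> in M. incseq (\<lambda>n. g n \<omega>) \<and> (\<lambda>n. g n \<omega>) \<longlonglongrightarrow> real m * indicat_real A \<omega>" by simp
    from fatou_normD[OF fatou g1 _ g3 this g2] show ?thesis by auto
  qed
  have ind: "indicat_real A \<in> elems X" using big[of 1] by simp
  have "real m * nrm X (indicat_real A) \<le> c" for m
    using big[of m] nrm_scale[OF ind, of "real m"] by simp
  then have "nrm X (indicat_real A) = 0"
    using nrm_nonneg[OF ind] reals_Archimedean3[of "nrm X (indicat_real A)"] by (metis less_le not_le)
  then have notA: "AE \<omega> in M. \<omega> \<notin> A" using nrm_eq_0_iff[OF ind] by (auto simp: indicator_def)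
  define s where "s = (\<lambda>\<omega>. enn2real (S \<omega>))"
  have sm: "s \<in> borel_measurable M" unfolding s_def by measurable
  have sums: "AE \<omega> in M. (\<lambda>k. d k \<omega>) sums s \<omega>"
    using notA
  proof (rule AE_mp, intro AE_I2 impI)
    fix \<omega> assume "\<omega> \<in> space M" "\<omega> \<notin> A"
    then have fin: "(\<Sum>k. ennreal (d k \<omega>)) \<noteq> top" by (simp add: A_def S_def)
    have sm: "summable (\<lambda>k. d k \<omega>)" by (rule summable_suminf_not_top[OF d(2) fin])
    have "S \<omega> = ennreal (\<Sum>k. d k \<omega>)" unfolding S_def by (rule suminf_ennreal2[OF d(2) sm])
    then have "s \<omega> = (\<Sum>k. d k \<omega>)" unfolding s_def using d(2) sm by (simp add: suminf_nonneg)
    then show "(\<lambda>k. d k \<omega>) sums s \<omega>" using sm by (simp add: summable_sums)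
  qed
  have "AE \<omega> in M. incseq (\<lambda>n. \<Sum>k<n. d k \<omega>) \<and> (\<lambda>n. \<Sum>k<n. d k \<omega>) \<longlonglongrightarrow> s \<omega>"
    using sums by eventually_elim (auto simp: sums_def part_mono)
  from fatou_normD[OF fatou part(1) sm _ this part(2)] have "s \<in> elems X" "nrm X s \<le> c"
    using d(2) by (auto intro: sum_nonneg)
  then show ?thesis using sums that by blast
qed

text \<open>Riesz-Fischer: along a subsequence with increments below (1/2)^k the absolute increments
  are summable in the space, so the subsequence converges almost everywhere, and tails of that sum
  dominate the distance to the limit.\<close>

theorem fatou_norm_imp_complete:
  assumes fatou: "fatou_norm M X"
  shows "norm_complete X"
  unfolding norm_complete_def
proof (intro allI impI)
  fix u assume u: "\<forall>n. u n \<in> elems X"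
    and cauchy: "\<forall>e>0. \<exists>N::nat. \<forall>m\<ge>N. \<forall>n\<ge>N. nrm X (\<lambda>\<omega>. u m \<omega> - u n \<omega>) < e"
  have "\<exists>N. \<forall>m\<ge>N. \<forall>n\<ge>N. nrm X (\<lambda>\<omega>. u m \<omega> - u n \<omega>) < (1/2)^k" for k
    using cauchy by simp
  then obtain N where N: "\<And>k m n. N k \<le> m \<Longrightarrow> N k \<le> n \<Longrightarrow> nrm X (\<lambda>\<omega>. u m \<omega> - u n \<omega>) < (1/2)^k"
    by metis
  \<comment> \<open>Summing the thresholds up to k gives an index beyond \<open>N k\<close>, and so
    does the next one, without any monotonicity of \<open>N\<close>.\<close>
  define idx where "idx k = (\<Sum>j\<le>k. N j)" for k
  have idx: "N k \<le> idx k" "N k \<le> idx (Suc k)" for k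
  proof -
    show *: "N k \<le> idx k" unfolding idx_def by (rule member_le_sum) auto
    then show "N k \<le> idx (Suc k)" unfolding idx_def by simp
  qed
  define v where "v k = u (idx k)" for k
  have v: "v k \<in> elems X" for k unfolding v_def using u by simp
  have vm [measurable]: "v k \<in> borel_measurable M" for k using elem_measurable[OF v] .
  define d where "d k \<omega> = \<bar>v (Suc k) \<omega> - v k \<omega>\<bar>" for k \<omega>
  have de: "d k \<in> elems X" for k unfolding d_def using v by (intro abs_elem diff_elem)
  have dn: "nrm X (d k) \<le> (1/2)^k" for k
    using nrm_abs[OF diff_elem[OF v v], of "Suc k" k] N[OF idx(2,1), of k] by (simp add: d_def[abs_def] v_def)
  have tail: "(\<Sum>k<n. nrm X (d (k + K))) \<le> 2 * (1/2)^K" for n K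
  proof -
    have "(\<Sum>k<n. nrm X (d (k + K))) \<le> (\<Sum>k<n. (1/2)^(k + K))" by (intro sum_mono dn)
    also have "\<dots> = (1/2)^K * (\<Sum>k<n. (1/2)^k)" by (simp add: power_add sum_distrib_left mult.commute)
    also have "(\<Sum>k<n. (1/2)^k) \<le> (2::real)" by (simp add: sum_gp_strict)
    finally show ?thesis by (simp add: mult.commute)
  qed
  \<comment> \<open>A measurable candidate everywhere; its values matter only where the subsequence
    converges, which is almost everywhere.\<close>
  define f where "f = (\<lambda>\<omega>. lim (\<lambda>k. v k \<omega>))"
  have fm [measurable]: "f \<in> borel_measurable M" unfolding f_def by measurable
  \<comment> \<open>The increments from \<open>K\<close> on sum to an element that dominates
    \<open>v K - f\<close>. For \<open>K = 0\<close> this also shows that \<open>f\<close> belongs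
    to the space.\<close>
  have close: "(\<lambda>\<omega>. v K \<omega> - f \<omega>) \<in> elems X \<and> nrm X (\<lambda>\<omega>. v K \<omega> - f \<omega>) \<le> 2 * (1/2)^K" for K
  proof -
    obtain s where s: "s \<in> elems X" "nrm X s \<le> 2 * (1/2)^K" "AE \<omega> in M. (\<lambda>k. d (k + K) \<omega>) sums s \<omega>"
      using fatou_norm_sums[OF fatou, of "\<lambda>k. d (k + K)", OF de _ tail] d_def by auto
    have le: "AE \<omega> in M. \<bar>v K \<omega> - f \<omega>\<bar> \<le> \<bar>s \<omega>\<bar>"
      using s(3)
    proof eventually_elim
      case (elim \<omega>)
      have d0: "0 \<le> d k \<omega>" for k by (simp add: d_def)
      have part: "\<bar>v (n + K) \<omega> - v K \<omega>\<bar> \<le> s \<omega>" for n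
      proof -
        have "v (n + K) \<omega> - v K \<omega> = (\<Sum>k<n. v (Suc k + K) \<omega> - v (k + K) \<omega>)"
          using sum_lessThan_telescope[of "\<lambda>k. v (k + K) \<omega>" n] by simp
        also have "\<bar>\<dots>\<bar> \<le> (\<Sum>k<n. d (k + K) \<omega>)" unfolding d_def by (rule order_trans[OF sum_abs]) simp
        also have "\<dots> \<le> s \<omega>" using elim d0 by (metis sum_le_suminf sums_iff finite_lessThan)
        finally show ?thesis .
      qed
      have "summable (\<lambda>k. v (Suc k + K) \<omega> - v (k + K) \<omega>)"
        using elim by (intro summable_rabs_cancel[OF sums_summable]) (simp add: d_def)
      then have "convergent (\<lambda>n. \<Sum>k<n. v (Suc k + K) \<omega> - v (k + K) \<omega>)" by (simp add: summable_iff_convergent)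
      moreover have "(\<lambda>n. \<Sum>k<n. v (Suc k + K) \<omega> - v (k + K) \<omega>) = (\<lambda>n. v (n + K) \<omega> - v K \<omega>)"
        using sum_lessThan_telescope[of "\<lambda>k. v (k + K) \<omega>"] by auto
      ultimately have "convergent (\<lambda>n. v (n + K) \<omega> - v K \<omega>)" by simp
      then obtain l where "(\<lambda>n. v (n + K) \<omega> - v K \<omega>) \<longlonglongrightarrow> l" by (auto simp: convergent_def)
      then have "(\<lambda>n. (v (n + K) \<omega> - v K \<omega>) + v K \<omega>) \<longlonglongrightarrow> l + v K \<omega>" by (intro tendsto_intros)
      then have "(\<lambda>n. v (n + K) \<omega>) \<longlonglongrightarrow> l + v K \<omega>" by simp
      then have "(\<lambda>n. v n \<omega>) \<longlonglongrightarrow> l + v K \<omega>" by (rule LIMSEQ_offset)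
      then have "(\<lambda>n. v n \<omega>) \<longlonglongrightarrow> f \<omega>" unfolding f_def by (simp add: limI)
      then have "(\<lambda>n. v (n + K) \<omega>) \<longlonglongrightarrow> f \<omega>" by (rule LIMSEQ_ignore_initial_segment)
      then have "(\<lambda>n. \<bar>v (n + K) \<omega> - v K \<omega>\<bar>) \<longlonglongrightarrow> \<bar>f \<omega> - v K \<omega>\<bar>" by (intro tendsto_intros)
      then have "\<bar>f \<omega> - v K \<omega>\<bar> \<le> s \<omega>" using part by (intro LIMSEQ_le_const2) auto
      then show ?case by linarith
    qed
    have m: "(\<lambda>\<omega>. v K \<omega> - f \<omega>) \<in> borel_measurable M" by measurable
    show ?thesis using solid_elem[OF m s(1) le] nrm_solid[OF m s(1) le] s(2) by auto
  qed
  have fe: "f \<in> elems X"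
    using diff_elem[OF v[of 0] conjunct1[OF close[of 0]]] by simp
  have lim: "(\<lambda>n. nrm X (\<lambda>\<omega>. u n \<omega> - f \<omega>)) \<longlonglongrightarrow> 0"
  proof (rule LIMSEQ_I)
    fix r :: real assume "0 < r"
    then obtain K where K: "(1/2)^K < r / 3" using real_arch_pow_inv[of "r / 3" "1/2"] by auto
    have "norm (nrm X (\<lambda>\<omega>. u n \<omega> - f \<omega>) - 0) < r" if n: "n \<ge> N K" for n
    proof -
      have "nrm X (\<lambda>\<omega>. (u n \<omega> - v K \<omega>) + (v K \<omega> - f \<omega>)) \<le> nrm X (\<lambda>\<omega>. u n \<omega> - v K \<omega>) + nrm X (\<lambda>\<omega>. v K \<omega> - f \<omega>)"
        using fe u v by (intro nrm_add diff_elem) auto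
      also have "\<dots> < (1/2)^K + 2 * (1/2)^K"
        using close[of K] N[OF n idx(1)] unfolding v_def by (intro add_less_le_mono) auto
      finally have "nrm X (\<lambda>\<omega>. u n \<omega> - f \<omega>) < r" using K by simp
      then show ?thesis using nrm_nonneg[OF diff_elem[OF _ fe], of "u n"] u by simp
    qed
    then show "\<exists>no. \<forall>n\<ge>no. norm (nrm X (\<lambda>\<omega>. u n \<omega> - f \<omega>) - 0) < r" by blast
  qed
  show "\<exists>f\<in>elems X. (\<lambda>n. nrm X (\<lambda>\<omega>. u n \<omega> - f \<omega>)) \<longlonglongrightarrow> 0" using fe lim by blast
qed

end

text \<open>A countable union of members whose measures approach the supremum attains it. If it
  missed a set of positive measure, \<open>ex\<close> would supply a member that enlarges it beyond
  the supremum.\<close>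

lemma (in finite_measure) exhaustion:
  assumes sub: "\<A> \<subseteq> sets M" and ne: "\<A> \<noteq> {}"
    and Un: "\<And>B :: nat \<Rightarrow> 'a set. (\<And>n. B n \<in> \<A>) \<Longrightarrow> (\<Union>n. B n) \<in> \<A>"
    and ex: "\<And>A. A \<in> sets M \<Longrightarrow> emeasure M A > 0 \<Longrightarrow> \<exists>B\<in>\<A>. emeasure M (A \<inter> B) > 0"
  obtains B where "B \<in> \<A>" "AE \<omega> in M. \<omega> \<in> B"
proof -
  define s where "s = (SUP B\<in>\<A>. measure M B)"
  have bdd: "bdd_above (measure M ` \<A>)" by (rule bdd_aboveI2[of _ _ "measure M (space M)"]) (rule bounded_measure)
  have "\<exists>B\<in>\<A>. s - 1 / real (Suc n) < measure M B" for n
    using less_cSUP_iff[OF ne bdd, of "s - 1 / real (Suc n)"] unfolding s_def by simp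
  then obtain B where B: "\<And>n. B n \<in> \<A>" "\<And>n. s - 1 / real (Suc n) < measure M (B n)" by metis
  define C where "C = (\<Union>n. B n)"
  have C: "C \<in> \<A>" unfolding C_def by (rule Un[OF B(1)])
  have Cs: "C \<in> sets M" using C sub by auto
  have le: "s \<le> measure M C"
  proof (rule field_le_epsilon)
    fix e :: real assume "0 < e"
    then obtain n where n: "1 / real (Suc n) < e" using nat_approx_posE by blast
    have "measure M (B n) \<le> measure M C" unfolding C_def[symmetric] using Cs by (intro finite_measure_mono) (auto simp: C_def)
    then show "s \<le> measure M C + e" using B(2)[of n] n by simp
  qed
  have "emeasure M (space M - C) = 0"
  proof (rule ccontr)
    assume "emeasure M (space M - C) \<noteq> 0"
    then have "emeasure M (space M - C) > 0" by (simp add: zero_less_iff_neq_zero)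
    then obtain D where D: "D \<in> \<A>" "emeasure M ((space M - C) \<inter> D) > 0" using ex[of "space M - C"] Cs by auto
    have Ds: "D \<in> sets M" using D sub by auto
    have "(\<Union>n::nat. if n = 0 then C else D) \<in> \<A>" using C D by (intro Un) auto
    moreover have "(\<Union>n::nat. if n = 0 then C else D) = C \<union> D" by (auto split: if_splits)
    ultimately have "C \<union> D \<in> \<A>" by simp
    then have "measure M (C \<union> D) \<le> s" unfolding s_def by (intro cSUP_upper bdd)
    moreover have "measure M (C \<union> D) = measure M C + measure M ((space M - C) \<inter> D)"
    proof -
      have "C \<union> D = C \<union> ((space M - C) \<inter> D)" using sets.sets_into_space[OF Ds] by auto
      moreover have "measure M (C \<union> ((space M - C) \<inter> D)) = measure M C + measure M ((space M - C) \<inter> D)"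
        using Cs Ds by (intro finite_measure_Union) auto
      ultimately show ?thesis by simp
    qed
    moreover have "measure M ((space M - C) \<inter> D) > 0" using D(2) by (simp add: emeasure_eq_measure)
    ultimately show False using le by simp
  qed
  then have "AE \<omega> in M. \<omega> \<in> C" using Cs by (intro AE_I[of _ _ "space M - C"]) auto
  then show ?thesis using that C by blast
qed

text \<open>The weak unit is positive at every point and not merely almost everywhere, so that one
  can divide by it and compare with its multiples pointwise.\<close>

locale weak_unit_lattice = function_lattice M X + finite_measure M for M :: "'a measure" and X :: "'a fspace" +
  assumes weak_unit_ex: "\<exists>u\<in>elems X. \<forall>\<omega>. 0 < u \<omega>"

text \<open>Sets on which some element is positive form a family closed under countable unions,
  because completeness lets a weighted series of elements converge. Full support makes the family
  rich enough for exhaustion.\<close>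

lemma (in function_lattice) weak_unitI:
  assumes fin: "finite_measure M" and comp: "norm_complete X" and full: "full_support M X"
  shows "weak_unit_lattice M X"
proof -
  interpret finite_measure M by (rule fin)
  define \<A> where "\<A> = {B \<in> sets M. \<exists>f\<in>elems X. AE \<omega> in M. \<omega> \<in> B \<longrightarrow> 0 < f \<omega>}"
  obtain B where B: "B \<in> \<A>" "AE \<omega> in M. \<omega> \<in> B"
  proof (rule exhaustion[of \<A>])
    show "\<A> \<subseteq> sets M" unfolding \<A>_def by auto
    show "\<A> \<noteq> {}" unfolding \<A>_def using zero_elem by (auto intro!: exI[of _ "{}"])
  next
    fix A assume A: "A \<in> sets M" "emeasure M A > 0"
    then obtain f where f: "f \<in> elems X" "\<not> (AE \<omega> in M. \<omega> \<in> A \<longrightarrow> f \<omega> = 0)"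
      using full unfolding full_support_def by blast
    have fm [measurable]: "f \<in> borel_measurable M" using elem_measurable[OF f(1)] .
    define B where "B = {\<omega> \<in> space M. 0 < \<bar>f \<omega>\<bar>}"
    have Bs: "B \<in> sets M" unfolding B_def by measurable
    have "B \<in> \<A>" unfolding \<A>_def using Bs abs_elem[OF f(1)] by (auto simp: B_def intro!: bexI[of _ "\<lambda>\<omega>. \<bar>f \<omega>\<bar>"])
    moreover have "emeasure M (A \<inter> B) \<noteq> 0"
    proof
      assume "emeasure M (A \<inter> B) = 0"
      then have "AE \<omega> in M. \<omega> \<in> A \<longrightarrow> f \<omega> = 0"
        using A Bs by (intro AE_I[of _ _ "A \<inter> B"]) (auto simp: B_def)
      then show False using f(2) by simp
    qed
    ultimately show "\<exists>B\<in>\<A>. emeasure M (A \<inter> B) > 0" by (auto simp: zero_less_iff_neq_zero)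
  next
    fix B :: "nat \<Rightarrow> 'a set" assume "\<And>n. B n \<in> \<A>"
    then have Bs: "\<And>n. B n \<in> sets M" and "\<And>n. \<exists>f\<in>elems X. AE \<omega> in M. \<omega> \<in> B n \<longrightarrow> 0 < f \<omega>"
      unfolding \<A>_def by auto
    then obtain f where f: "\<And>n. f n \<in> elems X" "\<And>n. AE \<omega> in M. \<omega> \<in> B n \<longrightarrow> 0 < f n \<omega>" by metis
    \<comment> \<open>The weights make the norms summable; the 1 in the denominator covers elements
      of norm zero.\<close>
    define g where "g n \<omega> = (1/2)^n / (1 + nrm X (f n)) * \<bar>f n \<omega>\<bar>" for n \<omega>
    have ge: "g n \<in> elems X" for n unfolding g_def by (intro scale_elem abs_elem f)
    have g0: "0 \<le> g n \<omega>" for n \<omega> unfolding g_def using nrm_nonneg[OF f(1)] by (auto intro!: mult_nonneg_nonneg divide_nonneg_nonneg add_nonneg_nonneg)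
    have gn: "nrm X (g n) \<le> (1/2)^n" for n
    proof -
      have pos: "1 + nrm X (f n) > 0" using nrm_nonneg[OF f(1), of n] by linarith
      have "nrm X (g n) = (1/2)^n / (1 + nrm X (f n)) * nrm X (f n)"
        unfolding g_def using nrm_scale[OF abs_elem[OF f(1)], of "(1/2)^n / (1 + nrm X (f n))" n] nrm_abs[OF f(1), of n] pos by simp
      also have "\<dots> = (1/2)^n * (nrm X (f n) / (1 + nrm X (f n)))" by simp
      also have "\<dots> \<le> (1/2)^n * 1" using pos by (intro mult_left_mono) auto
      finally show ?thesis by simp
    qed
    define S where "S N \<omega> = (\<Sum>n<N. g n \<omega>)" for N \<omega>
    have Se: "S N \<in> elems X" for N unfolding S_def by (intro sum_elem ge)
    have Sdiff: "nrm X (\<lambda>\<omega>. S (N + m) \<omega> - S N \<omega>) \<le> 2 * (1/2)^N" for N m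
    proof -
      have "S (N + m) \<omega> - S N \<omega> = (\<Sum>n<m. g (n + N) \<omega>)" for \<omega>
        unfolding S_def by (induction m) (auto simp: add.commute)
      then have "nrm X (\<lambda>\<omega>. S (N + m) \<omega> - S N \<omega>) \<le> (\<Sum>n<m. nrm X (g (n + N)))"
        using nrm_sum[of m "\<lambda>n. g (n + N)"] ge by simp
      also have "\<dots> \<le> (\<Sum>n<m. (1/2)^(n + N))" by (intro sum_mono gn)
      also have "\<dots> = (1/2)^N * (\<Sum>n<m. (1/2)^n)" by (simp add: power_add sum_distrib_left mult.commute)
      also have "(\<Sum>n<m. (1/2)^n) \<le> (2::real)" by (simp add: sum_gp_strict)
      finally show ?thesis by (simp add: mult.commute)
    qed
    have cauchy: "\<forall>e>0. \<exists>N::nat. \<forall>m\<ge>N. \<forall>n\<ge>N. nrm X (\<lambda>\<omega>. S m \<omega> - S n \<omega>) < e"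
    proof (intro allI impI)
      fix e :: real assume "0 < e"
      then obtain N where N: "(1/2)^N < e / 4" using real_arch_pow_inv[of "e / 4" "1/2"] by auto
      have "nrm X (\<lambda>\<omega>. S m \<omega> - S n \<omega>) < e" if "m \<ge> N" "n \<ge> N" for m n
      proof -
        have "nrm X (\<lambda>\<omega>. (S m \<omega> - S N \<omega>) - (S n \<omega> - S N \<omega>)) \<le> nrm X (\<lambda>\<omega>. S m \<omega> - S N \<omega>) + nrm X (\<lambda>\<omega>. S n \<omega> - S N \<omega>)"
          by (intro nrm_diff diff_elem Se)
        also have "\<dots> \<le> 2 * (1/2)^N + 2 * (1/2)^N"
          using Sdiff[of N "m - N"] Sdiff[of N "n - N"] that by (intro add_mono) auto
        finally show ?thesis using N by simp
      qed
      then show "\<exists>N::nat. \<forall>m\<ge>N. \<forall>n\<ge>N. nrm X (\<lambda>\<omega>. S m \<omega> - S n \<omega>) < e" by blast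
    qed
    obtain F where F: "F \<in> elems X" "(\<lambda>n. nrm X (\<lambda>\<omega>. S n \<omega> - F \<omega>)) \<longlonglongrightarrow> 0"
      using comp cauchy Se unfolding norm_complete_def by blast
    have Fm [measurable]: "F \<in> borel_measurable M" using elem_measurable[OF F(1)] .
    have gm [measurable]: "g n \<in> borel_measurable M" for n using elem_measurable[OF ge] .
    \<comment> \<open>The series converges in norm only, so domination by its limit has to be read
      off: the positive part of \<open>g n - F\<close> stays below \<open>S N - F\<close> in
      absolute value for all \<open>N\<close> beyond n, hence has norm zero.\<close>
    have gF: "AE \<omega> in M. g n \<omega> \<le> F \<omega>" for n
    proof -
      have e: "(\<lambda>\<omega>. max 0 (g n \<omega> - F \<omega>)) \<in> elems X" by (intro pos_part_elem diff_elem ge F)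
      have "nrm X (\<lambda>\<omega>. max 0 (g n \<omega> - F \<omega>)) \<le> nrm X (\<lambda>\<omega>. S N \<omega> - F \<omega>)" if "N \<ge> Suc n" for N
      proof (rule nrm_solid)
        have "g n \<omega> \<le> S N \<omega>" for \<omega> unfolding S_def using that g0 by (intro member_le_sum) auto
        then have "\<bar>max 0 (g n \<omega> - F \<omega>)\<bar> \<le> \<bar>S N \<omega> - F \<omega>\<bar>" for \<omega> by (smt (verit))
        then show "AE \<omega> in M. \<bar>max 0 (g n \<omega> - F \<omega>)\<bar> \<le> \<bar>S N \<omega> - F \<omega>\<bar>" by simp
      qed (use diff_elem[OF Se F(1)] in auto)
      then have "nrm X (\<lambda>\<omega>. max 0 (g n \<omega> - F \<omega>)) \<le> 0" by (intro LIMSEQ_le_const[OF F(2)]) blast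
      then have "nrm X (\<lambda>\<omega>. max 0 (g n \<omega> - F \<omega>)) = 0" using nrm_nonneg[OF e] by simp
      then have "AE \<omega> in M. max 0 (g n \<omega> - F \<omega>) = 0" using nrm_eq_0_iff[OF e] by simp
      then show ?thesis by eventually_elim (simp add: max_def split: if_splits)
    qed
    have "AE \<omega> in M. \<forall>n. g n \<omega> \<le> F \<omega> \<and> (\<omega> \<in> B n \<longrightarrow> 0 < f n \<omega>)"
      using gF f(2) by (subst AE_all_countable) auto
    then have "AE \<omega> in M. \<omega> \<in> (\<Union>n. B n) \<longrightarrow> 0 < F \<omega>"
    proof eventually_elim
      case (elim \<omega>)
      show ?case
      proof
        assume "\<omega> \<in> (\<Union>n. B n)"
        then obtain n where "\<omega> \<in> B n" by auto
        then have "0 < f n \<omega>" using elim by auto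
        then have "0 < g n \<omega>" unfolding g_def using nrm_nonneg[OF f(1), of n]
          by (intro mult_pos_pos divide_pos_pos) auto
        then show "0 < F \<omega>" using elim by (meson less_le_trans)
      qed
    qed
    then show "(\<Union>n. B n) \<in> \<A>" unfolding \<A>_def using Bs F(1) by auto
  qed blast
  then obtain f where f: "f \<in> elems X" "AE \<omega> in M. \<omega> \<in> B \<longrightarrow> 0 < f \<omega>" unfolding \<A>_def by auto
  have fm [measurable]: "f \<in> borel_measurable M" using elem_measurable[OF f(1)] .
  \<comment> \<open>The value 1 on the remaining null set makes the unit positive
    everywhere.\<close>
  define u where "u = (\<lambda>\<omega>. if 0 < f \<omega> then f \<omega> else 1)"
  have um: "u \<in> borel_measurable M" unfolding u_def by measurable
  have "AE \<omega> in M. u \<omega> = f \<omega>" using f(2) B(2) by eventually_elim (auto simp: u_def)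
  then have "u \<in> elems X" using elem_cong_AE[OF f(1) um] by simp
  then show ?thesis
    by unfold_locales (auto intro!: bexI[of _ u] simp: u_def)
qed

section \<open>Koethe duality\<close>

lemma nn_integral_incseq_tendsto:
  fixes f :: "nat \<Rightarrow> 'a \<Rightarrow> ennreal"
  assumes f: "\<And>i. f i \<in> borel_measurable M"
    and lim: "AE x in M. incseq (\<lambda>i. f i x) \<and> (\<lambda>i. f i x) \<longlonglongrightarrow> u x"
  shows "(\<lambda>i. \<integral>\<^sup>+x. f i x \<partial>M) \<longlonglongrightarrow> (\<integral>\<^sup>+x. u x \<partial>M)"
    and "(\<integral>\<^sup>+x. u x \<partial>M) = (SUP i. \<integral>\<^sup>+x. f i x \<partial>M)"
proof -
  have mono: "AE x in M. f i x \<le> f (Suc i) x" for i using lim by eventually_elim (auto simp: incseq_Suc_iff)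
  have "(\<integral>\<^sup>+x. u x \<partial>M) = (\<integral>\<^sup>+x. (SUP i. f i x) \<partial>M)"
  proof (rule nn_integral_cong_AE, use lim in eventually_elim)
    case (elim x)
    then show ?case using LIMSEQ_unique LIMSEQ_SUP by blast
  qed
  also have "\<dots> = (SUP i. \<integral>\<^sup>+x. f i x \<partial>M)" by (rule nn_integral_monotone_convergence_SUP_AE) (fact mono f)+
  finally show eq: "(\<integral>\<^sup>+x. u x \<partial>M) = (SUP i. \<integral>\<^sup>+x. f i x \<partial>M)" .
  show "(\<lambda>i. \<integral>\<^sup>+x. f i x \<partial>M) \<longlonglongrightarrow> (\<integral>\<^sup>+x. u x \<partial>M)"
    unfolding eq by (intro LIMSEQ_SUP incseq_SucI nn_integral_mono_AE mono)
qed

context weak_unit_lattice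
begin

definition wu :: "'a \<Rightarrow> real" where
  "wu = (SOME u. u \<in> elems X \<and> (\<forall>\<omega>. 0 < u \<omega>))"

lemma wu_elem: "wu \<in> elems X" and wu_pos: "0 < wu \<omega>"
proof -
  have "\<exists>u. u \<in> elems X \<and> (\<forall>\<omega>. 0 < u \<omega>)" using weak_unit_ex by auto
  then have "wu \<in> elems X \<and> (\<forall>\<omega>. 0 < wu \<omega>)" unfolding wu_def by (rule someI_ex)
  then show "wu \<in> elems X" "0 < wu \<omega>" by auto
qed

lemma wu_measurable [measurable]: "wu \<in> borel_measurable M"
  by (rule elem_measurable[OF wu_elem])

lemma wu_indicator_elem: "A \<in> sets M \<Longrightarrow> (\<lambda>\<omega>. wu \<omega> * indicat_real A \<omega>) \<in> elems X"
  by (rule mult_elem[OF wu_elem, of _ 1]) (auto simp: indicator_def)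

lemma wu_mult_nonneg: "0 \<le> w \<Longrightarrow> 0 \<le> wu \<omega> * w"
  using wu_pos[of \<omega>] by simp

lemma koethe_add:
  assumes h: "h \<in> elems X'" and k: "k \<in> elems X'"
  shows "(\<lambda>\<omega>. h \<omega> + k \<omega>) \<in> elems X'" "nrm X' (\<lambda>\<omega>. h \<omega> + k \<omega>) \<le> nrm X' h + nrm X' k"
proof -
  have [measurable]: "h \<in> borel_measurable M" "k \<in> borel_measurable M" using koethe_measurable h k by auto
  have *: "(\<integral>\<^sup>+\<omega>. ennreal (f \<omega> * \<bar>h \<omega> + k \<omega>\<bar>) \<partial>M) \<le> ennreal ((nrm X' h + nrm X' k) * nrm X f)"
    if f: "f \<in> elems X" and f0: "\<And>\<omega>. 0 \<le> f \<omega>" for f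
  proof -
    have [measurable]: "f \<in> borel_measurable M" using elem_measurable[OF f] .
    have "(\<integral>\<^sup>+\<omega>. ennreal (f \<omega> * \<bar>h \<omega> + k \<omega>\<bar>) \<partial>M) \<le> (\<integral>\<^sup>+\<omega>. ennreal \<bar>f \<omega> * h \<omega>\<bar> + ennreal \<bar>f \<omega> * k \<omega>\<bar> \<partial>M)"
    proof (rule nn_integral_mono)
      fix \<omega>
      have "f \<omega> * \<bar>h \<omega> + k \<omega>\<bar> \<le> f \<omega> * (\<bar>h \<omega>\<bar> + \<bar>k \<omega>\<bar>)" using f0[of \<omega>] by (intro mult_left_mono) auto
      also have "\<dots> = \<bar>f \<omega> * h \<omega>\<bar> + \<bar>f \<omega> * k \<omega>\<bar>" using f0[of \<omega>] by (simp add: abs_mult distrib_left)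
      finally show "ennreal (f \<omega> * \<bar>h \<omega> + k \<omega>\<bar>) \<le> ennreal \<bar>f \<omega> * h \<omega>\<bar> + ennreal \<bar>f \<omega> * k \<omega>\<bar>"
        by (simp add: ennreal_plus[symmetric] ennreal_leI del: ennreal_plus)
    qed
    also have "\<dots> = (\<integral>\<^sup>+\<omega>. ennreal \<bar>f \<omega> * h \<omega>\<bar> \<partial>M) + (\<integral>\<^sup>+\<omega>. ennreal \<bar>f \<omega> * k \<omega>\<bar> \<partial>M)"
      by (rule nn_integral_add) auto
    also have "\<dots> \<le> ennreal (nrm X' h * nrm X f) + ennreal (nrm X' k * nrm X f)"
      by (intro add_mono koethe_nn_bound h k f)
    also have "\<dots> = ennreal ((nrm X' h + nrm X' k) * nrm X f)"
      using koethe_nrm_nonneg[OF h] koethe_nrm_nonneg[OF k] nrm_nonneg[OF f]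
      by (simp add: ennreal_plus[symmetric] distrib_right del: ennreal_plus)
    finally show ?thesis .
  qed
  have c: "0 \<le> nrm X' h + nrm X' k" using koethe_nrm_nonneg[OF h] koethe_nrm_nonneg[OF k] by simp
  have m: "(\<lambda>\<omega>. h \<omega> + k \<omega>) \<in> borel_measurable M" by measurable
  show "(\<lambda>\<omega>. h \<omega> + k \<omega>) \<in> elems X'" "nrm X' (\<lambda>\<omega>. h \<omega> + k \<omega>) \<le> nrm X' h + nrm X' k"
    using koetheI[OF m c *] by auto
qed

lemma koethe_scale_le:
  assumes h: "h \<in> elems X'"
  shows "(\<lambda>\<omega>. c * h \<omega>) \<in> elems X'" "nrm X' (\<lambda>\<omega>. c * h \<omega>) \<le> \<bar>c\<bar> * nrm X' h"
proof -
  have [measurable]: "h \<in> borel_measurable M" using koethe_measurable h by auto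
  have *: "(\<integral>\<^sup>+\<omega>. ennreal (f \<omega> * \<bar>c * h \<omega>\<bar>) \<partial>M) \<le> ennreal ((\<bar>c\<bar> * nrm X' h) * nrm X f)"
    if f: "f \<in> elems X" and f0: "\<And>\<omega>. 0 \<le> f \<omega>" for f
  proof -
    have [measurable]: "f \<in> borel_measurable M" using elem_measurable[OF f] .
    have "(\<integral>\<^sup>+\<omega>. ennreal (f \<omega> * \<bar>c * h \<omega>\<bar>) \<partial>M) = (\<integral>\<^sup>+\<omega>. ennreal \<bar>c\<bar> * ennreal \<bar>f \<omega> * h \<omega>\<bar> \<partial>M)"
      using f0 by (intro nn_integral_cong) (simp add: ennreal_mult'[symmetric] abs_mult mult.left_commute)
    also have "\<dots> = ennreal \<bar>c\<bar> * (\<integral>\<^sup>+\<omega>. ennreal \<bar>f \<omega> * h \<omega>\<bar> \<partial>M)" by (rule nn_integral_cmult) measurable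
    also have "\<dots> \<le> ennreal \<bar>c\<bar> * ennreal (nrm X' h * nrm X f)"
      by (intro mult_left_mono koethe_nn_bound h f) auto
    also have "\<dots> = ennreal ((\<bar>c\<bar> * nrm X' h) * nrm X f)" by (simp add: ennreal_mult'[symmetric] mult.assoc)
    finally show ?thesis .
  qed
  have c: "0 \<le> \<bar>c\<bar> * nrm X' h" using koethe_nrm_nonneg[OF h] by simp
  have m: "(\<lambda>\<omega>. c * h \<omega>) \<in> borel_measurable M" by measurable
  show "(\<lambda>\<omega>. c * h \<omega>) \<in> elems X'" "nrm X' (\<lambda>\<omega>. c * h \<omega>) \<le> \<bar>c\<bar> * nrm X' h"
    using koetheI[OF m c *] by auto
qed

lemma koethe_solid:
  assumes h: "h \<in> borel_measurable M" and k: "k \<in> elems X'" and le: "AE \<omega> in M. \<bar>h \<omega>\<bar> \<le> \<bar>k \<omega>\<bar>"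
  shows "h \<in> elems X'" "nrm X' h \<le> nrm X' k"
proof -
  have *: "(\<integral>\<^sup>+\<omega>. ennreal (f \<omega> * \<bar>h \<omega>\<bar>) \<partial>M) \<le> ennreal (nrm X' k * nrm X f)"
    if f: "f \<in> elems X" and f0: "\<And>\<omega>. 0 \<le> f \<omega>" for f
  proof -
    have "(\<integral>\<^sup>+\<omega>. ennreal (f \<omega> * \<bar>h \<omega>\<bar>) \<partial>M) \<le> (\<integral>\<^sup>+\<omega>. ennreal \<bar>f \<omega> * k \<omega>\<bar> \<partial>M)"
      using le by (intro nn_integral_mono_AE) (auto simp: abs_mult f0 intro!: ennreal_leI mult_left_mono)
    also have "\<dots> \<le> ennreal (nrm X' k * nrm X f)" by (rule koethe_nn_bound[OF k f])
    finally show ?thesis .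
  qed
  show "h \<in> elems X'" "nrm X' h \<le> nrm X' k"
    using koetheI[OF h koethe_nrm_nonneg[OF k] *] by auto
qed

lemma koethe_zero_AE:
  assumes h: "h \<in> borel_measurable M" and 0: "AE \<omega> in M. h \<omega> = 0"
  shows "h \<in> elems X'" "nrm X' h \<le> 0"
proof -
  have *: "(\<integral>\<^sup>+\<omega>. ennreal (f \<omega> * \<bar>h \<omega>\<bar>) \<partial>M) \<le> ennreal (0 * nrm X f)" if f: "f \<in> elems X" for f
  proof -
    have "(\<integral>\<^sup>+\<omega>. ennreal (f \<omega> * \<bar>h \<omega>\<bar>) \<partial>M) = (\<integral>\<^sup>+\<omega>. 0 \<partial>M)"
      by (intro nn_integral_cong_AE) (use 0 in auto)
    then show ?thesis by simp
  qed
  show "h \<in> elems X'" "nrm X' h \<le> 0" using koetheI[OF h order_refl *] by auto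
qed

lemma koethe_function_lattice: "function_lattice M X'"
proof
  show "(\<lambda>_. 0) \<in> elems X'" by (intro koethe_zero_AE) auto
  show "nrm X' (\<lambda>\<omega>. c * h \<omega>) = \<bar>c\<bar> * nrm X' h" if h: "h \<in> elems X'" for h c
  proof (cases "c = 0")
    case True
    then show ?thesis using koethe_scale_le[OF h, of 0] koethe_nrm_nonneg[of "\<lambda>_. 0"] by simp
  next
    case False
    have "nrm X' (\<lambda>\<omega>. (1 / c) * (c * h \<omega>)) \<le> \<bar>1 / c\<bar> * nrm X' (\<lambda>\<omega>. c * h \<omega>)"
      by (rule koethe_scale_le(2)[OF koethe_scale_le(1)[OF h]])
    then have "\<bar>c\<bar> * nrm X' h \<le> nrm X' (\<lambda>\<omega>. c * h \<omega>)" using False by (simp add: field_simps)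
    then show ?thesis using koethe_scale_le(2)[OF h, of c] by simp
  qed
  show "nrm X' h = 0 \<longleftrightarrow> (AE \<omega> in M. h \<omega> = 0)" if h: "h \<in> elems X'" for h
  proof
    \<comment> \<open>Pairing with the weak unit alone detects \<open>h\<close>, as the unit
      vanishes nowhere.\<close>
    assume "nrm X' h = 0"
    then have "(\<integral>\<^sup>+\<omega>. ennreal \<bar>wu \<omega> * h \<omega>\<bar> \<partial>M) = 0" using koethe_nn_bound[OF h wu_elem] by simp
    moreover have "(\<lambda>\<omega>. ennreal \<bar>wu \<omega> * h \<omega>\<bar>) \<in> borel_measurable M" using koethe_measurable[OF h] by measurable
    ultimately have "AE \<omega> in M. ennreal \<bar>wu \<omega> * h \<omega>\<bar> = 0" by (subst (asm) nn_integral_0_iff_AE) auto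
    then show "AE \<omega> in M. h \<omega> = 0"
    proof eventually_elim
      case (elim \<omega>)
      then show ?case using wu_pos[of \<omega>] by auto
    qed
  next
    assume "AE \<omega> in M. h \<omega> = 0"
    then show "nrm X' h = 0" using koethe_zero_AE[OF koethe_measurable[OF h]] koethe_nrm_nonneg[OF h] by simp
  qed
qed (fact koethe_measurable koethe_add koethe_scale_le koethe_solid koethe_nrm_nonneg)+

text \<open>Monotone convergence in the pairing with each fixed nonnegative element.\<close>

lemma koethe_fatou: "fatou_norm M X'"
  unfolding fatou_norm_def
proof (intro allI impI)
  fix h :: "nat \<Rightarrow> 'a \<Rightarrow> real" and g c
  assume h: "\<forall>n. h n \<in> elems X'" and g: "g \<in> borel_measurable M" and h0: "\<forall>n \<omega>. 0 \<le> h n \<omega>"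
    and lim: "AE \<omega> in M. incseq (\<lambda>n. h n \<omega>) \<and> (\<lambda>n. h n \<omega>) \<longlonglongrightarrow> g \<omega>" and c: "\<forall>n. nrm X' (h n) \<le> c"
  have [measurable]: "h n \<in> borel_measurable M" for n using koethe_measurable h by auto
  have c0: "0 \<le> c" using koethe_nrm_nonneg[of "h 0"] h c by (meson order_trans)
  have *: "(\<integral>\<^sup>+\<omega>. ennreal (f \<omega> * \<bar>g \<omega>\<bar>) \<partial>M) \<le> ennreal (c * nrm X f)"
    if f: "f \<in> elems X" and f0: "\<And>\<omega>. 0 \<le> f \<omega>" for f
  proof -
    have [measurable]: "f \<in> borel_measurable M" using elem_measurable[OF f] .
    have "(\<integral>\<^sup>+\<omega>. ennreal (f \<omega> * \<bar>g \<omega>\<bar>) \<partial>M) = (SUP n. \<integral>\<^sup>+\<omega>. ennreal \<bar>f \<omega> * h n \<omega>\<bar> \<partial>M)"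
    proof (rule nn_integral_incseq_tendsto(2))
      show "AE \<omega> in M. incseq (\<lambda>n. ennreal \<bar>f \<omega> * h n \<omega>\<bar>) \<and>
        (\<lambda>n. ennreal \<bar>f \<omega> * h n \<omega>\<bar>) \<longlonglongrightarrow> ennreal (f \<omega> * \<bar>g \<omega>\<bar>)"
        using lim
      proof eventually_elim
        case (elim \<omega>)
        have "(\<lambda>n. ennreal \<bar>f \<omega> * h n \<omega>\<bar>) \<longlonglongrightarrow> ennreal \<bar>f \<omega> * g \<omega>\<bar>"
          using elim by (intro tendsto_ennrealI tendsto_intros) auto
        then show ?case using elim f0[of \<omega>] h0
          by (auto simp: incseq_def abs_mult intro!: ennreal_leI mult_left_mono)
      qed
    qed measurable
    also have "\<dots> \<le> ennreal (c * nrm X f)"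
    proof (rule SUP_least)
      fix n
      have "(\<integral>\<^sup>+\<omega>. ennreal \<bar>f \<omega> * h n \<omega>\<bar> \<partial>M) \<le> ennreal (nrm X' (h n) * nrm X f)" using h f by (intro koethe_nn_bound) auto
      also have "\<dots> \<le> ennreal (c * nrm X f)" using c nrm_nonneg[OF f] by (intro ennreal_leI mult_right_mono) auto
      finally show "(\<integral>\<^sup>+\<omega>. ennreal \<bar>f \<omega> * h n \<omega>\<bar> \<partial>M) \<le> ennreal (c * nrm X f)" .
    qed
    finally show ?thesis .
  qed
  show "g \<in> elems X' \<and> nrm X' g \<le> c" using koetheI[OF g c0 *] by auto
qed

lemma koethe_complete: "norm_complete X'"
  by (rule function_lattice.fatou_norm_imp_complete[OF koethe_function_lattice koethe_fatou])

end

section \<open>Order continuity: functionals become functions\<close>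

locale order_continuous_lattice = weak_unit_lattice +
  assumes order_cont: "order_continuous M X"
begin

lemma order_continuousD:
  assumes "\<And>n. f n \<in> elems X" "AE \<omega> in M. decseq (\<lambda>n. f n \<omega>) \<and> (\<lambda>n. f n \<omega>) \<longlonglongrightarrow> 0"
  shows "(\<lambda>n. nrm X (f n)) \<longlonglongrightarrow> 0"
  using order_cont assms unfolding order_continuous_def by blast

text \<open>The differences from the limit decrease to 0 almost everywhere, so their norms tend to
  0. This is the source of countable additivity for the measures attached to functionals.\<close>

lemma dual_incseq_tendsto:
  assumes \<phi>: "\<phi> \<in> dual X" and f: "\<And>n. f n \<in> elems X" and g: "g \<in> elems X"
    and lim: "AE \<omega> in M. incseq (\<lambda>n. f n \<omega>) \<and> (\<lambda>n. f n \<omega>) \<longlonglongrightarrow> g \<omega>"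
  shows "(\<lambda>n. \<phi> (f n)) \<longlonglongrightarrow> \<phi> g"
proof -
  obtain K where K: "\<forall>f\<in>elems X. \<bar>\<phi> f\<bar> \<le> K * nrm X f" using dual_bound[OF \<phi>] by auto
  have "(\<lambda>n. nrm X (\<lambda>\<omega>. g \<omega> - f n \<omega>)) \<longlonglongrightarrow> 0"
  proof (rule order_continuousD)
    show "(\<lambda>\<omega>. g \<omega> - f n \<omega>) \<in> elems X" for n by (intro diff_elem f g)
    show "AE \<omega> in M. decseq (\<lambda>n. g \<omega> - f n \<omega>) \<and> (\<lambda>n. g \<omega> - f n \<omega>) \<longlonglongrightarrow> 0"
      using lim
    proof eventually_elim
      case (elim \<omega>)
      then have "(\<lambda>n. g \<omega> - f n \<omega>) \<longlonglongrightarrow> g \<omega> - g \<omega>" by (intro tendsto_intros) auto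
      then show ?case using elim by (auto simp: decseq_def incseq_def)
    qed
  qed
  then have "(\<lambda>n. K * nrm X (\<lambda>\<omega>. g \<omega> - f n \<omega>)) \<longlonglongrightarrow> K * 0" by (intro tendsto_intros)
  moreover have "\<bar>\<phi> (f n) - \<phi> g\<bar> \<le> K * nrm X (\<lambda>\<omega>. g \<omega> - f n \<omega>)" for n
  proof -
    have "\<bar>\<phi> (\<lambda>\<omega>. g \<omega> - f n \<omega>)\<bar> \<le> K * nrm X (\<lambda>\<omega>. g \<omega> - f n \<omega>)" using K diff_elem[OF g f] by blast
    then show ?thesis unfolding dual_diff[OF \<phi> g f] by (simp add: abs_minus_commute)
  qed
  ultimately have "(\<lambda>n. \<phi> (f n) - \<phi> g) \<longlonglongrightarrow> 0"
    using Lim_null_comparison[of "\<lambda>n. \<phi> (f n) - \<phi> g" "\<lambda>n. K * nrm X (\<lambda>\<omega>. g \<omega> - f n \<omega>)" sequentially] by simp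
  then show ?thesis by (simp add: LIM_zero_iff)
qed

text \<open>Radon-Nikodym for the measure that sends A to \<phi> of the weak unit times the
  indicator of A. The weight is there because indicators themselves need not belong to the lattice;
  accordingly the representing function is the density divided by the weak unit.\<close>

lemma positive_dual_representation:
  assumes \<phi>: "\<phi> \<in> dual X" and pos: "\<And>f. f \<in> elems X \<Longrightarrow> AE \<omega> in M. 0 \<le> f \<omega> \<Longrightarrow> 0 \<le> \<phi> f"
  shows "\<exists>h\<in>elems X'. (\<forall>\<omega>. 0 \<le> h \<omega>) \<and> (\<forall>f\<in>elems X. \<phi> f = (\<integral>\<omega>. f \<omega> * h \<omega> \<partial>M))"
proof -
  obtain K where K: "K \<ge> 0" "\<forall>f\<in>elems X. \<bar>\<phi> f\<bar> \<le> K * nrm X f" using dual_bound[OF \<phi>] by auto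
  define m where "m A = ennreal (\<phi> (\<lambda>\<omega>. wu \<omega> * indicat_real A \<omega>))" for A
  have m0: "0 \<le> \<phi> (\<lambda>\<omega>. wu \<omega> * indicat_real A \<omega>)" if "A \<in> sets M" for A
    by (intro pos wu_indicator_elem that AE_I2 wu_mult_nonneg) auto
  define N where "N = measure_of (space M) (sets M) m"
  have sN [measurable_cong]: "sets N = sets M" and spN: "space N = space M" unfolding N_def by auto
  have empty: "m {} = 0"
    using dual_scale[OF \<phi> zero_elem, of 0] by (simp add: m_def)
  have eN: "emeasure N A = m A" if "A \<in> sets M" for A
  proof (rule emeasure_measure_of[OF N_def])
    show "sets M \<subseteq> Pow (space M)" by (rule sets.space_closed)
    show "positive (sets N) m" using empty by (simp add: positive_def)
    show "countably_additive (sets N) m"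
      unfolding countably_additive_def sN
    proof (intro allI impI)
      fix A :: "nat \<Rightarrow> 'a set" assume A: "range A \<subseteq> sets M" "disjoint_family A" "(\<Union>i. A i) \<in> sets M"
      have Ai: "A i \<in> sets M" for i using A by auto
      have part: "(\<Sum>i<n. \<phi> (\<lambda>\<omega>. wu \<omega> * indicat_real (A i) \<omega>)) = \<phi> (\<lambda>\<omega>. wu \<omega> * indicat_real (\<Union>i<n. A i) \<omega>)" for n
      proof (induction n)
        case 0
        then show ?case using dual_scale[OF \<phi> zero_elem, of 0] by simp
      next
        case (Suc n)
        have "\<phi> (\<lambda>\<omega>. wu \<omega> * indicat_real (\<Union>i<n. A i) \<omega> + wu \<omega> * indicat_real (A n) \<omega>) =
          \<phi> (\<lambda>\<omega>. wu \<omega> * indicat_real (\<Union>i<n. A i) \<omega>) + \<phi> (\<lambda>\<omega>. wu \<omega> * indicat_real (A n) \<omega>)"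
          using Ai by (intro dual_add[OF \<phi>] wu_indicator_elem) auto
        moreover have "wu \<omega> * indicat_real (\<Union>i<n. A i) \<omega> + wu \<omega> * indicat_real (A n) \<omega> = wu \<omega> * indicat_real (\<Union>i<Suc n. A i) \<omega>" for \<omega>
        proof -
          have "A n \<inter> A i = {}" if "i < n" for i
            using disjoint_family_onD[OF A(2), of n i] that by simp
          then have "A n \<inter> (\<Union>i<n. A i) = {}" by blast
          then have "indicat_real (\<Union>i<n. A i) \<omega> + indicat_real (A n) \<omega> = indicat_real (\<Union>i<Suc n. A i) \<omega>"
            by (auto simp: indicator_def lessThan_Suc)
          then show ?thesis by (simp add: distrib_left[symmetric])
        qed
        ultimately show ?case using Suc by simp
      qed
      have "(\<lambda>n. \<phi> (\<lambda>\<omega>. wu \<omega> * indicat_real (\<Union>i<n. A i) \<omega>)) \<longlonglongrightarrow> \<phi> (\<lambda>\<omega>. wu \<omega> * indicat_real (\<Union>i. A i) \<omega>)"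
      proof (rule dual_incseq_tendsto[OF \<phi>])
        show "(\<lambda>\<omega>. wu \<omega> * indicat_real (\<Union>i<n. A i) \<omega>) \<in> elems X" for n using Ai by (intro wu_indicator_elem) auto
        show "(\<lambda>\<omega>. wu \<omega> * indicat_real (\<Union>i. A i) \<omega>) \<in> elems X" using A by (intro wu_indicator_elem) auto
        have inc: "incseq (\<lambda>n. \<Union>i<n. A i)" by (intro incseq_SucI UN_mono) auto
        moreover have "(\<Union>n. \<Union>i<n. A i) = (\<Union>i. A i)" by auto
        ultimately have "(\<lambda>n. indicat_real (\<Union>i<n. A i) \<omega>) \<longlonglongrightarrow> indicat_real (\<Union>i. A i) \<omega>" for \<omega>
          using LIMSEQ_indicator_incseq[of "\<lambda>n. \<Union>i<n. A i" \<omega>] by simp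
        moreover have "incseq (\<lambda>n. wu \<omega> * indicat_real (\<Union>i<n. A i) \<omega>)" for \<omega>
          using wu_pos[of \<omega>] by (intro incseq_SucI mult_left_mono) (auto simp: indicator_def)
        ultimately show "AE \<omega> in M. incseq (\<lambda>n. wu \<omega> * indicat_real (\<Union>i<n. A i) \<omega>) \<and>
          (\<lambda>n. wu \<omega> * indicat_real (\<Union>i<n. A i) \<omega>) \<longlonglongrightarrow> wu \<omega> * indicat_real (\<Union>i. A i) \<omega>"
          by (intro AE_I2 conjI tendsto_intros) auto
      qed
      then have "(\<lambda>i. \<phi> (\<lambda>\<omega>. wu \<omega> * indicat_real (A i) \<omega>)) sums \<phi> (\<lambda>\<omega>. wu \<omega> * indicat_real (\<Union>i. A i) \<omega>)"
        unfolding sums_def part .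
      then show "(\<Sum>i. m (A i)) = m (\<Union>i. A i)"
        unfolding m_def using m0[OF Ai] by (intro suminf_ennreal_eq)
    qed
  qed (use that sN in auto)
  have "absolutely_continuous M N"
    unfolding absolutely_continuous_def
  proof
    fix A assume A: "A \<in> null_sets M"
    then have As: "A \<in> sets M" by auto
    have "AE \<omega> in M. wu \<omega> * indicat_real A \<omega> = 0"
      using AE_not_in[OF A] by eventually_elim auto
    then have "\<phi> (\<lambda>\<omega>. wu \<omega> * indicat_real A \<omega>) = \<phi> (\<lambda>_. 0)"
      using As by (intro dual_cong_AE[OF \<phi>] wu_indicator_elem zero_elem)
    also have "\<dots> = 0" using dual_scale[OF \<phi> zero_elem, of 0] by simp
    finally have "m A = 0" by (simp add: m_def)
    then show "A \<in> null_sets N" using As eN sN by auto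
  qed
  from Radon_Nikodym[OF this sN] obtain D where D [measurable]: "D \<in> borel_measurable M" and DN: "density M D = N"
    by auto
  have "(\<integral>\<^sup>+\<omega>. D \<omega> \<partial>M) = emeasure (density M D) (space M)"
    by (subst emeasure_density) (auto intro!: nn_integral_cong)
  also have "\<dots> < top" unfolding DN using eN[of "space M"] by (simp add: m_def)
  finally have Dfin: "AE \<omega> in M. D \<omega> \<noteq> top" using nn_integral_PInf_AE[OF D] by auto
  define h where "h = (\<lambda>\<omega>. enn2real (D \<omega>) / wu \<omega>)"
  have hm [measurable]: "h \<in> borel_measurable M" unfolding h_def by measurable
  have h0: "0 \<le> h \<omega>" for \<omega> unfolding h_def using wu_pos[of \<omega>] by simp
  \<comment> \<open>Membership in the lattice is kept as a premise inside the induction: it is known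
    for the final function only, and the smaller functions of each step inherit it by
    solidity.\<close>
  have repr: "(\<lambda>\<omega>. wu \<omega> * w \<omega>) \<in> elems X \<longrightarrow> (\<integral>\<^sup>+\<omega>. ennreal (w \<omega>) \<partial>N) = ennreal (\<phi> (\<lambda>\<omega>. wu \<omega> * w \<omega>))"
    if "w \<in> borel_measurable M" "\<And>\<omega>. 0 \<le> w \<omega>" for w
    using that
  proof (induction rule: borel_measurable_induct_real)
    case (set A)
    have "A \<in> sets N" using set sN by simp
    then show ?case using eN[OF set] by (simp add: m_def ennreal_indicator)
  next
    case (mult u c)
    show ?case
    proof (cases "c = 0")
      case True
      then show ?thesis using dual_scale[OF \<phi> zero_elem, of 0] by simp
    next
      case False
      show ?thesis
      proof
        assume e: "(\<lambda>\<omega>. wu \<omega> * (c * u \<omega>)) \<in> elems X"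
        have "(\<lambda>\<omega>. (1 / c) * (wu \<omega> * (c * u \<omega>))) \<in> elems X" by (rule scale_elem[OF e])
        then have e': "(\<lambda>\<omega>. wu \<omega> * u \<omega>) \<in> elems X" using False by (simp add: field_simps)
        have "(\<integral>\<^sup>+\<omega>. ennreal (c * u \<omega>) \<partial>N) = ennreal c * (\<integral>\<^sup>+\<omega>. ennreal (u \<omega>) \<partial>N)"
          using mult by (subst nn_integral_cmult[symmetric]) (auto simp: ennreal_mult' sN)
        also have "\<dots> = ennreal (c * \<phi> (\<lambda>\<omega>. wu \<omega> * u \<omega>))"
          using mult e' by (simp add: ennreal_mult')
        also have "c * \<phi> (\<lambda>\<omega>. wu \<omega> * u \<omega>) = \<phi> (\<lambda>\<omega>. c * (wu \<omega> * u \<omega>))" by (rule dual_scale[OF \<phi> e', symmetric])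
        finally show "(\<integral>\<^sup>+\<omega>. ennreal (c * u \<omega>) \<partial>N) = ennreal (\<phi> (\<lambda>\<omega>. wu \<omega> * (c * u \<omega>)))"
          by (simp add: mult.left_commute)
      qed
    qed
  next
    case (add u v)
    show ?case
    proof
      assume e: "(\<lambda>\<omega>. wu \<omega> * (v \<omega> + u \<omega>)) \<in> elems X"
      have le: "\<bar>wu \<omega> * u \<omega>\<bar> \<le> \<bar>wu \<omega> * (v \<omega> + u \<omega>)\<bar>" "\<bar>wu \<omega> * v \<omega>\<bar> \<le> \<bar>wu \<omega> * (v \<omega> + u \<omega>)\<bar>" for \<omega>
        using wu_pos[of \<omega>] add(2,4)[of \<omega>] by (auto simp: abs_mult)
      have eu: "(\<lambda>\<omega>. wu \<omega> * u \<omega>) \<in> elems X" by (rule solid_elem[OF _ e]) (use le add in auto)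
      have ev: "(\<lambda>\<omega>. wu \<omega> * v \<omega>) \<in> elems X" by (rule solid_elem[OF _ e]) (use le add in auto)
      have "(\<integral>\<^sup>+\<omega>. ennreal (v \<omega> + u \<omega>) \<partial>N) = (\<integral>\<^sup>+\<omega>. ennreal (v \<omega>) \<partial>N) + (\<integral>\<^sup>+\<omega>. ennreal (u \<omega>) \<partial>N)"
        using add by (subst nn_integral_add[symmetric]) (auto simp: sN)
      also have "\<dots> = ennreal (\<phi> (\<lambda>\<omega>. wu \<omega> * v \<omega>) + \<phi> (\<lambda>\<omega>. wu \<omega> * u \<omega>))"
        using add eu ev by (subst ennreal_plus) (auto intro!: pos wu_mult_nonneg)
      also have "\<phi> (\<lambda>\<omega>. wu \<omega> * v \<omega>) + \<phi> (\<lambda>\<omega>. wu \<omega> * u \<omega>) = \<phi> (\<lambda>\<omega>. wu \<omega> * (v \<omega> + u \<omega>))"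
        using dual_add[OF \<phi> ev eu] by (simp add: distrib_left)
      finally show "(\<integral>\<^sup>+\<omega>. ennreal (v \<omega> + u \<omega>) \<partial>N) = ennreal (\<phi> (\<lambda>\<omega>. wu \<omega> * (v \<omega> + u \<omega>)))" .
    qed
  next
    case (seq U)
    show ?case
    proof
      assume e: "(\<lambda>\<omega>. wu \<omega> * w \<omega>) \<in> elems X"
      have incU: "incseq U" by (fact seq)
      have inc: "incseq (\<lambda>i. U i \<omega>)" for \<omega> using incU by (auto simp: incseq_def le_fun_def)
      have lim: "(\<lambda>i. U i \<omega>) \<longlonglongrightarrow> w \<omega>" if "\<omega> \<in> space M" for \<omega> by (rule seq(4)[OF that])
      have Ule: "U i \<omega> \<le> w \<omega>" if "\<omega> \<in> space M" for i \<omega> using incseq_le[OF inc lim[OF that]] .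
      have Um [measurable]: "U i \<in> borel_measurable M" for i by (fact seq)
      have U0: "0 \<le> U i \<omega>" for i \<omega> by (fact seq)
      have eU: "(\<lambda>\<omega>. wu \<omega> * U i \<omega>) \<in> elems X" for i
      proof (rule solid_elem[OF _ e])
        show "AE \<omega> in M. \<bar>wu \<omega> * U i \<omega>\<bar> \<le> \<bar>wu \<omega> * w \<omega>\<bar>"
        proof (rule AE_I2)
          fix \<omega> assume "\<omega> \<in> space M"
          then have "wu \<omega> * U i \<omega> \<le> wu \<omega> * w \<omega>" using Ule wu_pos[of \<omega>] by (intro mult_left_mono) auto
          then show "\<bar>wu \<omega> * U i \<omega>\<bar> \<le> \<bar>wu \<omega> * w \<omega>\<bar>" using wu_mult_nonneg[OF U0, of \<omega> i \<omega>] by linarith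
        qed
      qed measurable
      have "(\<lambda>i. \<phi> (\<lambda>\<omega>. wu \<omega> * U i \<omega>)) \<longlonglongrightarrow> \<phi> (\<lambda>\<omega>. wu \<omega> * w \<omega>)"
      proof (rule dual_incseq_tendsto[OF \<phi> eU e], rule AE_I2, rule conjI)
        fix \<omega> assume "\<omega> \<in> space M"
        then show "(\<lambda>i. wu \<omega> * U i \<omega>) \<longlonglongrightarrow> wu \<omega> * w \<omega>" by (intro tendsto_intros lim)
        show "incseq (\<lambda>i. wu \<omega> * U i \<omega>)"
          using inc[of \<omega>] wu_pos[of \<omega>] by (auto simp: incseq_def)
      qed
      then have "(\<lambda>i. ennreal (\<phi> (\<lambda>\<omega>. wu \<omega> * U i \<omega>))) \<longlonglongrightarrow> ennreal (\<phi> (\<lambda>\<omega>. wu \<omega> * w \<omega>))"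
        by (rule tendsto_ennrealI)
      then have 1: "(\<lambda>i. \<integral>\<^sup>+\<omega>. ennreal (U i \<omega>) \<partial>N) \<longlonglongrightarrow> ennreal (\<phi> (\<lambda>\<omega>. wu \<omega> * w \<omega>))"
        using eU seq.IH by simp
      have "(\<lambda>i. \<integral>\<^sup>+\<omega>. ennreal (U i \<omega>) \<partial>N) \<longlonglongrightarrow> (\<integral>\<^sup>+\<omega>. ennreal (w \<omega>) \<partial>N)"
      proof (rule nn_integral_incseq_tendsto)
        show "(\<lambda>\<omega>. ennreal (U i \<omega>)) \<in> borel_measurable N" for i by measurable
        show "AE \<omega> in N. incseq (\<lambda>i. ennreal (U i \<omega>)) \<and> (\<lambda>i. ennreal (U i \<omega>)) \<longlonglongrightarrow> ennreal (w \<omega>)"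
          using lim spN inc by (intro AE_I2 conjI tendsto_ennrealI) (auto simp: incseq_def intro!: ennreal_leI)
      qed
      then show "(\<integral>\<^sup>+\<omega>. ennreal (w \<omega>) \<partial>N) = ennreal (\<phi> (\<lambda>\<omega>. wu \<omega> * w \<omega>))" using 1 by (rule LIMSEQ_unique)
    qed
  qed
  have nn: "(\<integral>\<^sup>+\<omega>. ennreal (f \<omega> * h \<omega>) \<partial>M) = ennreal (\<phi> f)" if f: "f \<in> elems X" and f0: "\<And>\<omega>. 0 \<le> f \<omega>" for f
  proof -
    have [measurable]: "f \<in> borel_measurable M" using elem_measurable[OF f] .
    have wne: "wu \<omega> \<noteq> 0" for \<omega> using wu_pos[of \<omega>] by simp
    have eq: "(\<lambda>\<omega>. wu \<omega> * (f \<omega> / wu \<omega>)) = f" using wne by auto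
    have "(\<integral>\<^sup>+\<omega>. ennreal (f \<omega> * h \<omega>) \<partial>M) = (\<integral>\<^sup>+\<omega>. D \<omega> * ennreal (f \<omega> / wu \<omega>) \<partial>M)"
    proof (rule nn_integral_cong_AE, use Dfin in eventually_elim)
      case (elim \<omega>)
      then have "D \<omega> = ennreal (enn2real (D \<omega>))" by (simp add: less_top)
      then have "D \<omega> * ennreal (f \<omega> / wu \<omega>) = ennreal (enn2real (D \<omega>) * (f \<omega> / wu \<omega>))"
        using ennreal_mult'[OF enn2real_nonneg, of "D \<omega>" "f \<omega> / wu \<omega>"] by simp
      then show ?case by (simp add: h_def mult.commute)
    qed
    also have "\<dots> = (\<integral>\<^sup>+\<omega>. ennreal (f \<omega> / wu \<omega>) \<partial>N)"
      unfolding DN[symmetric] by (rule nn_integral_density[symmetric]) measurable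
    also have "\<dots> = ennreal (\<phi> f)"
      using repr[of "\<lambda>\<omega>. f \<omega> / wu \<omega>"] f f0 wu_pos unfolding eq by (simp add: less_imp_le)
    finally show ?thesis .
  qed
  have h: "h \<in> elems X'"
  proof (rule koetheI(1)[OF hm K(1)])
    fix f assume f: "f \<in> elems X" "\<And>\<omega>. 0 \<le> f \<omega>"
    have "\<phi> f \<le> K * nrm X f" using bspec[OF K(2) f(1)] by linarith
    then show "(\<integral>\<^sup>+\<omega>. ennreal (f \<omega> * \<bar>h \<omega>\<bar>) \<partial>M) \<le> ennreal (K * nrm X f)"
      using nn[OF f] h0 by (simp add: ennreal_leI)
  qed
  have posrep: "\<phi> f = (\<integral>\<omega>. f \<omega> * h \<omega> \<partial>M)" if f: "f \<in> elems X" and f0: "\<And>\<omega>. 0 \<le> f \<omega>" for f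
  proof -
    have "ennreal (\<integral>\<omega>. f \<omega> * h \<omega> \<partial>M) = ennreal (\<phi> f)"
      unfolding nn[OF f f0, symmetric] using f0 h0
      by (intro nn_integral_eq_integral[symmetric] koethe_integrable h f) auto
    moreover have "0 \<le> \<phi> f" using f f0 by (intro pos) auto
    moreover have "0 \<le> (\<integral>\<omega>. f \<omega> * h \<omega> \<partial>M)" using f0 h0 by (intro integral_nonneg_AE) auto
    ultimately show ?thesis by simp
  qed
  have "\<phi> f = (\<integral>\<omega>. f \<omega> * h \<omega> \<partial>M)" if f: "f \<in> elems X" for f
  proof -
    define a b where "a = (\<lambda>\<omega>. max 0 (f \<omega>))" and "b = (\<lambda>\<omega>. max 0 (- f \<omega>))"
    have ab: "a \<in> elems X" "b \<in> elems X" unfolding a_def b_def by (intro pos_part_elem minus_elem f)+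
    have fab: "f = (\<lambda>\<omega>. a \<omega> - b \<omega>)" unfolding a_def b_def by (auto simp: max_def)
    have "\<phi> f = \<phi> a - \<phi> b" unfolding fab by (rule dual_diff[OF \<phi> ab])
    also have "\<dots> = (\<integral>\<omega>. a \<omega> * h \<omega> \<partial>M) - (\<integral>\<omega>. b \<omega> * h \<omega> \<partial>M)"
      using posrep ab by (simp add: a_def b_def)
    also have "\<dots> = (\<integral>\<omega>. a \<omega> * h \<omega> - b \<omega> * h \<omega> \<partial>M)" using ab h by (simp add: koethe_integrable)
    also have "\<dots> = (\<integral>\<omega>. f \<omega> * h \<omega> \<partial>M)" by (simp add: fab left_diff_distrib)
    finally show ?thesis .
  qed
  then show ?thesis using h h0 by blast
qed

lemma fun_subspace_elems: "fun_subspace (elems X)"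
  using zero_elem add_elem scale_elem unfolding fun_subspace_def by blast

lemma sublinear_pos_part:
  assumes "0 \<le> K"
  shows "sublinear_on (elems X) (\<lambda>f. K * nrm X (\<lambda>\<omega>. max 0 (f \<omega>)))"
  unfolding sublinear_on_def
proof (intro conjI ballI allI impI)
  fix f g assume f: "f \<in> elems X" and g: "g \<in> elems X"
  have [measurable]: "f \<in> borel_measurable M" "g \<in> borel_measurable M" using elem_measurable f g by auto
  have "nrm X (\<lambda>\<omega>. max 0 (f \<omega> + g \<omega>)) \<le> nrm X (\<lambda>\<omega>. max 0 (f \<omega>) + max 0 (g \<omega>))"
    using f g by (intro nrm_solid add_elem pos_part_elem) auto
  also have "\<dots> \<le> nrm X (\<lambda>\<omega>. max 0 (f \<omega>)) + nrm X (\<lambda>\<omega>. max 0 (g \<omega>))" using f g by (intro nrm_add pos_part_elem)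
  finally show "K * nrm X (\<lambda>\<omega>. max 0 (f \<omega> + g \<omega>)) \<le> K * nrm X (\<lambda>\<omega>. max 0 (f \<omega>)) + K * nrm X (\<lambda>\<omega>. max 0 (g \<omega>))"
    using assms by (simp add: distrib_left[symmetric] mult_left_mono)
next
  fix f and c :: real assume f: "f \<in> elems X" and c: "0 \<le> c"
  have "(\<lambda>\<omega>. max 0 (c * f \<omega>)) = (\<lambda>\<omega>. c * max 0 (f \<omega>))" using c by (auto simp: max_def zero_le_mult_iff mult_le_0_iff)
  then show "K * nrm X (\<lambda>\<omega>. max 0 (c * f \<omega>)) = c * (K * nrm X (\<lambda>\<omega>. max 0 (f \<omega>)))"
    using nrm_scale[OF pos_part_elem[OF f], of c] c by simp
qed

text \<open>
  The functional of the sandwich theorem is automatically positive because the sublinear functional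
  vanishes on negative functions.
\<close>

lemma positive_sandwich:
  assumes K: "0 \<le> K" and C: "pair_cone C" "\<And>f s. (f, s) \<in> C \<Longrightarrow> f \<in> elems X"
    "\<And>f s. (f, s) \<in> C \<Longrightarrow> s \<le> K * nrm X (\<lambda>\<omega>. max 0 (f \<omega>))"
  shows "\<exists>h\<in>elems X'. (\<forall>\<omega>. 0 \<le> h \<omega>) \<and> nrm X' h \<le> K \<and> (\<forall>f s. (f, s) \<in> C \<longrightarrow> s \<le> (\<integral>\<omega>. f \<omega> * h \<omega> \<partial>M))"
proof -
  have "\<exists>L. linear_fun_on (elems X) L \<and> (\<forall>f\<in>elems X. L f \<le> K * nrm X (\<lambda>\<omega>. max 0 (f \<omega>))) \<and>
    (\<forall>f s. (f, s) \<in> C \<longrightarrow> s \<le> L f)"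
    by (rule hahn_banach_sandwich[OF fun_subspace_elems sublinear_pos_part[OF K] C(1)]) (use C(2,3) in blast)+
  then obtain L where L: "linear_fun_on (elems X) L" "\<And>f. f \<in> elems X \<Longrightarrow> L f \<le> K * nrm X (\<lambda>\<omega>. max 0 (f \<omega>))"
      "\<And>f s. (f, s) \<in> C \<Longrightarrow> s \<le> L f" by blast
  have Lm: "L (\<lambda>\<omega>. - f \<omega>) = - L f" if "f \<in> elems X" for f
  proof -
    have "L (\<lambda>\<omega>. (-1) * f \<omega>) = (-1) * L f" using L(1) that unfolding linear_fun_on_def by blast
    then show ?thesis by simp
  qed
  have Lle: "L f \<le> K * nrm X f" if f: "f \<in> elems X" for f
  proof -
    have "nrm X (\<lambda>\<omega>. max 0 (f \<omega>)) \<le> nrm X f"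
      using f by (intro nrm_solid) (auto dest: elem_measurable)
    then have "K * nrm X (\<lambda>\<omega>. max 0 (f \<omega>)) \<le> K * nrm X f" using K by (rule mult_left_mono)
    then show ?thesis using L(2)[OF f] by linarith
  qed
  have Lb: "\<bar>L f\<bar> \<le> K * nrm X f" if f: "f \<in> elems X" for f
    using Lle[OF f] Lle[OF minus_elem[OF f]] Lm[OF f] nrm_minus[OF f] by simp
  have Ld: "L \<in> dual X" using L(1) Lb unfolding linear_fun_on_def dual_def by auto
  have Lpos: "0 \<le> L f" if f: "f \<in> elems X" and f0: "AE \<omega> in M. 0 \<le> f \<omega>" for f
  proof -
    have e: "(\<lambda>\<omega>. max 0 (- f \<omega>)) \<in> elems X" by (intro pos_part_elem minus_elem f)
    have "AE \<omega> in M. max 0 (- f \<omega>) = 0" using f0 by eventually_elim auto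
    then have "nrm X (\<lambda>\<omega>. max 0 (- f \<omega>)) = 0" using nrm_eq_0_iff[OF e] by simp
    then show ?thesis using L(2)[OF minus_elem[OF f]] Lm[OF f] by simp
  qed
  have "\<exists>h\<in>elems X'. (\<forall>\<omega>. 0 \<le> h \<omega>) \<and> (\<forall>f\<in>elems X. L f = (\<integral>\<omega>. f \<omega> * h \<omega> \<partial>M))"
    by (rule positive_dual_representation[OF Ld Lpos])
  then obtain h where h: "h \<in> elems X'" "\<And>\<omega>. 0 \<le> h \<omega>" "\<And>f. f \<in> elems X \<Longrightarrow> L f = (\<integral>\<omega>. f \<omega> * h \<omega> \<partial>M)"
    by blast
  have "nrm X' h = dual_norm X L"
    unfolding koethe_dual_def fspace.simps by (rule dual_norm_cong) (simp add: h(3))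
  then have "nrm X' h \<le> K" using dual_norm_le[OF K Lb] by simp
  moreover have "s \<le> (\<integral>\<omega>. f \<omega> * h \<omega> \<partial>M)" if "(f, s) \<in> C" for f s
    using L(3)[OF that] h(3)[OF C(2)[OF that]] by simp
  ultimately show ?thesis using h(1,2) by blast
qed

text \<open>A signed functional is the difference of two positive ones: the sandwich theorem yields
  a nonnegative function \<open>k\<close> whose functional dominates \<phi> on nonnegative elements,
  and then the functional of \<open>k\<close> minus \<phi> is positive and has a representing
  function itself.\<close>

lemma dual_representation:
  assumes \<phi>: "\<phi> \<in> dual X"
  obtains h where "h \<in> elems X'" "\<And>f. f \<in> elems X \<Longrightarrow> \<phi> f = (\<integral>\<omega>. f \<omega> * h \<omega> \<partial>M)"
proof -
  obtain K where K: "K \<ge> 0" "\<forall>f\<in>elems X. \<bar>\<phi> f\<bar> \<le> K * nrm X f" using dual_bound[OF \<phi>] by auto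
  \<comment> \<open>The demands are the values of \<phi> at nonnegative elements. There taking the
    positive part changes nothing, so the continuity bound for \<phi> is the bound that the sandwich
    requires.\<close>
  define C where "C = {(f, \<phi> f) | f. f \<in> elems X \<and> (AE \<omega> in M. 0 \<le> f \<omega>)}"
  have pc: "pair_cone C"
  proof (rule pair_coneI)
    show "((\<lambda>_. 0), 0) \<in> C" unfolding C_def using zero_elem dual_scale[OF \<phi> zero_elem, of 0] by auto
  next
    fix f s g t assume "(f, s) \<in> C" "(g, t) \<in> C"
    then have fg: "f \<in> elems X" "g \<in> elems X" "s = \<phi> f" "t = \<phi> g" "AE \<omega> in M. 0 \<le> f \<omega>" "AE \<omega> in M. 0 \<le> g \<omega>"
      unfolding C_def by auto
    have "AE \<omega> in M. 0 \<le> f \<omega> + g \<omega>" using fg(5,6) by eventually_elim auto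
    then show "((\<lambda>x. f x + g x), s + t) \<in> C" unfolding C_def using fg add_elem dual_add[OF \<phi> fg(1,2)] by auto
  next
    fix f s and c :: real assume "(f, s) \<in> C" "c > 0"
    then have f: "f \<in> elems X" "s = \<phi> f" "AE \<omega> in M. 0 \<le> f \<omega>" unfolding C_def by auto
    have "AE \<omega> in M. 0 \<le> c * f \<omega>" using f(3) by (rule eventually_mono) (use \<open>c > 0\<close> in auto)
    then show "((\<lambda>x. c * f x), c * s) \<in> C" unfolding C_def using f scale_elem dual_scale[OF \<phi> f(1), of c] by auto
  qed
  have CX: "f \<in> elems X" "s \<le> K * nrm X (\<lambda>\<omega>. max 0 (f \<omega>))" if "(f, s) \<in> C" for f s
  proof -
    have f: "f \<in> elems X" "s = \<phi> f" "AE \<omega> in M. 0 \<le> f \<omega>" using that unfolding C_def by auto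
    have "AE \<omega> in M. f \<omega> = max 0 (f \<omega>)" using f(3) by eventually_elim auto
    then have "nrm X f = nrm X (\<lambda>\<omega>. max 0 (f \<omega>))" using f by (intro nrm_cong_AE pos_part_elem) auto
    then have "\<bar>\<phi> f\<bar> \<le> K * nrm X (\<lambda>\<omega>. max 0 (f \<omega>))" using bspec[OF K(2) f(1)] by simp
    then show "f \<in> elems X" "s \<le> K * nrm X (\<lambda>\<omega>. max 0 (f \<omega>))" using f by auto
  qed
  have "\<exists>k\<in>elems X'. (\<forall>\<omega>. 0 \<le> k \<omega>) \<and> nrm X' k \<le> K \<and> (\<forall>f s. (f, s) \<in> C \<longrightarrow> s \<le> (\<integral>\<omega>. f \<omega> * k \<omega> \<partial>M))"
    by (rule positive_sandwich[OF K(1) pc]) (fact CX)+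
  then obtain k where k: "k \<in> elems X'" "\<And>\<omega>. 0 \<le> k \<omega>" "\<And>f s. (f, s) \<in> C \<Longrightarrow> s \<le> (\<integral>\<omega>. f \<omega> * k \<omega> \<partial>M)"
    by blast
  define \<psi> where "\<psi> f = (\<integral>\<omega>. f \<omega> * k \<omega> \<partial>M) - \<phi> f" for f
  have kd: "(\<lambda>f. \<integral>\<omega>. f \<omega> * k \<omega> \<partial>M) \<in> dual X" by (rule koethe_functional[OF k(1)])
  have "\<psi> \<in> dual X"
  proof -
    obtain K' where K': "\<forall>f\<in>elems X. \<bar>\<integral>\<omega>. f \<omega> * k \<omega> \<partial>M\<bar> \<le> K' * nrm X f" using dual_bound[OF kd] by auto
    have "\<bar>\<psi> f\<bar> \<le> (K' + K) * nrm X f" if "f \<in> elems X" for f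
    proof -
      have "\<bar>\<integral>\<omega>. f \<omega> * k \<omega> \<partial>M\<bar> \<le> K' * nrm X f" "\<bar>\<phi> f\<bar> \<le> K * nrm X f" using K' K that by auto
      then show ?thesis unfolding \<psi>_def by (simp add: distrib_right abs_le_iff)
    qed
    moreover have "\<psi> (\<lambda>\<omega>. f \<omega> + g \<omega>) = \<psi> f + \<psi> g" if "f \<in> elems X" "g \<in> elems X" for f g
      unfolding \<psi>_def using dual_add[OF \<phi> that] dual_add[OF kd that] by simp
    moreover have "\<psi> (\<lambda>\<omega>. c * f \<omega>) = c * \<psi> f" if "f \<in> elems X" for f c
      unfolding \<psi>_def using dual_scale[OF \<phi> that] dual_scale[OF kd that] by (simp add: right_diff_distrib)
    ultimately show ?thesis unfolding dual_def by blast
  qed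
  moreover have "0 \<le> \<psi> f" if "f \<in> elems X" "AE \<omega> in M. 0 \<le> f \<omega>" for f
  proof -
    have "(f, \<phi> f) \<in> C" using that unfolding C_def by blast
    from k(3)[OF this] show ?thesis unfolding \<psi>_def by simp
  qed
  ultimately have "\<exists>l\<in>elems X'. (\<forall>\<omega>. 0 \<le> l \<omega>) \<and> (\<forall>f\<in>elems X. \<psi> f = (\<integral>\<omega>. f \<omega> * l \<omega> \<partial>M))"
    by (rule positive_dual_representation)
  then obtain l where l: "l \<in> elems X'" "\<And>f. f \<in> elems X \<Longrightarrow> \<psi> f = (\<integral>\<omega>. f \<omega> * l \<omega> \<partial>M)" by blast
  interpret D: function_lattice M X' by (rule koethe_function_lattice)
  show ?thesis
  proof (rule that)
    show "(\<lambda>\<omega>. k \<omega> - l \<omega>) \<in> elems X'" by (rule D.diff_elem[OF k(1) l(1)])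
    show "\<phi> f = (\<integral>\<omega>. f \<omega> * (k \<omega> - l \<omega>) \<partial>M)" if f: "f \<in> elems X" for f
    proof -
      have "\<phi> f = (\<integral>\<omega>. f \<omega> * k \<omega> \<partial>M) - \<psi> f" by (simp add: \<psi>_def)
      also have "\<dots> = (\<integral>\<omega>. f \<omega> * k \<omega> - f \<omega> * l \<omega> \<partial>M)"
        using l(2)[OF f] koethe_integrable[OF k(1) f] koethe_integrable[OF l(1) f] by simp
      finally show ?thesis by (simp add: right_diff_distrib)
    qed
  qed
qed

text \<open>The sandwich theorem for the single ray through \<open>(f, nrm X f)\<close> with
  constant 1: the positive functional obtained lies in the unit ball and attains the norm of
  \<open>f\<close>.\<close>

lemma pos_ball_norming:
  assumes f: "f \<in> elems X" and f0: "AE \<omega> in M. 0 \<le> f \<omega>"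
  obtains h where "h \<in> pos_ball M X" "\<And>\<omega>. 0 \<le> h \<omega>" "nrm X f \<le> (\<integral>\<omega>. f \<omega> * h \<omega> \<partial>M)"
proof -
  define C where "C = {((\<lambda>\<omega>. t * f \<omega>), t * nrm X f) | t. 0 \<le> t}"
  have pc: "pair_cone C"
  proof (rule pair_coneI)
    show "((\<lambda>_. 0), 0) \<in> C" unfolding C_def by (auto intro!: exI[of _ 0])
  next
    fix a s b t assume "(a, s) \<in> C" "(b, t) \<in> C"
    then obtain x y where "a = (\<lambda>\<omega>. x * f \<omega>)" "s = x * nrm X f" "0 \<le> x" "b = (\<lambda>\<omega>. y * f \<omega>)" "t = y * nrm X f" "0 \<le> y"
      unfolding C_def by auto
    then show "((\<lambda>\<omega>. a \<omega> + b \<omega>), s + t) \<in> C"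
      unfolding C_def by (auto intro!: exI[of _ "x + y"] simp: distrib_right)
  next
    fix a s and c :: real assume "(a, s) \<in> C" "c > 0"
    then obtain x where "a = (\<lambda>\<omega>. x * f \<omega>)" "s = x * nrm X f" "0 \<le> x" unfolding C_def by auto
    then show "((\<lambda>\<omega>. c * a \<omega>), c * s) \<in> C"
      unfolding C_def using \<open>c > 0\<close> by (auto intro!: exI[of _ "c * x"] simp: mult.assoc)
  qed
  have CX: "g \<in> elems X" "s \<le> 1 * nrm X (\<lambda>\<omega>. max 0 (g \<omega>))" if gs: "(g, s) \<in> C" for g s
  proof -
    obtain t where t: "g = (\<lambda>\<omega>. t * f \<omega>)" "s = t * nrm X f" "0 \<le> t" using gs unfolding C_def by blast
    show g: "g \<in> elems X" unfolding t by (rule scale_elem[OF f])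
    have "AE \<omega> in M. g \<omega> = max 0 (g \<omega>)" using f0 t by (auto elim!: eventually_mono)
    then have "nrm X g = nrm X (\<lambda>\<omega>. max 0 (g \<omega>))" using g by (intro nrm_cong_AE pos_part_elem) auto
    then show "s \<le> 1 * nrm X (\<lambda>\<omega>. max 0 (g \<omega>))" using nrm_scale[OF f, of t] t by simp
  qed
  have "\<exists>h\<in>elems X'. (\<forall>\<omega>. 0 \<le> h \<omega>) \<and> nrm X' h \<le> 1 \<and> (\<forall>f s. (f, s) \<in> C \<longrightarrow> s \<le> (\<integral>\<omega>. f \<omega> * h \<omega> \<partial>M))"
    by (rule positive_sandwich[OF zero_le_one pc]) (fact CX)+
  then obtain h where h: "h \<in> elems X'" "\<And>\<omega>. 0 \<le> h \<omega>" "nrm X' h \<le> 1" "\<And>f s. (f, s) \<in> C \<Longrightarrow> s \<le> (\<integral>\<omega>. f \<omega> * h \<omega> \<partial>M)"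
    by blast
  show ?thesis
  proof (rule that)
    show "h \<in> pos_ball M X" using h unfolding pos_ball_def by auto
    show "nrm X f \<le> (\<integral>\<omega>. f \<omega> * h \<omega> \<partial>M)" by (rule h(4)) (auto simp: C_def intro!: exI[of _ 1])
  qed (rule h)
qed

text \<open>A function norming the weak unit restricted to \<open>A\<close> cannot vanish almost
  everywhere on \<open>A\<close> when \<open>A\<close> has positive measure.\<close>

lemma koethe_full_support: "full_support M X'"
  unfolding full_support_def
proof (intro ballI impI notI)
  fix A assume A: "A \<in> sets M" "emeasure M A > 0" and 0: "\<forall>h\<in>elems X'. AE \<omega> in M. \<omega> \<in> A \<longrightarrow> h \<omega> = 0"
  define f where "f = (\<lambda>\<omega>. wu \<omega> * indicat_real A \<omega>)"
  have f: "f \<in> elems X" unfolding f_def by (rule wu_indicator_elem[OF A(1)])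
  have "AE \<omega> in M. 0 \<le> f \<omega>" unfolding f_def by (intro AE_I2 wu_mult_nonneg) auto
  then obtain h where h: "h \<in> pos_ball M X" "nrm X f \<le> (\<integral>\<omega>. f \<omega> * h \<omega> \<partial>M)" by (rule pos_ball_norming[OF f])
  have "AE \<omega> in M. \<omega> \<in> A \<longrightarrow> h \<omega> = 0" using 0 h(1) unfolding pos_ball_def by auto
  then have "AE \<omega> in M. f \<omega> * h \<omega> = 0" by eventually_elim (auto simp: f_def)
  then have "(\<integral>\<omega>. f \<omega> * h \<omega> \<partial>M) = 0" by (rule integral_eq_zero_AE)
  then have "nrm X f = 0" using h(2) nrm_nonneg[OF f] by simp
  then have "AE \<omega> in M. f \<omega> = 0" using nrm_eq_0_iff[OF f] by simp
  then have "AE \<omega> in M. \<omega> \<notin> A"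
  proof eventually_elim
    case (elim \<omega>)
    then show ?case using wu_pos[of \<omega>] by (auto simp: f_def indicator_def)
  qed
  then have "emeasure M A = 0" using A(1) by (subst (asm) AE_iff_measurable[where N = A]) (auto dest: sets.sets_into_space)
  then show False using A(2) by simp
qed

lemma koethe_weak_unit_lattice: "weak_unit_lattice M X'"
  by (rule function_lattice.weak_unitI[OF koethe_function_lattice finite_measure_axioms koethe_complete koethe_full_support])

text \<open>A weak unit of the Koethe dual scaled into the unit ball. Pairing with it distinguishes
  every nonzero nonnegative element from 0.\<close>

lemma pos_ball_strictly_positive:
  obtains h where "h \<in> pos_ball M X" "\<And>\<omega>. 0 < h \<omega>"
proof -
  interpret D: weak_unit_lattice M X' by (rule koethe_weak_unit_lattice)
  define c where "c = 1 / (1 + nrm X' D.wu)"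
  have n: "0 \<le> nrm X' D.wu" by (rule D.nrm_nonneg[OF D.wu_elem])
  then have c: "c > 0" "c * nrm X' D.wu \<le> 1" unfolding c_def by (auto simp: field_simps)
  show ?thesis
  proof (rule that)
    show "0 < c * D.wu \<omega>" for \<omega> using c D.wu_pos[of \<omega>] by simp
    then show "(\<lambda>\<omega>. c * D.wu \<omega>) \<in> pos_ball M X"
      unfolding pos_ball_def using D.scale_elem[OF D.wu_elem, of c] D.nrm_scale[OF D.wu_elem, of c] c
      by (auto intro!: AE_I2 less_imp_le)
  qed
qed

end

section \<open>The weak topology of the positive ball and mixed norms\<close>

text \<open>Open sets of a pullback are preimages, so covers can be moved to the image and back.
  This is used for a map that identifies functions agreeing almost everywhere.\<close>

lemma compact_space_pullback:
  assumes "compactin T (f ` A)"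
  shows "compact_space (pullback_topology A f T)"
proof -
  have top: "topspace (pullback_topology A f T) = A"
    using compactin_subset_topspace[OF assms] by (auto simp: topspace_pullback_topology)
  have "\<exists>\<F>. finite \<F> \<and> \<F> \<subseteq> \<U> \<and> A \<subseteq> \<Union>\<F>"
    if U: "\<forall>U\<in>\<U>. openin (pullback_topology A f T) U" and A: "A \<subseteq> \<Union>\<U>" for \<U>
  proof -
    have "\<forall>U\<in>\<U>. \<exists>V. openin T V \<and> U = f -` V \<inter> A" using U by (simp add: openin_pullback_topology)
    then obtain V where V: "\<And>U. U \<in> \<U> \<Longrightarrow> openin T (V U)" "\<And>U. U \<in> \<U> \<Longrightarrow> U = f -` V U \<inter> A" by metis
    have cov: "f ` A \<subseteq> \<Union>(V ` \<U>)"
    proof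
      fix y assume "y \<in> f ` A"
      then obtain x where x: "x \<in> A" "y = f x" by auto
      then obtain U where "U \<in> \<U>" "x \<in> U" using A by auto
      then show "y \<in> \<Union>(V ` \<U>)" using V(2)[of U] x by auto
    qed
    have "\<forall>W\<in>V ` \<U>. openin T W" using V by auto
    then obtain \<G> where G: "finite \<G>" "\<G> \<subseteq> V ` \<U>" "f ` A \<subseteq> \<Union>\<G>"
      using assms cov unfolding compactin_def by meson
    then obtain \<F> where F: "finite \<F>" "\<F> \<subseteq> \<U>" "\<G> = V ` \<F>" by (meson finite_subset_image)
    have "A \<subseteq> \<Union>\<F>"
    proof
      fix x assume x: "x \<in> A"
      then obtain U where "U \<in> \<F>" "f x \<in> V U" using G(3) F(3) by auto
      then show "x \<in> \<Union>\<F>" using V(2)[of U] F(2) x by auto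
    qed
    then show ?thesis using F by auto
  qed
  then show ?thesis unfolding compact_space_def compactin_def top by auto
qed

text \<open>Closed sets of the pullback are preimages of relatively closed sets of the image, and
  disjointness passes to the image; there compactness and the Hausdorff property provide separating
  open sets, whose preimages separate upstairs.\<close>

lemma normal_space_pullback:
  assumes "compactin T (f ` A)" "Hausdorff_space T"
  shows "normal_space (pullback_topology A f T)"
proof -
  define S where "S = f ` A"
  have ST: "S \<subseteq> topspace T" unfolding S_def by (rule compactin_subset_topspace[OF assms(1)])
  have top: "topspace (pullback_topology A f T) = A"
    using ST by (auto simp: S_def topspace_pullback_topology)
  have norm: "normal_space (subtopology T S)"
    using assms unfolding S_def
    by (intro compact_Hausdorff_or_regular_imp_normal_space)
       (auto simp: compact_space_subtopology Hausdorff_space_subtopology)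
  have cl: "\<exists>D. closedin (subtopology T S) D \<and> C = f -` D \<inter> A" if C: "closedin (pullback_topology A f T) C" for C
  proof -
    have "openin (pullback_topology A f T) (A - C)" using C top unfolding closedin_def by simp
    then obtain V where V: "openin T V" "A - C = f -` V \<inter> A" by (auto simp: openin_pullback_topology)
    have CA: "C \<subseteq> A" using closedin_subset[OF C] top by simp
    have "closedin (subtopology T S) (S - V)"
    proof -
      have "openin (subtopology T S) (S \<inter> V)" using V(1) by (simp add: openin_subtopology_Int2)
      moreover have "topspace (subtopology T S) = S" using ST by auto
      ultimately show ?thesis using closedin_diff[OF closedin_topspace, of "subtopology T S" "S \<inter> V"] by (simp add: Diff_Int)
    qed
    moreover have "C = f -` (S - V) \<inter> A"
    proof -
      have "x \<in> C \<longleftrightarrow> f x \<notin> V" if "x \<in> A" for x using V(2) that by blast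
      then show ?thesis using CA unfolding S_def by blast
    qed
    ultimately show ?thesis by blast
  qed
  show ?thesis
    unfolding normal_space_def
  proof (intro allI impI)
    fix C1 C2 assume *: "closedin (pullback_topology A f T) C1 \<and> closedin (pullback_topology A f T) C2 \<and> disjnt C1 C2"
    then obtain D1 D2 where D: "closedin (subtopology T S) D1" "C1 = f -` D1 \<inter> A"
      "closedin (subtopology T S) D2" "C2 = f -` D2 \<inter> A" using cl by meson
    have sub: "D1 \<subseteq> S" "D2 \<subseteq> S" using closedin_subset[OF D(1)] closedin_subset[OF D(3)] by auto
    have "disjnt D1 D2" using * D(2,4) sub unfolding S_def disjnt_def by blast
    then obtain U1 U2 where U: "openin (subtopology T S) U1" "openin (subtopology T S) U2" "D1 \<subseteq> U1" "D2 \<subseteq> U2" "disjnt U1 U2"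
      using norm D(1,3) unfolding normal_space_def by meson
    then obtain V1 V2 where V: "openin T V1" "U1 = V1 \<inter> S" "openin T V2" "U2 = V2 \<inter> S"
      by (auto simp: openin_subtopology)
    have "openin (pullback_topology A f T) (f -` V1 \<inter> A)" "openin (pullback_topology A f T) (f -` V2 \<inter> A)"
      using V by (auto simp: openin_pullback_topology)
    moreover have "C1 \<subseteq> f -` V1 \<inter> A" "C2 \<subseteq> f -` V2 \<inter> A" using D U V by auto
    moreover have "disjnt (f -` V1 \<inter> A) (f -` V2 \<inter> A)" using U(5) V unfolding disjnt_def S_def by auto
    ultimately show "\<exists>U V. openin (pullback_topology A f T) U \<and> openin (pullback_topology A f T) V \<and> C1 \<subseteq> U \<and> C2 \<subseteq> V \<and> disjnt U V"
      by blast
  qed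
qed

section \<open>Weak compactness of the positive ball\<close>

context order_continuous_lattice
begin

definition eval_map :: "('a \<Rightarrow> real) \<Rightarrow> ('a \<Rightarrow> real) \<Rightarrow> real" where
  "eval_map h = (\<lambda>f\<in>elems X. \<integral>\<omega>. f \<omega> * h \<omega> \<partial>M)"

abbreviation eval_topology :: "(('a \<Rightarrow> real) \<Rightarrow> real) topology" where
  "eval_topology \<equiv> product_topology (\<lambda>_. euclideanreal) (elems X)"

lemma pos_ball_topology_eq: "pos_ball_topology M X = pullback_topology (pos_ball M X) eval_map eval_topology"
  by (simp add: pos_ball_topology_def eval_map_def[abs_def])

lemma pos_ballD:
  assumes "h \<in> pos_ball M X"
  shows "h \<in> elems X'" "AE \<omega> in M. 0 \<le> h \<omega>" "nrm X' h \<le> 1"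
  using assms by (auto simp: pos_ball_def)

lemma pos_ball_le:
  assumes h: "h \<in> pos_ball M X" and f: "f \<in> elems X"
  shows "\<bar>\<integral>\<omega>. f \<omega> * h \<omega> \<partial>M\<bar> \<le> nrm X f"
  using koethe_bound[OF pos_ballD(1)[OF h] f] mult_right_mono[OF pos_ballD(3)[OF h] nrm_nonneg[OF f]] by simp

lemma pos_ball_integral_nonneg:
  assumes h: "h \<in> pos_ball M X" and f: "AE \<omega> in M. 0 \<le> f \<omega>"
  shows "0 \<le> (\<integral>\<omega>. f \<omega> * h \<omega> \<partial>M)"
proof (rule integral_nonneg_AE)
  show "AE \<omega> in M. 0 \<le> f \<omega> * h \<omega>" using pos_ballD(2)[OF h] f by eventually_elim simp
qed

lemma topspace_pos_ball_topology: "topspace (pos_ball_topology M X) = pos_ball M X"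
  unfolding pos_ball_topology_eq topspace_pullback_topology
  by (auto simp: eval_map_def topspace_product_topology)

lemma continuous_eval:
  assumes f: "f \<in> elems X"
  shows "continuous_map (pos_ball_topology M X) euclideanreal (\<lambda>h. \<integral>\<omega>. f \<omega> * h \<omega> \<partial>M)"
proof -
  have "continuous_map eval_topology euclideanreal (\<lambda>\<phi>. \<phi> f)"
    using continuous_map_product_projection[OF f, of "\<lambda>_. euclideanreal"] by simp
  then have "continuous_map (pos_ball_topology M X) euclideanreal ((\<lambda>\<phi>. \<phi> f) \<circ> eval_map)"
    unfolding pos_ball_topology_eq by (rule continuous_map_pullback)
  moreover have "(\<lambda>\<phi>. \<phi> f) \<circ> eval_map = (\<lambda>h. \<integral>\<omega>. f \<omega> * h \<omega> \<partial>M)"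
    using f by (auto simp: eval_map_def)
  ultimately show ?thesis by simp
qed

text \<open>Banach-Alaoglu for the positive ball: the norm bound confines the functionals to a
  compact product of intervals, and additivity, homogeneity and positivity are closed conditions on
  coordinates.\<close>

lemma compactin_eval_image: "compactin eval_topology (eval_map ` pos_ball M X)"
proof -
  define B where "B = (\<Pi>\<^sub>E f\<in>elems X. {- nrm X f..nrm X f})"
  have Bc: "compactin eval_topology B" unfolding B_def by (subst compactin_PiE) auto
  have haus: "Hausdorff_space eval_topology" by (simp add: Hausdorff_space_product_topology)
  have Bcl: "closedin eval_topology B" by (rule compactin_imp_closedin[OF haus Bc])
  have top: "topspace eval_topology = (\<Pi>\<^sub>E f\<in>elems X. UNIV)" by (simp add: topspace_product_topology)
  have proj: "continuous_map eval_topology euclideanreal (\<lambda>\<phi>. \<phi> f)" if "f \<in> elems X" for f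
    using continuous_map_product_projection[OF that, of "\<lambda>_. euclideanreal"] by simp
  define A1 where "A1 f g = {\<phi> \<in> topspace eval_topology. \<phi> (\<lambda>\<omega>. f \<omega> + g \<omega>) - (\<phi> f + \<phi> g) \<in> {0}}" for f g
  define A2 where "A2 f c = {\<phi> \<in> topspace eval_topology. \<phi> (\<lambda>\<omega>. c * f \<omega>) - c * \<phi> f \<in> {0}}" for f c
  define A3 where "A3 f = {\<phi> \<in> topspace eval_topology. \<phi> f \<in> {0..}}" for f
  have c1: "closedin eval_topology (A1 f g)" if "f \<in> elems X" "g \<in> elems X" for f g
    unfolding A1_def using that
    by (intro closedin_continuous_map_preimage[where Y = euclideanreal] continuous_map_diff continuous_map_add proj add_elem) auto
  have c2: "closedin eval_topology (A2 f c)" if "f \<in> elems X" for f c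
    unfolding A2_def using that
    by (intro closedin_continuous_map_preimage[where Y = euclideanreal] continuous_map_diff continuous_map_real_mult_left proj scale_elem) auto
  have c3: "closedin eval_topology (A3 f)" if "f \<in> elems X" for f
    unfolding A3_def using that by (intro closedin_continuous_map_preimage[where Y = euclideanreal] proj) auto
  define S where "S = B \<inter> (\<Inter>(f, g)\<in>elems X \<times> elems X. A1 f g) \<inter> (\<Inter>(f, c)\<in>elems X \<times> UNIV. A2 f c) \<inter>
    (\<Inter>f\<in>{f \<in> elems X. AE \<omega> in M. 0 \<le> f \<omega>}. A3 f)"
  have ne: "elems X \<times> elems X \<noteq> {}" "elems X \<times> (UNIV :: real set) \<noteq> {}" "{f \<in> elems X. AE \<omega> in M. 0 \<le> f \<omega>} \<noteq> {}"
    using zero_elem by auto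
  have "closedin eval_topology S"
    unfolding S_def using c1 c2 c3 by (intro closedin_Int Bcl closedin_INT ne) auto
  moreover have "S \<subseteq> B" unfolding S_def by auto
  ultimately have Sc: "compactin eval_topology S" using Bc closed_compactin by blast
  have "eval_map ` pos_ball M X = S"
  proof
    show "eval_map ` pos_ball M X \<subseteq> S"
    proof
      fix \<phi> assume "\<phi> \<in> eval_map ` pos_ball M X"
      then obtain h where h: "h \<in> pos_ball M X" "\<phi> = eval_map h" by auto
      have e: "eval_map h f = (\<integral>\<omega>. f \<omega> * h \<omega> \<partial>M)" if "f \<in> elems X" for f using that by (simp add: eval_map_def)
      have ext: "eval_map h \<in> topspace eval_topology" unfolding top by (auto simp: eval_map_def)
      have d: "(\<lambda>f. \<integral>\<omega>. f \<omega> * h \<omega> \<partial>M) \<in> dual X" using koethe_functional pos_ballD(1)[OF h(1)] by simp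
      have "eval_map h \<in> B"
        unfolding B_def using pos_ball_le[OF h(1)] by (auto simp: eval_map_def abs_le_iff minus_le_iff)
      moreover have "eval_map h \<in> A1 f g" if "f \<in> elems X" "g \<in> elems X" for f g
        unfolding A1_def using ext dual_add[OF d that] that add_elem[OF that] by (simp add: e)
      moreover have "eval_map h \<in> A2 f c" if "f \<in> elems X" for f c
        unfolding A2_def using ext dual_scale[OF d that, of c] that scale_elem[OF that, of c] by (simp add: e)
      moreover have "eval_map h \<in> A3 f" if "f \<in> elems X" "AE \<omega> in M. 0 \<le> f \<omega>" for f
        unfolding A3_def using ext pos_ball_integral_nonneg[OF h(1) that(2)] that by (simp add: e)
      ultimately show "\<phi> \<in> S" unfolding S_def h(2) by auto
    qed
    \<comment> \<open>A point of \<open>S\<close> is a positive functional of norm at most 1. Order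
      continuity supplies a function representing it, so the closed set contains nothing beyond the
      image of the ball.\<close>
    show "S \<subseteq> eval_map ` pos_ball M X"
    proof
      fix \<phi> assume S: "\<phi> \<in> S"
      have B: "\<phi> \<in> B" using S by (simp add: S_def)
      have 1: "\<phi> (\<lambda>\<omega>. f \<omega> + g \<omega>) = \<phi> f + \<phi> g" if "f \<in> elems X" "g \<in> elems X" for f g
      proof -
        have "\<phi> \<in> (\<Inter>(f, g)\<in>elems X \<times> elems X. A1 f g)" using S unfolding S_def by (elim IntE)
        from INT_D[OF this, of "(f, g)"] that have "\<phi> \<in> A1 f g" by simp
        then show ?thesis by (simp add: A1_def)
      qed
      have 2: "\<phi> (\<lambda>\<omega>. c * f \<omega>) = c * \<phi> f" if "f \<in> elems X" for f c
      proof -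
        have "\<phi> \<in> (\<Inter>(f, c)\<in>elems X \<times> UNIV. A2 f c)" using S unfolding S_def by (elim IntE)
        from INT_D[OF this, of "(f, c)"] that have "\<phi> \<in> A2 f c" by simp
        then show ?thesis by (simp add: A2_def)
      qed
      have 3: "0 \<le> \<phi> f" if "f \<in> elems X" "AE \<omega> in M. 0 \<le> f \<omega>" for f
      proof -
        have "\<phi> \<in> (\<Inter>f\<in>{f \<in> elems X. AE \<omega> in M. 0 \<le> f \<omega>}. A3 f)" using S unfolding S_def by (elim IntE)
        from INT_D[OF this, of f] that have "\<phi> \<in> A3 f" by simp
        then show ?thesis by (simp add: A3_def)
      qed
      have b: "\<bar>\<phi> f\<bar> \<le> 1 * nrm X f" if "f \<in> elems X" for f
        using PiE_mem[OF B[unfolded B_def] that] by auto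
      have d: "\<phi> \<in> dual X" unfolding dual_def using 1 2 b by (auto intro!: exI[of _ 1])
      have "\<exists>h\<in>elems X'. (\<forall>\<omega>. 0 \<le> h \<omega>) \<and> (\<forall>f\<in>elems X. \<phi> f = (\<integral>\<omega>. f \<omega> * h \<omega> \<partial>M))"
        by (rule positive_dual_representation[OF d 3])
      then obtain h where h: "h \<in> elems X'" "\<And>\<omega>. 0 \<le> h \<omega>" "\<And>f. f \<in> elems X \<Longrightarrow> \<phi> f = (\<integral>\<omega>. f \<omega> * h \<omega> \<partial>M)" by blast
      have "nrm X' h = dual_norm X \<phi>"
        unfolding koethe_dual_def fspace.simps by (rule dual_norm_cong) (simp add: h(3))
      also have "\<dots> \<le> 1" by (rule dual_norm_le[OF zero_le_one b])
      finally have "h \<in> pos_ball M X" using h unfolding pos_ball_def by auto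
      moreover have "\<phi> = eval_map h"
        unfolding eval_map_def using B h(3) unfolding B_def by (auto simp: PiE_def extensional_def restrict_def)
      ultimately show "\<phi> \<in> eval_map ` pos_ball M X" by blast
    qed
  qed
  then show ?thesis using Sc by simp
qed

lemma compact_pos_ball_topology: "compact_space (pos_ball_topology M X)"
  unfolding pos_ball_topology_eq by (rule compact_space_pullback[OF compactin_eval_image])

lemma normal_pos_ball_topology: "normal_space (pos_ball_topology M X)"
  unfolding pos_ball_topology_eq
  by (rule normal_space_pullback[OF compactin_eval_image]) (simp add: Hausdorff_space_product_topology)

end

section \<open>The power space of a convex lattice\<close>

locale convex_lattice = order_continuous_lattice +
  fixes p :: real
  assumes p_ge_1: "1 \<le> p" and convex: "p_convex X (ennreal p) 1"
begin

abbreviation Xp :: "'a fspace" where "Xp \<equiv> p_power M X p"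

lemma Xp_elem_iff: "f \<in> elems Xp \<longleftrightarrow> f \<in> borel_measurable M \<and> (\<lambda>\<omega>. \<bar>f \<omega>\<bar> powr (1 / p)) \<in> elems X"
  by (simp add: p_power_def)

lemma nrm_Xp: "nrm Xp f = nrm X (\<lambda>\<omega>. \<bar>f \<omega>\<bar> powr (1 / p)) powr p"
  by (simp add: p_power_def)

lemma p_pos: "0 < p" using p_ge_1 by simp

text \<open>The triangle inequality in the power space is p-convexity with constant 1, read for the
  two functions |f|^(1/p) and |g|^(1/p). With a larger constant the power space would carry only a
  quasi-norm in general.\<close>

lemma Xp_function_lattice: "function_lattice M Xp"
proof
  show "f \<in> borel_measurable M" if "f \<in> elems Xp" for f using that by (simp add: Xp_elem_iff)
  show "(\<lambda>_. 0) \<in> elems Xp" using zero_elem by (simp add: Xp_elem_iff)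
next
  fix f g assume f: "f \<in> elems Xp" and g: "g \<in> elems Xp"
  define x where "x k = (if k = 0 then (\<lambda>\<omega>. \<bar>f \<omega>\<bar> powr (1 / p)) else (\<lambda>\<omega>. \<bar>g \<omega>\<bar> powr (1 / p)))" for k :: nat
  have x: "x k \<in> elems X" for k using f g by (simp add: x_def Xp_elem_iff)
  have [measurable]: "f \<in> borel_measurable M" "g \<in> borel_measurable M" using f g by (auto simp: Xp_elem_iff)
  have ln: "lnorm (ennreal p) 2 (\<lambda>k. x k \<omega>) = (\<bar>f \<omega>\<bar> + \<bar>g \<omega>\<bar>) powr (1 / p)" for \<omega>
    using p_pos by (simp add: lnorm_ennreal x_def numeral_2_eq_2 powr_powr)
  have le: "AE \<omega> in M. \<bar>\<bar>f \<omega> + g \<omega>\<bar> powr (1 / p)\<bar> \<le> \<bar>lnorm (ennreal p) 2 (\<lambda>k. x k \<omega>)\<bar>"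
    unfolding ln using p_pos by (intro AE_I2) (auto intro!: powr_mono2)
  have m: "(\<lambda>\<omega>. \<bar>f \<omega> + g \<omega>\<bar> powr (1 / p)) \<in> borel_measurable M" by measurable
  have L: "(\<lambda>\<omega>. lnorm (ennreal p) 2 (\<lambda>k. x k \<omega>)) \<in> elems X" by (rule lnorm_elem(1)[OF p_ge_1 x])
  show "(\<lambda>\<omega>. f \<omega> + g \<omega>) \<in> elems Xp"
    unfolding Xp_elem_iff using solid_elem[OF m L le] by simp
  have "nrm X (\<lambda>\<omega>. \<bar>f \<omega> + g \<omega>\<bar> powr (1 / p)) \<le> nrm X (\<lambda>\<omega>. lnorm (ennreal p) 2 (\<lambda>k. x k \<omega>))"
    by (rule nrm_solid[OF m L le])
  also have "\<dots> \<le> lnorm (ennreal p) 2 (\<lambda>k. nrm X (x k))"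
    using convex[unfolded p_convex_def, rule_format, of 2 x] x by simp
  finally have "nrm X (\<lambda>\<omega>. \<bar>f \<omega> + g \<omega>\<bar> powr (1 / p)) powr p \<le> lnorm (ennreal p) 2 (\<lambda>k. nrm X (x k)) powr p"
    using p_pos nrm_nonneg[OF solid_elem[OF m L le]] by (intro powr_mono2) auto
  also have "\<dots> = nrm Xp f + nrm Xp g"
    using nrm_nonneg[OF x[of 0]] nrm_nonneg[OF x[of 1]]
    by (subst lnorm_powr[OF p_pos]) (simp add: numeral_2_eq_2 x_def nrm_Xp)
  finally show "nrm Xp (\<lambda>\<omega>. f \<omega> + g \<omega>) \<le> nrm Xp f + nrm Xp g" by (simp add: nrm_Xp)
next
  fix f and c :: real assume f: "f \<in> elems Xp"
  then have fX: "(\<lambda>\<omega>. \<bar>f \<omega>\<bar> powr (1 / p)) \<in> elems X" by (simp add: Xp_elem_iff)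
  have eq: "(\<lambda>\<omega>. \<bar>c * f \<omega>\<bar> powr (1 / p)) = (\<lambda>\<omega>. \<bar>c\<bar> powr (1 / p) * \<bar>f \<omega>\<bar> powr (1 / p))"
    by (simp add: abs_mult powr_mult)
  have [measurable]: "f \<in> borel_measurable M" using f by (simp add: Xp_elem_iff)
  have "(\<lambda>\<omega>. c * f \<omega>) \<in> borel_measurable M" by measurable
  then show "(\<lambda>\<omega>. c * f \<omega>) \<in> elems Xp" unfolding Xp_elem_iff eq using scale_elem[OF fX] by simp
  show "nrm Xp (\<lambda>\<omega>. c * f \<omega>) = \<bar>c\<bar> * nrm Xp f"
    unfolding nrm_Xp eq nrm_scale[OF fX] using p_pos by (simp add: powr_mult powr_powr)
next
  fix f assume f: "f \<in> elems Xp"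
  then have fX: "(\<lambda>\<omega>. \<bar>f \<omega>\<bar> powr (1 / p)) \<in> elems X" by (simp add: Xp_elem_iff)
  show "0 \<le> nrm Xp f" by (simp add: nrm_Xp)
  show "nrm Xp f = 0 \<longleftrightarrow> (AE \<omega> in M. f \<omega> = 0)" using nrm_eq_0_iff[OF fX] by (simp add: nrm_Xp)
next
  fix f g assume f: "f \<in> borel_measurable M" and g: "g \<in> elems Xp" and le: "AE \<omega> in M. \<bar>f \<omega>\<bar> \<le> \<bar>g \<omega>\<bar>"
  have gX: "(\<lambda>\<omega>. \<bar>g \<omega>\<bar> powr (1 / p)) \<in> elems X" using g by (simp add: Xp_elem_iff)
  have le': "AE \<omega> in M. \<bar>\<bar>f \<omega>\<bar> powr (1 / p)\<bar> \<le> \<bar>\<bar>g \<omega>\<bar> powr (1 / p)\<bar>"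
    using le by eventually_elim (use p_pos in \<open>auto intro: powr_mono2\<close>)
  have m: "(\<lambda>\<omega>. \<bar>f \<omega>\<bar> powr (1 / p)) \<in> borel_measurable M" using f by measurable
  show "f \<in> elems Xp" using f solid_elem[OF m gX le'] by (simp add: Xp_elem_iff)
  show "nrm Xp f \<le> nrm Xp g"
    unfolding nrm_Xp using p_pos nrm_solid[OF m gX le'] nrm_nonneg[OF solid_elem[OF m gX le']] by (intro powr_mono2) auto
qed

lemma power_elem:
  assumes "f \<in> elems X"
  shows "(\<lambda>\<omega>. \<bar>f \<omega>\<bar> powr p) \<in> elems Xp" "nrm Xp (\<lambda>\<omega>. \<bar>f \<omega>\<bar> powr p) = nrm X f powr p"
proof -
  have eq: "\<bar>\<bar>f \<omega>\<bar> powr p\<bar> powr (1 / p) = \<bar>f \<omega>\<bar>" for \<omega> using p_pos by (simp add: powr_powr)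
  show "(\<lambda>\<omega>. \<bar>f \<omega>\<bar> powr p) \<in> elems Xp" unfolding Xp_elem_iff eq using elem_measurable[OF assms] abs_elem[OF assms] by simp
  show "nrm Xp (\<lambda>\<omega>. \<bar>f \<omega>\<bar> powr p) = nrm X f powr p" unfolding nrm_Xp eq nrm_abs[OF assms] ..
qed

lemma Xp_order_continuous: "order_continuous M Xp"
  unfolding order_continuous_def
proof (intro allI impI)
  fix f :: "nat \<Rightarrow> 'a \<Rightarrow> real"
  assume f: "\<forall>n. f n \<in> elems Xp" and lim: "AE \<omega> in M. decseq (\<lambda>n. f n \<omega>) \<and> (\<lambda>n. f n \<omega>) \<longlonglongrightarrow> 0"
  have "(\<lambda>n. nrm X (\<lambda>\<omega>. \<bar>f n \<omega>\<bar> powr (1 / p))) \<longlonglongrightarrow> 0"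
  proof (rule order_continuousD)
    show "(\<lambda>\<omega>. \<bar>f n \<omega>\<bar> powr (1 / p)) \<in> elems X" for n using f by (simp add: Xp_elem_iff)
    show "AE \<omega> in M. decseq (\<lambda>n. \<bar>f n \<omega>\<bar> powr (1 / p)) \<and> (\<lambda>n. \<bar>f n \<omega>\<bar> powr (1 / p)) \<longlonglongrightarrow> 0"
      using lim
    proof eventually_elim
      case (elim \<omega>)
      have pos: "0 \<le> f n \<omega>" for n using elim by (auto intro: decseq_ge)
      have "(\<lambda>n. \<bar>f n \<omega>\<bar>) \<longlonglongrightarrow> 0" using elim by (simp add: tendsto_rabs_zero)
      then have "(\<lambda>n. \<bar>f n \<omega>\<bar> powr (1 / p)) \<longlonglongrightarrow> 0"
        using p_pos tendsto_zero_powrI[of "\<lambda>n. \<bar>f n \<omega>\<bar>" sequentially "\<lambda>_. 1 / p" "1 / p"] by simp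
      moreover have "decseq (\<lambda>n. \<bar>f n \<omega>\<bar> powr (1 / p))"
        using elim pos p_pos by (auto simp: decseq_def intro!: powr_mono2)
      ultimately show ?case by simp
    qed
  qed
  then show "(\<lambda>n. nrm Xp (f n)) \<longlonglongrightarrow> 0"
    unfolding nrm_Xp using p_pos f
      tendsto_zero_powrI[of "\<lambda>n. nrm X (\<lambda>\<omega>. \<bar>f n \<omega>\<bar> powr (1 / p))" sequentially "\<lambda>_. p" p]
    by (simp add: nrm_nonneg Xp_elem_iff)
qed

end

sublocale convex_lattice \<subseteq> Xp: order_continuous_lattice M "p_power M X p"
proof -
  interpret Z: function_lattice M "p_power M X p" by (rule Xp_function_lattice)
  show "order_continuous_lattice M (p_power M X p)"
  proof
    show "\<exists>u\<in>elems Xp. \<forall>\<omega>. 0 < u \<omega>"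
    proof
      show "\<forall>\<omega>. 0 < \<bar>wu \<omega>\<bar> powr p"
      proof
        show "0 < \<bar>wu \<omega>\<bar> powr p" for \<omega> using wu_pos[of \<omega>] by simp
      qed
    qed (rule power_elem(1)[OF wu_elem])
    show "order_continuous M Xp" by (rule Xp_order_continuous)
  qed
qed

section \<open>Mixed norms of finite sequences\<close>

context function_lattice
begin

lemma mixed_sup_bdd:
  assumes "1 \<le> p" "r = top \<or> 0 < enn2real r" "\<And>k. k < n \<Longrightarrow> x k \<in> elems X"
  shows "bdd_above ((\<lambda>\<alpha>. nrm X (\<lambda>\<omega>. lnorm (ennreal p) n (\<lambda>k. \<alpha> k * x k \<omega>))) ` lball r n)"
proof (rule bdd_aboveI2)
  fix \<alpha> assume \<alpha>: "\<alpha> \<in> lball r n"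
  have "nrm X (\<lambda>\<omega>. lnorm (ennreal p) n (\<lambda>k. \<alpha> k * x k \<omega>)) \<le> (\<Sum>k<n. nrm X (\<lambda>\<omega>. \<alpha> k * x k \<omega>))"
    using assms by (intro lnorm_elem scale_elem) auto
  also have "\<dots> \<le> (\<Sum>k<n. nrm X (x k))"
  proof (rule sum_mono)
    fix k assume "k \<in> {..<n}"
    then have k: "k < n" by simp
    show "nrm X (\<lambda>\<omega>. \<alpha> k * x k \<omega>) \<le> nrm X (x k)"
      using nrm_scale[OF assms(3)[OF k]] lball_abs_le_1[OF \<alpha> assms(2) k] nrm_nonneg[OF assms(3)[OF k]]
      by (simp add: mult_left_le_one_le)
  qed
  finally show "nrm X (\<lambda>\<omega>. lnorm (ennreal p) n (\<lambda>k. \<alpha> k * x k \<omega>)) \<le> (\<Sum>k<n. nrm X (x k))" .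
qed

lemma mixed_sup_upper:
  assumes "1 \<le> p" "r = top \<or> 0 < enn2real r" "\<And>k. k < n \<Longrightarrow> x k \<in> elems X" "\<alpha> \<in> lball r n"
  shows "nrm X (\<lambda>\<omega>. lnorm (ennreal p) n (\<lambda>k. \<alpha> k * x k \<omega>)) \<le> mixed_sup X (ennreal p) r n x"
  unfolding mixed_sup_def by (rule cSUP_upper[OF assms(4) mixed_sup_bdd[OF assms(1-3)]])

lemma mixed_sup_nonneg:
  assumes "1 \<le> p" "r = top \<or> 0 < enn2real r" "\<And>k. k < n \<Longrightarrow> x k \<in> elems X"
  shows "0 \<le> mixed_sup X (ennreal p) r n x"
proof -
  have "nrm X (\<lambda>\<omega>. lnorm (ennreal p) n (\<lambda>k. 0 * x k \<omega>)) \<le> mixed_sup X (ennreal p) r n x"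
    by (rule mixed_sup_upper[OF assms zero_in_lball])
  then show ?thesis using nrm_zero by simp
qed

end

context convex_lattice
begin

lemma lnorm_power_integral:
  assumes h: "h \<in> pos_ball M Xp" and x: "\<And>k. k < n \<Longrightarrow> x k \<in> elems X"
  shows "(\<integral>\<omega>. \<bar>lnorm (ennreal p) n (\<lambda>k. \<alpha> k * x k \<omega>)\<bar> powr p * h \<omega> \<partial>M) =
    (\<Sum>k<n. \<bar>\<alpha> k\<bar> powr p * (\<integral>\<omega>. \<bar>x k \<omega>\<bar> powr p * h \<omega> \<partial>M))"
proof -
  have "(\<integral>\<omega>. \<bar>lnorm (ennreal p) n (\<lambda>k. \<alpha> k * x k \<omega>)\<bar> powr p * h \<omega> \<partial>M) =
    (\<integral>\<omega>. (\<Sum>k<n. \<bar>\<alpha> k\<bar> powr p * (\<bar>x k \<omega>\<bar> powr p * h \<omega>)) \<partial>M)"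
    by (intro Bochner_Integration.integral_cong refl)
      (simp add: lnorm_powr[OF p_pos] lnorm_nonneg abs_mult powr_mult sum_distrib_right mult.assoc)
  also have "\<dots> = (\<Sum>k<n. \<integral>\<omega>. \<bar>\<alpha> k\<bar> powr p * (\<bar>x k \<omega>\<bar> powr p * h \<omega>) \<partial>M)"
    using Xp.koethe_integrable[OF Xp.pos_ballD(1)[OF h] power_elem(1)[OF x]]
    by (intro Bochner_Integration.integral_sum integrable_mult_right) auto
  finally show ?thesis by simp
qed

lemma power_integral_nonneg: "h \<in> pos_ball M Xp \<Longrightarrow> 0 \<le> (\<integral>\<omega>. \<bar>f \<omega>\<bar> powr p * h \<omega> \<partial>M)"
  by (rule Xp.pos_ball_integral_nonneg) auto

text \<open>For a fixed \<open>h\<close> the extremal coefficients for the weights c_k = \<integral>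
  |x_k|^p h turn the left side into the integral of the p-th power of a single admissible element
  against \<open>h\<close>, which the norm of that element controls.\<close>

lemma sum_le_mixed_sup:
  assumes q: "p \<le> q" "1 / r = ennreal (1 / p - 1 / q)"
    and h: "h \<in> pos_ball M Xp" and x: "\<And>k. k < n \<Longrightarrow> x k \<in> elems X"
  shows "(\<Sum>k<n. (\<integral>\<omega>. \<bar>x k \<omega>\<bar> powr p * h \<omega> \<partial>M) powr (q / p)) \<le> mixed_sup X (ennreal p) r n x powr q"
proof -
  define c where "c k = (\<integral>\<omega>. \<bar>x k \<omega>\<bar> powr p * h \<omega> \<partial>M)" for k
  have rp: "r = top \<or> 0 < enn2real r" by (rule mixed_exponent_pos[OF p_ge_1 q])
  have qp: "0 < q" using q p_pos by simp
  have c0: "0 \<le> c k" for k unfolding c_def by (rule power_integral_nonneg[OF h])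
  obtain \<alpha> where \<alpha>: "\<alpha> \<in> lball r n" "(\<Sum>k<n. \<bar>\<alpha> k\<bar> powr p * c k) = (\<Sum>k<n. c k powr (q / p)) powr (p / q)"
    using mixed_sum_attained[OF p_ge_1 q, of n c] c0 by blast
  define F where "F = (\<lambda>\<omega>. lnorm (ennreal p) n (\<lambda>k. \<alpha> k * x k \<omega>))"
  have F: "F \<in> elems X" unfolding F_def using x by (intro lnorm_elem p_ge_1 scale_elem)
  have "(\<Sum>k<n. c k powr (q / p)) powr (p / q) = (\<Sum>k<n. \<bar>\<alpha> k\<bar> powr p * c k)" by (rule \<alpha>(2)[symmetric])
  also have "\<dots> = (\<integral>\<omega>. \<bar>F \<omega>\<bar> powr p * h \<omega> \<partial>M)"
    unfolding c_def F_def by (rule lnorm_power_integral[OF h x, symmetric])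
  also have "\<dots> \<le> nrm X F powr p"
    using Xp.pos_ball_le[OF h power_elem(1)[OF F]] power_elem(2)[OF F] by simp
  also have "\<dots> \<le> mixed_sup X (ennreal p) r n x powr p"
    using mixed_sup_upper[OF p_ge_1 rp x \<alpha>(1)] nrm_nonneg[OF F] p_pos unfolding F_def by (intro powr_mono2) auto
  finally have "((\<Sum>k<n. c k powr (q / p)) powr (p / q)) powr (q / p) \<le> (mixed_sup X (ennreal p) r n x powr p) powr (q / p)"
    using p_pos qp by (intro powr_mono2) auto
  then show ?thesis unfolding c_def[symmetric] using p_pos qp by (simp add: powr_powr sum_nonneg)
qed

text \<open>Here the coefficients are fixed and \<open>h\<close> is chosen: it norms the p-th power
  of the combined element in the power space, after which Hoelder's inequality removes the
  coefficients.\<close>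

lemma mixed_sup_le:
  assumes q: "p \<le> q" "1 / r = ennreal (1 / p - 1 / q)" and x: "\<And>k. k < n \<Longrightarrow> x k \<in> elems X"
    and S: "\<And>h. h \<in> pos_ball M Xp \<Longrightarrow> (\<Sum>k<n. (\<integral>\<omega>. \<bar>x k \<omega>\<bar> powr p * h \<omega> \<partial>M) powr (q / p)) \<le> S"
  shows "mixed_sup X (ennreal p) r n x \<le> S powr (1 / q)"
  unfolding mixed_sup_def
proof (rule cSUP_least)
  show "lball r n \<noteq> {}" using zero_in_lball by blast
  fix \<alpha> assume \<alpha>: "\<alpha> \<in> lball r n"
  have qp: "0 < q" using q p_pos by simp
  define F where "F = (\<lambda>\<omega>. lnorm (ennreal p) n (\<lambda>k. \<alpha> k * x k \<omega>))"
  have F: "F \<in> elems X" unfolding F_def using x by (intro lnorm_elem p_ge_1 scale_elem)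
  obtain h where h: "h \<in> pos_ball M Xp" "nrm Xp (\<lambda>\<omega>. \<bar>F \<omega>\<bar> powr p) \<le> (\<integral>\<omega>. \<bar>F \<omega>\<bar> powr p * h \<omega> \<partial>M)"
    using Xp.pos_ball_norming[OF power_elem(1)[OF F]] by auto
  define c where "c k = (\<integral>\<omega>. \<bar>x k \<omega>\<bar> powr p * h \<omega> \<partial>M)" for k
  have c0: "0 \<le> c k" for k unfolding c_def by (rule power_integral_nonneg[OF h(1)])
  have "nrm X F powr p \<le> (\<integral>\<omega>. \<bar>F \<omega>\<bar> powr p * h \<omega> \<partial>M)" using h(2) power_elem(2)[OF F] by simp
  also have "\<dots> = (\<Sum>k<n. \<bar>\<alpha> k\<bar> powr p * c k)" unfolding F_def c_def by (rule lnorm_power_integral[OF h(1) x])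
  also have "\<dots> \<le> (\<Sum>k<n. c k powr (q / p)) powr (p / q)" by (rule mixed_sum_le[OF p_ge_1 q \<alpha> c0])
  also have "\<dots> \<le> S powr (p / q)"
    using S[OF h(1)] p_pos qp unfolding c_def[symmetric] by (intro powr_mono2) (auto intro: sum_nonneg)
  finally have "(nrm X F powr p) powr (1 / p) \<le> (S powr (p / q)) powr (1 / p)"
    using p_pos by (intro powr_mono2) auto
  then show "nrm X (\<lambda>\<omega>. lnorm (ennreal p) n (\<lambda>k. \<alpha> k * x k \<omega>)) \<le> S powr (1 / q)"
    using p_pos nrm_nonneg[OF F] unfolding F_def[symmetric] by (simp add: powr_powr)
qed

end

text \<open>A countable substitute for the ball, so that inequalities valid almost everywhere for
  each coefficient vector hold simultaneously off one null set. Entries from n on are fixed to 0, as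
  otherwise the set of functions would be uncountable.\<close>

definition rational_lball :: "ennreal \<Rightarrow> nat \<Rightarrow> (nat \<Rightarrow> real) set" where
  "rational_lball r n = {a \<in> lball r n. (\<forall>k<n. a k \<in> \<rat>) \<and> (\<forall>k\<ge>n. a k = 0)}"

lemma countable_rational_lball: "countable (rational_lball r n)"
proof -
  have "countable ((\<lambda>a k. if k < n then a k else 0) ` (\<Pi>\<^sub>E k\<in>{..<n}. (\<rat> :: real set)))"
    by (intro countable_image countable_PiE) (auto simp: countable_rat)
  moreover have "rational_lball r n \<subseteq> (\<lambda>a k. if k < n then a k else 0) ` (\<Pi>\<^sub>E k\<in>{..<n}. \<rat>)"
  proof
    fix a assume a: "a \<in> rational_lball r n"
    have "a = (\<lambda>k. if k < n then restrict a {..<n} k else 0)" using a by (auto simp: rational_lball_def fun_eq_iff)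
    moreover have "restrict a {..<n} \<in> (\<Pi>\<^sub>E k\<in>{..<n}. \<rat>)" using a by (auto simp: rational_lball_def)
    ultimately show "a \<in> (\<lambda>a k. if k < n then a k else 0) ` (\<Pi>\<^sub>E k\<in>{..<n}. \<rat>)" by (rule image_eqI)
  qed
  ultimately show ?thesis by (rule countable_subset[rotated])
qed

text \<open>Approximating from the side of 0 does not increase absolute values, and the unit ball is
  solid; so approximants of a vector in the ball stay in it.\<close>

lemma rational_approx_below:
  fixes b d :: real assumes "0 < d"
  obtains a where "a \<in> \<rat>" "\<bar>a\<bar> \<le> \<bar>b\<bar>" "\<bar>a - b\<bar> \<le> d"
proof -
  consider "b = 0" | "0 < b" | "b < 0" by linarith
  then show ?thesis
  proof cases
    case 1
    then show ?thesis using that[of 0] assms by simp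
  next
    case 2
    then have "max 0 (b - d) < b" using assms by simp
    then obtain a where "a \<in> \<rat>" "max 0 (b - d) < a" "a < b" using Rats_dense_in_real by blast
    then show ?thesis using that[of a] 2 by (simp add: abs_if)
  next
    case 3
    then have "b < min 0 (b + d)" using assms by simp
    then obtain a where "a \<in> \<rat>" "b < a" "a < min 0 (b + d)" using Rats_dense_in_real by blast
    then show ?thesis using that[of a] 3 by (simp add: abs_if)
  qed
qed

text \<open>The norming vector, with the signs of x, is replaced by a nearby rational vector that
  does not leave the ball.\<close>

lemma lnorm_le_rational:
  assumes e: "1 \<le> p" "1 / ennreal p + 1 / p' = 1"
    and t: "\<And>a. a \<in> rational_lball p' n \<Longrightarrow> (\<Sum>k<n. a k * x k) \<le> t"
  shows "lnorm (ennreal p) n x \<le> t"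
proof (rule field_le_epsilon)
  fix \<epsilon> :: real assume "0 < \<epsilon>"
  \<comment> \<open>The total error is at most d times the sum of the |x_k|; the 1 in S keeps d =
    \<epsilon>/S meaningful for the zero vector.\<close>
  define S where "S = 1 + (\<Sum>k<n. \<bar>x k\<bar>)"
  have S: "S > 0" unfolding S_def by (simp add: add_pos_nonneg sum_nonneg)
  define d where "d = \<epsilon> / S"
  have d: "0 < d" using S \<open>0 < \<epsilon>\<close> unfolding d_def by simp
  define b where "b k = dual_vec p n x k * sgn (x k)" for k
  have "\<exists>a. a \<in> \<rat> \<and> \<bar>a\<bar> \<le> \<bar>b k\<bar> \<and> \<bar>a - b k\<bar> \<le> d" for k by (rule rational_approx_below[OF d, of "b k"]) blast
  then obtain a where a: "\<And>k. a k \<in> \<rat>" "\<And>k. \<bar>a k\<bar> \<le> \<bar>b k\<bar>" "\<And>k. \<bar>a k - b k\<bar> \<le> d" by metis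
  define a' where "a' k = (if k < n then a k else 0)" for k
  have "dual_vec p n x \<in> lball p' n" unfolding lball_def using lnorm_dual_vec[OF e] by simp
  moreover have "\<bar>a' k\<bar> \<le> \<bar>dual_vec p n x k\<bar>" for k
    using a(2)[of k] unfolding a'_def b_def by (auto simp: abs_mult sgn_real_def split: if_splits)
  ultimately have "a' \<in> lball p' n" by (rule lball_solid)
  then have "a' \<in> rational_lball p' n" using a(1) by (simp add: rational_lball_def a'_def)
  then have le: "(\<Sum>k<n. a k * x k) \<le> t" using t[of a'] by (simp add: a'_def)
  have "lnorm (ennreal p) n x = (\<Sum>k<n. b k * x k)"
    unfolding dual_vec_sum[OF e(1), symmetric] b_def by (intro sum.cong refl) (simp add: mult.assoc linordered_idom_class.mult_sgn_abs abs_sgn mult.commute)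
  also have "\<dots> = (\<Sum>k<n. a k * x k) + (\<Sum>k<n. (b k - a k) * x k)"
    by (simp add: sum.distrib[symmetric] algebra_simps)
  also have "(\<Sum>k<n. (b k - a k) * x k) \<le> (\<Sum>k<n. d * \<bar>x k\<bar>)"
  proof (rule sum_mono)
    fix k
    have "(b k - a k) * x k \<le> \<bar>a k - b k\<bar> * \<bar>x k\<bar>" by (metis abs_ge_self abs_minus_commute abs_mult)
    also have "\<dots> \<le> d * \<bar>x k\<bar>" using a(3) by (intro mult_right_mono) auto
    finally show "(b k - a k) * x k \<le> d * \<bar>x k\<bar>" .
  qed
  also have "\<dots> = d * (\<Sum>k<n. \<bar>x k\<bar>)" by (simp add: sum_distrib_left)
  also have "\<dots> \<le> d * S" unfolding S_def using d by (intro mult_left_mono) auto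
  also have "\<dots> = \<epsilon>" unfolding d_def using S by simp
  finally show "lnorm (ennreal p) n x \<le> t + \<epsilon>" using le by simp
qed

context order_continuous_lattice
begin

sublocale dual: weak_unit_lattice M "koethe_dual M X"
  by (rule koethe_weak_unit_lattice)

text \<open>Tested on the weak unit restricted to the set where \<open>k < h\<close>, the inequality
  of integrals makes the integral of a nonnegative function vanish.\<close>

lemma koethe_le:
  assumes h: "h \<in> elems X'" and k: "k \<in> elems X'"
    and le: "\<And>f. f \<in> elems X \<Longrightarrow> AE \<omega> in M. 0 \<le> f \<omega> \<Longrightarrow> (\<integral>\<omega>. f \<omega> * h \<omega> \<partial>M) \<le> (\<integral>\<omega>. f \<omega> * k \<omega> \<partial>M)"
  shows "AE \<omega> in M. h \<omega> \<le> k \<omega>"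
proof -
  have [measurable]: "h \<in> borel_measurable M" "k \<in> borel_measurable M" using koethe_measurable h k by auto
  define A where "A = {\<omega> \<in> space M. k \<omega> < h \<omega>}"
  have A [measurable]: "A \<in> sets M" unfolding A_def by measurable
  define f where "f = (\<lambda>\<omega>. wu \<omega> * indicat_real A \<omega>)"
  have f: "f \<in> elems X" unfolding f_def by (rule wu_indicator_elem[OF A])
  have f0: "0 \<le> f \<omega>" for \<omega> unfolding f_def by (rule wu_mult_nonneg) simp
  have int: "integrable M (\<lambda>\<omega>. f \<omega> * h \<omega>)" "integrable M (\<lambda>\<omega>. f \<omega> * k \<omega>)"
    using koethe_integrable h k f by auto
  have pos: "0 \<le> f \<omega> * h \<omega> - f \<omega> * k \<omega>" for \<omega>
    unfolding right_diff_distrib[symmetric] using f0[of \<omega>] by (cases "\<omega> \<in> A") (auto simp: A_def f_def indicator_def)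
  have "(\<integral>\<omega>. f \<omega> * h \<omega> - f \<omega> * k \<omega> \<partial>M) \<le> 0" using le[OF f] f0 int by simp
  then have "(\<integral>\<omega>. f \<omega> * h \<omega> - f \<omega> * k \<omega> \<partial>M) = 0" using pos by (intro antisym integral_nonneg_AE) auto
  then have "AE \<omega> in M. f \<omega> * h \<omega> - f \<omega> * k \<omega> = 0"
    using int pos by (subst (asm) integral_nonneg_eq_0_iff_AE) auto
  then show ?thesis
  proof (rule AE_mp, intro AE_I2 impI)
    fix \<omega> assume "\<omega> \<in> space M" "f \<omega> * h \<omega> - f \<omega> * k \<omega> = 0"
    then show "h \<omega> \<le> k \<omega>" using wu_pos[of \<omega>] by (auto simp: f_def A_def indicator_def not_less[symmetric])
  qed
qed

text \<open>The pointwise norm is an upper bound by Hoelder's inequality. It is the least one, since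
  any other upper bound is represented by a function that dominates all rational combinations and
  hence their pointwise supremum.\<close>

lemma dual_psum_representation:
  assumes e: "1 \<le> p" "1 / ennreal p + 1 / p' = 1"
    and h: "\<And>k. k < n \<Longrightarrow> h k \<in> elems X'"
    and \<phi>: "\<And>k f. k < n \<Longrightarrow> f \<in> elems X \<Longrightarrow> \<phi> k f = (\<integral>\<omega>. f \<omega> * h k \<omega> \<partial>M)"
    and f: "f \<in> elems X"
  shows "dual_psum M X (ennreal p) n \<phi> f = (\<integral>\<omega>. f \<omega> * lnorm (ennreal p) n (\<lambda>k. h k \<omega>) \<partial>M)"
proof -
  define H where "H = (\<lambda>\<omega>. lnorm (ennreal p) n (\<lambda>k. h k \<omega>))"
  have H: "H \<in> elems X'" unfolding H_def by (rule dual.lnorm_elem(1)[OF e(1) h])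
  define \<psi>\<^sub>0 where "\<psi>\<^sub>0 = (\<lambda>f. \<integral>\<omega>. f \<omega> * H \<omega> \<partial>M)"
  define P where "P \<psi> \<longleftrightarrow> \<psi> \<in> dual X \<and>
     (\<forall>a\<in>lball p' n. dual_le M X (\<lambda>f. \<Sum>k<n. a k * \<phi> k f) \<psi>) \<and>
     (\<forall>\<theta>\<in>dual X. (\<forall>a\<in>lball p' n. dual_le M X (\<lambda>f. \<Sum>k<n. a k * \<phi> k f) \<theta>) \<longrightarrow> dual_le M X \<psi> \<theta>)" for \<psi>
  have comb: "(\<lambda>\<omega>. \<Sum>k<n. a k * h k \<omega>) \<in> elems X'" for a using h by (intro dual.sum_elem dual.scale_elem)
  have combi: "(\<Sum>k<n. a k * \<phi> k f) = (\<integral>\<omega>. f \<omega> * (\<Sum>k<n. a k * h k \<omega>) \<partial>M)" if f: "f \<in> elems X" for a f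
  proof -
    have "(\<integral>\<omega>. f \<omega> * (\<Sum>k<n. a k * h k \<omega>) \<partial>M) = (\<integral>\<omega>. (\<Sum>k<n. a k * (f \<omega> * h k \<omega>)) \<partial>M)"
      by (simp add: sum_distrib_left mult.left_commute)
    also have "\<dots> = (\<Sum>k<n. \<integral>\<omega>. a k * (f \<omega> * h k \<omega>) \<partial>M)"
      using koethe_integrable[OF h f] by (intro Bochner_Integration.integral_sum integrable_mult_right) auto
    also have "\<dots> = (\<Sum>k<n. a k * \<phi> k f)" using \<phi> f by (intro sum.cong refl) simp
    finally show ?thesis by simp
  qed
  have P0: "P \<psi>\<^sub>0"
    unfolding P_def
  proof (intro conjI ballI impI)
    show "\<psi>\<^sub>0 \<in> dual X" unfolding \<psi>\<^sub>0_def by (rule koethe_functional[OF H])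
  next
    fix a assume a: "a \<in> lball p' n"
    show "dual_le M X (\<lambda>f. \<Sum>k<n. a k * \<phi> k f) \<psi>\<^sub>0"
      unfolding dual_le_def \<psi>\<^sub>0_def
    proof (intro ballI impI)
      fix f assume f: "f \<in> elems X" and f0: "AE \<omega> in M. 0 \<le> f \<omega>"
      have le: "(\<Sum>k<n. a k * h k \<omega>) \<le> H \<omega>" for \<omega>
      proof -
        have "(\<Sum>k<n. a k * h k \<omega>) \<le> (\<Sum>k<n. \<bar>h k \<omega>\<bar> * \<bar>a k\<bar>)"
          by (intro sum_mono) (metis abs_ge_self abs_mult mult.commute)
        also have "\<dots> \<le> H \<omega> * lnorm p' n a" unfolding H_def by (rule lnorm_Hoelder[OF e])
        also have "\<dots> \<le> H \<omega> * 1" using a lnorm_nonneg unfolding H_def lball_def by (intro mult_left_mono) auto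
        finally show ?thesis by simp
      qed
      show "(\<Sum>k<n. a k * \<phi> k f) \<le> (\<integral>\<omega>. f \<omega> * H \<omega> \<partial>M)"
        unfolding combi[OF f]
      proof (rule integral_mono_AE)
        show "AE \<omega> in M. f \<omega> * (\<Sum>k<n. a k * h k \<omega>) \<le> f \<omega> * H \<omega>"
          using f0 by eventually_elim (intro mult_left_mono le)
      qed (intro koethe_integrable comb H f)+
    qed
  next
    fix \<theta> assume \<theta>: "\<theta> \<in> dual X" and up: "\<forall>a\<in>lball p' n. dual_le M X (\<lambda>f. \<Sum>k<n. a k * \<phi> k f) \<theta>"
    obtain t where t: "t \<in> elems X'" "\<And>f. f \<in> elems X \<Longrightarrow> \<theta> f = (\<integral>\<omega>. f \<omega> * t \<omega> \<partial>M)"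
      by (rule dual_representation[OF \<theta>]) blast
    \<comment> \<open>Each coefficient vector brings its own exceptional null set; restricting to
      rational vectors leaves countably many to unite.\<close>
    have "AE \<omega> in M. (\<Sum>k<n. a k * h k \<omega>) \<le> t \<omega>" if a: "a \<in> rational_lball p' n" for a
    proof (rule koethe_le[OF comb t(1)])
      fix f assume f: "f \<in> elems X" "AE \<omega> in M. 0 \<le> f \<omega>"
      have "a \<in> lball p' n" using a by (simp add: rational_lball_def)
      then show "(\<integral>\<omega>. f \<omega> * (\<Sum>k<n. a k * h k \<omega>) \<partial>M) \<le> (\<integral>\<omega>. f \<omega> * t \<omega> \<partial>M)"
        using up f unfolding dual_le_def combi[OF f(1), symmetric] t(2)[OF f(1), symmetric] by simp
    qed
    then have "AE \<omega> in M. \<forall>a\<in>rational_lball p' n. (\<Sum>k<n. a k * h k \<omega>) \<le> t \<omega>"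
      by (subst AE_ball_countable[OF countable_rational_lball]) blast
    then have Ht: "AE \<omega> in M. H \<omega> \<le> t \<omega>"
      by eventually_elim (auto simp: H_def intro: lnorm_le_rational[OF e])
    show "dual_le M X \<psi>\<^sub>0 \<theta>"
      unfolding dual_le_def \<psi>\<^sub>0_def
    proof (intro ballI impI)
      fix f assume f: "f \<in> elems X" and f0: "AE \<omega> in M. 0 \<le> f \<omega>"
      show "(\<integral>\<omega>. f \<omega> * H \<omega> \<partial>M) \<le> \<theta> f"
        unfolding t(2)[OF f]
      proof (rule integral_mono_AE)
        show "AE \<omega> in M. f \<omega> * H \<omega> \<le> f \<omega> * t \<omega>" using f0 Ht by eventually_elim (rule mult_left_mono)
      qed (intro koethe_integrable t H f)+
    qed
  qed
  have dp: "dual_psum M X (ennreal p) n \<phi> = (SOME \<psi>. P \<psi>)"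
    unfolding dual_psum_def conj_exp_eq[OF e] P_def ..
  have P1: "P (dual_psum M X (ennreal p) n \<phi>)" unfolding dp by (rule someI[of P, OF P0])
  define \<psi> where "\<psi> = dual_psum M X (ennreal p) n \<phi>"
  have d: "\<psi> \<in> dual X" "\<psi>\<^sub>0 \<in> dual X" using P0 P1 unfolding P_def \<psi>_def by auto
  have "dual_le M X \<psi> \<psi>\<^sub>0" "dual_le M X \<psi>\<^sub>0 \<psi>" using P0 P1 unfolding P_def \<psi>_def by auto
  \<comment> \<open>Two least upper bounds dominate each other, but only on nonnegative elements;
    splitting into positive and negative parts extends the equality to the whole lattice.\<close>
  then have pos: "\<psi> f = \<psi>\<^sub>0 f" if "f \<in> elems X" "\<And>\<omega>. 0 \<le> f \<omega>" for f
    using that unfolding dual_le_def by (intro antisym) auto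
  define a b where "a = (\<lambda>\<omega>. max 0 (f \<omega>))" and "b = (\<lambda>\<omega>. max 0 (- f \<omega>))"
  have ab: "a \<in> elems X" "b \<in> elems X" unfolding a_def b_def by (intro pos_part_elem minus_elem f)+
  have fab: "f = (\<lambda>\<omega>. a \<omega> - b \<omega>)" unfolding a_def b_def by (auto simp: max_def)
  have "\<psi> f = \<psi> a - \<psi> b" unfolding fab by (rule dual_diff[OF d(1) ab])
  also have "\<dots> = \<psi>\<^sub>0 a - \<psi>\<^sub>0 b" using pos ab by (simp add: a_def b_def)
  also have "\<dots> = \<psi>\<^sub>0 f" unfolding fab by (rule dual_diff[OF d(2) ab, symmetric])
  finally show ?thesis unfolding \<psi>_def \<psi>\<^sub>0_def H_def .
qed

lemma dual_mixed_sup_representation: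
  assumes e: "1 \<le> p" "1 / ennreal p + 1 / p' = 1"
    and h: "\<And>k. k < n \<Longrightarrow> h k \<in> elems X'"
    and \<phi>: "\<And>k f. k < n \<Longrightarrow> f \<in> elems X \<Longrightarrow> \<phi> k f = (\<integral>\<omega>. f \<omega> * h k \<omega> \<partial>M)"
  shows "dual_mixed_sup M X (ennreal p) r n \<phi> = mixed_sup X' (ennreal p) r n h"
  unfolding dual_mixed_sup_def mixed_sup_def
proof (intro SUP_cong refl)
  fix \<beta>
  have "dual_norm X (dual_psum M X (ennreal p) n (\<lambda>k f. \<beta> k * \<phi> k f)) =
    dual_norm X (\<lambda>f. \<integral>\<omega>. f \<omega> * lnorm (ennreal p) n (\<lambda>k. \<beta> k * h k \<omega>) \<partial>M)"
  proof (intro dual_norm_cong dual_psum_representation[OF e])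
    show "(\<lambda>\<omega>. \<beta> k * h k \<omega>) \<in> elems X'" if "k < n" for k using h[OF that] by (rule dual.scale_elem)
    show "\<beta> k * \<phi> k f = (\<integral>\<omega>. f \<omega> * (\<beta> k * h k \<omega>) \<partial>M)" if "k < n" "f \<in> elems X" for k f
      using \<phi>[OF that] by (simp add: mult.left_commute)
  qed
  then show "dual_norm X (dual_psum M X (ennreal p) n (\<lambda>k f. \<beta> k * \<phi> k f)) =
    nrm X' (\<lambda>\<omega>. lnorm (ennreal p) n (\<lambda>k. \<beta> k * h k \<omega>))"
    by (simp add: koethe_dual_def)
qed

text \<open>Duality between concavity and convexity: the pointwise norming vector b of (h_k) divides
  a test function f into pieces f b_k whose l_p' norm is pointwise at most |f|. Hoelder's inequality
  pairs the norms of the h_k with those of the pieces, and concavity bounds the latter by the norm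
  of f.\<close>

lemma koethe_dual_convex:
  assumes e: "1 \<le> p" "1 / ennreal p + 1 / p' = 1" and conc: "s_concave X p' 1"
  shows "p_convex X' (ennreal p) 1"
  unfolding p_convex_def
proof (intro allI impI)
  fix n and h :: "nat \<Rightarrow> 'a \<Rightarrow> real" assume h: "\<forall>k<n. h k \<in> elems X'"
  have p'pos: "p' = top \<or> 0 < enn2real p'"
    using e by (cases rule: conjugate_exponent_cases) auto
  have hm: "h k \<in> borel_measurable M" if "k < n" for k using koethe_measurable h that by auto
  define H where "H = (\<lambda>\<omega>. lnorm (ennreal p) n (\<lambda>k. h k \<omega>))"
  have Hm [measurable]: "H \<in> borel_measurable M" unfolding H_def using hm by (rule lnorm_measurable)
  define b where "b k = (\<lambda>\<omega>. dual_vec p n (\<lambda>k. h k \<omega>) k)" for k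
  have bm: "b k \<in> borel_measurable M" if "k < n" for k
  proof -
    have [measurable]: "(\<lambda>\<omega>. lnorm (ennreal p) n (\<lambda>k. h k \<omega>)) \<in> borel_measurable M" using Hm unfolding H_def .
    note [measurable] = hm[OF that]
    show ?thesis unfolding b_def dual_vec_def by measurable
  qed
  have bl: "lnorm p' n (\<lambda>k. b k \<omega>) \<le> 1" for \<omega> unfolding b_def by (rule lnorm_dual_vec[OF e])
  have b0: "0 \<le> b k \<omega>" for k \<omega> unfolding b_def by (rule dual_vec_nonneg)
  have b1: "\<bar>b k \<omega>\<bar> \<le> 1" if "k < n" for k \<omega>
    using abs_le_lnorm[OF that p'pos, of "\<lambda>k. b k \<omega>"] bl[of \<omega>] by simp
  define c where "c = lnorm (ennreal p) n (\<lambda>k. nrm X' (h k))"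
  have c0: "0 \<le> c" unfolding c_def by (rule lnorm_nonneg)
  have "nrm X' H \<le> c"
  proof (rule koetheI(2)[OF Hm c0])
    fix f assume f: "f \<in> elems X" and f0: "\<And>\<omega>. 0 \<le> f \<omega>"
    have [measurable]: "f \<in> borel_measurable M" by (rule elem_measurable[OF f])
    \<comment> \<open>Pieces with index at least n are set to 0, so that every \<open>g k\<close> is
      an element, also beyond the range where b is known to be measurable.\<close>
    define g where "g k = (\<lambda>\<omega>. f \<omega> * (if k < n then b k \<omega> else 0))" for k
    have g: "g k \<in> elems X" for k
      unfolding g_def using bm b1 by (intro mult_elem[OF f, of _ 1]) (cases "k < n"; auto)+
    have "(\<integral>\<^sup>+\<omega>. ennreal (f \<omega> * \<bar>H \<omega>\<bar>) \<partial>M) = (\<integral>\<^sup>+\<omega>. (\<Sum>k<n. ennreal \<bar>g k \<omega> * h k \<omega>\<bar>) \<partial>M)"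
    proof (rule nn_integral_cong)
      fix \<omega>
      have "f \<omega> * \<bar>H \<omega>\<bar> = f \<omega> * (\<Sum>k<n. b k \<omega> * \<bar>h k \<omega>\<bar>)"
        unfolding b_def dual_vec_sum[OF e(1)] by (simp add: H_def lnorm_nonneg)
      also have "\<dots> = (\<Sum>k<n. \<bar>g k \<omega> * h k \<omega>\<bar>)"
        unfolding sum_distrib_left by (intro sum.cong refl) (auto simp: g_def abs_mult f0 b0)
      finally show "ennreal (f \<omega> * \<bar>H \<omega>\<bar>) = (\<Sum>k<n. ennreal \<bar>g k \<omega> * h k \<omega>\<bar>)" by (simp add: sum_ennreal)
    qed
    also have "\<dots> = (\<Sum>k<n. \<integral>\<^sup>+\<omega>. ennreal \<bar>g k \<omega> * h k \<omega>\<bar> \<partial>M)"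
      using hm elem_measurable[OF g] by (intro nn_integral_sum) auto
    also have "\<dots> \<le> (\<Sum>k<n. ennreal (nrm X' (h k) * nrm X (g k)))"
      using h g by (intro sum_mono koethe_nn_bound) auto
    also have "\<dots> = ennreal (\<Sum>k<n. \<bar>nrm X' (h k)\<bar> * \<bar>nrm X (g k)\<bar>)"
      using h koethe_nrm_nonneg nrm_nonneg[OF g] by (subst sum_ennreal) (auto intro!: sum.cong arg_cong[where f = ennreal])
    also have "\<dots> \<le> ennreal (c * nrm X f)"
    proof (rule ennreal_leI)
      have "(\<Sum>k<n. \<bar>nrm X' (h k)\<bar> * \<bar>nrm X (g k)\<bar>) \<le> c * lnorm p' n (\<lambda>k. nrm X (g k))"
        unfolding c_def by (rule lnorm_Hoelder[OF e])
      also have "lnorm p' n (\<lambda>k. nrm X (g k)) \<le> nrm X (\<lambda>\<omega>. lnorm p' n (\<lambda>k. g k \<omega>))"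
        using conc[unfolded s_concave_def, rule_format, of n g] g by simp
      also have "\<dots> \<le> nrm X f"
      proof (rule nrm_solid[OF _ f])
        show "(\<lambda>\<omega>. lnorm p' n (\<lambda>k. g k \<omega>)) \<in> borel_measurable M" using elem_measurable[OF g] by (rule lnorm_measurable)
        show "AE \<omega> in M. \<bar>lnorm p' n (\<lambda>k. g k \<omega>)\<bar> \<le> \<bar>f \<omega>\<bar>"
        proof (rule AE_I2)
          fix \<omega>
          have "lnorm p' n (\<lambda>k. g k \<omega>) = lnorm p' n (\<lambda>k. f \<omega> * b k \<omega>)" by (rule lnorm_cong) (simp add: g_def)
          also have "\<dots> = \<bar>f \<omega>\<bar> * lnorm p' n (\<lambda>k. b k \<omega>)" by (rule lnorm_scale[OF p'pos])
          also have "\<dots> \<le> \<bar>f \<omega>\<bar> * 1" using bl by (intro mult_left_mono) auto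
          finally show "\<bar>lnorm p' n (\<lambda>k. g k \<omega>)\<bar> \<le> \<bar>f \<omega>\<bar>" using lnorm_nonneg[of p' n "\<lambda>k. g k \<omega>"] by simp
        qed
      qed
      finally show "(\<Sum>k<n. \<bar>nrm X' (h k)\<bar> * \<bar>nrm X (g k)\<bar>) \<le> c * nrm X f"
        using c0 by (simp add: mult_left_mono)
    qed
    finally show "(\<integral>\<^sup>+\<omega>. ennreal (f \<omega> * \<bar>H \<omega>\<bar>) \<partial>M) \<le> ennreal (c * nrm X f)" .
  qed
  then show "nrm X' (\<lambda>\<omega>. lnorm (ennreal p) n (\<lambda>k. h k \<omega>)) \<le> 1 * lnorm (ennreal p) n (\<lambda>k. nrm X' (h k))"
    by (simp add: H_def c_def)
qed

end

section \<open>The spaces S\<close>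

context weak_unit_lattice
begin

text \<open>Setting large values to 0, instead of clipping them, makes the difference from
  \<open>f\<close> at each point either \<open>f\<close> or 0 and eventually 0; the result is
  bounded by a multiple of the weak unit and so belongs to the lattice.\<close>

definition trunc :: "nat \<Rightarrow> ('a \<Rightarrow> real) \<Rightarrow> 'a \<Rightarrow> real" where
  "trunc n f \<omega> = (if \<bar>f \<omega>\<bar> \<le> real n * wu \<omega> then f \<omega> else 0)"

lemma trunc_measurable [measurable]:
  assumes [measurable]: "f \<in> borel_measurable M"
  shows "trunc n f \<in> borel_measurable M"
  unfolding trunc_def[abs_def] by measurable

lemma abs_trunc_le: "\<bar>trunc n f \<omega>\<bar> \<le> \<bar>f \<omega>\<bar>"
  by (simp add: trunc_def)

lemma trunc_elem: "f \<in> borel_measurable M \<Longrightarrow> trunc n f \<in> elems X"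
proof (rule solid_elem[OF _ scale_elem[OF wu_elem, of "real n"]])
  show "AE \<omega> in M. \<bar>trunc n f \<omega>\<bar> \<le> \<bar>real n * wu \<omega>\<bar>"
  proof (rule AE_I2)
    show "\<bar>trunc n f \<omega>\<bar> \<le> \<bar>real n * wu \<omega>\<bar>" for \<omega> using wu_pos[of \<omega>] by (auto simp: trunc_def abs_mult)
  qed
qed measurable

lemma trunc_mono: "m \<le> n \<Longrightarrow> \<bar>trunc m f \<omega>\<bar> \<le> \<bar>trunc n f \<omega>\<bar>"
proof -
  assume "m \<le> n"
  then have "real m * wu \<omega> \<le> real n * wu \<omega>" using wu_pos[of \<omega>] by (intro mult_right_mono) auto
  then show ?thesis by (auto simp: trunc_def)
qed

lemma trunc_eventually: "eventually (\<lambda>n. trunc n f \<omega> = f \<omega>) sequentially"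
proof -
  obtain N where N: "\<bar>f \<omega>\<bar> < real N * wu \<omega>" using reals_Archimedean3[OF wu_pos[of \<omega>]] by blast
  have "trunc n f \<omega> = f \<omega>" if "n \<ge> N" for n
  proof -
    have "real N * wu \<omega> \<le> real n * wu \<omega>" using wu_pos[of \<omega>] that by (intro mult_right_mono) auto
    then show ?thesis using N by (simp add: trunc_def)
  qed
  then show ?thesis by (auto simp: eventually_sequentially)
qed

lemma trunc_tendsto: "(\<lambda>n. trunc n f \<omega>) \<longlonglongrightarrow> f \<omega>"
  by (rule tendsto_eventually[OF trunc_eventually])

lemma trunc_diff_decseq: "decseq (\<lambda>n. \<bar>f \<omega> - trunc n f \<omega>\<bar>)"
  unfolding decseq_def
proof (intro allI impI)
  fix m n :: nat assume "m \<le> n"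
  then have "real m * wu \<omega> \<le> real n * wu \<omega>" using wu_pos[of \<omega>] by (intro mult_right_mono) auto
  then show "\<bar>f \<omega> - trunc n f \<omega>\<bar> \<le> \<bar>f \<omega> - trunc m f \<omega>\<bar>" by (auto simp: trunc_def)
qed

end

section \<open>The functional of S for a probability measure on the positive ball\<close>

locale S_measure = convex_lattice +
  fixes q :: real and \<nu> :: "('a \<Rightarrow> real) measure"
  assumes p_le_q: "p \<le> q" and regular: "regular_borel_prob (pos_ball_topology M (p_power M X p)) \<nu>"
begin

sublocale \<nu>: prob_space \<nu>
  using regular by (simp add: regular_borel_prob_def)

lemma q_pos: "0 < q" using p_le_q p_pos by simp

lemma space_\<nu>: "space \<nu> = pos_ball M Xp"
  using regular Xp.topspace_pos_ball_topology by (simp add: regular_borel_prob_def)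

lemma \<nu>_measurable [measurable_dest]: "h \<in> space \<nu> \<Longrightarrow> h \<in> borel_measurable M"
  unfolding space_\<nu> using Xp.koethe_measurable Xp.pos_ballD(1) by blast

abbreviation S :: "'a fspace" where "S \<equiv> S_space M p q \<nu>"

definition I :: "('a \<Rightarrow> real) \<Rightarrow> ('a \<Rightarrow> real) \<Rightarrow> ennreal" where
  "I f h = (\<integral>\<^sup>+\<omega>. ennreal (\<bar>f \<omega>\<bar> powr p * h \<omega>) \<partial>M)"

abbreviation Sf :: "('a \<Rightarrow> real) \<Rightarrow> ennreal" where "Sf \<equiv> S_functional M p q \<nu>"

lemma Sf_def: "Sf f = ennreal_powr (\<integral>\<^sup>+h. ennreal_powr (I f h) (q / p) \<partial>\<nu>) (1 / q)"
  by (simp add: S_functional_def I_def)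

lemma I_eq:
  assumes h: "h \<in> pos_ball M Xp" and f: "f \<in> elems X"
  shows "I f h = ennreal (\<integral>\<omega>. \<bar>f \<omega>\<bar> powr p * h \<omega> \<partial>M)"
  unfolding I_def
proof (rule nn_integral_eq_integral)
  show "integrable M (\<lambda>\<omega>. \<bar>f \<omega>\<bar> powr p * h \<omega>)"
    by (rule Xp.koethe_integrable[OF Xp.pos_ballD(1)[OF h] power_elem(1)[OF f]])
  show "AE \<omega> in M. 0 \<le> \<bar>f \<omega>\<bar> powr p * h \<omega>" using Xp.pos_ballD(2)[OF h] by eventually_elim simp
qed

lemma I_mono:
  assumes "h \<in> space \<nu>" "AE \<omega> in M. \<bar>f \<omega>\<bar> \<le> \<bar>g \<omega>\<bar>"
  shows "I f h \<le> I g h"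
  unfolding I_def
proof (rule nn_integral_mono_AE)
  have "AE \<omega> in M. 0 \<le> h \<omega>" using assms(1) unfolding space_\<nu> by (rule Xp.pos_ballD)
  then show "AE \<omega> in M. ennreal (\<bar>f \<omega>\<bar> powr p * h \<omega>) \<le> ennreal (\<bar>g \<omega>\<bar> powr p * h \<omega>)"
    using assms(2) by eventually_elim (use p_pos in \<open>auto intro!: ennreal_leI mult_right_mono powr_mono2\<close>)
qed

lemma I_SUP:
  assumes h: "h \<in> space \<nu>" and f: "\<And>n. f n \<in> borel_measurable M"
    and lim: "AE \<omega> in M. incseq (\<lambda>n. \<bar>f n \<omega>\<bar>) \<and> (\<lambda>n. \<bar>f n \<omega>\<bar>) \<longlonglongrightarrow> \<bar>g \<omega>\<bar>"
  shows "I g h = (SUP n. I (f n) h)"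
  unfolding I_def
proof (rule nn_integral_incseq_tendsto(2))
  have [measurable]: "h \<in> borel_measurable M" using h by (rule \<nu>_measurable)
  note [measurable] = f
  show "(\<lambda>\<omega>. ennreal (\<bar>f n \<omega>\<bar> powr p * h \<omega>)) \<in> borel_measurable M" for n by measurable
  have "AE \<omega> in M. 0 \<le> h \<omega>" using h unfolding space_\<nu> by (rule Xp.pos_ballD)
  then show "AE \<omega> in M. incseq (\<lambda>n. ennreal (\<bar>f n \<omega>\<bar> powr p * h \<omega>)) \<and>
      (\<lambda>n. ennreal (\<bar>f n \<omega>\<bar> powr p * h \<omega>)) \<longlonglongrightarrow> ennreal (\<bar>g \<omega>\<bar> powr p * h \<omega>)"
    using lim
  proof eventually_elim
    case (elim \<omega>)
    have "incseq (\<lambda>n. ennreal (\<bar>f n \<omega>\<bar> powr p * h \<omega>))"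
      using elim p_pos by (auto simp: incseq_def intro!: ennreal_leI mult_right_mono powr_mono2)
    moreover have "(\<lambda>n. \<bar>f n \<omega>\<bar> powr p) \<longlonglongrightarrow> \<bar>g \<omega>\<bar> powr p"
      using elim p_pos by (intro tendsto_powr') auto
    then have "(\<lambda>n. ennreal (\<bar>f n \<omega>\<bar> powr p * h \<omega>)) \<longlonglongrightarrow> ennreal (\<bar>g \<omega>\<bar> powr p * h \<omega>)"
      by (intro tendsto_ennrealI tendsto_mult tendsto_const)
    ultimately show ?case by (intro conjI)
  qed
qed

text \<open>For elements of \<open>X\<close> the pairing is a weakly continuous function of
  \<open>h\<close>. A general measurable \<open>f\<close> need not belong to \<open>X\<close>; its
  truncations do, and \<open>I f\<close> is the supremum of theirs.\<close>

lemma I_measurable [measurable]: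
  assumes f [measurable]: "f \<in> borel_measurable M"
  shows "I f \<in> borel_measurable \<nu>"
proof -
  have base: "I g \<in> borel_measurable \<nu>" if g: "g \<in> elems X" for g
  proof -
    have "(\<lambda>h. \<integral>\<omega>. \<bar>g \<omega>\<bar> powr p * h \<omega> \<partial>M) \<in> borel_measurable \<nu>"
      by (rule regular_borel_prob_continuous_measurable[OF regular Xp.continuous_eval[OF power_elem(1)[OF g]]])
    then have "(\<lambda>h. ennreal (\<integral>\<omega>. \<bar>g \<omega>\<bar> powr p * h \<omega> \<partial>M)) \<in> borel_measurable \<nu>" by measurable
    moreover have "I g h = ennreal (\<integral>\<omega>. \<bar>g \<omega>\<bar> powr p * h \<omega> \<partial>M)" if "h \<in> space \<nu>" for h
      using that unfolding space_\<nu> by (rule I_eq[OF _ g])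
    ultimately show ?thesis by (simp cong: measurable_cong)
  qed
  have eq: "I f h = (SUP n. I (trunc n f) h)" if h: "h \<in> space \<nu>" for h
  proof (rule I_SUP[OF h])
    show "trunc n f \<in> borel_measurable M" for n by measurable
    show "AE \<omega> in M. incseq (\<lambda>n. \<bar>trunc n f \<omega>\<bar>) \<and> (\<lambda>n. \<bar>trunc n f \<omega>\<bar>) \<longlonglongrightarrow> \<bar>f \<omega>\<bar>"
      by (intro AE_I2 conjI tendsto_rabs trunc_tendsto) (simp add: incseq_def trunc_mono)
  qed
  have "(\<lambda>h. SUP n. I (trunc n f) h) \<in> borel_measurable \<nu>"
    by (intro borel_measurable_SUP base trunc_elem f) auto
  then show ?thesis using eq by (simp cong: measurable_cong)
qed

lemma Sf_mono:
  assumes "AE \<omega> in M. \<bar>f \<omega>\<bar> \<le> \<bar>g \<omega>\<bar>"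
  shows "Sf f \<le> Sf g"
  unfolding Sf_def using p_pos q_pos
  by (intro ennreal_powr_mono nn_integral_mono I_mono assms) auto

text \<open>The inner half of the triangle inequality for S, for a single \<open>h\<close>;
  Minkowski's inequality in L^q of \<nu> supplies the outer half.\<close>

lemma I_root_add:
  assumes [measurable]: "f \<in> borel_measurable M" "g \<in> borel_measurable M" and h: "h \<in> space \<nu>"
  shows "ennreal_powr (I (\<lambda>\<omega>. f \<omega> + g \<omega>) h) (1 / p) \<le> ennreal_powr (I f h) (1 / p) + ennreal_powr (I g h) (1 / p)"
proof -
  have [measurable]: "h \<in> borel_measurable M" using h by (rule \<nu>_measurable)
  \<comment> \<open>With respect to the measure of density \<open>h\<close> the quantity
    \<open>I f h\<close> is the p-th power of an L^p norm.\<close>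
  define D where "D = density M (\<lambda>\<omega>. ennreal (h \<omega>))"
  have ID: "I f h = (\<integral>\<^sup>+\<omega>. ennreal_powr (ennreal \<bar>f \<omega>\<bar>) p \<partial>D)" if [measurable]: "f \<in> borel_measurable M" for f
    unfolding I_def D_def
    by (subst nn_integral_density) (auto simp: ennreal_powr_ennreal ennreal_mult'' mult.commute intro!: nn_integral_cong)
  have "ennreal_powr (I (\<lambda>\<omega>. f \<omega> + g \<omega>) h) (1 / p) \<le>
     ennreal_powr (\<integral>\<^sup>+\<omega>. ennreal_powr (ennreal \<bar>f \<omega>\<bar> + ennreal \<bar>g \<omega>\<bar>) p \<partial>D) (1 / p)"
    using p_pos
    by (subst ID) (auto intro!: ennreal_powr_mono nn_integral_mono ennreal_leI simp: ennreal_plus[symmetric] simp del: ennreal_plus)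
  also have "\<dots> \<le> ennreal_powr (I f h) (1 / p) + ennreal_powr (I g h) (1 / p)"
    unfolding ID[OF assms(1)] ID[OF assms(2)] by (rule nn_integral_Minkowski[OF p_ge_1]) (auto simp: D_def)
  finally show ?thesis .
qed

lemma Sf_add:
  assumes [measurable]: "f \<in> borel_measurable M" "g \<in> borel_measurable M"
  shows "Sf (\<lambda>\<omega>. f \<omega> + g \<omega>) \<le> Sf f + Sf g"
proof -
  have eq: "Sf f = ennreal_powr (\<integral>\<^sup>+h. ennreal_powr (ennreal_powr (I f h) (1 / p)) q \<partial>\<nu>) (1 / q)" for f
    unfolding Sf_def ennreal_powr_powr by simp
  have "Sf (\<lambda>\<omega>. f \<omega> + g \<omega>) \<le>
    ennreal_powr (\<integral>\<^sup>+h. ennreal_powr (ennreal_powr (I f h) (1 / p) + ennreal_powr (I g h) (1 / p)) q \<partial>\<nu>) (1 / q)"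
    unfolding eq[of "\<lambda>\<omega>. f \<omega> + g \<omega>"] using q_pos by (intro ennreal_powr_mono nn_integral_mono I_root_add assms) auto
  also have "\<dots> \<le> Sf f + Sf g"
    unfolding eq[of f] eq[of g] using p_ge_1 p_le_q by (intro nn_integral_Minkowski) auto
  finally show ?thesis .
qed

lemma Sf_scale:
  assumes [measurable]: "f \<in> borel_measurable M"
  shows "Sf (\<lambda>\<omega>. c * f \<omega>) = ennreal \<bar>c\<bar> * Sf f"
proof -
  have I: "I (\<lambda>\<omega>. c * f \<omega>) h = ennreal (\<bar>c\<bar> powr p) * I f h" if h: "h \<in> space \<nu>" for h
  proof -
    have [measurable]: "h \<in> borel_measurable M" using h by (rule \<nu>_measurable)
    show ?thesis unfolding I_def
      by (subst nn_integral_cmult[symmetric]) (auto simp: abs_mult powr_mult ennreal_mult'[symmetric] mult.assoc)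
  qed
  have "(\<integral>\<^sup>+h. ennreal_powr (I (\<lambda>\<omega>. c * f \<omega>) h) (q / p) \<partial>\<nu>) = (\<integral>\<^sup>+h. ennreal (\<bar>c\<bar> powr q) * ennreal_powr (I f h) (q / p) \<partial>\<nu>)"
    using p_pos by (intro nn_integral_cong) (simp add: I ennreal_powr_mult ennreal_powr_ennreal powr_powr)
  also have "\<dots> = ennreal (\<bar>c\<bar> powr q) * (\<integral>\<^sup>+h. ennreal_powr (I f h) (q / p) \<partial>\<nu>)"
    by (rule nn_integral_cmult) measurable
  finally show ?thesis
    unfolding Sf_def using q_pos by (simp add: ennreal_powr_mult ennreal_powr_ennreal powr_powr)
qed

lemma Sf_SUP:
  assumes f: "\<And>n. f n \<in> borel_measurable M"
    and lim: "AE \<omega> in M. incseq (\<lambda>n. \<bar>f n \<omega>\<bar>) \<and> (\<lambda>n. \<bar>f n \<omega>\<bar>) \<longlonglongrightarrow> \<bar>g \<omega>\<bar>"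
  shows "Sf g = (SUP n. Sf (f n))"
proof -
  note [measurable] = f
  have mono: "AE \<omega> in M. \<bar>f n \<omega>\<bar> \<le> \<bar>f (Suc n) \<omega>\<bar>" for n
    using lim by eventually_elim (auto simp: incseq_Suc_iff)
  have "(\<integral>\<^sup>+h. ennreal_powr (I g h) (q / p) \<partial>\<nu>) = (\<integral>\<^sup>+h. (SUP n. ennreal_powr (I (f n) h) (q / p)) \<partial>\<nu>)"
    using p_pos q_pos by (intro nn_integral_cong) (simp add: I_SUP[OF _ f lim] ennreal_powr_SUP)
  also have "\<dots> = (SUP n. \<integral>\<^sup>+h. ennreal_powr (I (f n) h) (q / p) \<partial>\<nu>)"
  proof (rule nn_integral_monotone_convergence_SUP_AE)
    show "AE h in \<nu>. ennreal_powr (I (f n) h) (q / p) \<le> ennreal_powr (I (f (Suc n)) h) (q / p)" for n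
      using p_pos q_pos by (intro AE_I2 ennreal_powr_mono I_mono mono) auto
  qed measurable
  finally show ?thesis unfolding Sf_def using q_pos by (simp add: ennreal_powr_SUP)
qed

lemma Sf_zero: "f \<in> borel_measurable M \<Longrightarrow> AE \<omega> in M. f \<omega> = 0 \<Longrightarrow> Sf f = 0"
  using Sf_mono[of f "\<lambda>_. 0"] Sf_scale[of "\<lambda>_. 0" 0] by simp

text \<open>Every \<open>h\<close> in the ball pairs with |f|^p to at most the p-th power of the
  norm of \<open>f\<close>, and averaging over a probability measure keeps this bound. So the
  inclusion of \<open>X\<close> has norm at most 1.\<close>

lemma Sf_le_nrm:
  assumes f: "f \<in> elems X"
  shows "Sf f \<le> ennreal (nrm X f)"
proof -
  have "(\<integral>\<^sup>+h. ennreal_powr (I f h) (q / p) \<partial>\<nu>) \<le> (\<integral>\<^sup>+h. ennreal (nrm X f powr q) \<partial>\<nu>)"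
  proof (rule nn_integral_mono)
    fix h assume "h \<in> space \<nu>"
    then have h: "h \<in> pos_ball M Xp" by (simp add: space_\<nu>)
    have "(\<integral>\<omega>. \<bar>f \<omega>\<bar> powr p * h \<omega> \<partial>M) \<le> nrm X f powr p"
      using Xp.pos_ball_le[OF h power_elem(1)[OF f]] power_elem(2)[OF f] by simp
    then have "(\<integral>\<omega>. \<bar>f \<omega>\<bar> powr p * h \<omega> \<partial>M) powr (q / p) \<le> (nrm X f powr p) powr (q / p)"
      using p_pos q_pos power_integral_nonneg[OF h] by (intro powr_mono2) auto
    then show "ennreal_powr (I f h) (q / p) \<le> ennreal (nrm X f powr q)"
      using p_pos power_integral_nonneg[OF h] by (simp add: I_eq[OF h f] ennreal_powr_ennreal powr_powr ennreal_leI)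
  qed
  also have "\<dots> = ennreal (nrm X f powr q)" by (simp add: \<nu>.emeasure_space_1)
  finally have "Sf f \<le> ennreal_powr (ennreal (nrm X f powr q)) (1 / q)"
    unfolding Sf_def using q_pos by (intro ennreal_powr_mono) auto
  then show ?thesis using q_pos nrm_nonneg[OF f] by (simp add: ennreal_powr_ennreal powr_powr)
qed

lemma S_elem_iff: "f \<in> elems S \<longleftrightarrow> f \<in> borel_measurable M \<and> Sf f < top"
  by (simp add: S_space_def)

lemma nrm_S: "nrm S f = enn2real (Sf f)"
  by (simp add: S_space_def)

lemma ennreal_nrm_S: "f \<in> elems S \<Longrightarrow> ennreal (nrm S f) = Sf f"
  by (simp add: S_elem_iff nrm_S)

lemma X_subset_S: "f \<in> elems X \<Longrightarrow> f \<in> elems S"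
  using Sf_le_nrm[of f] elem_measurable[of f] by (auto simp: S_elem_iff intro: le_less_trans)

lemma nrm_S_le: "f \<in> elems X \<Longrightarrow> nrm S f \<le> nrm X f"
  using Sf_le_nrm[of f] ennreal_nrm_S[OF X_subset_S, of f] nrm_nonneg[of f] by (metis ennreal_le_iff)

lemma S_powr:
  assumes f: "f \<in> elems X"
  shows "(\<integral>\<^sup>+h. ennreal ((\<integral>\<omega>. \<bar>f \<omega>\<bar> powr p * h \<omega> \<partial>M) powr (q / p)) \<partial>\<nu>) = ennreal (nrm S f powr q)"
proof -
  have "(\<integral>\<^sup>+h. ennreal ((\<integral>\<omega>. \<bar>f \<omega>\<bar> powr p * h \<omega> \<partial>M) powr (q / p)) \<partial>\<nu>) = (\<integral>\<^sup>+h. ennreal_powr (I f h) (q / p) \<partial>\<nu>)"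
    by (intro nn_integral_cong) (simp add: I_eq[OF _ f] space_\<nu> ennreal_powr_ennreal power_integral_nonneg)
  also have "\<dots> = ennreal_powr (Sf f) q" unfolding Sf_def using q_pos by (simp add: ennreal_powr_inverse')
  also have "\<dots> = ennreal (nrm S f powr q)"
    unfolding ennreal_nrm_S[OF X_subset_S[OF f], symmetric] by (rule ennreal_powr_ennreal) (simp add: nrm_S)
  finally show ?thesis .
qed

text \<open>The pointwise bound \<open>sum_le_mixed_sup\<close> is uniform in \<open>h\<close>, and
  its left side integrates to the sum of the q-th powers of the norms in S.\<close>

lemma sum_nrm_S_le:
  assumes r: "1 / r = ennreal (1 / p - 1 / q)" and x: "\<And>k. k < n \<Longrightarrow> x k \<in> elems X"
  shows "(\<Sum>k<n. nrm S (x k) powr q) \<le> mixed_sup X (ennreal p) r n x powr q"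
proof -
  define G where "G k h = (\<integral>\<omega>. \<bar>x k \<omega>\<bar> powr p * h \<omega> \<partial>M) powr (q / p)" for k h
  have Gm: "(\<lambda>h. ennreal (G k h)) \<in> borel_measurable \<nu>" if "k < n" for k
  proof -
    have [measurable]: "(\<lambda>h. \<integral>\<omega>. \<bar>x k \<omega>\<bar> powr p * h \<omega> \<partial>M) \<in> borel_measurable \<nu>"
      by (rule regular_borel_prob_continuous_measurable[OF regular Xp.continuous_eval[OF power_elem(1)[OF x[OF that]]]])
    show ?thesis unfolding G_def by measurable
  qed
  have "ennreal (\<Sum>k<n. nrm S (x k) powr q) = (\<Sum>k<n. \<integral>\<^sup>+h. ennreal (G k h) \<partial>\<nu>)"
  proof (subst sum_ennreal[symmetric])
    show "(\<Sum>k<n. ennreal (nrm S (x k) powr q)) = (\<Sum>k<n. \<integral>\<^sup>+h. ennreal (G k h) \<partial>\<nu>)"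
      unfolding G_def by (intro sum.cong refl S_powr[symmetric] x) simp
  qed simp
  also have "\<dots> = (\<integral>\<^sup>+h. (\<Sum>k<n. ennreal (G k h)) \<partial>\<nu>)" using Gm by (intro nn_integral_sum[symmetric]) auto
  also have "\<dots> \<le> (\<integral>\<^sup>+h. ennreal (mixed_sup X (ennreal p) r n x powr q) \<partial>\<nu>)"
  proof (rule nn_integral_mono)
    fix h assume h: "h \<in> space \<nu>"
    have "(\<Sum>k<n. G k h) \<le> mixed_sup X (ennreal p) r n x powr q"
      unfolding G_def using h unfolding space_\<nu> by (intro sum_le_mixed_sup p_le_q r x) auto
    then show "(\<Sum>k<n. ennreal (G k h)) \<le> ennreal (mixed_sup X (ennreal p) r n x powr q)"
      by (subst sum_ennreal) (auto simp: G_def intro: ennreal_leI)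
  qed
  also have "\<dots> = ennreal (mixed_sup X (ennreal p) r n x powr q)" by (simp add: \<nu>.emeasure_space_1)
  finally show ?thesis by (simp add: ennreal_le_iff)
qed

end

text \<open>The condition that turns the seminorm into a norm. It is imposed on \<open>X\<close>
  alone, because the truncations of any measurable function lie in \<open>X\<close> and recover the
  function.\<close>

locale faithful_S_measure = S_measure +
  assumes faithful: "f \<in> elems X \<Longrightarrow> S_functional M p q \<nu> f = 0 \<Longrightarrow> AE \<omega> in M. f \<omega> = 0"
begin

lemma Sf_faithful:
  assumes [measurable]: "f \<in> borel_measurable M" and 0: "Sf f = 0"
  shows "AE \<omega> in M. f \<omega> = 0"
proof -
  have "AE \<omega> in M. trunc n f \<omega> = 0" for n
  proof (rule faithful)
    show "trunc n f \<in> elems X" by (rule trunc_elem) measurable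
    show "Sf (trunc n f) = 0" using Sf_mono[of "trunc n f" f] abs_trunc_le 0 by simp
  qed
  then have "AE \<omega> in M. \<forall>n. trunc n f \<omega> = 0" by (simp add: AE_all_countable)
  then show ?thesis
  proof eventually_elim
    case (elim \<omega>)
    then show ?case using LIMSEQ_unique[OF trunc_tendsto[of f \<omega>]] by simp
  qed
qed

lemma S_function_lattice: "function_lattice M S"
proof
  show "f \<in> borel_measurable M" if "f \<in> elems S" for f using that by (simp add: S_elem_iff)
  show "(\<lambda>_. 0) \<in> elems S" using X_subset_S[OF zero_elem] .
next
  fix f g assume f: "f \<in> elems S" and g: "g \<in> elems S"
  then have [measurable]: "f \<in> borel_measurable M" "g \<in> borel_measurable M" by (auto simp: S_elem_iff)
  have le: "Sf (\<lambda>\<omega>. f \<omega> + g \<omega>) \<le> Sf f + Sf g" by (intro Sf_add) measurable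
  have fin: "Sf f < top" "Sf g < top" using f g by (auto simp: S_elem_iff)
  then have "Sf f + Sf g < top" by simp
  then show e: "(\<lambda>\<omega>. f \<omega> + g \<omega>) \<in> elems S" using le by (auto simp: S_elem_iff intro: le_less_trans)
  have "enn2real (Sf (\<lambda>\<omega>. f \<omega> + g \<omega>)) \<le> enn2real (Sf f + Sf g)" using le \<open>Sf f + Sf g < top\<close> by (rule enn2real_mono)
  also have "\<dots> = enn2real (Sf f) + enn2real (Sf g)" using fin by (rule enn2real_plus)
  finally show "nrm S (\<lambda>\<omega>. f \<omega> + g \<omega>) \<le> nrm S f + nrm S g" by (simp add: nrm_S)
next
  fix f and c :: real assume f: "f \<in> elems S"
  then have [measurable]: "f \<in> borel_measurable M" by (auto simp: S_elem_iff)
  show "(\<lambda>\<omega>. c * f \<omega>) \<in> elems S" using f by (auto simp: S_elem_iff Sf_scale ennreal_mult_less_top)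
  show "nrm S (\<lambda>\<omega>. c * f \<omega>) = \<bar>c\<bar> * nrm S f" by (simp add: nrm_S Sf_scale enn2real_mult)
next
  fix f assume f: "f \<in> elems S"
  then have [measurable]: "f \<in> borel_measurable M" by (auto simp: S_elem_iff)
  show "0 \<le> nrm S f" by (simp add: nrm_S)
  show "nrm S f = 0 \<longleftrightarrow> (AE \<omega> in M. f \<omega> = 0)"
    using Sf_faithful[of f] Sf_zero[of f] f by (auto simp: nrm_S S_elem_iff enn2real_eq_0_iff)
next
  fix f g assume f: "f \<in> borel_measurable M" and g: "g \<in> elems S" and le: "AE \<omega> in M. \<bar>f \<omega>\<bar> \<le> \<bar>g \<omega>\<bar>"
  have S: "Sf f \<le> Sf g" by (rule Sf_mono[OF le])
  have fin: "Sf g < top" using g by (simp add: S_elem_iff)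
  show "f \<in> elems S" using f S fin by (auto simp: S_elem_iff intro: le_less_trans)
  show "nrm S f \<le> nrm S g" unfolding nrm_S using S fin by (rule enn2real_mono)
qed

lemma S_fatou: "fatou_norm M S"
  unfolding fatou_norm_def
proof (intro allI impI)
  fix f :: "nat \<Rightarrow> 'a \<Rightarrow> real" and g c
  assume f: "\<forall>n. f n \<in> elems S" and g: "g \<in> borel_measurable M" and f0: "\<forall>n \<omega>. 0 \<le> f n \<omega>"
    and lim: "AE \<omega> in M. incseq (\<lambda>n. f n \<omega>) \<and> (\<lambda>n. f n \<omega>) \<longlonglongrightarrow> g \<omega>" and c: "\<forall>n. nrm S (f n) \<le> c"
  have c0: "0 \<le> c" using c f by (metis nrm_S enn2real_nonneg order_trans)
  have "Sf g = (SUP n. Sf (f n))"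
  proof (rule Sf_SUP)
    show "f n \<in> borel_measurable M" for n using f by (simp add: S_elem_iff)
    show "AE \<omega> in M. incseq (\<lambda>n. \<bar>f n \<omega>\<bar>) \<and> (\<lambda>n. \<bar>f n \<omega>\<bar>) \<longlonglongrightarrow> \<bar>g \<omega>\<bar>"
      using lim
    proof eventually_elim
      case (elim \<omega>)
      have "(\<lambda>n. \<bar>f n \<omega>\<bar>) \<longlonglongrightarrow> \<bar>g \<omega>\<bar>" using elim by (intro tendsto_rabs) auto
      moreover have "incseq (\<lambda>n. \<bar>f n \<omega>\<bar>)" using elim f0 by simp
      ultimately show ?case by (intro conjI)
    qed
  qed
  also have "\<dots> \<le> ennreal c"
  proof (rule SUP_least)
    fix n
    have "f n \<in> elems S" using f by simp
    from ennreal_nrm_S[OF this] show "Sf (f n) \<le> ennreal c" using c by (metis ennreal_leI)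
  qed
  finally have le: "Sf g \<le> ennreal c" .
  then have "g \<in> elems S" using g by (auto simp: S_elem_iff intro: le_less_trans)
  moreover have "nrm S g \<le> c" unfolding nrm_S using enn2real_mono[OF le] c0 by simp
  ultimately show "g \<in> elems S \<and> nrm S g \<le> c" ..
qed

text \<open>Convergence of integrals along decreasing sequences, used once over \<Omega> for almost
  every \<open>h\<close> and once more over the ball.\<close>

lemma S_order_continuous: "order_continuous M S"
  unfolding order_continuous_def
proof (intro allI impI)
  fix f :: "nat \<Rightarrow> 'a \<Rightarrow> real"
  assume f: "\<forall>n. f n \<in> elems S" and lim: "AE \<omega> in M. decseq (\<lambda>n. f n \<omega>) \<and> (\<lambda>n. f n \<omega>) \<longlonglongrightarrow> 0"
  have fm [measurable]: "f n \<in> borel_measurable M" for n using f by (simp add: S_elem_iff)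
  have lim': "AE \<omega> in M. decseq (\<lambda>n. \<bar>f n \<omega>\<bar>) \<and> (\<lambda>n. \<bar>f n \<omega>\<bar>) \<longlonglongrightarrow> 0"
    using lim
  proof eventually_elim
    case (elim \<omega>)
    have pos: "0 \<le> f n \<omega>" for n using elim by (auto intro: decseq_ge)
    then show ?case using elim by simp
  qed
  have mono: "AE \<omega> in M. \<bar>f (Suc n) \<omega>\<bar> \<le> \<bar>f n \<omega>\<bar>" for n
    using lim' by eventually_elim (auto simp: decseq_Suc_iff)
  \<comment> \<open>Decreasing sequences may be integrated termwise once the first integral is
    finite. This gives it for the outer integral and, for almost every \<open>h\<close>, for the
    inner one.\<close>
  have fin: "(\<integral>\<^sup>+h. ennreal_powr (I (f 0) h) (q / p) \<partial>\<nu>) < top"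
    using f q_pos unfolding S_elem_iff Sf_def by simp
  then have "AE h in \<nu>. ennreal_powr (I (f 0) h) (q / p) \<noteq> \<infinity>" by (intro nn_integral_PInf_AE) auto
  then have I0: "AE h in \<nu>. I (f 0) h < top" by eventually_elim (auto simp: less_top[symmetric])
  have "AE h in \<nu>. (INF n. ennreal_powr (I (f n) h) (q / p)) = 0"
    using I0
  proof (rule AE_mp, intro AE_I2 impI)
    fix h assume h: "h \<in> space \<nu>" and h0: "I (f 0) h < top"
    have [measurable]: "h \<in> borel_measurable M" using h by (rule \<nu>_measurable)
    have hpos: "AE \<omega> in M. 0 \<le> h \<omega>" using h unfolding space_\<nu> by (rule Xp.pos_ballD)
    have "(INF n. I (f n) h) = (\<integral>\<^sup>+\<omega>. (INF n. ennreal (\<bar>f n \<omega>\<bar> powr p * h \<omega>)) \<partial>M)"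
      unfolding I_def
    proof (rule nn_integral_monotone_convergence_INF_AE[symmetric])
      show "AE \<omega> in M. ennreal (\<bar>f (Suc n) \<omega>\<bar> powr p * h \<omega>) \<le> ennreal (\<bar>f n \<omega>\<bar> powr p * h \<omega>)" for n
        using mono[of n] hpos by eventually_elim (use p_pos in \<open>auto intro!: ennreal_leI mult_right_mono powr_mono2\<close>)
      show "(\<integral>\<^sup>+\<omega>. ennreal (\<bar>f 0 \<omega>\<bar> powr p * h \<omega>) \<partial>M) < \<infinity>" using h0 by (simp add: I_def)
    qed measurable
    also have "\<dots> = (\<integral>\<^sup>+\<omega>. 0 \<partial>M)"
    proof (rule nn_integral_cong_AE, use lim' hpos in eventually_elim)
      case (elim \<omega>)
      have "(\<lambda>n. \<bar>f n \<omega>\<bar> powr p) \<longlonglongrightarrow> 0"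
        using elim p_pos tendsto_zero_powrI[of "\<lambda>n. \<bar>f n \<omega>\<bar>" sequentially "\<lambda>_. p" p] by simp
      then have "(\<lambda>n. ennreal (\<bar>f n \<omega>\<bar> powr p * h \<omega>)) \<longlonglongrightarrow> ennreal (0 * h \<omega>)"
        by (intro tendsto_ennrealI tendsto_mult tendsto_const)
      moreover have "(\<lambda>n. ennreal (\<bar>f n \<omega>\<bar> powr p * h \<omega>)) \<longlonglongrightarrow> (INF n. ennreal (\<bar>f n \<omega>\<bar> powr p * h \<omega>))"
        using elim p_pos by (intro LIMSEQ_INF) (auto simp: decseq_def intro!: ennreal_leI mult_right_mono powr_mono2)
      ultimately show ?case using LIMSEQ_unique by fastforce
    qed
    finally have "(INF n. I (f n) h) = 0" by simp
    then show "(INF n. ennreal_powr (I (f n) h) (q / p)) = 0"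
      using ennreal_powr_INF[of "q / p" "\<lambda>n. I (f n) h" UNIV] p_pos q_pos by simp
  qed
  then have "(\<integral>\<^sup>+h. (INF n. ennreal_powr (I (f n) h) (q / p)) \<partial>\<nu>) = 0"
    by (subst nn_integral_0_iff_AE) auto
  moreover have "(\<integral>\<^sup>+h. (INF n. ennreal_powr (I (f n) h) (q / p)) \<partial>\<nu>) = (INF n. \<integral>\<^sup>+h. ennreal_powr (I (f n) h) (q / p) \<partial>\<nu>)"
  proof (rule nn_integral_monotone_convergence_INF_AE)
    show "AE h in \<nu>. ennreal_powr (I (f (Suc n)) h) (q / p) \<le> ennreal_powr (I (f n) h) (q / p)" for n
      using p_pos q_pos by (intro AE_I2 ennreal_powr_mono I_mono mono) auto
    show "(\<integral>\<^sup>+h. ennreal_powr (I (f 0) h) (q / p) \<partial>\<nu>) < \<infinity>" using fin by simp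
  qed measurable
  ultimately have INF0: "(INF n. Sf (f n)) = 0"
    unfolding Sf_def using q_pos ennreal_powr_INF[of "1 / q" "\<lambda>n. \<integral>\<^sup>+h. ennreal_powr (I (f n) h) (q / p) \<partial>\<nu>" UNIV] by simp
  have "decseq (\<lambda>n. Sf (f n))" by (intro decseq_SucI Sf_mono mono)
  then have "(\<lambda>n. Sf (f n)) \<longlonglongrightarrow> ennreal 0" using LIMSEQ_INF[of "\<lambda>n. Sf (f n)"] INF0 by simp
  then have "(\<lambda>n. enn2real (Sf (f n))) \<longlonglongrightarrow> 0" by (rule tendsto_enn2real) simp
  then show "(\<lambda>n. nrm S (f n)) \<longlonglongrightarrow> 0" by (simp add: nrm_S)
qed

lemma S_order_continuous_lattice: "order_continuous_lattice M S"
proof -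
  interpret S: function_lattice M S by (rule S_function_lattice)
  show ?thesis
  proof
    show "\<exists>u\<in>elems S. \<forall>\<omega>. 0 < u \<omega>" by (intro bexI[OF _ X_subset_S[OF wu_elem]] allI wu_pos)
    show "order_continuous M S" by (rule S_order_continuous)
  qed
qed

lemma S_full_support: "full_support M S"
  unfolding full_support_def
proof (intro ballI impI notI)
  fix A assume A: "A \<in> sets M" "emeasure M A > 0" and 0: "\<forall>f\<in>elems S. AE \<omega> in M. \<omega> \<in> A \<longrightarrow> f \<omega> = 0"
  have "AE \<omega> in M. \<omega> \<in> A \<longrightarrow> wu \<omega> = 0" using 0 X_subset_S[OF wu_elem] by blast
  then have "AE \<omega> in M. \<omega> \<notin> A"
  proof eventually_elim
    case (elim \<omega>)
    then show ?case using wu_pos[of \<omega>] by auto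
  qed
  then have "emeasure M A = 0" using A(1) by (subst (asm) AE_iff_measurable[where N = A]) (auto dest: sets.sets_into_space)
  then show False using A(2) by simp
qed

lemma S_banach: "banach_function_lattice M S"
  unfolding banach_function_lattice_iff
  using S_function_lattice S_full_support function_lattice.fatou_norm_imp_complete[OF S_function_lattice S_fatou] by simp

end

section \<open>Extension and separation\<close>

lemma sum_lessThan_add: "(\<Sum>k<n + m. f k) = (\<Sum>k<n. f k) + (\<Sum>k<m. f (n + k))" for f :: "nat \<Rightarrow> real"
  by (induction m) (auto simp: add.assoc)

text \<open>The power composed with the absolute value is continuous on the whole line, and for
  nonnegative functions the absolute value changes nothing.\<close>

lemma continuous_map_powr:
  assumes f: "continuous_map \<tau> euclideanreal f" and c: "0 < c" and pos: "\<And>x. x \<in> topspace \<tau> \<Longrightarrow> 0 \<le> f x"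
  shows "continuous_map \<tau> euclideanreal (\<lambda>x. f x powr c)"
proof -
  have "continuous_on UNIV (\<lambda>t::real. \<bar>t\<bar> powr c)"
    using c by (intro continuous_on_powr' continuous_intros) auto
  then have "continuous_map euclideanreal euclideanreal (\<lambda>t. \<bar>t\<bar> powr c)" by simp
  then have "continuous_map \<tau> euclideanreal ((\<lambda>t. \<bar>t\<bar> powr c) \<circ> f)" by (rule continuous_map_compose[OF f])
  then show ?thesis by (rule continuous_map_eq) (simp add: pos)
qed

section \<open>Extension of operators from a dense subspace\<close>

context order_continuous_lattice
begin

text \<open>The usual extension by continuity, complicated by representatives: limits are determined
  only almost everywhere, so each value is a chosen limit, and linearity follows almost everywhere
  from uniqueness of limits.\<close>

lemma extension_by_density:
  fixes T :: "('a \<Rightarrow> real) \<Rightarrow> ('a \<Rightarrow> real)"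
  assumes W: "function_lattice M W" "norm_complete W"
    and E: "\<And>f. f \<in> E \<Longrightarrow> f \<in> elems X"
      "\<And>f g. f \<in> E \<Longrightarrow> g \<in> E \<Longrightarrow> (\<lambda>\<omega>. f \<omega> + g \<omega>) \<in> E"
      "\<And>f c. f \<in> E \<Longrightarrow> (\<lambda>\<omega>. c * f \<omega>) \<in> E"
    and dense: "\<And>f. f \<in> elems X \<Longrightarrow> \<exists>x. (\<forall>n::nat. x n \<in> E) \<and> (\<lambda>n. nrm X (\<lambda>\<omega>. f \<omega> - x n \<omega>)) \<longlonglongrightarrow> 0"
    and T: "\<And>f. f \<in> E \<Longrightarrow> T f \<in> elems W"
      "\<And>f g. f \<in> E \<Longrightarrow> g \<in> E \<Longrightarrow> AE \<omega> in M. T (\<lambda>\<omega>. f \<omega> + g \<omega>) \<omega> = T f \<omega> + T g \<omega>"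
      "\<And>f c. f \<in> E \<Longrightarrow> AE \<omega> in M. T (\<lambda>\<omega>. c * f \<omega>) \<omega> = c * T f \<omega>"
      "\<And>f. f \<in> E \<Longrightarrow> nrm W (T f) \<le> K * nrm X f"
  shows "\<exists>T0. bounded_operator M X W T0 \<and> (\<forall>f\<in>E. AE \<omega> in M. T0 f \<omega> = T f \<omega>)"
proof -
  interpret W: function_lattice M W by (rule W(1))
  have Tdiff: "nrm W (\<lambda>\<omega>. T f \<omega> - T g \<omega>) \<le> K * nrm X (\<lambda>\<omega>. f \<omega> - g \<omega>)" if f: "f \<in> E" and g: "g \<in> E" for f g
  proof -
    have m: "(\<lambda>\<omega>. (-1) * g \<omega>) \<in> E" by (rule E(3)[OF g])
    have d: "(\<lambda>\<omega>. f \<omega> + (-1) * g \<omega>) \<in> E" by (rule E(2)[OF f m])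
    have "AE \<omega> in M. T f \<omega> - T g \<omega> = T (\<lambda>\<omega>. f \<omega> + (-1) * g \<omega>) \<omega>"
      using T(2)[OF f m] T(3)[OF g, of "-1"] by eventually_elim simp
    then have "nrm W (\<lambda>\<omega>. T f \<omega> - T g \<omega>) = nrm W (T (\<lambda>\<omega>. f \<omega> + (-1) * g \<omega>))"
      by (intro W.nrm_cong_AE W.diff_elem T(1) f g d)
    also have "\<dots> \<le> K * nrm X (\<lambda>\<omega>. f \<omega> + (-1) * g \<omega>)" by (rule T(4)[OF d])
    finally show ?thesis by simp
  qed
  \<comment> \<open>Convergence is demanded along every approximating sequence, so that later the
    limit may be computed along the convenient one, such as a sum of two sequences.\<close>
  define L where "L f w \<longleftrightarrow> w \<in> elems W \<and> (\<forall>x. (\<forall>n. x n \<in> E) \<longrightarrow>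
    (\<lambda>n. nrm X (\<lambda>\<omega>. f \<omega> - x n \<omega>)) \<longlonglongrightarrow> 0 \<longrightarrow> (\<lambda>n. nrm W (\<lambda>\<omega>. T (x n) \<omega> - w \<omega>)) \<longlonglongrightarrow> 0)" for f w
  have LD: "(\<lambda>n. nrm W (\<lambda>\<omega>. T (x n) \<omega> - w \<omega>)) \<longlonglongrightarrow> 0"
    if "L f w" "\<And>n. x n \<in> E" "(\<lambda>n. nrm X (\<lambda>\<omega>. f \<omega> - x n \<omega>)) \<longlonglongrightarrow> 0" for f w x
    using that unfolding L_def by simp
  \<comment> \<open>The sign of \<open>K\<close> is unknown, so estimates that multiply inequalities
    by it pass to its absolute value. The middle point \<open>h\<close> serves as the common limit
    of two approximating sequences.\<close>
  have Kabs: "nrm W (\<lambda>\<omega>. T f \<omega> - T g \<omega>) \<le> \<bar>K\<bar> * (nrm X (\<lambda>\<omega>. h \<omega> - f \<omega>) + nrm X (\<lambda>\<omega>. h \<omega> - g \<omega>))"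
    if f: "f \<in> E" and g: "g \<in> E" and h: "h \<in> elems X" for f g h
  proof -
    have "nrm X (\<lambda>\<omega>. (h \<omega> - g \<omega>) - (h \<omega> - f \<omega>)) \<le> nrm X (\<lambda>\<omega>. h \<omega> - g \<omega>) + nrm X (\<lambda>\<omega>. h \<omega> - f \<omega>)"
      by (intro nrm_diff diff_elem h E(1)[OF f] E(1)[OF g])
    then have 1: "nrm X (\<lambda>\<omega>. f \<omega> - g \<omega>) \<le> nrm X (\<lambda>\<omega>. h \<omega> - f \<omega>) + nrm X (\<lambda>\<omega>. h \<omega> - g \<omega>)" by simp
    have "K * nrm X (\<lambda>\<omega>. f \<omega> - g \<omega>) \<le> \<bar>K\<bar> * nrm X (\<lambda>\<omega>. f \<omega> - g \<omega>)"
      using nrm_nonneg[OF diff_elem[OF E(1)[OF f] E(1)[OF g]]] by (intro mult_right_mono) auto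
    also have "\<dots> \<le> \<bar>K\<bar> * (nrm X (\<lambda>\<omega>. h \<omega> - f \<omega>) + nrm X (\<lambda>\<omega>. h \<omega> - g \<omega>))" using 1 by (intro mult_left_mono) auto
    finally show ?thesis using Tdiff[OF f g] by linarith
  qed
  have Lex: "\<exists>w. L f w" if f: "f \<in> elems X" for f
  proof -
    obtain x where x: "\<And>n. x n \<in> E" "(\<lambda>n. nrm X (\<lambda>\<omega>. f \<omega> - x n \<omega>)) \<longlonglongrightarrow> 0"
      using dense[OF f] by auto
    have nn: "0 \<le> nrm X (\<lambda>\<omega>. f \<omega> - x n \<omega>)" for n by (rule nrm_nonneg[OF diff_elem[OF f E(1)[OF x(1)]]])
    have cauchy: "\<forall>e>0. \<exists>N::nat. \<forall>m\<ge>N. \<forall>n\<ge>N. nrm W (\<lambda>\<omega>. T (x m) \<omega> - T (x n) \<omega>) < e"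
    proof (intro allI impI)
      fix e :: real assume "0 < e"
      then have "0 < e / (2 * (\<bar>K\<bar> + 1))" by simp
      from order_tendstoD(2)[OF x(2) this] obtain N
        where N: "\<And>n. n \<ge> N \<Longrightarrow> nrm X (\<lambda>\<omega>. f \<omega> - x n \<omega>) < e / (2 * (\<bar>K\<bar> + 1))"
        by (auto simp: eventually_sequentially)
      have "nrm W (\<lambda>\<omega>. T (x m) \<omega> - T (x n) \<omega>) < e" if "m \<ge> N" "n \<ge> N" for m n
      proof -
        have s: "nrm X (\<lambda>\<omega>. f \<omega> - x m \<omega>) + nrm X (\<lambda>\<omega>. f \<omega> - x n \<omega>) < e / (\<bar>K\<bar> + 1)"
          using N[OF that(1)] N[OF that(2)] by (simp add: field_simps)
        have "nrm W (\<lambda>\<omega>. T (x m) \<omega> - T (x n) \<omega>) \<le> \<bar>K\<bar> * (nrm X (\<lambda>\<omega>. f \<omega> - x m \<omega>) + nrm X (\<lambda>\<omega>. f \<omega> - x n \<omega>))"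
          by (rule Kabs[OF x(1) x(1) f])
        also have "\<dots> \<le> (\<bar>K\<bar> + 1) * (nrm X (\<lambda>\<omega>. f \<omega> - x m \<omega>) + nrm X (\<lambda>\<omega>. f \<omega> - x n \<omega>))"
          using nn by (intro mult_right_mono) auto
        also have "\<dots> < (\<bar>K\<bar> + 1) * (e / (\<bar>K\<bar> + 1))" using s by (intro mult_strict_left_mono) auto
        also have "\<dots> = e" by simp
        finally show ?thesis .
      qed
      then show "\<exists>N::nat. \<forall>m\<ge>N. \<forall>n\<ge>N. nrm W (\<lambda>\<omega>. T (x m) \<omega> - T (x n) \<omega>) < e" by blast
    qed
    have "\<exists>w\<in>elems W. (\<lambda>n. nrm W (\<lambda>\<omega>. T (x n) \<omega> - w \<omega>)) \<longlonglongrightarrow> 0"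
      using W(2)[unfolded norm_complete_def, rule_format, of "\<lambda>n. T (x n)"] T(1)[OF x(1)] cauchy by simp
    then obtain w where w: "w \<in> elems W" "(\<lambda>n. nrm W (\<lambda>\<omega>. T (x n) \<omega> - w \<omega>)) \<longlonglongrightarrow> 0" by blast
    have "L f w"
      unfolding L_def
    proof (intro conjI allI impI w(1))
      fix y assume y: "\<forall>n. y n \<in> E" "(\<lambda>n. nrm X (\<lambda>\<omega>. f \<omega> - y n \<omega>)) \<longlonglongrightarrow> 0"
      have ye: "y n \<in> E" for n using y by simp
      have lim: "(\<lambda>n. \<bar>K\<bar> * (nrm X (\<lambda>\<omega>. f \<omega> - y n \<omega>) + nrm X (\<lambda>\<omega>. f \<omega> - x n \<omega>)) + nrm W (\<lambda>\<omega>. T (x n) \<omega> - w \<omega>))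
        \<longlonglongrightarrow> \<bar>K\<bar> * (0 + 0) + 0" by (intro tendsto_intros y(2) x(2) w(2))
      show "(\<lambda>n. nrm W (\<lambda>\<omega>. T (y n) \<omega> - w \<omega>)) \<longlonglongrightarrow> 0"
      proof (rule tendsto_sandwich[OF _ _ tendsto_const])
        show "\<forall>\<^sub>F n in sequentially. 0 \<le> nrm W (\<lambda>\<omega>. T (y n) \<omega> - w \<omega>)"
          by (intro always_eventually allI W.nrm_nonneg W.diff_elem T(1) ye w(1))
        show "\<forall>\<^sub>F n in sequentially. nrm W (\<lambda>\<omega>. T (y n) \<omega> - w \<omega>) \<le>
          \<bar>K\<bar> * (nrm X (\<lambda>\<omega>. f \<omega> - y n \<omega>) + nrm X (\<lambda>\<omega>. f \<omega> - x n \<omega>)) + nrm W (\<lambda>\<omega>. T (x n) \<omega> - w \<omega>)"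
        proof (intro always_eventually allI)
          fix n
          have "nrm W (\<lambda>\<omega>. (T (y n) \<omega> - T (x n) \<omega>) + (T (x n) \<omega> - w \<omega>)) \<le>
            nrm W (\<lambda>\<omega>. T (y n) \<omega> - T (x n) \<omega>) + nrm W (\<lambda>\<omega>. T (x n) \<omega> - w \<omega>)"
            by (intro W.nrm_add W.diff_elem T(1) ye x(1) w(1))
          then show "nrm W (\<lambda>\<omega>. T (y n) \<omega> - w \<omega>) \<le>
            \<bar>K\<bar> * (nrm X (\<lambda>\<omega>. f \<omega> - y n \<omega>) + nrm X (\<lambda>\<omega>. f \<omega> - x n \<omega>)) + nrm W (\<lambda>\<omega>. T (x n) \<omega> - w \<omega>)"
            using Kabs[OF ye[of n] x(1)[of n] f] by simp
        qed
        show "(\<lambda>n. \<bar>K\<bar> * (nrm X (\<lambda>\<omega>. f \<omega> - y n \<omega>) + nrm X (\<lambda>\<omega>. f \<omega> - x n \<omega>)) + nrm W (\<lambda>\<omega>. T (x n) \<omega> - w \<omega>))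
          \<longlonglongrightarrow> 0" using lim by simp
      qed
    qed
    then show ?thesis by blast
  qed
  define T0 where "T0 f = (SOME w. L f w)" for f
  have LT0: "L f (T0 f)" if "f \<in> elems X" for f unfolding T0_def using Lex[OF that] by (rule someI_ex)
  have T0W: "T0 f \<in> elems W" if "f \<in> elems X" for f using LT0[OF that] unfolding L_def by simp
  have unique: "AE \<omega> in M. v \<omega> = w \<omega>"
    if v: "v \<in> elems W" and w: "w \<in> elems W" and u: "\<And>n. u n \<in> elems W"
      and lv: "(\<lambda>n. nrm W (\<lambda>\<omega>. u n \<omega> - v \<omega>)) \<longlonglongrightarrow> 0" and lw: "(\<lambda>n. nrm W (\<lambda>\<omega>. u n \<omega> - w \<omega>)) \<longlonglongrightarrow> 0"
    for v w and u :: "nat \<Rightarrow> 'a \<Rightarrow> real"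
  proof -
    have d: "(\<lambda>\<omega>. v \<omega> - w \<omega>) \<in> elems W" by (rule W.diff_elem[OF v w])
    have "(\<lambda>n. nrm W (\<lambda>\<omega>. u n \<omega> - w \<omega>) + nrm W (\<lambda>\<omega>. u n \<omega> - v \<omega>)) \<longlonglongrightarrow> 0 + 0" by (intro tendsto_intros lv lw)
    moreover have "nrm W (\<lambda>\<omega>. v \<omega> - w \<omega>) \<le> nrm W (\<lambda>\<omega>. u n \<omega> - w \<omega>) + nrm W (\<lambda>\<omega>. u n \<omega> - v \<omega>)" for n
    proof -
      have "nrm W (\<lambda>\<omega>. (u n \<omega> - w \<omega>) - (u n \<omega> - v \<omega>)) \<le> nrm W (\<lambda>\<omega>. u n \<omega> - w \<omega>) + nrm W (\<lambda>\<omega>. u n \<omega> - v \<omega>)"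
        by (intro W.nrm_diff W.diff_elem u v w)
      then show ?thesis by simp
    qed
    ultimately have "nrm W (\<lambda>\<omega>. v \<omega> - w \<omega>) \<le> 0" by (intro LIMSEQ_le_const) auto
    then have "nrm W (\<lambda>\<omega>. v \<omega> - w \<omega>) = 0" using W.nrm_nonneg[OF d] by simp
    then show ?thesis using W.nrm_eq_0_iff[OF d] by simp
  qed
  have T0E: "AE \<omega> in M. T0 f \<omega> = T f \<omega>" if f: "f \<in> E" for f
  proof (rule unique[of "T0 f" "T f" "\<lambda>_. T f"])
    have z: "(\<lambda>n::nat. nrm X (\<lambda>\<omega>. f \<omega> - f \<omega>)) \<longlonglongrightarrow> 0" using nrm_zero by simp
    show "(\<lambda>n. nrm W (\<lambda>\<omega>. T f \<omega> - T0 f \<omega>)) \<longlonglongrightarrow> 0" by (rule LD[OF LT0[OF E(1)[OF f]] f z])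
    show "(\<lambda>n. nrm W (\<lambda>\<omega>. T f \<omega> - T f \<omega>)) \<longlonglongrightarrow> 0" using W.nrm_zero by simp
  qed (intro T0W T(1) E(1) f)+
  have T0b: "nrm W (T0 f) \<le> \<bar>K\<bar> * nrm X f" if f: "f \<in> elems X" for f
  proof -
    obtain x where x: "\<And>n. x n \<in> E" "(\<lambda>n. nrm X (\<lambda>\<omega>. f \<omega> - x n \<omega>)) \<longlonglongrightarrow> 0"
      using dense[OF f] by auto
    have "(\<lambda>n. nrm W (\<lambda>\<omega>. T (x n) \<omega> - T0 f \<omega>) + \<bar>K\<bar> * (nrm X (\<lambda>\<omega>. f \<omega> - x n \<omega>) + nrm X f)) \<longlonglongrightarrow> 0 + \<bar>K\<bar> * (0 + nrm X f)"
      by (intro tendsto_intros x(2) LD[OF LT0[OF f] x])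
    moreover have "nrm W (T0 f) \<le> nrm W (\<lambda>\<omega>. T (x n) \<omega> - T0 f \<omega>) + \<bar>K\<bar> * (nrm X (\<lambda>\<omega>. f \<omega> - x n \<omega>) + nrm X f)" for n
    proof -
      have xe: "x n \<in> elems X" by (rule E(1)[OF x(1)])
      have "nrm W (T0 f) \<le> nrm W (\<lambda>\<omega>. T0 f \<omega> - T (x n) \<omega>) + nrm W (T (x n))"
        by (intro W.nrm_le_diff T0W f T(1) x(1))
      also have "nrm W (\<lambda>\<omega>. T0 f \<omega> - T (x n) \<omega>) = nrm W (\<lambda>\<omega>. T (x n) \<omega> - T0 f \<omega>)"
        by (intro W.nrm_diff_commute T0W f T(1) x(1))
      also have "nrm W (T (x n)) \<le> \<bar>K\<bar> * nrm X (x n)"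
        using T(4)[OF x(1), of n] mult_right_mono[OF abs_ge_self[of K] nrm_nonneg[OF xe]] by linarith
      also have "\<dots> \<le> \<bar>K\<bar> * (nrm X (\<lambda>\<omega>. f \<omega> - x n \<omega>) + nrm X f)"
        using nrm_le_diff[OF xe f] nrm_diff_commute[OF xe f] by (intro mult_left_mono) auto
      finally show ?thesis by simp
    qed
    ultimately have "nrm W (T0 f) \<le> 0 + \<bar>K\<bar> * (0 + nrm X f)" by (intro LIMSEQ_le_const) auto
    then show ?thesis by simp
  qed
  have T0add: "AE \<omega> in M. T0 (\<lambda>\<omega>. f \<omega> + g \<omega>) \<omega> = T0 f \<omega> + T0 g \<omega>" if f: "f \<in> elems X" and g: "g \<in> elems X" for f g
  proof -
    obtain x where x: "\<And>n. x n \<in> E" "(\<lambda>n. nrm X (\<lambda>\<omega>. f \<omega> - x n \<omega>)) \<longlonglongrightarrow> 0"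
      using dense[OF f] by auto
    obtain y where y: "\<And>n. y n \<in> E" "(\<lambda>n. nrm X (\<lambda>\<omega>. g \<omega> - y n \<omega>)) \<longlonglongrightarrow> 0"
      using dense[OF g] by auto
    define z where "z n = (\<lambda>\<omega>. x n \<omega> + y n \<omega>)" for n
    have zE: "z n \<in> E" for n unfolding z_def by (rule E(2)[OF x(1) y(1)])
    have zl: "(\<lambda>n. nrm X (\<lambda>\<omega>. (f \<omega> + g \<omega>) - z n \<omega>)) \<longlonglongrightarrow> 0"
    proof (rule tendsto_sandwich[OF _ _ tendsto_const])
      show "\<forall>\<^sub>F n in sequentially. 0 \<le> nrm X (\<lambda>\<omega>. (f \<omega> + g \<omega>) - z n \<omega>)"
        by (intro always_eventually allI nrm_nonneg diff_elem add_elem f g E(1) zE)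
      show "\<forall>\<^sub>F n in sequentially. nrm X (\<lambda>\<omega>. (f \<omega> + g \<omega>) - z n \<omega>) \<le> nrm X (\<lambda>\<omega>. f \<omega> - x n \<omega>) + nrm X (\<lambda>\<omega>. g \<omega> - y n \<omega>)"
      proof (intro always_eventually allI)
        fix n
        have "nrm X (\<lambda>\<omega>. (f \<omega> - x n \<omega>) + (g \<omega> - y n \<omega>)) \<le> nrm X (\<lambda>\<omega>. f \<omega> - x n \<omega>) + nrm X (\<lambda>\<omega>. g \<omega> - y n \<omega>)"
          by (intro nrm_add diff_elem f g E(1) x(1) y(1))
        moreover have "(\<lambda>\<omega>. (f \<omega> - x n \<omega>) + (g \<omega> - y n \<omega>)) = (\<lambda>\<omega>. (f \<omega> + g \<omega>) - z n \<omega>)" by (simp add: z_def fun_eq_iff)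
        ultimately show "nrm X (\<lambda>\<omega>. (f \<omega> + g \<omega>) - z n \<omega>) \<le> nrm X (\<lambda>\<omega>. f \<omega> - x n \<omega>) + nrm X (\<lambda>\<omega>. g \<omega> - y n \<omega>)" by simp
      qed
      show "(\<lambda>n. nrm X (\<lambda>\<omega>. f \<omega> - x n \<omega>) + nrm X (\<lambda>\<omega>. g \<omega> - y n \<omega>)) \<longlonglongrightarrow> 0"
        using tendsto_add[OF x(2) y(2)] by simp
    qed
    show ?thesis
    proof (rule unique[of "T0 (\<lambda>\<omega>. f \<omega> + g \<omega>)" "\<lambda>\<omega>. T0 f \<omega> + T0 g \<omega>" "\<lambda>n. T (z n)"])
      show "(\<lambda>n. nrm W (\<lambda>\<omega>. T (z n) \<omega> - T0 (\<lambda>\<omega>. f \<omega> + g \<omega>) \<omega>)) \<longlonglongrightarrow> 0"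
        by (rule LD[OF LT0[OF add_elem[OF f g]] zE zl])
      show "(\<lambda>n. nrm W (\<lambda>\<omega>. T (z n) \<omega> - (T0 f \<omega> + T0 g \<omega>))) \<longlonglongrightarrow> 0"
      proof (rule tendsto_sandwich[OF _ _ tendsto_const])
        show "\<forall>\<^sub>F n in sequentially. 0 \<le> nrm W (\<lambda>\<omega>. T (z n) \<omega> - (T0 f \<omega> + T0 g \<omega>))"
          by (intro always_eventually allI W.nrm_nonneg W.diff_elem W.add_elem T0W f g T(1) zE)
        show "\<forall>\<^sub>F n in sequentially. nrm W (\<lambda>\<omega>. T (z n) \<omega> - (T0 f \<omega> + T0 g \<omega>)) \<le>
          nrm W (\<lambda>\<omega>. T (x n) \<omega> - T0 f \<omega>) + nrm W (\<lambda>\<omega>. T (y n) \<omega> - T0 g \<omega>)"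
        proof (intro always_eventually allI)
          fix n
          have "AE \<omega> in M. T (z n) \<omega> - (T0 f \<omega> + T0 g \<omega>) = (T (x n) \<omega> - T0 f \<omega>) + (T (y n) \<omega> - T0 g \<omega>)"
            using T(2)[OF x(1)[of n] y(1)[of n]] unfolding z_def by eventually_elim simp
          then have "nrm W (\<lambda>\<omega>. T (z n) \<omega> - (T0 f \<omega> + T0 g \<omega>)) = nrm W (\<lambda>\<omega>. (T (x n) \<omega> - T0 f \<omega>) + (T (y n) \<omega> - T0 g \<omega>))"
            by (intro W.nrm_cong_AE W.diff_elem W.add_elem T0W f g T(1) zE x(1) y(1))
          also have "\<dots> \<le> nrm W (\<lambda>\<omega>. T (x n) \<omega> - T0 f \<omega>) + nrm W (\<lambda>\<omega>. T (y n) \<omega> - T0 g \<omega>)"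
            by (intro W.nrm_add W.diff_elem T0W f g T(1) x(1) y(1))
          finally show "nrm W (\<lambda>\<omega>. T (z n) \<omega> - (T0 f \<omega> + T0 g \<omega>)) \<le>
            nrm W (\<lambda>\<omega>. T (x n) \<omega> - T0 f \<omega>) + nrm W (\<lambda>\<omega>. T (y n) \<omega> - T0 g \<omega>)" .
        qed
        show "(\<lambda>n. nrm W (\<lambda>\<omega>. T (x n) \<omega> - T0 f \<omega>) + nrm W (\<lambda>\<omega>. T (y n) \<omega> - T0 g \<omega>)) \<longlonglongrightarrow> 0"
          using tendsto_add[OF LD[OF LT0[OF f] x] LD[OF LT0[OF g] y]] by simp
      qed
    qed (intro T0W add_elem W.add_elem f g T(1) zE)+
  qed
  have T0sc: "AE \<omega> in M. T0 (\<lambda>\<omega>. c * f \<omega>) \<omega> = c * T0 f \<omega>" if f: "f \<in> elems X" for f c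
  proof -
    obtain x where x: "\<And>n. x n \<in> E" "(\<lambda>n. nrm X (\<lambda>\<omega>. f \<omega> - x n \<omega>)) \<longlonglongrightarrow> 0"
      using dense[OF f] by auto
    define z where "z n = (\<lambda>\<omega>. c * x n \<omega>)" for n
    have zE: "z n \<in> E" for n unfolding z_def by (rule E(3)[OF x(1)])
    have "nrm X (\<lambda>\<omega>. c * f \<omega> - z n \<omega>) = \<bar>c\<bar> * nrm X (\<lambda>\<omega>. f \<omega> - x n \<omega>)" for n
      using nrm_scale[OF diff_elem[OF f E(1)[OF x(1)[of n]]], of c] by (simp add: z_def right_diff_distrib)
    then have zl: "(\<lambda>n. nrm X (\<lambda>\<omega>. c * f \<omega> - z n \<omega>)) \<longlonglongrightarrow> 0" using tendsto_mult_right_zero[OF x(2), of "\<bar>c\<bar>"] by simp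
    show ?thesis
    proof (rule unique[of "T0 (\<lambda>\<omega>. c * f \<omega>)" "\<lambda>\<omega>. c * T0 f \<omega>" "\<lambda>n. T (z n)"])
      show "(\<lambda>n. nrm W (\<lambda>\<omega>. T (z n) \<omega> - T0 (\<lambda>\<omega>. c * f \<omega>) \<omega>)) \<longlonglongrightarrow> 0"
        by (rule LD[OF LT0[OF scale_elem[OF f]] zE zl])
      have "nrm W (\<lambda>\<omega>. T (z n) \<omega> - c * T0 f \<omega>) = \<bar>c\<bar> * nrm W (\<lambda>\<omega>. T (x n) \<omega> - T0 f \<omega>)" for n
      proof -
        have "AE \<omega> in M. T (z n) \<omega> - c * T0 f \<omega> = c * (T (x n) \<omega> - T0 f \<omega>)"
          using T(3)[OF x(1)[of n], of c] unfolding z_def by eventually_elim (simp add: right_diff_distrib)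
        then have "nrm W (\<lambda>\<omega>. T (z n) \<omega> - c * T0 f \<omega>) = nrm W (\<lambda>\<omega>. c * (T (x n) \<omega> - T0 f \<omega>))"
          by (intro W.nrm_cong_AE W.scale_elem W.diff_elem T0W f T(1) zE x(1))
        also have "\<dots> = \<bar>c\<bar> * nrm W (\<lambda>\<omega>. T (x n) \<omega> - T0 f \<omega>)"
          by (intro W.nrm_scale W.diff_elem T0W f T(1) x(1))
        finally show ?thesis .
      qed
      then show "(\<lambda>n. nrm W (\<lambda>\<omega>. T (z n) \<omega> - c * T0 f \<omega>)) \<longlonglongrightarrow> 0"
        using tendsto_mult_right_zero[OF LD[OF LT0[OF f] x], of "\<bar>c\<bar>"] by simp
    qed (intro T0W scale_elem W.scale_elem f T(1) zE)+
  qed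
  have "bounded_operator M X W T0"
    unfolding bounded_operator_def by (intro conjI ballI allI T0W T0add T0sc exI[of _ "\<bar>K\<bar>"] T0b)
  then show ?thesis using T0E by blast
qed

end

context faithful_S_measure
begin

text \<open>The absolute differences from the truncations decrease to 0 pointwise, and S is order
  continuous.\<close>

lemma trunc_dense:
  assumes f: "f \<in> elems S"
  shows "(\<lambda>n. nrm S (\<lambda>\<omega>. f \<omega> - trunc n f \<omega>)) \<longlonglongrightarrow> 0"
proof -
  interpret S: order_continuous_lattice M S by (rule S_order_continuous_lattice)
  have fm: "f \<in> borel_measurable M" by (rule S.elem_measurable[OF f])
  have d: "(\<lambda>\<omega>. f \<omega> - trunc n f \<omega>) \<in> elems S" for n
    by (intro S.diff_elem f X_subset_S trunc_elem fm)
  have "(\<lambda>n. nrm S (\<lambda>\<omega>. \<bar>f \<omega> - trunc n f \<omega>\<bar>)) \<longlonglongrightarrow> 0"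
  proof (rule S.order_continuousD)
    show "(\<lambda>\<omega>. \<bar>f \<omega> - trunc n f \<omega>\<bar>) \<in> elems S" for n by (rule S.abs_elem[OF d])
    show "AE \<omega> in M. decseq (\<lambda>n. \<bar>f \<omega> - trunc n f \<omega>\<bar>) \<and> (\<lambda>n. \<bar>f \<omega> - trunc n f \<omega>\<bar>) \<longlonglongrightarrow> 0"
    proof (intro AE_I2 conjI trunc_diff_decseq)
      fix \<omega>
      have "(\<lambda>n. \<bar>f \<omega> - trunc n f \<omega>\<bar>) \<longlonglongrightarrow> \<bar>f \<omega> - f \<omega>\<bar>" by (intro tendsto_intros trunc_tendsto)
      then show "(\<lambda>n. \<bar>f \<omega> - trunc n f \<omega>\<bar>) \<longlonglongrightarrow> 0" by simp
    qed
  qed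
  then show ?thesis by (simp add: S.nrm_abs[OF d])
qed

text \<open>Testing on \<open>X\<close> suffices: truncations of an element of S lie in
  \<open>X\<close>, their absolute values increase to that of the element, and monotone convergence
  carries the bound over.\<close>

lemma koethe_dual_S_I:
  assumes g: "g \<in> borel_measurable M" and c: "0 \<le> c"
    and int: "\<And>y. y \<in> elems X \<Longrightarrow> integrable M (\<lambda>\<omega>. y \<omega> * g \<omega>)"
    and bound: "\<And>y. y \<in> elems X \<Longrightarrow> \<bar>\<integral>\<omega>. y \<omega> * g \<omega> \<partial>M\<bar> \<le> c * nrm S y"
  shows "g \<in> elems (koethe_dual M S)" "nrm (koethe_dual M S) g \<le> c"
proof -
  interpret S: order_continuous_lattice M S by (rule S_order_continuous_lattice)
  note [measurable] = g
  have *: "(\<integral>\<^sup>+\<omega>. ennreal (f \<omega> * \<bar>g \<omega>\<bar>) \<partial>M) \<le> ennreal (c * nrm S f)"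
    if f: "f \<in> elems S" and f0: "\<And>\<omega>. 0 \<le> f \<omega>" for f
  proof -
    have fm [measurable]: "f \<in> borel_measurable M" by (rule S.elem_measurable[OF f])
    have "(\<integral>\<^sup>+\<omega>. ennreal (f \<omega> * \<bar>g \<omega>\<bar>) \<partial>M) = (SUP n. \<integral>\<^sup>+\<omega>. ennreal (\<bar>trunc n f \<omega>\<bar> * \<bar>g \<omega>\<bar>) \<partial>M)"
    proof (rule nn_integral_incseq_tendsto(2), measurable, intro AE_I2 conjI)
      fix \<omega>
      show "incseq (\<lambda>n. ennreal (\<bar>trunc n f \<omega>\<bar> * \<bar>g \<omega>\<bar>))"
        unfolding incseq_def by (intro allI impI ennreal_leI mult_right_mono trunc_mono) auto
      have "(\<lambda>n. ennreal (\<bar>trunc n f \<omega>\<bar> * \<bar>g \<omega>\<bar>)) \<longlonglongrightarrow> ennreal (\<bar>f \<omega>\<bar> * \<bar>g \<omega>\<bar>)"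
        by (intro tendsto_intros tendsto_ennrealI trunc_tendsto)
      then show "(\<lambda>n. ennreal (\<bar>trunc n f \<omega>\<bar> * \<bar>g \<omega>\<bar>)) \<longlonglongrightarrow> ennreal (f \<omega> * \<bar>g \<omega>\<bar>)" using f0[of \<omega>] by simp
    qed
    also have "\<dots> \<le> ennreal (c * nrm S f)"
    proof (rule SUP_least)
      fix n
      \<comment> \<open>The sign of \<open>g\<close> converts the bound for the signed pairing into
        one for the pairing of absolute values.\<close>
      define y where "y = (\<lambda>\<omega>. \<bar>trunc n f \<omega>\<bar> * sgn (g \<omega>))"
      have y: "y \<in> elems X"
        unfolding y_def by (rule mult_elem[OF abs_elem[OF trunc_elem[OF fm]], of _ 1]) (auto simp: sgn_real_def)
      have yg: "y \<omega> * g \<omega> = \<bar>trunc n f \<omega>\<bar> * \<bar>g \<omega>\<bar>" for \<omega> by (simp add: y_def abs_sgn mult.assoc mult.commute)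
      have "(\<integral>\<^sup>+\<omega>. ennreal (\<bar>trunc n f \<omega>\<bar> * \<bar>g \<omega>\<bar>) \<partial>M) = ennreal (\<integral>\<omega>. y \<omega> * g \<omega> \<partial>M)"
        unfolding yg[symmetric] by (rule nn_integral_eq_integral[OF int[OF y]]) (simp add: yg)
      also have "\<dots> \<le> ennreal (c * nrm S f)"
      proof (rule ennreal_leI)
        have ym: "y \<in> borel_measurable M" by (rule elem_measurable[OF y])
        have "nrm S y \<le> nrm S f"
        proof (rule S.nrm_solid[OF ym f], rule AE_I2)
          show "\<bar>y \<omega>\<bar> \<le> \<bar>f \<omega>\<bar>" for \<omega> using abs_trunc_le[of n f \<omega>] by (auto simp: y_def abs_mult sgn_real_def)
        qed
        then have "c * nrm S y \<le> c * nrm S f" using c by (rule mult_left_mono)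
        then show "(\<integral>\<omega>. y \<omega> * g \<omega> \<partial>M) \<le> c * nrm S f" using bound[OF y] by linarith
      qed
      finally show "(\<integral>\<^sup>+\<omega>. ennreal (\<bar>trunc n f \<omega>\<bar> * \<bar>g \<omega>\<bar>) \<partial>M) \<le> ennreal (c * nrm S f)" .
    qed
    finally show ?thesis .
  qed
  show "g \<in> elems (koethe_dual M S)" "nrm (koethe_dual M S) g \<le> c"
    using S.koetheI[OF g c *] by auto
qed

end

section \<open>Suprema of bounded functions and separation\<close>

lemma bounded_funs_bdd_above: "f \<in> bounded_funs K \<Longrightarrow> bdd_above (f ` K)"
  by (simp add: bounded_funs_def bounded_imp_bdd_above)

lemma bounded_funs_SUP_upper: "f \<in> bounded_funs K \<Longrightarrow> x \<in> K \<Longrightarrow> f x \<le> (SUP x\<in>K. f x)"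
  by (rule cSUP_upper[OF _ bounded_funs_bdd_above])

lemma bounded_funs_SUP_add:
  assumes "K \<noteq> {}" "f \<in> bounded_funs K" "g \<in> bounded_funs K"
  shows "(SUP x\<in>K. f x + g x) \<le> (SUP x\<in>K. f x) + (SUP x\<in>K. g x)"
  by (rule cSUP_least[OF assms(1)]) (intro add_mono bounded_funs_SUP_upper assms)

lemma bounded_funs_SUP_scale:
  assumes K: "K \<noteq> {}" and f: "f \<in> bounded_funs K" and c: "0 \<le> c"
  shows "(SUP x\<in>K. c * f x) = c * (SUP x\<in>K. f x)"
proof (rule antisym)
  have le: "(SUP x\<in>K. c * f x) \<le> c * (SUP x\<in>K. f x)" if "f \<in> bounded_funs K" "0 \<le> c" for f and c :: real
    by (rule cSUP_least[OF K]) (intro mult_left_mono bounded_funs_SUP_upper that)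
  show "(SUP x\<in>K. c * f x) \<le> c * (SUP x\<in>K. f x)" by (rule le[OF f c])
  show "c * (SUP x\<in>K. f x) \<le> (SUP x\<in>K. c * f x)"
  proof (cases "c = 0")
    case True
    then show ?thesis using K by simp
  next
    case False
    then have "(SUP x\<in>K. (1 / c) * (c * f x)) \<le> (1 / c) * (SUP x\<in>K. c * f x)"
      using c by (intro le bounded_funs_scale f) auto
    then show ?thesis using False c by (simp add: field_simps)
  qed
qed

text \<open>
  Functions on the disjoint union of \<open>K1\<close> and \<open>K2\<close> are separated by means of the sublinear functional
  that adds the two suprema; it is affine in the constants on either part, so a linear minorant splits
  into two normalized positive functionals.
\<close>

lemma separation_by_functionals:
  fixes K1 :: "'b set" and K2 :: "'c set" and A :: "(('b \<Rightarrow> real) \<times> ('c \<Rightarrow> real) \<times> real) set"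
  assumes ne: "K1 \<noteq> {}" "K2 \<noteq> {}"
    and zero: "((\<lambda>_. 0), (\<lambda>_. 0), 0) \<in> A"
    and add: "\<And>f g s f' g' s'. (f, g, s) \<in> A \<Longrightarrow> (f', g', s') \<in> A \<Longrightarrow> ((\<lambda>x. f x + f' x), (\<lambda>x. g x + g' x), s + s') \<in> A"
    and scale: "\<And>f g s c. (f, g, s) \<in> A \<Longrightarrow> 0 < c \<Longrightarrow> ((\<lambda>x. c * f x), (\<lambda>x. c * g x), c * s) \<in> A"
    and bdd: "\<And>f g s. (f, g, s) \<in> A \<Longrightarrow> f \<in> bounded_funs K1" "\<And>f g s. (f, g, s) \<in> A \<Longrightarrow> g \<in> bounded_funs K2"
    and le: "\<And>f g s a b. (f, g, s) \<in> A \<Longrightarrow> (\<And>x. x \<in> K1 \<Longrightarrow> f x \<le> a) \<Longrightarrow> (\<And>x. x \<in> K2 \<Longrightarrow> g x \<le> b) \<Longrightarrow> s \<le> a + b"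
  shows "\<exists>L1 L2. linear_fun_on (bounded_funs K1) L1 \<and> linear_fun_on (bounded_funs K2) L2 \<and>
    (\<forall>f\<in>bounded_funs K1. (\<forall>x\<in>K1. 0 \<le> f x) \<longrightarrow> 0 \<le> L1 f) \<and> (\<forall>f\<in>bounded_funs K2. (\<forall>x\<in>K2. 0 \<le> f x) \<longrightarrow> 0 \<le> L2 f) \<and>
    L1 (\<lambda>_. 1) = 1 \<and> L2 (\<lambda>_. 1) = 1 \<and> (\<forall>(f, g, s)\<in>A. s \<le> L1 f + L2 g)"
proof -
  define V :: "('b + 'c \<Rightarrow> real) set" where "V = {F. (\<lambda>x. F (Inl x)) \<in> bounded_funs K1 \<and> (\<lambda>x. F (Inr x)) \<in> bounded_funs K2}"
  define p where "p F = (SUP x\<in>K1. F (Inl x)) + (SUP x\<in>K2. F (Inr x))" for F :: "'b + 'c \<Rightarrow> real"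
  define C where "C = (\<lambda>(f, g, s). (case_sum f g, s)) ` A"
  have CE: "\<exists>f g. F = case_sum f g \<and> (f, g, s) \<in> A" if "(F, s) \<in> C" for F s
    using that unfolding C_def by auto
  have CI: "(case_sum f g, s) \<in> C" if "(f, g, s) \<in> A" for f g s using that unfolding C_def by force
  have V: "fun_subspace V"
    unfolding fun_subspace_def V_def by (auto intro: bounded_funs_add bounded_funs_scale bounded_funsI[of _ _ 0])
  have sub: "sublinear_on V p"
    unfolding sublinear_on_def
  proof (intro conjI ballI allI impI)
    fix F G assume FG: "F \<in> V" "G \<in> V"
    have "(SUP x\<in>K1. F (Inl x) + G (Inl x)) \<le> (SUP x\<in>K1. F (Inl x)) + (SUP x\<in>K1. G (Inl x))"
      "(SUP x\<in>K2. F (Inr x) + G (Inr x)) \<le> (SUP x\<in>K2. F (Inr x)) + (SUP x\<in>K2. G (Inr x))"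
      using FG unfolding V_def by (auto intro!: bounded_funs_SUP_add ne)
    then show "p (\<lambda>x. F x + G x) \<le> p F + p G" by (simp add: p_def)
  next
    fix F and c :: real assume F: "F \<in> V" "0 \<le> c"
    have "(SUP x\<in>K1. c * F (Inl x)) = c * (SUP x\<in>K1. F (Inl x))" "(SUP x\<in>K2. c * F (Inr x)) = c * (SUP x\<in>K2. F (Inr x))"
      using F unfolding V_def by (auto intro!: bounded_funs_SUP_scale[where f = "\<lambda>x. F (Inl x)"] bounded_funs_SUP_scale[where f = "\<lambda>x. F (Inr x)"] ne)
    then show "p (\<lambda>x. c * F x) = c * p F" by (simp add: p_def distrib_left)
  qed
  have cone: "pair_cone C"
  proof (rule pair_coneI)
    have "case_sum (\<lambda>_. 0) (\<lambda>_. 0) = (\<lambda>_::'b + 'c. 0 :: real)" by (auto split: sum.split)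
    then show "((\<lambda>_. 0), 0) \<in> C" using CI[OF zero] by simp
  next
    fix F s G t assume "(F, s) \<in> C" "(G, t) \<in> C"
    from CE[OF this(1)] CE[OF this(2)] obtain f g f' g'
      where *: "F = case_sum f g" "(f, g, s) \<in> A" "G = case_sum f' g'" "(f', g', t) \<in> A" by blast
    have "(\<lambda>x. F x + G x) = case_sum (\<lambda>x. f x + f' x) (\<lambda>x. g x + g' x)" using * by (auto split: sum.split)
    then show "((\<lambda>x. F x + G x), s + t) \<in> C" using CI[OF add[OF *(2,4)]] by simp
  next
    fix F s and c :: real assume "(F, s) \<in> C" "c > 0"
    from CE[OF this(1)] obtain f g where *: "F = case_sum f g" "(f, g, s) \<in> A" by blast
    have "(\<lambda>x. c * F x) = case_sum (\<lambda>x. c * f x) (\<lambda>x. c * g x)" using * by (auto split: sum.split)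
    then show "((\<lambda>x. c * F x), c * s) \<in> C" using CI[OF scale[OF *(2) \<open>c > 0\<close>]] by simp
  qed
  have CV: "F \<in> V" "s \<le> p F" if "(F, s) \<in> C" for F s
  proof -
    from CE[OF that] obtain f g where *: "F = case_sum f g" "(f, g, s) \<in> A" by blast
    have b: "f \<in> bounded_funs K1" "g \<in> bounded_funs K2" using bdd[OF *(2)] by auto
    then show "F \<in> V" using * by (simp add: V_def)
    show "s \<le> p F" unfolding p_def *(1) using bounded_funs_SUP_upper[OF b(1)] bounded_funs_SUP_upper[OF b(2)]
      by (intro le[OF *(2)]) auto
  qed
  have "\<exists>L. linear_fun_on V L \<and> (\<forall>F\<in>V. L F \<le> p F) \<and> (\<forall>F s. (F, s) \<in> C \<longrightarrow> s \<le> L F)"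
    by (rule hahn_banach_sandwich[OF V sub cone]) (fact CV, fact CV, blast)
  then obtain L where L: "linear_fun_on V L" "\<And>F. F \<in> V \<Longrightarrow> L F \<le> p F" "\<And>F s. (F, s) \<in> C \<Longrightarrow> s \<le> L F" by blast
  note Ladd = linear_fun_on_add[OF L(1)] and Lsc = linear_fun_on_scale[OF L(1)]
  define i1 :: "('b \<Rightarrow> real) \<Rightarrow> 'b + 'c \<Rightarrow> real" where "i1 f = case_sum f (\<lambda>_. 0)" for f
  define i2 :: "('c \<Rightarrow> real) \<Rightarrow> 'b + 'c \<Rightarrow> real" where "i2 g = case_sum (\<lambda>_. 0) g" for g
  have i1V: "i1 f \<in> V" if "f \<in> bounded_funs K1" for f using that by (auto simp: i1_def V_def intro: bounded_funsI[of _ _ 0])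
  have i2V: "i2 f \<in> V" if "f \<in> bounded_funs K2" for f using that by (auto simp: i2_def V_def intro: bounded_funsI[of _ _ 0])
  have i1: "i1 (\<lambda>x. f x + g x) = (\<lambda>x. i1 f x + i1 g x)" "i1 (\<lambda>x. c * f x) = (\<lambda>x. c * i1 f x)" for f g c
    by (auto simp: i1_def split: sum.split)
  have i2: "i2 (\<lambda>x. f x + g x) = (\<lambda>x. i2 f x + i2 g x)" "i2 (\<lambda>x. c * f x) = (\<lambda>x. c * i2 f x)" for f g c
    by (auto simp: i2_def split: sum.split)
  \<comment> \<open>The zero function contributes supremum 0 over the other part, which is
    nonempty.\<close>
  have p1: "p (i1 f) = (SUP x\<in>K1. f x)" for f unfolding p_def i1_def using ne by simp
  have p2: "p (i2 f) = (SUP x\<in>K2. f x)" for f unfolding p_def i2_def using ne by simp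
  define L1 where "L1 f = L (i1 f)" for f
  define L2 where "L2 f = L (i2 f)" for f
  have lin1: "L1 (\<lambda>x. f x + g x) = L1 f + L1 g" "L1 (\<lambda>x. c * f x) = c * L1 f"
    if "f \<in> bounded_funs K1" "g \<in> bounded_funs K1" for f g c
    unfolding L1_def i1 using Ladd[OF i1V i1V] Lsc[OF i1V] that by simp_all
  have lin2: "L2 (\<lambda>x. f x + g x) = L2 f + L2 g" "L2 (\<lambda>x. c * f x) = c * L2 f"
    if "f \<in> bounded_funs K2" "g \<in> bounded_funs K2" for f g c
    unfolding L2_def i2 using Ladd[OF i2V i2V] Lsc[OF i2V] that by simp_all
  have up1: "L1 f \<le> b" if "f \<in> bounded_funs K1" "\<And>x. x \<in> K1 \<Longrightarrow> f x \<le> b" for f b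
  proof -
    have "(SUP x\<in>K1. f x) \<le> b" by (rule cSUP_least[OF ne(1) that(2)])
    then show ?thesis using L(2)[OF i1V[OF that(1)]] unfolding L1_def p1 by linarith
  qed
  have up2: "L2 f \<le> b" if "f \<in> bounded_funs K2" "\<And>x. x \<in> K2 \<Longrightarrow> f x \<le> b" for f b
  proof -
    have "(SUP x\<in>K2. f x) \<le> b" by (rule cSUP_least[OF ne(2) that(2)])
    then show ?thesis using L(2)[OF i2V[OF that(1)]] unfolding L2_def p2 by linarith
  qed
  \<comment> \<open>Domination by the supremum bounds \<open>L1\<close> at the negative of
    \<open>f\<close> by 0.\<close>
  have pos1: "0 \<le> L1 f" if f: "f \<in> bounded_funs K1" "\<And>x. x \<in> K1 \<Longrightarrow> 0 \<le> f x" for f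
    using up1[OF bounded_funs_scale[OF f(1)], of "-1" 0] lin1(2)[OF f(1) f(1), of "-1"] f(2) by simp
  have pos2: "0 \<le> L2 f" if f: "f \<in> bounded_funs K2" "\<And>x. x \<in> K2 \<Longrightarrow> 0 \<le> f x" for f
    using up2[OF bounded_funs_scale[OF f(1)], of "-1" 0] lin2(2)[OF f(1) f(1), of "-1"] f(2) by simp
  have c1: "(\<lambda>_. 1) \<in> bounded_funs K1" "(\<lambda>_. 1) \<in> bounded_funs K2" by (auto intro: bounded_funsI[of _ _ 1])
  \<comment> \<open>The suprema of the constants 1 and -1 bound \<open>L1\<close> by 1 at the former
    and by -1 at the latter, leaving exactly the value 1.\<close>
  have one1: "L1 (\<lambda>_. 1) = 1"
    using up1[OF c1(1), of 1] up1[OF bounded_funs_scale[OF c1(1)], of "-1" "-1"] lin1(2)[OF c1(1) c1(1), of "-1"] by simp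
  have one2: "L2 (\<lambda>_. 1) = 1"
    using up2[OF c1(2), of 1] up2[OF bounded_funs_scale[OF c1(2)], of "-1" "-1"] lin2(2)[OF c1(2) c1(2), of "-1"] by simp
  have "s \<le> L1 f + L2 g" if a: "(f, g, s) \<in> A" for f g s
  proof -
    have "case_sum f g = (\<lambda>x. i1 f x + i2 g x)" by (auto simp: i1_def i2_def split: sum.split)
    then have "L (case_sum f g) = L1 f + L2 g"
      unfolding L1_def L2_def using Ladd[OF i1V[OF bdd(1)[OF a]] i2V[OF bdd(2)[OF a]]] by simp
    then show ?thesis using L(3)[OF CI[OF a]] by simp
  qed
  moreover have "linear_fun_on (bounded_funs K1) L1" "linear_fun_on (bounded_funs K2) L2"
    unfolding linear_fun_on_def using lin1 lin2 by simp_all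
  ultimately show ?thesis using pos1 pos2 one1 one2 by (intro exI[of _ L1] exI[of _ L2]) auto
qed

section \<open>Domination of bilinear forms\<close>

context convex_lattice
begin

abbreviation power_pairing :: "real \<Rightarrow> ('a \<Rightarrow> real) \<Rightarrow> ('a \<Rightarrow> real) \<Rightarrow> real" where
  "power_pairing q x h \<equiv> (\<integral>\<omega>. \<bar>x \<omega>\<bar> powr p * h \<omega> \<partial>M) powr (q / p)"

lemma power_pairing_bounded:
  assumes "p \<le> q" "x \<in> elems X"
  shows "power_pairing q x \<in> bounded_funs (pos_ball M Xp)"
proof (rule bounded_funsI)
  fix h assume h: "h \<in> pos_ball M Xp"
  have "(\<integral>\<omega>. \<bar>x \<omega>\<bar> powr p * h \<omega> \<partial>M) \<le> nrm X x powr p"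
    using Xp.pos_ball_le[OF h power_elem(1)[OF assms(2)]] power_elem(2)[OF assms(2)] by simp
  then have "power_pairing q x h \<le> (nrm X x powr p) powr (q / p)"
    using power_integral_nonneg[OF h] p_pos assms(1) by (intro powr_mono2) auto
  then show "\<bar>power_pairing q x h\<bar> \<le> (nrm X x powr p) powr (q / p)" by simp
qed

lemma power_pairing_scale:
  assumes "0 < q" "h \<in> pos_ball M Xp"
  shows "power_pairing q (\<lambda>\<omega>. c * x \<omega>) h = \<bar>c\<bar> powr q * power_pairing q x h"
proof -
  have "(\<integral>\<omega>. \<bar>c * x \<omega>\<bar> powr p * h \<omega> \<partial>M) = \<bar>c\<bar> powr p * (\<integral>\<omega>. \<bar>x \<omega>\<bar> powr p * h \<omega> \<partial>M)"
    by (simp add: abs_mult powr_mult mult.assoc)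
  then show ?thesis using p_pos by (simp add: powr_mult powr_powr)
qed

text \<open>
  Averaging with the evaluation at a strictly positive \<open>h0\<close> makes the seminorm of \<open>S\<close> a norm.
\<close>

lemma faithful_measure_of_functional:
  assumes q: "p \<le> q" and lin: "linear_fun_on (bounded_funs (pos_ball M Xp)) L"
    and pos: "\<And>f. f \<in> bounded_funs (pos_ball M Xp) \<Longrightarrow> (\<And>h. h \<in> pos_ball M Xp \<Longrightarrow> 0 \<le> f h) \<Longrightarrow> 0 \<le> L f"
    and one: "L (\<lambda>_. 1) = 1"
  shows "\<exists>\<nu>. faithful_S_measure M X p q \<nu> \<and>
    (\<forall>x\<in>elems X. L (power_pairing q x) \<le> 2 * nrm (S_space M p q \<nu>) x powr q)"
proof -
  obtain h0 where h0: "h0 \<in> pos_ball M Xp" "\<And>\<omega>. 0 < h0 \<omega>" by (rule Xp.pos_ball_strictly_positive) blast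
  define L' where "L' f = (L f + f h0) / 2" for f
  define \<tau> where "\<tau> = pos_ball_topology M Xp"
  have top: "topspace \<tau> = pos_ball M Xp" unfolding \<tau>_def by (rule Xp.topspace_pos_ball_topology)
  have comp: "compact_space \<tau>" unfolding \<tau>_def by (rule Xp.compact_pos_ball_topology)
  have norm: "normal_space \<tau>" unfolding \<tau>_def by (rule Xp.normal_pos_ball_topology)
  have lin': "linear_fun_on (bounded_funs (topspace \<tau>)) L'"
    using lin unfolding linear_fun_on_def top L'_def by (simp add: field_simps)
  have pos': "0 \<le> L' f" if "f \<in> bounded_funs (topspace \<tau>)" "\<And>x. x \<in> topspace \<tau> \<Longrightarrow> 0 \<le> f x" for f
    using pos[of f] that h0(1) unfolding top L'_def by simp
  have one': "L' (\<lambda>_. 1) = 1" using one by (simp add: L'_def)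
  have "\<exists>\<nu>. regular_borel_prob \<tau> \<nu> \<and> (\<forall>G. continuous_map \<tau> euclideanreal G \<longrightarrow> (\<forall>x\<in>topspace \<tau>. 0 \<le> G x) \<longrightarrow>
      ennreal (L' G) \<le> (\<integral>\<^sup>+x. ennreal (G x) \<partial>\<nu>))"
    by (rule regular_measure_of_functional[OF comp norm lin' pos' one']) auto
  then obtain \<nu> where \<nu>: "regular_borel_prob \<tau> \<nu>" "\<And>G. continuous_map \<tau> euclideanreal G \<Longrightarrow>
      (\<And>x. x \<in> topspace \<tau> \<Longrightarrow> 0 \<le> G x) \<Longrightarrow> ennreal (L' G) \<le> (\<integral>\<^sup>+x. ennreal (G x) \<partial>\<nu>)" by blast
  interpret S_measure M X p q \<nu>
    by unfold_locales (use q \<nu>(1) \<tau>_def in auto)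
  have key: "L' (power_pairing q x) \<le> nrm S x powr q" if x: "x \<in> elems X" for x
  proof -
    have "continuous_map \<tau> euclideanreal (power_pairing q x)"
    proof (rule continuous_map_powr)
      show "continuous_map \<tau> euclideanreal (\<lambda>h. \<integral>\<omega>. \<bar>x \<omega>\<bar> powr p * h \<omega> \<partial>M)"
        unfolding \<tau>_def by (rule Xp.continuous_eval[OF power_elem(1)[OF x]])
      show "0 < q / p" using q_pos p_pos by simp
      show "0 \<le> (\<integral>\<omega>. \<bar>x \<omega>\<bar> powr p * h \<omega> \<partial>M)" if "h \<in> topspace \<tau>" for h
        using that unfolding top by (rule power_integral_nonneg)
    qed
    then have "ennreal (L' (power_pairing q x)) \<le> (\<integral>\<^sup>+h. ennreal (power_pairing q x h) \<partial>\<nu>)"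
      by (rule \<nu>(2)) simp
    also have "\<dots> = ennreal (nrm S x powr q)" by (rule S_powr[OF x])
    finally show ?thesis by (simp add: ennreal_le_iff)
  qed
  have Lpos: "0 \<le> L (power_pairing q x)" if x: "x \<in> elems X" for x
    by (rule pos[OF power_pairing_bounded[OF q x]]) simp
  \<comment> \<open>The measure dominates the average of \<open>L\<close> and the evaluation at
    \<open>h0\<close>. Dropping the nonnegative evaluation costs the factor 2.\<close>
  have bound: "L (power_pairing q x) \<le> 2 * nrm S x powr q" if x: "x \<in> elems X" for x
  proof -
    have half: "u \<le> 2 * w" if "(u + v) / 2 \<le> w" "0 \<le> v" for u v w :: real using that by simp
    show ?thesis by (rule half[OF key[OF x, unfolded L'_def]]) simp
  qed
  have "faithful_S_measure M X p q \<nu>"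
  proof unfold_locales
    fix x assume x: "x \<in> elems X" and "S_functional M p q \<nu> x = 0"
    then have "nrm S x = 0" by (simp add: nrm_S)
    then have "L' (power_pairing q x) \<le> 0" using key[OF x] by simp
    have half: "v \<le> 0" if "(u + v) / 2 \<le> 0" "0 \<le> u" for u v :: real using that by simp
    \<comment> \<open>Now the other half of the average is used: with the nonnegative value of
      \<open>L\<close> dropped, the pairing with \<open>h0\<close> is at most 0, and positivity of
      \<open>h0\<close> at every point makes x vanish almost everywhere.\<close>
    have "power_pairing q x h0 \<le> 0"
      by (rule half[OF \<open>L' (power_pairing q x) \<le> 0\<close>[unfolded L'_def] Lpos[OF x]])
    then have 0: "(\<integral>\<omega>. \<bar>x \<omega>\<bar> powr p * h0 \<omega> \<partial>M) = 0" by simp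
    have int: "integrable M (\<lambda>\<omega>. \<bar>x \<omega>\<bar> powr p * h0 \<omega>)"
      by (rule Xp.koethe_integrable[OF Xp.pos_ballD(1)[OF h0(1)] power_elem(1)[OF x]])
    have "0 \<le> \<bar>x \<omega>\<bar> powr p * h0 \<omega>" for \<omega> using h0(2)[of \<omega>] by simp
    then have "AE \<omega> in M. \<bar>x \<omega>\<bar> powr p * h0 \<omega> = 0"
      using 0 int by (subst (asm) integral_nonneg_eq_0_iff_AE) auto
    then show "AE \<omega> in M. x \<omega> = 0"
    proof (rule AE_mp, intro AE_I2 impI)
      fix \<omega> assume "\<bar>x \<omega>\<bar> powr p * h0 \<omega> = 0"
      then show "x \<omega> = 0" using h0(2)[of \<omega>] by simp
    qed
  qed
  then show ?thesis using bound by blast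
qed

end

lemma (in function_lattice) mixed_sup_scale_le:
  assumes "1 \<le> p" "r = top \<or> 0 < enn2real r" "\<And>k. k < n \<Longrightarrow> x k \<in> elems X"
  shows "mixed_sup X (ennreal p) r n (\<lambda>k \<omega>. c * x k \<omega>) \<le> \<bar>c\<bar> * mixed_sup X (ennreal p) r n x"
  unfolding mixed_sup_def[of X "ennreal p" r n "\<lambda>k \<omega>. c * x k \<omega>"]
proof (rule cSUP_least)
  show "lball r n \<noteq> {}" using zero_in_lball by blast
  fix \<alpha> assume \<alpha>: "\<alpha> \<in> lball r n"
  define F where "F = (\<lambda>\<omega>. lnorm (ennreal p) n (\<lambda>k. \<alpha> k * x k \<omega>))"
  have F: "F \<in> elems X" unfolding F_def using assms(3) by (intro lnorm_elem assms(1) scale_elem)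
  have "(\<lambda>\<omega>. lnorm (ennreal p) n (\<lambda>k. \<alpha> k * (c * x k \<omega>))) = (\<lambda>\<omega>. \<bar>c\<bar> * F \<omega>)"
  proof
    fix \<omega>
    have "lnorm (ennreal p) n (\<lambda>k. c * (\<alpha> k * x k \<omega>)) = \<bar>c\<bar> * lnorm (ennreal p) n (\<lambda>k. \<alpha> k * x k \<omega>)"
      using assms(1) by (intro lnorm_scale) simp
    then show "lnorm (ennreal p) n (\<lambda>k. \<alpha> k * (c * x k \<omega>)) = \<bar>c\<bar> * F \<omega>" by (simp add: F_def mult.left_commute)
  qed
  then have "nrm X (\<lambda>\<omega>. lnorm (ennreal p) n (\<lambda>k. \<alpha> k * (c * x k \<omega>))) = \<bar>c\<bar> * nrm X F" using nrm_scale[OF F, of "\<bar>c\<bar>"] by simp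
  also have "\<dots> \<le> \<bar>c\<bar> * mixed_sup X (ennreal p) r n x"
    unfolding F_def by (intro mult_left_mono mixed_sup_upper assms \<alpha>) auto
  finally show "nrm X (\<lambda>\<omega>. lnorm (ennreal p) n (\<lambda>k. \<alpha> k * (c * x k \<omega>))) \<le> \<bar>c\<bar> * mixed_sup X (ennreal p) r n x" .
qed

text \<open>
  Young's inequality turns the product of the two mixed norms into a sum, which makes the separation
  argument applicable; the product is recovered at the end by homogeneity.
\<close>

theorem bilinear_domination:
  fixes b :: "('a \<Rightarrow> real) \<Rightarrow> ('a \<Rightarrow> real) \<Rightarrow> real"
  assumes X: "convex_lattice M X p1" and Y: "convex_lattice M Y p2"
    and q: "p1 \<le> q1" "p2 \<le> q2" "1 < q1" "1 < q2" "1 / q1 + 1 / q2 = 1"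
    and r: "1 / r1 = ennreal (1 / p1 - 1 / q1)" "1 / r2 = ennreal (1 / p2 - 1 / q2)"
    and scale: "\<And>x y c d. x \<in> elems X \<Longrightarrow> y \<in> elems Y \<Longrightarrow> b (\<lambda>\<omega>. c * x \<omega>) (\<lambda>\<omega>. d * y \<omega>) = c * d * b x y"
    and C: "0 < C" "\<And>n x y. (\<And>k. k < n \<Longrightarrow> x k \<in> elems X) \<Longrightarrow> (\<And>k. k < n \<Longrightarrow> y k \<in> elems Y) \<Longrightarrow>
      \<bar>\<Sum>k<n. b (x k) (y k)\<bar> \<le> C * mixed_sup X (ennreal p1) r1 n x * mixed_sup Y (ennreal p2) r2 n y"
  shows "\<exists>\<nu>1 \<nu>2. faithful_S_measure M X p1 q1 \<nu>1 \<and> faithful_S_measure M Y p2 q2 \<nu>2 \<and>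
    (\<forall>x\<in>elems X. \<forall>y\<in>elems Y. \<bar>b x y\<bar> \<le> 2 * C * nrm (S_space M p1 q1 \<nu>1) x * nrm (S_space M p2 q2 \<nu>2) y)"
proof -
  interpret X: convex_lattice M X p1 by (rule X)
  interpret Y: convex_lattice M Y p2 by (rule Y)
  have q0: "0 < q1" "0 < q2" using q by auto
  let ?K1 = "pos_ball M X.Xp" and ?K2 = "pos_ball M Y.Xp"
  obtain k1 where k1: "k1 \<in> ?K1" by (rule X.Xp.pos_ball_strictly_positive) blast
  obtain k2 where k2: "k2 \<in> ?K2" by (rule Y.Xp.pos_ball_strictly_positive) blast
  \<comment> \<open>Young's inequality bounds C m1 m2 by C m1^q1/q1 + C m2^q2/q2. With these weights
    the two terms are the suprema of \<open>G1\<close> and \<open>G2\<close> over the respective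
    balls.\<close>
  define G1 where "G1 n x h = C / q1 * (\<Sum>k<n. X.power_pairing q1 (x k) h)" for n :: nat and x h
  define G2 where "G2 n y h = C / q2 * (\<Sum>k<n. Y.power_pairing q2 (y k) h)" for n :: nat and y h
  define s where "s n x y = (\<Sum>k<n. b (x k) (y k))" for n :: nat and x y
  \<comment> \<open>Only values on the two balls are prescribed, so sums and multiples of members
    need to agree with \<open>G1\<close> and \<open>G2\<close> there alone.\<close>
  define A where "A = {(f, g, t). \<exists>n x y. (\<forall>k<n. x k \<in> elems X) \<and> (\<forall>k<n. y k \<in> elems Y) \<and>
    (\<forall>h\<in>?K1. f h = G1 n x h) \<and> (\<forall>h\<in>?K2. g h = G2 n y h) \<and> t = s n x y}"
  have AI: "(f, g, t) \<in> A" if "\<And>k. k < n \<Longrightarrow> x k \<in> elems X" "\<And>k. k < n \<Longrightarrow> y k \<in> elems Y"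
      "\<And>h. h \<in> ?K1 \<Longrightarrow> f h = G1 n x h" "\<And>h. h \<in> ?K2 \<Longrightarrow> g h = G2 n y h" "t = s n x y" for f g t n x y
    unfolding A_def using that by blast
  have AE: "\<exists>n x y. (\<forall>k<n. x k \<in> elems X) \<and> (\<forall>k<n. y k \<in> elems Y) \<and>
    (\<forall>h\<in>?K1. f h = G1 n x h) \<and> (\<forall>h\<in>?K2. g h = G2 n y h) \<and> t = s n x y" if "(f, g, t) \<in> A" for f g t
    using that unfolding A_def by simp
  have "\<exists>L1 L2. linear_fun_on (bounded_funs ?K1) L1 \<and> linear_fun_on (bounded_funs ?K2) L2 \<and>
    (\<forall>f\<in>bounded_funs ?K1. (\<forall>x\<in>?K1. 0 \<le> f x) \<longrightarrow> 0 \<le> L1 f) \<and> (\<forall>f\<in>bounded_funs ?K2. (\<forall>x\<in>?K2. 0 \<le> f x) \<longrightarrow> 0 \<le> L2 f) \<and>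
    L1 (\<lambda>_. 1) = 1 \<and> L2 (\<lambda>_. 1) = 1 \<and> (\<forall>(f, g, t)\<in>A. t \<le> L1 f + L2 g)"
  proof (rule separation_by_functionals)
    show "?K1 \<noteq> {}" "?K2 \<noteq> {}" using k1 k2 by auto
    show "((\<lambda>_. 0), (\<lambda>_. 0), 0) \<in> A"
      by (rule AI[of 0 "\<lambda>_ _. 0" "\<lambda>_ _. 0"]) (auto simp: G1_def G2_def s_def)
  next
    fix f g t f' g' t' assume "(f, g, t) \<in> A" "(f', g', t') \<in> A"
    from AE[OF this(1)] AE[OF this(2)] obtain n x y n' x' y'
      where 1: "\<forall>k<n. x k \<in> elems X" "\<forall>k<n. y k \<in> elems Y" "\<forall>h\<in>?K1. f h = G1 n x h" "\<forall>h\<in>?K2. g h = G2 n y h" "t = s n x y"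
        and 2: "\<forall>k<n'. x' k \<in> elems X" "\<forall>k<n'. y' k \<in> elems Y" "\<forall>h\<in>?K1. f' h = G1 n' x' h" "\<forall>h\<in>?K2. g' h = G2 n' y' h" "t' = s n' x' y'"
      by (elim exE conjE)
    \<comment> \<open>Concatenation of families: power sums and pairings both add.\<close>
    define x'' where "x'' k = (if k < n then x k else x' (k - n))" for k
    define y'' where "y'' k = (if k < n then y k else y' (k - n))" for k
    show "((\<lambda>h. f h + f' h), (\<lambda>h. g h + g' h), t + t') \<in> A"
    proof (rule AI[of "n + n'" x'' y''])
      show "x'' k \<in> elems X" if "k < n + n'" for k using 1(1) 2(1) that by (auto simp: x''_def)
      show "y'' k \<in> elems Y" if "k < n + n'" for k using 1(2) 2(2) that by (auto simp: y''_def)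
      show "f h + f' h = G1 (n + n') x'' h" if "h \<in> ?K1" for h
        using 1(3) 2(3) that by (simp add: G1_def sum_lessThan_add x''_def distrib_left)
      show "g h + g' h = G2 (n + n') y'' h" if "h \<in> ?K2" for h
        using 1(4) 2(4) that by (simp add: G2_def sum_lessThan_add y''_def distrib_left)
      show "t + t' = s (n + n') x'' y''" using 1(5) 2(5) by (simp add: s_def sum_lessThan_add x''_def y''_def)
    qed
  next
    fix f g t and c :: real assume "(f, g, t) \<in> A" and c: "0 < c"
    from AE[OF this(1)] obtain n x y
      where 1: "\<forall>k<n. x k \<in> elems X" "\<forall>k<n. y k \<in> elems Y" "\<forall>h\<in>?K1. f h = G1 n x h" "\<forall>h\<in>?K2. g h = G2 n y h" "t = s n x y"
      by (elim exE conjE)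
    show "((\<lambda>h. c * f h), (\<lambda>h. c * g h), c * t) \<in> A"
    \<comment> \<open>The roots scale both power sums by c, whose degrees are q1 and q2, and the
      pairing also by c, since 1/q1 + 1/q2 = 1.\<close>
    proof (rule AI[of n "\<lambda>k \<omega>. c powr (1 / q1) * x k \<omega>" "\<lambda>k \<omega>. c powr (1 / q2) * y k \<omega>"])
      show "(\<lambda>\<omega>. c powr (1 / q1) * x k \<omega>) \<in> elems X" if "k < n" for k using 1(1) that by (intro X.scale_elem) auto
      show "(\<lambda>\<omega>. c powr (1 / q2) * y k \<omega>) \<in> elems Y" if "k < n" for k using 1(2) that by (intro Y.scale_elem) auto
      show "c * f h = G1 n (\<lambda>k \<omega>. c powr (1 / q1) * x k \<omega>) h" if h: "h \<in> ?K1" for h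
        unfolding G1_def X.power_pairing_scale[OF q0(1) h] using 1(3) h q0 c
        by (simp add: G1_def powr_powr sum_distrib_left[symmetric] mult.left_commute)
      show "c * g h = G2 n (\<lambda>k \<omega>. c powr (1 / q2) * y k \<omega>) h" if h: "h \<in> ?K2" for h
        unfolding G2_def Y.power_pairing_scale[OF q0(2) h] using 1(4) h q0 c
        by (simp add: G2_def powr_powr sum_distrib_left[symmetric] mult.left_commute)
      have "c powr (1 / q1) * c powr (1 / q2) = c" using c q(5) by (simp add: powr_add[symmetric])
      then show "c * t = s n (\<lambda>k \<omega>. c powr (1 / q1) * x k \<omega>) (\<lambda>k \<omega>. c powr (1 / q2) * y k \<omega>)"
        unfolding s_def 1(5) sum_distrib_left using 1(1,2) by (intro sum.cong refl) (simp add: scale)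
    qed
  next
    fix f g t assume "(f, g, t) \<in> A"
    from AE[OF this(1)] obtain n x y
      where 1: "\<forall>k<n. x k \<in> elems X" "\<forall>k<n. y k \<in> elems Y" "\<forall>h\<in>?K1. f h = G1 n x h" "\<forall>h\<in>?K2. g h = G2 n y h" "t = s n x y"
      by (elim exE conjE)
    have sum_bounded: "(\<lambda>h. \<Sum>k<m. F k h) \<in> bounded_funs K" if "\<And>k. k < m \<Longrightarrow> F k \<in> bounded_funs K"
      for F :: "nat \<Rightarrow> ('a \<Rightarrow> real) \<Rightarrow> real" and m K
      using that by (induction m) (auto intro: bounded_funs_add bounded_funsI[of _ _ 0])
    have cong: "F \<in> bounded_funs K" if "G \<in> bounded_funs K" "\<And>h. h \<in> K \<Longrightarrow> F h = G h"
      for F G :: "('a \<Rightarrow> real) \<Rightarrow> real" and K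
      using that unfolding bounded_funs_def by (simp cong: image_cong)
    have "G1 n x \<in> bounded_funs ?K1"
      unfolding G1_def[abs_def] using 1(1) q(1) by (intro bounded_funs_scale sum_bounded X.power_pairing_bounded) auto
    then show "f \<in> bounded_funs ?K1" by (rule cong) (use 1(3) in auto)
    have "G2 n y \<in> bounded_funs ?K2"
      unfolding G2_def[abs_def] using 1(2) q(2) by (intro bounded_funs_scale sum_bounded Y.power_pairing_bounded) auto
    then show "g \<in> bounded_funs ?K2" by (rule cong) (use 1(4) in auto)
  next
    fix f g t u v assume "(f, g, t) \<in> A" and u: "\<And>h. h \<in> ?K1 \<Longrightarrow> f h \<le> u" and v: "\<And>h. h \<in> ?K2 \<Longrightarrow> g h \<le> v"
    from AE[OF this(1)] obtain n x y
      where 1: "\<forall>k<n. x k \<in> elems X" "\<forall>k<n. y k \<in> elems Y" "\<forall>h\<in>?K1. f h = G1 n x h" "\<forall>h\<in>?K2. g h = G2 n y h" "t = s n x y"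
      by (elim exE conjE)
    have x: "x k \<in> elems X" if "k < n" for k using 1(1) that by simp
    have y: "y k \<in> elems Y" if "k < n" for k using 1(2) that by simp
    have le1: "(\<Sum>k<n. X.power_pairing q1 (x k) h) \<le> u * q1 / C" if h: "h \<in> ?K1" for h
      using u[OF h] 1(3) h q0 C(1) by (simp add: G1_def field_simps)
    have le2: "(\<Sum>k<n. Y.power_pairing q2 (y k) h) \<le> v * q2 / C" if h: "h \<in> ?K2" for h
      using v[OF h] 1(4) h q0 C(1) by (simp add: G2_def field_simps)
    define m1 where "m1 = mixed_sup X (ennreal p1) r1 n x"
    define m2 where "m2 = mixed_sup Y (ennreal p2) r2 n y"
    have m10: "0 \<le> m1" unfolding m1_def
      by (rule X.mixed_sup_nonneg[OF X.p_ge_1 mixed_exponent_pos[OF X.p_ge_1 q(1) r(1)] x])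
    have m20: "0 \<le> m2" unfolding m2_def
      by (rule Y.mixed_sup_nonneg[OF Y.p_ge_1 mixed_exponent_pos[OF Y.p_ge_1 q(2) r(2)] y])
    note m0 = m10 m20
    have "0 \<le> (\<Sum>k<n. X.power_pairing q1 (x k) k1)" by (intro sum_nonneg) simp
    then have uv1: "0 \<le> u * q1 / C" using le1[OF k1] by (rule order_trans)
    have "0 \<le> (\<Sum>k<n. Y.power_pairing q2 (y k) k2)" by (intro sum_nonneg) simp
    then have uv2: "0 \<le> v * q2 / C" using le2[OF k2] by (rule order_trans)
    note uv = uv1 uv2
    \<comment> \<open>The upper bound \<open>u\<close> for the weighted sum over the ball becomes
      m1^q1/q1 \<le> u/C, one of the two terms of Young's inequality.\<close>
    have "m1 \<le> (u * q1 / C) powr (1 / q1)" unfolding m1_def by (rule X.mixed_sup_le[OF q(1) r(1) x le1])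
    then have "m1 powr q1 \<le> ((u * q1 / C) powr (1 / q1)) powr q1" using m0 q0 by (intro powr_mono2) auto
    then have 3: "m1 powr q1 / q1 \<le> u / C" using q0 uv by (simp add: powr_powr field_simps)
    have "m2 \<le> (v * q2 / C) powr (1 / q2)" unfolding m2_def by (rule Y.mixed_sup_le[OF q(2) r(2) y le2])
    then have "m2 powr q2 \<le> ((v * q2 / C) powr (1 / q2)) powr q2" using m0 q0 by (intro powr_mono2) auto
    then have 4: "m2 powr q2 / q2 \<le> v / C" using q0 uv by (simp add: powr_powr field_simps)
    have "t \<le> C * m1 * m2" using C(2)[of n x y, OF x y] unfolding 1(5) s_def m1_def m2_def by simp
    also have "\<dots> = C * (m1 * m2)" by simp
    also have "m1 * m2 \<le> m1 powr q1 / q1 + m2 powr q2 / q2" by (rule Youngs_inequality[OF q(3-5) m0])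
    also have "\<dots> \<le> u / C + v / C" using 3 4 by simp
    also have "C * \<dots> = u + v" using C(1) by (simp add: field_simps)
    finally show "t \<le> u + v" using C(1) by simp
  qed
  then obtain L1 L2 where L: "linear_fun_on (bounded_funs ?K1) L1" "linear_fun_on (bounded_funs ?K2) L2"
    "\<And>f. f \<in> bounded_funs ?K1 \<Longrightarrow> (\<And>h. h \<in> ?K1 \<Longrightarrow> 0 \<le> f h) \<Longrightarrow> 0 \<le> L1 f"
    "\<And>f. f \<in> bounded_funs ?K2 \<Longrightarrow> (\<And>h. h \<in> ?K2 \<Longrightarrow> 0 \<le> f h) \<Longrightarrow> 0 \<le> L2 f"
    "L1 (\<lambda>_. 1) = 1" "L2 (\<lambda>_. 1) = 1" and LA: "\<forall>(f, g, t)\<in>A. t \<le> L1 f + L2 g"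
    by (elim exE conjE) (rule that; simp)
  have "\<exists>\<nu>. faithful_S_measure M X p1 q1 \<nu> \<and>
    (\<forall>x\<in>elems X. L1 (X.power_pairing q1 x) \<le> 2 * nrm (S_space M p1 q1 \<nu>) x powr q1)"
    by (rule X.faithful_measure_of_functional[OF q(1) L(1,3,5)])
  then obtain \<nu>1 where \<nu>1: "faithful_S_measure M X p1 q1 \<nu>1"
    "\<forall>x\<in>elems X. L1 (X.power_pairing q1 x) \<le> 2 * nrm (S_space M p1 q1 \<nu>1) x powr q1" by blast
  have "\<exists>\<nu>. faithful_S_measure M Y p2 q2 \<nu> \<and>
    (\<forall>y\<in>elems Y. L2 (Y.power_pairing q2 y) \<le> 2 * nrm (S_space M p2 q2 \<nu>) y powr q2)"
    by (rule Y.faithful_measure_of_functional[OF q(2) L(2,4,6)])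
  then obtain \<nu>2 where \<nu>2: "faithful_S_measure M Y p2 q2 \<nu>2"
    "\<forall>y\<in>elems Y. L2 (Y.power_pairing q2 y) \<le> 2 * nrm (S_space M p2 q2 \<nu>2) y powr q2" by blast
  interpret V1: faithful_S_measure M X p1 q1 \<nu>1 by (rule \<nu>1(1))
  interpret V2: faithful_S_measure M Y p2 q2 \<nu>2 by (rule \<nu>2(1))
  interpret S1: function_lattice M "S_space M p1 q1 \<nu>1" by (rule V1.S_function_lattice)
  interpret S2: function_lattice M "S_space M p2 q2 \<nu>2" by (rule V2.S_function_lattice)
  let ?N1 = "nrm (S_space M p1 q1 \<nu>1)" and ?N2 = "nrm (S_space M p2 q2 \<nu>2)"
  \<comment> \<open>The one-element family at x and y already carries the demand; its power sums are
    replaced by norms in the two spaces, each with the factor 2 of the averaged functional.\<close>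
  have sum_bound: "b x y \<le> 2 * C * (?N1 x powr q1 / q1 + ?N2 y powr q2 / q2)" if x: "x \<in> elems X" and y: "y \<in> elems Y" for x y
  proof -
    have "((\<lambda>h. C / q1 * X.power_pairing q1 x h), (\<lambda>h. C / q2 * Y.power_pairing q2 y h), b x y) \<in> A"
      by (rule AI[of 1 "\<lambda>_. x" "\<lambda>_. y"]) (auto simp: G1_def G2_def s_def x y)
    then have "b x y \<le> L1 (\<lambda>h. C / q1 * X.power_pairing q1 x h) + L2 (\<lambda>h. C / q2 * Y.power_pairing q2 y h)"
      using bspec[OF LA] by fastforce
    also have "L1 (\<lambda>h. C / q1 * X.power_pairing q1 x h) = C / q1 * L1 (X.power_pairing q1 x)"
      by (rule linear_fun_on_scale[OF L(1) X.power_pairing_bounded[OF q(1) x]])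
    also have "L2 (\<lambda>h. C / q2 * Y.power_pairing q2 y h) = C / q2 * L2 (Y.power_pairing q2 y)"
      by (rule linear_fun_on_scale[OF L(2) Y.power_pairing_bounded[OF q(2) y]])
    also have "C / q1 * L1 (X.power_pairing q1 x) + C / q2 * L2 (Y.power_pairing q2 y) \<le>
      C / q1 * (2 * ?N1 x powr q1) + C / q2 * (2 * ?N2 y powr q2)"
      using \<nu>1(2) \<nu>2(2) x y C(1) q0 by (intro add_mono mult_left_mono) auto
    also have "\<dots> = 2 * C * (?N1 x powr q1 / q1 + ?N2 y powr q2 / q2)" by (simp add: field_simps)
    finally show ?thesis .
  qed
  have prod_bound: "b x y \<le> 2 * C * ?N1 x * ?N2 y" if x: "x \<in> elems X" and y: "y \<in> elems Y" for x y
  proof -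
    have n0: "0 \<le> ?N1 x" "0 \<le> ?N2 y" by (simp_all add: V1.nrm_S V2.nrm_S)
    \<comment> \<open>Homogeneity recovers the product: after division by the norms, each enlarged
      by e to be nonzero, the two terms add up to at most 1/q1 + 1/q2 = 1.\<close>
    have eps: "b x y \<le> 2 * C * (?N1 x + e) * (?N2 y + e)" if e: "0 < e" for e
    proof -
      define u v where "u = ?N1 x + e" and "v = ?N2 y + e"
      have uv: "0 < u" "0 < v" "?N1 x \<le> u" "?N2 y \<le> v" using n0 e unfolding u_def v_def by auto
      have "1 / u * (1 / v) * b x y = b (\<lambda>\<omega>. 1 / u * x \<omega>) (\<lambda>\<omega>. 1 / v * y \<omega>)" using scale[OF x y, of "1 / u" "1 / v"] by simp
      also have "\<dots> \<le> 2 * C * (?N1 (\<lambda>\<omega>. 1 / u * x \<omega>) powr q1 / q1 + ?N2 (\<lambda>\<omega>. 1 / v * y \<omega>) powr q2 / q2)"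
        by (intro sum_bound X.scale_elem Y.scale_elem x y)
      also have "\<dots> \<le> 2 * C * (1 / q1 + 1 / q2)"
      proof (intro mult_left_mono add_mono divide_right_mono powr_le1)
        show "\<bar>?N1 (\<lambda>\<omega>. 1 / u * x \<omega>)\<bar> \<le> 1"
          unfolding S1.nrm_scale[OF V1.X_subset_S[OF x], of "1 / u"] using uv n0 by simp
        show "\<bar>?N2 (\<lambda>\<omega>. 1 / v * y \<omega>)\<bar> \<le> 1"
          unfolding S2.nrm_scale[OF V2.X_subset_S[OF y], of "1 / v"] using uv n0 by simp
      qed (use q0 C(1) in auto)
      finally have "1 / u * (1 / v) * b x y \<le> 2 * C" using q(5) by simp
      then show ?thesis using uv unfolding u_def[symmetric] v_def[symmetric] by (simp add: field_simps)
    qed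
    have "(\<lambda>n. 2 * C * (?N1 x + inverse (real (Suc n))) * (?N2 y + inverse (real (Suc n)))) \<longlonglongrightarrow> 2 * C * (?N1 x + 0) * (?N2 y + 0)"
      by (intro tendsto_intros LIMSEQ_inverse_real_of_nat)
    moreover have "b x y \<le> 2 * C * (?N1 x + inverse (real (Suc n))) * (?N2 y + inverse (real (Suc n)))" for n
      by (rule eps) simp
    ultimately have "b x y \<le> 2 * C * (?N1 x + 0) * (?N2 y + 0)" by (intro LIMSEQ_le_const) auto
    then show ?thesis by simp
  qed
  have "\<bar>b x y\<bar> \<le> 2 * C * ?N1 x * ?N2 y" if x: "x \<in> elems X" and y: "y \<in> elems Y" for x y
  proof -
    \<comment> \<open>The one-sided bound at the negative of y, which has the same norm, gives the
      other sign.\<close>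
    have "b (\<lambda>\<omega>. 1 * x \<omega>) (\<lambda>\<omega>. (-1) * y \<omega>) = - b x y" using scale[OF x y, of 1 "-1"] by simp
    moreover have "?N2 (\<lambda>\<omega>. (-1) * y \<omega>) = ?N2 y" using S2.nrm_scale[OF V2.X_subset_S[OF y], of "-1"] by simp
    ultimately have "- b x y \<le> 2 * C * ?N1 x * ?N2 y"
      using prod_bound[OF x Y.scale_elem[OF y, of "-1"]] by simp
    then show ?thesis using prod_bound[OF x y] by simp
  qed
  then show ?thesis using \<nu>1(1) \<nu>2(1) by blast
qed

section \<open>Factorization of strongly concave operators\<close>

text \<open>The roles of the two sides are symmetric here: \<open>X\<close> with p1 and the Koethe
  dual of \<open>Y\<close> with p2 are both convex lattices, and the operator acts as a bilinear
  form on them.\<close>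

locale operator_setting = X: convex_lattice M X p1 + Y: order_continuous_lattice M Y +
  Y': convex_lattice M "koethe_dual M Y" p2
  for M :: "'a measure" and X Y :: "'a fspace" and p1 p2 :: real +
  fixes q1 q2 :: real and r1 r2 p2' :: ennreal and T :: "('a \<Rightarrow> real) \<Rightarrow> ('a \<Rightarrow> real)"
  assumes q: "p1 \<le> q1" "p2 \<le> q2" "1 < q1" "1 < q2" "1 / q1 + 1 / q2 = 1"
    and r: "1 / r1 = ennreal (1 / p1 - 1 / q1)" "1 / r2 = ennreal (1 / p2 - 1 / q2)"
    and p2': "1 / ennreal p2 + 1 / p2' = 1"
    and T: "bounded_operator M X Y T"
begin

lemma T_elem: "x \<in> elems X \<Longrightarrow> T x \<in> elems Y"
  and T_add: "x \<in> elems X \<Longrightarrow> y \<in> elems X \<Longrightarrow> AE \<omega> in M. T (\<lambda>\<omega>. x \<omega> + y \<omega>) \<omega> = T x \<omega> + T y \<omega>"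
  and T_scale: "x \<in> elems X \<Longrightarrow> AE \<omega> in M. T (\<lambda>\<omega>. c * x \<omega>) \<omega> = c * T x \<omega>"
  using T unfolding bounded_operator_def by simp_all

lemma r_pos: "r1 = top \<or> 0 < enn2real r1" "r2 = top \<or> 0 < enn2real r2"
  by (rule mixed_exponent_pos[OF X.p_ge_1 q(1) r(1)], rule mixed_exponent_pos[OF Y'.p_ge_1 q(2) r(2)])

abbreviation mX :: "nat \<Rightarrow> (nat \<Rightarrow> 'a \<Rightarrow> real) \<Rightarrow> real" where
  "mX \<equiv> mixed_sup X (ennreal p1) r1"

abbreviation mY :: "nat \<Rightarrow> (nat \<Rightarrow> 'a \<Rightarrow> real) \<Rightarrow> real" where
  "mY \<equiv> mixed_sup Y.X' (ennreal p2) r2"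

lemma mX_nonneg: "(\<And>k. k < n \<Longrightarrow> x k \<in> elems X) \<Longrightarrow> 0 \<le> mX n x"
  by (rule X.mixed_sup_nonneg[OF X.p_ge_1 r_pos(1)])

lemma mY_nonneg: "(\<And>k. k < n \<Longrightarrow> h k \<in> elems Y.X') \<Longrightarrow> 0 \<le> mY n h"
  by (rule Y.dual.mixed_sup_nonneg[OF Y'.p_ge_1 r_pos(2)])

text \<open>Strong concavity with functionals on \<open>Y\<close> replaced by representing
  functions, so that abstract lattice sums in the dual become mixed norms of functions.\<close>

definition concave_on_functions :: bool where
  "concave_on_functions \<longleftrightarrow> (\<exists>C>0. \<forall>n x h. (\<forall>k<n. x k \<in> elems X) \<longrightarrow> (\<forall>k<n. h k \<in> elems Y.X') \<longrightarrow>
     \<bar>\<Sum>k<n. \<integral>\<omega>. T (x k) \<omega> * h k \<omega> \<partial>M\<bar> \<le> C * mX n x * mY n h)"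

lemma represent:
  assumes "\<And>k. k < n \<Longrightarrow> \<phi> k \<in> dual Y"
  obtains h where "\<And>k. k < n \<Longrightarrow> h k \<in> elems Y.X'"
    "\<And>k f. k < n \<Longrightarrow> f \<in> elems Y \<Longrightarrow> \<phi> k f = (\<integral>\<omega>. f \<omega> * h k \<omega> \<partial>M)"
    "dual_mixed_sup M Y (ennreal p2) r2 n \<phi> = mY n h"
proof -
  have "\<exists>h. h \<in> elems Y.X' \<and> (\<forall>f\<in>elems Y. \<phi> k f = (\<integral>\<omega>. f \<omega> * h \<omega> \<partial>M))" if "k < n" for k
    by (rule Y.dual_representation[OF assms[OF that]]) blast
  then have "\<forall>k. \<exists>h. k < n \<longrightarrow> h \<in> elems Y.X' \<and> (\<forall>f\<in>elems Y. \<phi> k f = (\<integral>\<omega>. f \<omega> * h \<omega> \<partial>M))" by blast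
  from choice[OF this] obtain h where h: "\<forall>k. k < n \<longrightarrow> h k \<in> elems Y.X' \<and>
    (\<forall>f\<in>elems Y. \<phi> k f = (\<integral>\<omega>. f \<omega> * h k \<omega> \<partial>M))" ..
  have h1: "h k \<in> elems Y.X'" if "k < n" for k using h that by simp
  have h2: "\<phi> k f = (\<integral>\<omega>. f \<omega> * h k \<omega> \<partial>M)" if "k < n" "f \<in> elems Y" for k f using h that by simp
  have "dual_mixed_sup M Y (ennreal p2) r2 n \<phi> = mY n h"
    by (rule Y.dual_mixed_sup_representation[OF Y'.p_ge_1 p2' h1 h2])
  then show ?thesis using that[of h] h1 h2 by simp
qed

lemma dual_mixed_sup_function:
  assumes "\<And>k. k < n \<Longrightarrow> h k \<in> elems Y.X'"
  shows "dual_mixed_sup M Y (ennreal p2) r2 n (\<lambda>k f. \<integral>\<omega>. f \<omega> * h k \<omega> \<partial>M) = mY n h"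
  by (rule Y.dual_mixed_sup_representation[OF Y'.p_ge_1 p2' assms]) simp_all

lemma r_eq: "1 / ennreal (1 / p1 - 1 / q1) = r1" "1 / ennreal (1 / p2 - 1 / q2) = r2"
  using r by (simp_all add: ennreal_one_div_eq_iff)

lemma strongly_concave_iff: "strongly_concave M X Y p1 p2 q1 q2 T \<longleftrightarrow> concave_on_functions"
  unfolding strongly_concave_def Let_def r_eq concave_on_functions_def
proof (intro ex_cong1 conj_cong refl iffI allI impI)
  fix C :: real and n and x h :: "nat \<Rightarrow> 'a \<Rightarrow> real"
  assume H: "\<forall>n x \<phi>. (\<forall>k<n. x k \<in> elems X) \<longrightarrow> (\<forall>k<n. \<phi> k \<in> dual Y) \<longrightarrow>
      \<bar>\<Sum>k<n. \<phi> k (T (x k))\<bar> \<le> C * mX n x * dual_mixed_sup M Y (ennreal p2) r2 n \<phi>"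
    and x: "\<forall>k<n. x k \<in> elems X" and h: "\<forall>k<n. h k \<in> elems Y.X'"
  have "\<forall>k<n. (\<lambda>f. \<integral>\<omega>. f \<omega> * h k \<omega> \<partial>M) \<in> dual Y" using h Y.koethe_functional by simp
  from H[rule_format, of n x "\<lambda>k f. \<integral>\<omega>. f \<omega> * h k \<omega> \<partial>M"] x this
  show "\<bar>\<Sum>k<n. \<integral>\<omega>. T (x k) \<omega> * h k \<omega> \<partial>M\<bar> \<le> C * mX n x * mY n h"
    using dual_mixed_sup_function[of n h] h by simp
next
  fix C :: real and n and x :: "nat \<Rightarrow> 'a \<Rightarrow> real" and \<phi>
  assume H: "\<forall>n x h. (\<forall>k<n. x k \<in> elems X) \<longrightarrow> (\<forall>k<n. h k \<in> elems Y.X') \<longrightarrow>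
      \<bar>\<Sum>k<n. \<integral>\<omega>. T (x k) \<omega> * h k \<omega> \<partial>M\<bar> \<le> C * mX n x * mY n h"
    and x: "\<forall>k<n. x k \<in> elems X" and \<phi>: "\<forall>k<n. \<phi> k \<in> dual Y"
  obtain h where h: "\<And>k. k < n \<Longrightarrow> h k \<in> elems Y.X'"
    "\<And>k f. k < n \<Longrightarrow> f \<in> elems Y \<Longrightarrow> \<phi> k f = (\<integral>\<omega>. f \<omega> * h k \<omega> \<partial>M)"
    "dual_mixed_sup M Y (ennreal p2) r2 n \<phi> = mY n h" using represent[of n \<phi>] \<phi> by auto
  have "(\<Sum>k<n. \<phi> k (T (x k))) = (\<Sum>k<n. \<integral>\<omega>. T (x k) \<omega> * h k \<omega> \<partial>M)"
    using x by (intro sum.cong refl h(2) T_elem) auto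
  then show "\<bar>\<Sum>k<n. \<phi> k (T (x k))\<bar> \<le> C * mX n x * dual_mixed_sup M Y (ennreal p2) r2 n \<phi>"
    using H[rule_format, of n x h] x h by simp
qed

text \<open>Both sides of the concavity inequality are positively homogeneous in the family of
  functionals, so it may be tested on families of mixed norm at most 1.\<close>

lemma concave_iff_normalized:
  "concave_on_functions \<longleftrightarrow> (\<exists>C>0. \<forall>n x. (\<forall>k<n. x k \<in> elems X) \<longrightarrow>
     (SUP \<phi>\<in>{\<phi>. (\<forall>k<n. \<phi> k \<in> dual Y) \<and> dual_mixed_sup M Y (ennreal p2) r2 n \<phi> \<le> 1}.
        ennreal \<bar>\<Sum>k<n. \<phi> k (T (x k))\<bar>) \<le> ennreal (C * mX n x))"
  unfolding concave_on_functions_def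
proof (intro ex_cong1 conj_cong refl iffI allI impI)
  fix C :: real and n and x :: "nat \<Rightarrow> 'a \<Rightarrow> real"
  assume C: "0 < C" and H: "\<forall>n x h. (\<forall>k<n. x k \<in> elems X) \<longrightarrow> (\<forall>k<n. h k \<in> elems Y.X') \<longrightarrow>
      \<bar>\<Sum>k<n. \<integral>\<omega>. T (x k) \<omega> * h k \<omega> \<partial>M\<bar> \<le> C * mX n x * mY n h"
    and x: "\<forall>k<n. x k \<in> elems X"
  show "(SUP \<phi>\<in>{\<phi>. (\<forall>k<n. \<phi> k \<in> dual Y) \<and> dual_mixed_sup M Y (ennreal p2) r2 n \<phi> \<le> 1}.
        ennreal \<bar>\<Sum>k<n. \<phi> k (T (x k))\<bar>) \<le> ennreal (C * mX n x)"
  proof (rule SUP_least, rule ennreal_leI)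
    fix \<phi> assume \<phi>: "\<phi> \<in> {\<phi>. (\<forall>k<n. \<phi> k \<in> dual Y) \<and> dual_mixed_sup M Y (ennreal p2) r2 n \<phi> \<le> 1}"
    obtain h where h: "\<And>k. k < n \<Longrightarrow> h k \<in> elems Y.X'"
      "\<And>k f. k < n \<Longrightarrow> f \<in> elems Y \<Longrightarrow> \<phi> k f = (\<integral>\<omega>. f \<omega> * h k \<omega> \<partial>M)"
      "dual_mixed_sup M Y (ennreal p2) r2 n \<phi> = mY n h" using represent[of n \<phi>] \<phi> by auto
    have "(\<Sum>k<n. \<phi> k (T (x k))) = (\<Sum>k<n. \<integral>\<omega>. T (x k) \<omega> * h k \<omega> \<partial>M)"
      using x by (intro sum.cong refl h(2) T_elem) auto
    then have "\<bar>\<Sum>k<n. \<phi> k (T (x k))\<bar> \<le> C * mX n x * mY n h" using H[rule_format, of n x h] x h by simp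
    also have "\<dots> \<le> C * mX n x * 1"
      using \<phi> h(3) C mX_nonneg[of n x] x by (intro mult_left_mono) auto
    finally show "\<bar>\<Sum>k<n. \<phi> k (T (x k))\<bar> \<le> C * mX n x" by simp
  qed
next
  fix C :: real and n and x h :: "nat \<Rightarrow> 'a \<Rightarrow> real"
  assume C: "0 < C" and H: "\<forall>n x. (\<forall>k<n. x k \<in> elems X) \<longrightarrow>
     (SUP \<phi>\<in>{\<phi>. (\<forall>k<n. \<phi> k \<in> dual Y) \<and> dual_mixed_sup M Y (ennreal p2) r2 n \<phi> \<le> 1}.
        ennreal \<bar>\<Sum>k<n. \<phi> k (T (x k))\<bar>) \<le> ennreal (C * mX n x)"
    and x: "\<forall>k<n. x k \<in> elems X" and h: "\<forall>k<n. h k \<in> elems Y.X'"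
  have Cm: "0 \<le> C * mX n x" using C mX_nonneg[of n x] x by simp
  define s where "s = (\<Sum>k<n. \<integral>\<omega>. T (x k) \<omega> * h k \<omega> \<partial>M)"
  \<comment> \<open>Division is by a number \<open>t\<close> above the mixed norm, since the latter
    may be 0; letting \<open>t\<close> decrease to it finishes the argument.\<close>
  have bound: "\<bar>s\<bar> \<le> C * mX n x * t" if t: "mY n h < t" for t
  proof -
    have t0: "0 < t" using t mY_nonneg[of n h] h by simp
    define h' where "h' k \<omega> = (1 / t) * h k \<omega>" for k \<omega>
    have h': "h' k \<in> elems Y.X'" if "k < n" for k
      unfolding h'_def using h that by (intro Y.dual.scale_elem) auto
    define \<phi> where "\<phi> k f = (\<integral>\<omega>. f \<omega> * h' k \<omega> \<partial>M)" for k f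
    have \<phi>d: "\<phi> k \<in> dual Y" if "k < n" for k unfolding \<phi>_def by (rule Y.koethe_functional[OF h'[OF that]])
    have "dual_mixed_sup M Y (ennreal p2) r2 n \<phi> = mY n h'"
      unfolding \<phi>_def by (rule dual_mixed_sup_function[OF h'])
    also have "\<dots> \<le> \<bar>1 / t\<bar> * mY n h"
      unfolding h'_def using h by (intro Y.dual.mixed_sup_scale_le Y'.p_ge_1 r_pos(2)) auto
    also have "\<dots> \<le> 1" using t t0 by (simp add: field_simps)
    finally have mem: "\<phi> \<in> {\<phi>. (\<forall>k<n. \<phi> k \<in> dual Y) \<and> dual_mixed_sup M Y (ennreal p2) r2 n \<phi> \<le> 1}" using \<phi>d by simp
    have "ennreal \<bar>\<Sum>k<n. \<phi> k (T (x k))\<bar> \<le> ennreal (C * mX n x)"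
      by (rule order_trans[OF SUP_upper[OF mem] H[rule_format, of n x]]) (use x in auto)
    then have "\<bar>\<Sum>k<n. \<phi> k (T (x k))\<bar> \<le> C * mX n x" using Cm by (simp add: ennreal_le_iff)
    moreover have "(\<Sum>k<n. \<phi> k (T (x k))) = (1 / t) * s"
      unfolding s_def \<phi>_def h'_def sum_distrib_left by (intro sum.cong refl) (simp add: mult.left_commute[of _ "inverse t"] divide_inverse)
    ultimately show ?thesis using t0 by (simp add: abs_mult field_simps)
  qed
  have "\<bar>s\<bar> \<le> C * mX n x * (mY n h + 0)"
  proof (rule LIMSEQ_le_const)
    show "(\<lambda>n'. C * mX n x * (mY n h + inverse (real (Suc n')))) \<longlonglongrightarrow> C * mX n x * (mY n h + 0)"
      by (intro tendsto_intros LIMSEQ_inverse_real_of_nat)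
    have "\<bar>s\<bar> \<le> C * mX n x * (mY n h + inverse (real (Suc n')))" for n' by (rule bound) simp
    then show "\<exists>N. \<forall>n'\<ge>N. \<bar>s\<bar> \<le> C * mX n x * (mY n h + inverse (real (Suc n')))" by blast
  qed
  then show "\<bar>\<Sum>k<n. \<integral>\<omega>. T (x k) \<omega> * h k \<omega> \<partial>M\<bar> \<le> C * mX n x * mY n h" by (simp add: s_def)
qed

definition factorization :: bool where
  "factorization \<longleftrightarrow> (\<exists>\<nu>1 \<nu>2 T0 J.
     regular_borel_prob (pos_ball_topology M (p_power M X p1)) \<nu>1 \<and>
     regular_borel_prob (pos_ball_topology M (p_power M Y.X' p2)) \<nu>2 \<and>
     banach_function_lattice M (S_space M p1 q1 \<nu>1) \<and> banach_function_lattice M (S_space M p2 q2 \<nu>2) \<and>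
     bounded_operator M X (S_space M p1 q1 \<nu>1) (\<lambda>f. f) \<and>
     bounded_operator M Y.X' (S_space M p2 q2 \<nu>2) (\<lambda>f. f) \<and>
     bounded_operator M (S_space M p1 q1 \<nu>1) (koethe_dual M (S_space M p2 q2 \<nu>2)) T0 \<and>
     koethe_adjoint M Y.X' (S_space M p2 q2 \<nu>2) (\<lambda>f. f) J \<and>
     (\<forall>f\<in>elems X. AE \<omega> in M. T f \<omega> = (J \<circ> T0 \<circ> (\<lambda>f. f)) f \<omega>))"

text \<open>The factorization bounds each pairing by the product of the two norms in the spaces S.
  Hoelder's inequality for q1 and q2 separates the sums of these products, and
  \<open>sum_nrm_S_le\<close> compares each factor with a mixed norm.\<close>

lemma factorization_imp_concave:
  assumes factorization shows concave_on_functions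
proof -
  obtain \<nu>1 \<nu>2 T0 J where
    F: "regular_borel_prob (pos_ball_topology M (p_power M X p1)) \<nu>1"
     "regular_borel_prob (pos_ball_topology M (p_power M Y.X' p2)) \<nu>2"
     "banach_function_lattice M (S_space M p2 q2 \<nu>2)"
     "bounded_operator M (S_space M p1 q1 \<nu>1) (koethe_dual M (S_space M p2 q2 \<nu>2)) T0"
     "koethe_adjoint M Y.X' (S_space M p2 q2 \<nu>2) (\<lambda>f. f) J"
     "\<forall>f\<in>elems X. AE \<omega> in M. T f \<omega> = (J \<circ> T0 \<circ> (\<lambda>f. f)) f \<omega>"
    using assms unfolding factorization_def by (elim exE conjE)
  interpret V1: S_measure M X p1 q1 \<nu>1 by unfold_locales (use q F(1) in auto)
  interpret V2: S_measure M "Y.X'" p2 q2 \<nu>2 by unfold_locales (use q F(2) in auto)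
  interpret S2: function_lattice M "S_space M p2 q2 \<nu>2" using F(3) by (simp add: banach_function_lattice_iff)
  let ?N1 = "nrm (S_space M p1 q1 \<nu>1)" and ?N2 = "nrm (S_space M p2 q2 \<nu>2)"
  have T0W: "T0 f \<in> elems (koethe_dual M (S_space M p2 q2 \<nu>2))" if "f \<in> elems (S_space M p1 q1 \<nu>1)" for f
    using F(4) that unfolding bounded_operator_def by simp
  have "\<exists>K. \<forall>f\<in>elems (S_space M p1 q1 \<nu>1). nrm (koethe_dual M (S_space M p2 q2 \<nu>2)) (T0 f) \<le> K * ?N1 f"
    using F(4) unfolding bounded_operator_def by (elim conjE)
  then obtain K where K: "\<And>f. f \<in> elems (S_space M p1 q1 \<nu>1) \<Longrightarrow> nrm (koethe_dual M (S_space M p2 q2 \<nu>2)) (T0 f) \<le> K * ?N1 f"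
    by blast
  have n0: "0 \<le> ?N1 f" "0 \<le> ?N2 f" for f by (simp_all add: V1.nrm_S V2.nrm_S)
  \<comment> \<open>The bound \<open>K\<close> of the middle operator may be nonpositive, whereas
    the concavity constant has to be positive.\<close>
  define C where "C = \<bar>K\<bar> + 1"
  have C: "0 < C" unfolding C_def by simp
  have pair: "\<bar>\<integral>\<omega>. T x \<omega> * h \<omega> \<partial>M\<bar> \<le> C * (?N1 x * ?N2 h)" if x: "x \<in> elems X" and h: "h \<in> elems Y.X'" for x h
  proof -
    have xS: "x \<in> elems (S_space M p1 q1 \<nu>1)" by (rule V1.X_subset_S[OF x])
    have hS: "h \<in> elems (S_space M p2 q2 \<nu>2)" by (rule V2.X_subset_S[OF h])
    have JY: "J (T0 x) \<in> elems (koethe_dual M Y.X')"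
      using F(5) T0W[OF xS] unfolding koethe_adjoint_def bounded_operator_def by simp
    have [measurable]: "T x \<in> borel_measurable M" "h \<in> borel_measurable M" "J (T0 x) \<in> borel_measurable M"
      using Y.elem_measurable[OF T_elem[OF x]] Y.koethe_measurable[OF h] Y.dual.koethe_measurable[OF JY] by auto
    have "AE \<omega> in M. T x \<omega> = J (T0 x) \<omega>" using F(6) x by simp
    then have "(\<integral>\<omega>. T x \<omega> * h \<omega> \<partial>M) = (\<integral>\<omega>. h \<omega> * J (T0 x) \<omega> \<partial>M)"
      by (intro integral_cong_AE) (auto simp: mult.commute)
    also have "\<dots> = (\<integral>\<omega>. h \<omega> * T0 x \<omega> \<partial>M)"
      using F(5) T0W[OF xS] h unfolding koethe_adjoint_def by simp
    also have "\<bar>\<dots>\<bar> \<le> nrm (koethe_dual M (S_space M p2 q2 \<nu>2)) (T0 x) * ?N2 h"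
      by (rule S2.koethe_bound[OF T0W[OF xS] hS])
    also have "\<dots> \<le> (C * ?N1 x) * ?N2 h"
    proof (rule mult_right_mono[OF _ n0(2)])
      have "K * ?N1 x \<le> C * ?N1 x" using n0 unfolding C_def by (intro mult_right_mono) auto
      then show "nrm (koethe_dual M (S_space M p2 q2 \<nu>2)) (T0 x) \<le> C * ?N1 x" using K[OF xS] by linarith
    qed
    finally show ?thesis by (simp add: mult.assoc)
  qed
  show ?thesis
    unfolding concave_on_functions_def
  proof (intro exI[of _ C] conjI C allI impI)
    fix n and x h :: "nat \<Rightarrow> 'a \<Rightarrow> real"
    assume x: "\<forall>k<n. x k \<in> elems X" and h: "\<forall>k<n. h k \<in> elems Y.X'"
    have "\<bar>\<Sum>k<n. \<integral>\<omega>. T (x k) \<omega> * h k \<omega> \<partial>M\<bar> \<le> (\<Sum>k<n. C * (?N1 (x k) * ?N2 (h k)))"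
      using x h by (intro order_trans[OF sum_abs] sum_mono pair) auto
    also have "\<dots> = C * (\<Sum>k<n. \<bar>?N1 (x k)\<bar> * \<bar>?N2 (h k)\<bar>)" using n0 by (simp add: sum_distrib_left)
    also have "(\<Sum>k<n. \<bar>?N1 (x k)\<bar> * \<bar>?N2 (h k)\<bar>) \<le>
      (\<Sum>k<n. \<bar>?N1 (x k)\<bar> powr q1) powr (1 / q1) * (\<Sum>k<n. \<bar>?N2 (h k)\<bar> powr q2) powr (1 / q2)"
      by (rule sum_Hoelder[OF q(3-5)])
    also have "\<dots> \<le> mX n x * mY n h"
    proof (rule mult_mono)
      have "(\<Sum>k<n. ?N1 (x k) powr q1) \<le> mX n x powr q1" using x by (intro V1.sum_nrm_S_le r) auto
      then have "(\<Sum>k<n. \<bar>?N1 (x k)\<bar> powr q1) powr (1 / q1) \<le> (mX n x powr q1) powr (1 / q1)"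
        using n0 q by (intro powr_mono2) (auto intro: sum_nonneg)
      then show "(\<Sum>k<n. \<bar>?N1 (x k)\<bar> powr q1) powr (1 / q1) \<le> mX n x"
        using q mX_nonneg[of n x] x by (simp add: powr_powr)
      have "(\<Sum>k<n. ?N2 (h k) powr q2) \<le> mY n h powr q2" using h by (intro V2.sum_nrm_S_le r) auto
      then have "(\<Sum>k<n. \<bar>?N2 (h k)\<bar> powr q2) powr (1 / q2) \<le> (mY n h powr q2) powr (1 / q2)"
        using n0 q by (intro powr_mono2) (auto intro: sum_nonneg)
      then show "(\<Sum>k<n. \<bar>?N2 (h k)\<bar> powr q2) powr (1 / q2) \<le> mY n h"
        using q mY_nonneg[of n h] h by (simp add: powr_powr)
    qed (use mX_nonneg[of n x] x in auto)
    finally show "\<bar>\<Sum>k<n. \<integral>\<omega>. T (x k) \<omega> * h k \<omega> \<partial>M\<bar> \<le> C * mX n x * mY n h" using C by (simp add: mult.assoc)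
  qed
qed

text \<open>Domination of the bilinear form makes the operator continuous for the weaker norm of the
  first space S, with values measured in the Koethe dual of the second; both inclusions are then
  identities on functions.\<close>

lemma concave_imp_factorization:
  assumes concave_on_functions shows factorization
proof -
  obtain C where C: "0 < C" and H: "\<forall>n x h. (\<forall>k<n. x k \<in> elems X) \<longrightarrow> (\<forall>k<n. h k \<in> elems Y.X') \<longrightarrow>
     \<bar>\<Sum>k<n. \<integral>\<omega>. T (x k) \<omega> * h k \<omega> \<partial>M\<bar> \<le> C * mX n x * mY n h"
    using assms unfolding concave_on_functions_def by (elim exE conjE)
  define b where "b x h = (\<integral>\<omega>. T x \<omega> * h \<omega> \<partial>M)" for x h
  have scale: "b (\<lambda>\<omega>. c * x \<omega>) (\<lambda>\<omega>. d * h \<omega>) = c * d * b x h" if x: "x \<in> elems X" and h: "h \<in> elems Y.X'" for x h c d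
  proof -
    have [measurable]: "T x \<in> borel_measurable M" "h \<in> borel_measurable M" "T (\<lambda>\<omega>. c * x \<omega>) \<in> borel_measurable M"
      using Y.elem_measurable[OF T_elem[OF x]] Y.koethe_measurable[OF h] Y.elem_measurable[OF T_elem[OF X.scale_elem[OF x]]] by auto
    have "b (\<lambda>\<omega>. c * x \<omega>) (\<lambda>\<omega>. d * h \<omega>) = (\<integral>\<omega>. (c * d) * (T x \<omega> * h \<omega>) \<partial>M)"
      unfolding b_def
    proof (rule integral_cong_AE)
      show "AE \<omega> in M. T (\<lambda>\<omega>. c * x \<omega>) \<omega> * (d * h \<omega>) = (c * d) * (T x \<omega> * h \<omega>)"
        using T_scale[OF x, of c] by eventually_elim simp
    qed measurable
    then show ?thesis by (simp add: b_def)
  qed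
  have bound: "\<bar>\<Sum>k<n. b (x k) (h k)\<bar> \<le> C * mX n x * mY n h"
    if "\<And>k. k < n \<Longrightarrow> x k \<in> elems X" "\<And>k. k < n \<Longrightarrow> h k \<in> elems Y.X'" for n x h
    unfolding b_def using H[rule_format, of n x h] that by simp
  have "\<exists>\<nu>1 \<nu>2. faithful_S_measure M X p1 q1 \<nu>1 \<and> faithful_S_measure M Y.X' p2 q2 \<nu>2 \<and>
    (\<forall>x\<in>elems X. \<forall>y\<in>elems (Y.X').
      \<bar>b x y\<bar> \<le> 2 * C * nrm (S_space M p1 q1 \<nu>1) x * nrm (S_space M p2 q2 \<nu>2) y)"
    by (rule bilinear_domination[OF X.convex_lattice_axioms Y'.convex_lattice_axioms q r scale C bound])
  then obtain \<nu>1 \<nu>2 where \<nu>: "faithful_S_measure M X p1 q1 \<nu>1" "faithful_S_measure M Y.X' p2 q2 \<nu>2"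
    and dom: "\<forall>x\<in>elems X. \<forall>y\<in>elems (Y.X').
      \<bar>b x y\<bar> \<le> 2 * C * nrm (S_space M p1 q1 \<nu>1) x * nrm (S_space M p2 q2 \<nu>2) y" by (elim exE conjE)
  interpret V1: faithful_S_measure M X p1 q1 \<nu>1 by (rule \<nu>(1))
  interpret V2: faithful_S_measure M "Y.X'" p2 q2 \<nu>2 by (rule \<nu>(2))
  interpret S1: order_continuous_lattice M "S_space M p1 q1 \<nu>1" by (rule V1.S_order_continuous_lattice)
  interpret S2: order_continuous_lattice M "S_space M p2 q2 \<nu>2" by (rule V2.S_order_continuous_lattice)
  let ?S1 = "S_space M p1 q1 \<nu>1" and ?S2 = "S_space M p2 q2 \<nu>2"
  \<comment> \<open>The function \<open>T x\<close> is not changed: domination of its pairings says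
    that it already lies in the Koethe dual of the second space.\<close>
  have TW: "T x \<in> elems (koethe_dual M ?S2)" "nrm (koethe_dual M ?S2) (T x) \<le> 2 * C * nrm ?S1 x" if x: "x \<in> elems X" for x
  proof -
    have m: "T x \<in> borel_measurable M" by (rule Y.elem_measurable[OF T_elem[OF x]])
    have c: "0 \<le> 2 * C * nrm ?S1 x" using C by (simp add: V1.nrm_S)
    have int: "integrable M (\<lambda>\<omega>. y \<omega> * T x \<omega>)" if y: "y \<in> elems Y.X'" for y
      using Y.koethe_integrable[OF y T_elem[OF x]] by (simp add: mult.commute)
    have bd: "\<bar>\<integral>\<omega>. y \<omega> * T x \<omega> \<partial>M\<bar> \<le> 2 * C * nrm ?S1 x * nrm ?S2 y" if y: "y \<in> elems Y.X'" for y
      using dom[rule_format, OF x y] by (simp add: b_def mult.commute)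
    show "T x \<in> elems (koethe_dual M ?S2)" "nrm (koethe_dual M ?S2) (T x) \<le> 2 * C * nrm ?S1 x"
      by (rule V2.koethe_dual_S_I[OF m c int bd], assumption+)+
  qed
  \<comment> \<open>Truncations lie in \<open>X\<close> and approximate every element of the first
    space, and the Koethe dual of the second is complete.\<close>
  have "\<exists>T0. bounded_operator M ?S1 (koethe_dual M ?S2) T0 \<and> (\<forall>f\<in>elems X. AE \<omega> in M. T0 f \<omega> = T f \<omega>)"
  proof (rule S1.extension_by_density[where K = "2 * C"])
    show "\<exists>x. (\<forall>n::nat. x n \<in> elems X) \<and> (\<lambda>n. nrm ?S1 (\<lambda>\<omega>. f \<omega> - x n \<omega>)) \<longlonglongrightarrow> 0" if f: "f \<in> elems ?S1" for f
      by (intro exI[of _ "\<lambda>n. X.trunc n f"] conjI allI X.trunc_elem S1.elem_measurable[OF f] V1.trunc_dense[OF f])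
  qed (fact S2.koethe_function_lattice S2.koethe_complete V1.X_subset_S X.add_elem X.scale_elem TW T_add T_scale)+
  then obtain T0 where T0: "bounded_operator M ?S1 (koethe_dual M ?S2) T0" "\<forall>f\<in>elems X. AE \<omega> in M. T0 f \<omega> = T f \<omega>" by (elim exE conjE)
  have incl1: "bounded_operator M X ?S1 (\<lambda>f. f)"
    unfolding bounded_operator_def using V1.X_subset_S V1.nrm_S_le by (auto intro!: exI[of _ 1])
  have incl2: "bounded_operator M Y.X' ?S2 (\<lambda>f. f)"
    unfolding bounded_operator_def using V2.X_subset_S V2.nrm_S_le by (auto intro!: exI[of _ 1])
  \<comment> \<open>A function bounded against the larger space is bounded against \<open>Y'\<close>
    with no larger norm, so restricting functionals amounts to keeping the function.\<close>
  have restr: "h \<in> elems (koethe_dual M Y.X')" "nrm (koethe_dual M Y.X') h \<le> nrm (koethe_dual M ?S2) h"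
    if h: "h \<in> elems (koethe_dual M ?S2)" for h
  proof -
    have m: "h \<in> borel_measurable M" by (rule S2.koethe_measurable[OF h])
    have n: "0 \<le> nrm (koethe_dual M ?S2) h" by (rule S2.koethe_nrm_nonneg[OF h])
    have *: "(\<integral>\<^sup>+\<omega>. ennreal (f \<omega> * \<bar>h \<omega>\<bar>) \<partial>M) \<le> ennreal (nrm (koethe_dual M ?S2) h * nrm Y.X' f)"
      if f: "f \<in> elems Y.X'" and f0: "\<And>\<omega>. 0 \<le> f \<omega>" for f
    proof -
      have "(\<integral>\<^sup>+\<omega>. ennreal (f \<omega> * \<bar>h \<omega>\<bar>) \<partial>M) = (\<integral>\<^sup>+\<omega>. ennreal \<bar>f \<omega> * h \<omega>\<bar> \<partial>M)"
        using f0 by (simp add: abs_mult)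
      also have "\<dots> \<le> ennreal (nrm (koethe_dual M ?S2) h * nrm ?S2 f)"
        by (rule S2.koethe_nn_bound[OF h V2.X_subset_S[OF f]])
      also have "\<dots> \<le> ennreal (nrm (koethe_dual M ?S2) h * nrm Y.X' f)"
        by (intro ennreal_leI mult_left_mono V2.nrm_S_le f n)
      finally show ?thesis .
    qed
    show "h \<in> elems (koethe_dual M Y.X')" "nrm (koethe_dual M Y.X') h \<le> nrm (koethe_dual M ?S2) h"
      by (rule Y.dual.koetheI[OF m n *], assumption+)+
  qed
  have adj: "koethe_adjoint M Y.X' ?S2 (\<lambda>f. f) (\<lambda>f. f)"
    unfolding koethe_adjoint_def bounded_operator_def using restr by (auto intro!: exI[of _ 1])
  have fact: "\<forall>f\<in>elems X. AE \<omega> in M. T f \<omega> = ((\<lambda>f. f) \<circ> T0 \<circ> (\<lambda>f. f)) f \<omega>"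
  proof
    fix f assume "f \<in> elems X"
    then have "AE \<omega> in M. T0 f \<omega> = T f \<omega>" using T0(2) by simp
    then show "AE \<omega> in M. T f \<omega> = ((\<lambda>f. f) \<circ> T0 \<circ> (\<lambda>f. f)) f \<omega>" by eventually_elim simp
  qed
  show ?thesis
    unfolding factorization_def
    by (intro exI conjI) (fact V1.regular V2.regular V1.S_banach V2.S_banach incl1 incl2 T0(1) adj fact)+
qed

end

text \<open>The supremum of the second condition is formed in \<open>ennreal\<close>, where it
  exists before any bound is known. The adjoint is quantified as \<open>J\<close> because it is
  determined only up to equality almost everywhere.\<close>

theorem theorem5p3:
  fixes M :: "'a measure" and X Y :: "'a fspace"
    and p1 p2 q1 q2 :: real and r1 r2 p2' :: ennreal
    and T :: "('a \<Rightarrow> real) \<Rightarrow> ('a \<Rightarrow> real)"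
  assumes "1 \<le> p1" "1 \<le> p2" "1 \<le> q1" "1 \<le> q2"
    and "p1 \<le> q1" "p2 \<le> q2" "1 / q1 + 1 / q2 = 1"
    and "1 / r1 = ennreal (1 / p1 - 1 / q1)"
    and "1 / r2 = ennreal (1 / p2 - 1 / q2)"
    and "1 / ennreal p2 + 1 / p2' = 1"
    and "finite_measure M"
    and "banach_function_lattice M X" "order_continuous M X" "p_convex X (ennreal p1) 1"
    and "banach_function_lattice M Y" "order_continuous M Y" "s_concave Y p2' 1"
    and "fatou_property M Y"
    and "order_continuous M (koethe_dual M Y)"
    and "bounded_operator M X Y T"
  shows
    "(strongly_concave M X Y p1 p2 q1 q2 T \<longleftrightarrow>
      (\<exists>C>0. \<forall>n x. (\<forall>k<n. x k \<in> elems X) \<longrightarrow>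
        (SUP \<phi>\<in>{\<phi>. (\<forall>k<n. \<phi> k \<in> dual Y) \<and> dual_mixed_sup M Y (ennreal p2) r2 n \<phi> \<le> 1}.
            ennreal \<bar>\<Sum>k<n. \<phi> k (T (x k))\<bar>)
          \<le> ennreal (C * mixed_sup X (ennreal p1) r1 n x))) \<and>
     (strongly_concave M X Y p1 p2 q1 q2 T \<longleftrightarrow>
      (\<exists>\<nu>1 \<nu>2 T0 J.
        let Y' = koethe_dual M Y; S1 = S_space M p1 q1 \<nu>1; S2 = S_space M p2 q2 \<nu>2;
            \<iota>X = (\<lambda>f. f); \<iota>Y' = (\<lambda>f. f) in
        regular_borel_prob (pos_ball_topology M (p_power M X p1)) \<nu>1 \<and>
        regular_borel_prob (pos_ball_topology M (p_power M Y' p2)) \<nu>2 \<and>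
        banach_function_lattice M S1 \<and> banach_function_lattice M S2 \<and>
        bounded_operator M X S1 \<iota>X \<and> bounded_operator M Y' S2 \<iota>Y' \<and>
        bounded_operator M S1 (koethe_dual M S2) T0 \<and>
        koethe_adjoint M Y' S2 \<iota>Y' J \<and>
        (\<forall>f\<in>elems X. AE \<omega> in M. T f \<omega> = (J \<circ> T0 \<circ> \<iota>X) f \<omega>)))"
proof -
  have wX: "weak_unit_lattice M X" and wY: "weak_unit_lattice M Y"
    using assms by (auto simp: banach_function_lattice_iff intro: function_lattice.weak_unitI)
  interpret Y: order_continuous_lattice M Y
    by (intro order_continuous_lattice.intro order_continuous_lattice_axioms.intro wY assms)
  have X: "convex_lattice M X p1"
    by (intro convex_lattice.intro order_continuous_lattice.intro convex_lattice_axioms.intro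
      order_continuous_lattice_axioms.intro wX assms)
  have Y': "convex_lattice M (koethe_dual M Y) p2"
    by (intro convex_lattice.intro order_continuous_lattice.intro convex_lattice_axioms.intro
      order_continuous_lattice_axioms.intro Y.koethe_weak_unit_lattice Y.koethe_dual_convex[of _ p2'] assms)
  \<comment> \<open>An exponent 1 would force the reciprocal of the other to be 0, so Young's and
    Hoelder's inequalities apply with both exponents above 1.\<close>
  have "q1 \<noteq> 1" "q2 \<noteq> 1" using assms(1-7) by auto
  then have q: "1 < q1" "1 < q2" using assms by auto
  interpret operator_setting M X Y p1 p2 q1 q2 r1 r2 p2' T
    by (intro operator_setting.intro operator_setting_axioms.intro X Y' Y.order_continuous_lattice_axioms assms q)
  have "concave_on_functions \<longleftrightarrow> factorization"
    using concave_imp_factorization factorization_imp_concave by blast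
  then show ?thesis
    unfolding Let_def factorization_def[symmetric] strongly_concave_iff
    using concave_iff_normalized by simp
qed

end
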